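(* Let $(P,\boldsymbol\Theta)$ be an exact $k$-symplectic manifold with $\boldsymbol\omega=\mathrm d\boldsymbol\Theta$, let $\Phi\colon G\times P\to P$ be an exact $k$-symplectic Lie group action, and let $\boldsymbol\mu=(\mu^1,\ldots,\mu^k)\in(\mathfrak g^* )^k$ be a weak regular $k$-value of an associated exact $k$-symplectic momentum map $\mathbf{J}^\Phi_{\boldsymbol\Theta}\colon P\to(\mathfrak g^* )^k$. Assume that $K_{[\boldsymbol\mu]}$ acts in a quotientable manner on $\mathbf{J}^{\Phi-1}_{\boldsymbol\Theta}(\mathbb R^{\times k}\boldsymbol\mu)$ and that, for every $p\in \mathbf{J}^{\Phi-1}_{\boldsymbol\Theta}(\mathbb R^{\times k}\boldsymbol\mu)$, $$\mathrm T_p\big(\mathbf{J}^{\Phi-1}_{\boldsymbol\Theta\,\alpha}(\mathbb R^\times\mu^\alpha)\big)=\mathrm T_p\big(\mathbf{J}^{\Phi-1}_{\boldsymbol\Theta}(\mathbb R^{\times k}\boldsymbol\mu)\big)+\ker\omega^\alpha(p)+\mathrm T_p(K_{[\mu^\alpha]}p),\qquad \alpha=1,\ldots,k,$$ and $$\mathrm T_p(K_{[\boldsymbol\mu]}p)=\bigcap_{\alpha=1}^k\big(\ker\omega^\alpha(p)+\mathrm T_p(K_{[\mu^\alpha]}p)\big)\cap \mathrm T_p\big(\mathbf{J}^{\Phi-1}_{\boldsymbol\Theta}(\mathbb R^{\times k}\boldsymbol\mu)\big).$$ Then $(P_{[\boldsymbol\mu]}:=\mathbf{J}^{\Phi-1}_{\boldsymbol\Theta}(\mathbb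 R^{\times k}\boldsymbol\mu)/K_{[\boldsymbol\mu]},\boldsymbol\Theta_{[\boldsymbol\mu]})$ is an exact $k$-symplectic manifold such that $$\pi^*_{[\boldsymbol\mu]}\boldsymbol\Theta_{[\boldsymbol\mu]}=\jmath^*_{[\boldsymbol\mu]}\boldsymbol\Theta,$$ where $\pi_{[\boldsymbol\mu]}\colon \mathbf{J}^{\Phi-1}_{\boldsymbol\Theta}(\mathbb R^{\times k}\boldsymbol\mu)\to P_{[\boldsymbol\mu]}$ is the canonical projection and $\jmath_{[\boldsymbol\mu]}\colon \mathbf{J}^{\Phi-1}_{\boldsymbol\Theta}(\mathbb R^{\times k}\boldsymbol\mu)\hookrightarrow P$ is the canonical inclusion.
   Context: An $\mathbb R^k$-valued form is written $\boldsymbol\theta=\sum_\alpha\theta^\alpha\otimes e_\alpha$, with $\{e_\alpha\}$ the canonical basis of $\mathbb R^k$; operations act componentwise; it is nondegenerate if $\ker\boldsymbol\theta=\bigcap_\alpha\ker\theta^\alpha=0$. A $k$-symplectic form is a closed nondegenerate $\boldsymbol\omega\in\Omega^2(P,\mathbb R^k)$; closed forms are assumed to have constant rank. An exact $k$-symplectic manifold $(P,\boldsymbol\Theta)$ is a manifold with $\boldsymbol\Theta\in\Omega^1(P,\mathbb R^k)$ such that $\boldsymbol\omega=\mathrm d\boldsymbol\Theta$ is $k$-symplectic. $G$ is a Lie group with Lie algebra $\mathfrak g$; $\Phi$ is an exact $k$-symplectic Lie group action if $\Phi_g^*\boldsymbol\Theta=\boldsymbol\Theta$ for all $g\in G$.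 $\xi_P(p)=\frac{\mathrm d}{\mathrm dt}|_{t=0}\Phi(\exp(t\xi),p)$. An exact $k$-symplectic momentum map is a map $\mathbf{J}^\Phi_{\boldsymbol\Theta}=(\mathbf{J}^\Phi_{\boldsymbol\Theta\,1},\ldots,\mathbf{J}^\Phi_{\boldsymbol\Theta\,k})\colon P\to(\mathfrak g^* )^k$ with $\iota_{\xi_P}\boldsymbol\Theta=\langle \mathbf{J}^\Phi_{\boldsymbol\Theta},\xi\rangle$ for all $\xi\in\mathfrak g$. $y$ is a weak regular value of $F\colon M\to N$ if $F^{-1}(y)$ is a submanifold and $\mathrm T_xF^{-1}(y)=\ker \mathrm T_xF$ for all $x\in F^{-1}(y)$. $\boldsymbol\mu$ is a weak regular $k$-value of $\mathbf J=(\mathbf J_1,\ldots,\mathbf J_k)$ if each $\mu^\alpha$ is a weak regular value of $\mathbf J_\alpha$ and $\boldsymbol\mu$ is a weak regular value of $\mathbf J$. $\mathbb R^\times=\mathbb R\setminus\{0\}$, $\mathbb R^{\times k}\boldsymbol\mu=\{(\lambda_1\mu^1,\ldots,\lambda_k\mu^k):\lambda_\alpha\in\mathbb R^\times\}$. Standing assumption: for a weak regular $k$-value $\boldsymbol\mu$, the sets $\mathbf{J}^{\Phi-1}_{\boldsymbol\Theta}(\mathbb R^{\times k}\boldsymbol\mu)$ and $\mathbf{J}^{\Phi-1}_{\boldsymbol\Theta\,\alpha}(\mathbb R^\times\mu^\alpha)$ are submanifolds whose tangent spaces consist of the tangent vectors $v$ with $\mathrm T\mathbf J_\beta(v)\in\mathbb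 R\mu^\beta$ for all $\beta$ (resp. for $\beta=\alpha$). For $\mu\in\mathfrak g^*$: $\ker\mu=\{\xi\in\mathfrak g:\langle\mu,\xi\rangle=0\}$, $\mathfrak g_{[\mu]}=\{\xi\in\mathfrak g: \mathrm{ad}^*_\xi\mu\wedge\mu=0\}$ with $\langle \mathrm{ad}^*_\xi\mu,\nu\rangle=\langle\mu,[\xi,\nu]\rangle$, $\mathfrak k_{[\mu]}=\ker\mu\cap\mathfrak g_{[\mu]}$ (a Lie subalgebra), and $K_{[\mu]}$ is the connected Lie subgroup of $G$ with Lie algebra $\mathfrak k_{[\mu]}$. $\mathfrak k_{[\boldsymbol\mu]}=\bigcap_\alpha\mathfrak k_{[\mu^\alpha]}$ and $K_{[\boldsymbol\mu]}$ is the connected Lie subgroup with Lie algebra $\mathfrak k_{[\boldsymbol\mu]}$. $Kp$ denotes the orbit of $p$. An action of a Lie group $K$ on $N$ is quotientable if $N/K$ is a manifold and $N\to N/K$ is a submersion. *)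

theory Defs
  imports "HOL-Analysis.Analysis" "HOL-Algebra.Group"
begin

section \<open>Smooth maps between subsets of normed spaces\<close>

fun C_k_on :: "nat \<Rightarrow> 'a::real_normed_vector set \<Rightarrow> ('a \<Rightarrow> 'b::real_normed_vector) \<Rightarrow> bool" where
  "C_k_on 0 W f \<longleftrightarrow> continuous_on W f"
| "C_k_on (Suc n) W f \<longleftrightarrow>
     (\<forall>x\<in>W. f differentiable at x) \<and> (\<forall>v. C_k_on n W (\<lambda>x. frechet_derivative f (at x) v))"

text \<open>On an arbitrary set, smoothness means being locally the restriction of a \<open>C\<^sup>\<infinity>\<close> map defined on an
  open set. It is used below for relatively open subsets of linear subspaces, where this agrees
  with smoothness inside the subspace.\<close>

definition smooth_on :: "'a::real_normed_vector set \<Rightarrow> ('a \<Rightarrow> 'b::real_normed_vector) \<Rightarrow> bool" where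
  "smooth_on A f \<longleftrightarrow>
     (\<forall>x\<in>A. \<exists>W g. open W \<and> x \<in> W \<and> (\<forall>n. C_k_on n W g) \<and> (\<forall>y\<in>A \<inter> W. g y = f y))"

definition dir_deriv :: "('a::real_normed_vector \<Rightarrow> 'b::real_normed_vector) \<Rightarrow> 'a \<Rightarrow> 'a \<Rightarrow> 'b" where
  "dir_deriv f x v = vector_derivative (\<lambda>t::real. f (x + t *\<^sub>R v)) (at 0)"


section \<open>Manifolds\<close>

text \<open>A chart is a pair of its domain and its coordinate map. All charts take values in one
  finite-dimensional linear subspace \<open>model M\<close> of the type \<open>'e\<close>; its dimension is the dimension of
  the manifold. Working with subspaces (possibly \<open>{0}\<close>) lets submanifolds and quotients, whose
  dimension is not known in advance, use the same type \<open>'e\<close>.\<close>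

record ('a, 'e) mfd =
  mtop :: "'a topology"
  model :: "'e set"
  atlas :: "('a set \<times> ('a \<Rightarrow> 'e)) set"

abbreviation pts :: "('a, 'e, 'z) mfd_scheme \<Rightarrow> 'a set" where
  "pts M \<equiv> topspace (mtop M)"

definition smooth_manifold :: "('a, 'e::real_normed_vector) mfd \<Rightarrow> bool" where
  "smooth_manifold M \<longleftrightarrow>
     Hausdorff_space (mtop M) \<and> second_countable (mtop M) \<and>
     (\<exists>B. finite B \<and> model M = span B) \<and>
     (\<Union>(U, c)\<in>atlas M. U) = pts M \<and>
     (\<forall>(U, c)\<in>atlas M.
        openin (mtop M) U \<and> openin (top_of_set (model M)) (c ` U) \<and>
        homeomorphic_map (subtopology (mtop M) U) (top_of_set (c ` U)) c) \<and>
     (\<forall>(U, c)\<in>atlas M. \<forall>(U', c')\<in>atlas M. smooth_on (c ` (U \<inter> U')) (c' \<circ> inv_into U c))"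

definition vspace_mfd :: "'e::real_normed_vector set \<Rightarrow> ('e, 'e) mfd" where
  "vspace_mfd V = \<lparr>mtop = top_of_set V, model = V, atlas = {(V, id)}\<rparr>"

definition prod_mfd :: "('a, 'e) mfd \<Rightarrow> ('b, 'f) mfd \<Rightarrow> ('a \<times> 'b, 'e \<times> 'f) mfd" where
  "prod_mfd M N =
     \<lparr>mtop = prod_topology (mtop M) (mtop N), model = model M \<times> model N,
      atlas = {(U \<times> U', map_prod c c') | U c U' c'. (U, c) \<in> atlas M \<and> (U', c') \<in> atlas N}\<rparr>"

definition smooth_map ::
  "('a, 'e::real_normed_vector) mfd \<Rightarrow> ('b, 'f::real_normed_vector) mfd \<Rightarrow> ('a \<Rightarrow> 'b) \<Rightarrow> bool" where
  "smooth_map M N f \<longleftrightarrow>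
     continuous_map (mtop M) (mtop N) f \<and>
     (\<forall>(U, c)\<in>atlas M. \<forall>(U', c')\<in>atlas N.
        smooth_on (c ` {x \<in> U. f x \<in> U'}) (c' \<circ> f \<circ> inv_into U c))"

subsection \<open>Tangent vectors\<close>

text \<open>Once and for all a preferred chart is selected around every point, and a tangent vector at \<open>p\<close>
  is identified with its coordinate vector in the preferred chart at \<open>p\<close>. Every
  tangent space is thus a copy of \<open>model M\<close>; the change of charts is accounted for in \<open>tmap\<close>.\<close>

definition chart_at :: "('a, 'e) mfd \<Rightarrow> 'a \<Rightarrow> 'a set \<times> ('a \<Rightarrow> 'e)" where
  "chart_at M p = (SOME C. C \<in> atlas M \<and> p \<in> fst C)"

definition coord :: "('a, 'e) mfd \<Rightarrow> 'a \<Rightarrow> 'a \<Rightarrow> 'e" where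
  "coord M p = snd (chart_at M p)"

definition icoord :: "('a, 'e) mfd \<Rightarrow> 'a \<Rightarrow> 'e \<Rightarrow> 'a" where
  "icoord M p = inv_into (fst (chart_at M p)) (snd (chart_at M p))"

definition tangent_space :: "('a, 'e) mfd \<Rightarrow> 'a \<Rightarrow> 'e set" where
  "tangent_space M p = model M"

text \<open>The tangent map \<open>T\<^sub>p f\<close>: the derivative of the coordinate representation of \<open>f\<close> in the preferred
  charts at \<open>p\<close> and \<open>f p\<close>. It only depends on \<open>f\<close> near \<open>p\<close>.\<close>

definition tmap ::
  "('a, 'e::real_normed_vector) mfd \<Rightarrow> ('b, 'f::real_normed_vector) mfd \<Rightarrow> ('a \<Rightarrow> 'b) \<Rightarrow> 'a \<Rightarrow> 'e \<Rightarrow> 'f" where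
  "tmap M N f p v = dir_deriv (coord N (f p) \<circ> f \<circ> icoord M p) (coord M p p) v"

definition velocity :: "('a, 'e::real_normed_vector) mfd \<Rightarrow> (real \<Rightarrow> 'a) \<Rightarrow> real \<Rightarrow> 'e" where
  "velocity M \<gamma> t = vector_derivative (\<lambda>s. coord M (\<gamma> t) (\<gamma> s)) (at t)"

definition immersion ::
  "('a, 'e::real_normed_vector) mfd \<Rightarrow> ('b, 'f::real_normed_vector) mfd \<Rightarrow> ('a \<Rightarrow> 'b) \<Rightarrow> bool" where
  "immersion M N f \<longleftrightarrow>
     smooth_map M N f \<and> (\<forall>p\<in>pts M. inj_on (tmap M N f p) (tangent_space M p))"

definition submersion ::
  "('a, 'e::real_normed_vector) mfd \<Rightarrow> ('b, 'f::real_normed_vector) mfd \<Rightarrow> ('a \<Rightarrow> 'b) \<Rightarrow> bool" where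
  "submersion M N f \<longleftrightarrow>
     smooth_map M N f \<and>
     (\<forall>p\<in>pts M. tmap M N f p ` tangent_space M p = tangent_space N (f p))"

subsection \<open>Embedded submanifolds\<close>

definition is_submanifold_structure ::
  "('a, 'e::real_normed_vector) mfd \<Rightarrow> 'a set \<Rightarrow> ('a, 'e) mfd \<Rightarrow> bool" where
  "is_submanifold_structure M S N \<longleftrightarrow>
     smooth_manifold N \<and> S \<subseteq> pts M \<and> mtop N = subtopology (mtop M) S \<and> immersion N M id"

definition submanifold :: "('a, 'e::real_normed_vector) mfd \<Rightarrow> 'a set \<Rightarrow> bool" where
  "submanifold M S \<longleftrightarrow> (\<exists>N. is_submanifold_structure M S N)"

text \<open>The smooth structure of a submanifold is unique, up to the choice of an atlas.\<close>

definition sub_mfd :: "('a, 'e::real_normed_vector) mfd \<Rightarrow> 'a set \<Rightarrow> ('a, 'e) mfd" where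
  "sub_mfd M S = (SOME N. is_submanifold_structure M S N)"

text \<open>\<open>T\<^sub>p S\<close> as a subspace of \<open>T\<^sub>p M\<close>.\<close>

definition sub_tangent :: "('a, 'e::real_normed_vector) mfd \<Rightarrow> 'a set \<Rightarrow> 'a \<Rightarrow> 'e set" where
  "sub_tangent M S p = tmap (sub_mfd M S) M id p ` tangent_space (sub_mfd M S) p"

definition weak_regular_value ::
  "('a, 'e::real_normed_vector) mfd \<Rightarrow> ('b, 'f::real_normed_vector) mfd \<Rightarrow> ('a \<Rightarrow> 'b) \<Rightarrow> 'b \<Rightarrow> bool" where
  "weak_regular_value M N F y \<longleftrightarrow>
     y \<in> pts N \<and> submanifold M {x \<in> pts M. F x = y} \<and>
     (\<forall>x\<in>pts M. F x = y \<longrightarrow>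
        sub_tangent M {x \<in> pts M. F x = y} x = {v \<in> tangent_space M x. tmap M N F x v = 0})"


section \<open>Vector-valued differential forms\<close>

text \<open>Only the values \<open>\<theta> p v\<close> with \<open>p \<in> pts M\<close> and \<open>v \<in> tangent_space M p\<close> are meaningful.\<close>

definition pullback1 ::
  "('a, 'e::real_normed_vector) mfd \<Rightarrow> ('b, 'f::real_normed_vector) mfd \<Rightarrow> ('a \<Rightarrow> 'b) \<Rightarrow>
   ('b \<Rightarrow> 'f \<Rightarrow> 'w) \<Rightarrow> 'a \<Rightarrow> 'e \<Rightarrow> 'w" where
  "pullback1 M N f \<theta> p v = \<theta> (f p) (tmap M N f p v)"

definition pullback2 ::
  "('a, 'e::real_normed_vector) mfd \<Rightarrow> ('b, 'f::real_normed_vector) mfd \<Rightarrow> ('a \<Rightarrow> 'b) \<Rightarrow>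
   ('b \<Rightarrow> 'f \<Rightarrow> 'f \<Rightarrow> 'w) \<Rightarrow> 'a \<Rightarrow> 'e \<Rightarrow> 'e \<Rightarrow> 'w" where
  "pullback2 M N f \<omega> p u v = \<omega> (f p) (tmap M N f p u) (tmap M N f p v)"

definition linear_form_on :: "'e::real_vector set \<Rightarrow> ('e \<Rightarrow> 'w::real_vector) \<Rightarrow> bool" where
  "linear_form_on V f \<longleftrightarrow>
     (\<forall>a b. \<forall>u\<in>V. \<forall>v\<in>V. f (a *\<^sub>R u + b *\<^sub>R v) = a *\<^sub>R f u + b *\<^sub>R f v)"

text \<open>The coordinate representation of a form in a chart \<open>(U, c)\<close> is its pullback along the inverse
  chart, a form on \<open>c ` U \<subseteq> model M\<close>; its coefficients are required to be smooth.\<close>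

definition one_form ::
  "('a, 'e::real_normed_vector) mfd \<Rightarrow> ('a \<Rightarrow> 'e \<Rightarrow> 'w::real_normed_vector) \<Rightarrow> bool" where
  "one_form M \<theta> \<longleftrightarrow>
     (\<forall>p\<in>pts M. linear_form_on (tangent_space M p) (\<theta> p)) \<and>
     (\<forall>(U, c)\<in>atlas M. \<forall>v\<in>model M.
        smooth_on (c ` U) (\<lambda>x. pullback1 (vspace_mfd (model M)) M (inv_into U c) \<theta> x v))"

definition two_form ::
  "('a, 'e::real_normed_vector) mfd \<Rightarrow> ('a \<Rightarrow> 'e \<Rightarrow> 'e \<Rightarrow> 'w::real_normed_vector) \<Rightarrow> bool" where
  "two_form M \<omega> \<longleftrightarrow>
     (\<forall>p\<in>pts M. \<forall>u\<in>tangent_space M p.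
        linear_form_on (tangent_space M p) (\<omega> p u) \<and>
        linear_form_on (tangent_space M p) (\<lambda>v. \<omega> p v u) \<and> \<omega> p u u = 0) \<and>
     (\<forall>(U, c)\<in>atlas M. \<forall>u\<in>model M. \<forall>v\<in>model M.
        smooth_on (c ` U) (\<lambda>x. pullback2 (vspace_mfd (model M)) M (inv_into U c) \<omega> x u v))"

text \<open>Exterior derivatives, evaluated at \<open>p\<close> in the preferred chart at \<open>p\<close>, where \<open>u, v, w\<close> extend to
  constant (hence commuting) vector fields.\<close>

definition ext_deriv1 ::
  "('a, 'e::real_normed_vector) mfd \<Rightarrow> ('a \<Rightarrow> 'e \<Rightarrow> 'w::real_normed_vector) \<Rightarrow> 'a \<Rightarrow> 'e \<Rightarrow> 'e \<Rightarrow> 'w" where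
  "ext_deriv1 M \<theta> p u v =
     (let r = pullback1 (vspace_mfd (model M)) M (icoord M p) \<theta>; x = coord M p p
      in dir_deriv (\<lambda>y. r y v) x u - dir_deriv (\<lambda>y. r y u) x v)"

definition ext_deriv2 ::
  "('a, 'e::real_normed_vector) mfd \<Rightarrow> ('a \<Rightarrow> 'e \<Rightarrow> 'e \<Rightarrow> 'w::real_normed_vector) \<Rightarrow>
   'a \<Rightarrow> 'e \<Rightarrow> 'e \<Rightarrow> 'e \<Rightarrow> 'w" where
  "ext_deriv2 M \<omega> p u v w =
     (let r = pullback2 (vspace_mfd (model M)) M (icoord M p) \<omega>; x = coord M p p
      in dir_deriv (\<lambda>y. r y v w) x u - dir_deriv (\<lambda>y. r y u w) x v + dir_deriv (\<lambda>y. r y u v) x w)"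

definition closed_two_form ::
  "('a, 'e::real_normed_vector) mfd \<Rightarrow> ('a \<Rightarrow> 'e \<Rightarrow> 'e \<Rightarrow> 'w::real_normed_vector) \<Rightarrow> bool" where
  "closed_two_form M \<omega> \<longleftrightarrow>
     two_form M \<omega> \<and>
     (\<forall>p\<in>pts M. \<forall>u\<in>tangent_space M p. \<forall>v\<in>tangent_space M p. \<forall>w\<in>tangent_space M p.
        ext_deriv2 M \<omega> p u v w = 0)"


section \<open>k-symplectic manifolds\<close>

text \<open>An \<open>\<real>\<^sup>k\<close>-valued form takes values in \<open>real ^ 'k\<close>. \<open>comp_ker M \<omega> \<alpha> p\<close> is the kernel at \<open>p\<close> of
  the component \<open>\<omega>\<^sup>\<alpha>\<close>.\<close>

definition comp_ker ::
  "('a, 'e) mfd \<Rightarrow> ('a \<Rightarrow> 'e \<Rightarrow> 'e \<Rightarrow> real ^ 'k) \<Rightarrow> 'k::finite \<Rightarrow> 'a \<Rightarrow> 'e set" where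
  "comp_ker M \<omega> \<alpha> p = {u \<in> tangent_space M p. \<forall>v\<in>tangent_space M p. \<omega> p u v $ \<alpha> = 0}"

definition nondegenerate ::
  "('a, 'e::zero) mfd \<Rightarrow> ('a \<Rightarrow> 'e \<Rightarrow> 'e \<Rightarrow> real ^ 'k::finite) \<Rightarrow> bool" where
  "nondegenerate M \<omega> \<longleftrightarrow> (\<forall>p\<in>pts M. (\<Inter>\<alpha>. comp_ker M \<omega> \<alpha> p) = {0})"

definition constant_rank ::
  "('a, 'e::real_vector) mfd \<Rightarrow> ('a \<Rightarrow> 'e \<Rightarrow> 'e \<Rightarrow> real ^ 'k::finite) \<Rightarrow> bool" where
  "constant_rank M \<omega> \<longleftrightarrow>
     (\<forall>\<alpha>. \<exists>r. \<forall>p\<in>pts M. dim (tangent_space M p) - dim (comp_ker M \<omega> \<alpha> p) = r)"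

text \<open>Closed forms are assumed to have constant rank; for a nondegenerate \<open>\<omega>\<close> this is a condition on
  the closed forms \<open>\<omega>\<^sup>\<alpha>\<close>.\<close>

definition k_symplectic_form ::
  "('a, 'e::real_normed_vector) mfd \<Rightarrow> ('a \<Rightarrow> 'e \<Rightarrow> 'e \<Rightarrow> real ^ 'k::finite) \<Rightarrow> bool" where
  "k_symplectic_form M \<omega> \<longleftrightarrow> closed_two_form M \<omega> \<and> constant_rank M \<omega> \<and> nondegenerate M \<omega>"

definition exact_k_symplectic ::
  "('a, 'e::real_normed_vector) mfd \<Rightarrow> ('a \<Rightarrow> 'e \<Rightarrow> real ^ 'k::finite) \<Rightarrow> bool" where
  "exact_k_symplectic M \<Theta> \<longleftrightarrow>
     smooth_manifold M \<and> one_form M \<Theta> \<and> k_symplectic_form M (ext_deriv1 M \<Theta>)"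


section \<open>Lie groups\<close>

record ('g, 'f) liegrp = "'g monoid" +
  lg_mfd :: "('g, 'f) mfd"

definition lie_group :: "('g, 'f::real_normed_vector) liegrp \<Rightarrow> bool" where
  "lie_group G \<longleftrightarrow>
     group G \<and> smooth_manifold (lg_mfd G) \<and> pts (lg_mfd G) = carrier G \<and>
     smooth_map (prod_mfd (lg_mfd G) (lg_mfd G)) (lg_mfd G) (\<lambda>(g, h). g \<otimes>\<^bsub>G\<^esub> h) \<and>
     smooth_map (lg_mfd G) (lg_mfd G) (\<lambda>g. inv\<^bsub>G\<^esub> g)"

definition lie_algebra :: "('g, 'f) liegrp \<Rightarrow> 'f set" where
  "lie_algebra G = tangent_space (lg_mfd G) \<one>\<^bsub>G\<^esub>"

definition left_inv_field :: "('g, 'f::real_normed_vector) liegrp \<Rightarrow> 'f \<Rightarrow> 'g \<Rightarrow> 'f" where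
  "left_inv_field G \<xi> g = tmap (lg_mfd G) (lg_mfd G) (\<lambda>h. g \<otimes>\<^bsub>G\<^esub> h) \<one>\<^bsub>G\<^esub> \<xi>"

text \<open>Coordinate representation \<open>X\<^sup>c\<close> of a vector field \<open>X\<close> in the preferred chart \<open>c\<close> at \<open>p\<close>, and the
  Lie bracket \<open>[X, Y] = D Y\<^sup>c \<cdot> X\<^sup>c - D X\<^sup>c \<cdot> Y\<^sup>c\<close>.\<close>

definition field_rep ::
  "('a, 'e::real_normed_vector) mfd \<Rightarrow> 'a \<Rightarrow> ('a \<Rightarrow> 'e) \<Rightarrow> 'e \<Rightarrow> 'e" where
  "field_rep M p X x =
     (let q = icoord M p x in tmap M (vspace_mfd (model M)) (coord M p) q (X q))"

definition field_bracket ::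
  "('a, 'e::real_normed_vector) mfd \<Rightarrow> ('a \<Rightarrow> 'e) \<Rightarrow> ('a \<Rightarrow> 'e) \<Rightarrow> 'a \<Rightarrow> 'e" where
  "field_bracket M X Y p =
     dir_deriv (field_rep M p Y) (coord M p p) (X p) - dir_deriv (field_rep M p X) (coord M p p) (Y p)"

definition lie_bracket :: "('g, 'f::real_normed_vector) liegrp \<Rightarrow> 'f \<Rightarrow> 'f \<Rightarrow> 'f" where
  "lie_bracket G \<xi> \<eta> = field_bracket (lg_mfd G) (left_inv_field G \<xi>) (left_inv_field G \<eta>) \<one>\<^bsub>G\<^esub>"

definition one_parameter_subgroup ::
  "('g, 'f::real_normed_vector) liegrp \<Rightarrow> 'f \<Rightarrow> (real \<Rightarrow> 'g) \<Rightarrow> bool" where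
  "one_parameter_subgroup G \<xi> \<gamma> \<longleftrightarrow>
     smooth_map (vspace_mfd (UNIV :: real set)) (lg_mfd G) \<gamma> \<and>
     (\<forall>s t. \<gamma> (s + t) = \<gamma> s \<otimes>\<^bsub>G\<^esub> \<gamma> t) \<and> velocity (lg_mfd G) \<gamma> 0 = \<xi>"

definition lie_exp :: "('g, 'f::real_normed_vector) liegrp \<Rightarrow> 'f \<Rightarrow> 'g" where
  "lie_exp G \<xi> = (THE g. \<exists>\<gamma>. one_parameter_subgroup G \<xi> \<gamma> \<and> g = \<gamma> 1)"

subsection \<open>Lie subgroups\<close>

text \<open>A Lie subgroup carries its own manifold structure, whose topology may be finer than the subspace
  topology.\<close>

definition lie_subgroup ::
  "('g, 'f::real_normed_vector) liegrp \<Rightarrow> ('g, 'f) liegrp \<Rightarrow> bool" where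
  "lie_subgroup G K \<longleftrightarrow>
     lie_group K \<and> subgroup (carrier K) G \<and> mult K = mult G \<and> one K = one G \<and>
     immersion (lg_mfd K) (lg_mfd G) id"

text \<open>\<open>K\<close> is the connected Lie subgroup of \<open>G\<close> with Lie algebra \<open>\<hh> \<subseteq> \<gg>\<close>.\<close>

definition connected_lie_subgroup_of ::
  "('g, 'f::real_normed_vector) liegrp \<Rightarrow> 'f set \<Rightarrow> ('g, 'f) liegrp \<Rightarrow> bool" where
  "connected_lie_subgroup_of G \<hh> K \<longleftrightarrow>
     lie_subgroup G K \<and> connected_space (mtop (lg_mfd K)) \<and>
     tmap (lg_mfd K) (lg_mfd G) id \<one>\<^bsub>G\<^esub> ` lie_algebra K = \<hh>"

subsection \<open>Actions\<close>

definition lie_action ::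
  "('g, 'f::real_normed_vector) liegrp \<Rightarrow> ('a, 'e::real_normed_vector) mfd \<Rightarrow> ('g \<Rightarrow> 'a \<Rightarrow> 'a) \<Rightarrow> bool" where
  "lie_action G M \<Phi> \<longleftrightarrow>
     lie_group G \<and> smooth_manifold M \<and>
     smooth_map (prod_mfd (lg_mfd G) M) M (\<lambda>(g, p). \<Phi> g p) \<and>
     (\<forall>p\<in>pts M. \<Phi> \<one>\<^bsub>G\<^esub> p = p) \<and>
     (\<forall>g\<in>carrier G. \<forall>h\<in>carrier G. \<forall>p\<in>pts M. \<Phi> (g \<otimes>\<^bsub>G\<^esub> h) p = \<Phi> g (\<Phi> h p))"

definition inf_generator ::
  "('g, 'f::real_normed_vector) liegrp \<Rightarrow> ('a, 'e::real_normed_vector) mfd \<Rightarrow> ('g \<Rightarrow> 'a \<Rightarrow> 'a) \<Rightarrow>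
   'f \<Rightarrow> 'a \<Rightarrow> 'e" where
  "inf_generator G M \<Phi> \<xi> p = velocity M (\<lambda>t. \<Phi> (lie_exp G (t *\<^sub>R \<xi>)) p) 0"

definition orbit :: "('g, 'f) liegrp \<Rightarrow> ('g \<Rightarrow> 'a \<Rightarrow> 'a) \<Rightarrow> 'a \<Rightarrow> 'a set" where
  "orbit K \<Phi> p = (\<lambda>g. \<Phi> g p) ` carrier K"

text \<open>\<open>T\<^sub>p (K p)\<close> as a subspace of \<open>T\<^sub>p M\<close>. The orbit is an immersed submanifold, the image of the
  constant rank map \<open>g \<mapsto> \<Phi> g p\<close>, so its tangent space at \<open>p\<close> is the image of the tangent map at the
  identity.\<close>

definition orbit_tangent ::
  "('g, 'f::real_normed_vector) liegrp \<Rightarrow> ('a, 'e::real_normed_vector) mfd \<Rightarrow> ('g \<Rightarrow> 'a \<Rightarrow> 'a) \<Rightarrow>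
   'a \<Rightarrow> 'e set" where
  "orbit_tangent K M \<Phi> p = tmap (lg_mfd K) M (\<lambda>g. \<Phi> g p) \<one>\<^bsub>K\<^esub> ` lie_algebra K"

text \<open>A manifold structure on the set of orbits, compatible with the quotient topology, for which the
  projection is a submersion. It is unique, up to the choice of an atlas.\<close>

definition is_quotient_structure ::
  "('g, 'f) liegrp \<Rightarrow> ('a, 'e::real_normed_vector) mfd \<Rightarrow> ('g \<Rightarrow> 'a \<Rightarrow> 'a) \<Rightarrow> ('a set, 'e) mfd \<Rightarrow> bool" where
  "is_quotient_structure K N \<Phi> Q \<longleftrightarrow>
     smooth_manifold Q \<and> pts Q = orbit K \<Phi> ` pts N \<and>
     quotient_map (mtop N) (mtop Q) (orbit K \<Phi>) \<and> submersion N Q (orbit K \<Phi>)"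

definition quotient_mfd ::
  "('g, 'f) liegrp \<Rightarrow> ('a, 'e::real_normed_vector) mfd \<Rightarrow> ('g \<Rightarrow> 'a \<Rightarrow> 'a) \<Rightarrow> ('a set, 'e) mfd" where
  "quotient_mfd K N \<Phi> = (SOME Q. is_quotient_structure K N \<Phi> Q)"

definition quotientable_action ::
  "('g, 'f::real_normed_vector) liegrp \<Rightarrow> ('a, 'e::real_normed_vector) mfd \<Rightarrow> ('g \<Rightarrow> 'a \<Rightarrow> 'a) \<Rightarrow> bool" where
  "quotientable_action K N \<Phi> \<longleftrightarrow> lie_action K N \<Phi> \<and> (\<exists>Q. is_quotient_structure K N \<Phi> Q)"


section \<open>Momentum maps\<close>

text \<open>The dual of a subspace \<open>V\<close> of a Euclidean space: a functional on \<open>V\<close> is represented by its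
  extension by zero to the orthogonal complement of \<open>V\<close>.\<close>

definition dual_space :: "'f::euclidean_space set \<Rightarrow> ('f \<Rightarrow>\<^sub>L real) set" where
  "dual_space V = {\<phi>. \<forall>x. (\<forall>v\<in>V. x \<bullet> v = 0) \<longrightarrow> blinfun_apply \<phi> x = 0}"

definition dual_power :: "'f::euclidean_space set \<Rightarrow> (('f \<Rightarrow>\<^sub>L real) ^ 'k::finite) set" where
  "dual_power V = {\<mu>. \<forall>\<alpha>. \<mu> $ \<alpha> \<in> dual_space V}"

abbreviation dual_mfd :: "('g, 'f::euclidean_space) liegrp \<Rightarrow> ('f \<Rightarrow>\<^sub>L real, 'f \<Rightarrow>\<^sub>L real) mfd" where
  "dual_mfd G \<equiv> vspace_mfd (dual_space (lie_algebra G))"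

abbreviation dual_power_mfd ::
  "('g, 'f::euclidean_space) liegrp \<Rightarrow> (('f \<Rightarrow>\<^sub>L real) ^ 'k::finite, ('f \<Rightarrow>\<^sub>L real) ^ 'k) mfd" where
  "dual_power_mfd G \<equiv> vspace_mfd (dual_power (lie_algebra G))"

definition exact_k_symplectic_action ::
  "('g, 'f::real_normed_vector) liegrp \<Rightarrow> ('p, 'e::real_normed_vector) mfd \<Rightarrow>
   ('p \<Rightarrow> 'e \<Rightarrow> real ^ 'k::finite) \<Rightarrow> ('g \<Rightarrow> 'p \<Rightarrow> 'p) \<Rightarrow> bool" where
  "exact_k_symplectic_action G P \<Theta> \<Phi> \<longleftrightarrow>
     lie_action G P \<Phi> \<and>
     (\<forall>g\<in>carrier G. \<forall>p\<in>pts P. \<forall>v\<in>tangent_space P p. pullback1 P P (\<Phi> g) \<Theta> p v = \<Theta> p v)"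

definition exact_momentum_map ::
  "('g, 'f::euclidean_space) liegrp \<Rightarrow> ('p, 'e::real_normed_vector) mfd \<Rightarrow>
   ('p \<Rightarrow> 'e \<Rightarrow> real ^ 'k::finite) \<Rightarrow> ('g \<Rightarrow> 'p \<Rightarrow> 'p) \<Rightarrow> ('p \<Rightarrow> ('f \<Rightarrow>\<^sub>L real) ^ 'k) \<Rightarrow> bool" where
  "exact_momentum_map G P \<Theta> \<Phi> J \<longleftrightarrow>
     smooth_map P (dual_power_mfd G) J \<and>
     (\<forall>\<xi>\<in>lie_algebra G. \<forall>p\<in>pts P. \<forall>\<alpha>.
        \<Theta> p (inf_generator G P \<Phi> \<xi> p) $ \<alpha> = blinfun_apply (J p $ \<alpha>) \<xi>)"

definition weak_regular_k_value ::
  "('g, 'f::euclidean_space) liegrp \<Rightarrow> ('p, 'e::real_normed_vector) mfd \<Rightarrow>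
   ('p \<Rightarrow> ('f \<Rightarrow>\<^sub>L real) ^ 'k::finite) \<Rightarrow> ('f \<Rightarrow>\<^sub>L real) ^ 'k \<Rightarrow> bool" where
  "weak_regular_k_value G P J \<mu> \<longleftrightarrow>
     (\<forall>\<alpha>. weak_regular_value P (dual_mfd G) (\<lambda>p. J p $ \<alpha>) (\<mu> $ \<alpha>)) \<and>
     weak_regular_value P (dual_power_mfd G) J \<mu>"

text \<open>\<open>J\<inverse>(\<real>\<^sup>\<times>\<^sup>k \<mu>)\<close> and \<open>J\<^sub>\<alpha>\<inverse>(\<real>\<^sup>\<times> \<mu>\<^sup>\<alpha>)\<close>.\<close>

definition level_set ::
  "('p, 'e) mfd \<Rightarrow> ('p \<Rightarrow> 'w::real_vector ^ 'k::finite) \<Rightarrow> 'w ^ 'k \<Rightarrow> 'p set" where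
  "level_set P J \<mu> = {p \<in> pts P. \<exists>c :: 'k \<Rightarrow> real. (\<forall>\<alpha>. c \<alpha> \<noteq> 0) \<and> J p = (\<chi> \<alpha>. c \<alpha> *\<^sub>R \<mu> $ \<alpha>)}"

definition level_set_comp ::
  "('p, 'e) mfd \<Rightarrow> ('p \<Rightarrow> 'w::real_vector ^ 'k::finite) \<Rightarrow> 'w ^ 'k \<Rightarrow> 'k \<Rightarrow> 'p set" where
  "level_set_comp P J \<mu> \<alpha> = {p \<in> pts P. \<exists>c :: real. c \<noteq> 0 \<and> J p $ \<alpha> = c *\<^sub>R \<mu> $ \<alpha>}"

text \<open>The vectors at \<open>p\<close> which \<open>T J\<^sub>\<beta>\<close> maps into \<open>\<real> \<mu>\<^sup>\<beta>\<close>.\<close>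

definition vectors_into_line ::
  "('g, 'f::euclidean_space) liegrp \<Rightarrow> ('p, 'e::real_normed_vector) mfd \<Rightarrow>
   ('p \<Rightarrow> ('f \<Rightarrow>\<^sub>L real) ^ 'k::finite) \<Rightarrow> ('f \<Rightarrow>\<^sub>L real) ^ 'k \<Rightarrow> 'k \<Rightarrow> 'p \<Rightarrow> 'e set" where
  "vectors_into_line G P J \<mu> \<beta> p =
     {v \<in> tangent_space P p. tmap P (dual_mfd G) (\<lambda>q. J q $ \<beta>) p v \<in> span {\<mu> $ \<beta>}}"

text \<open>The standing assumption that the two kinds of level sets are submanifolds with the expected
  tangent spaces.\<close>

definition regular_level_sets ::
  "('g, 'f::euclidean_space) liegrp \<Rightarrow> ('p, 'e::real_normed_vector) mfd \<Rightarrow>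
   ('p \<Rightarrow> ('f \<Rightarrow>\<^sub>L real) ^ 'k::finite) \<Rightarrow> ('f \<Rightarrow>\<^sub>L real) ^ 'k \<Rightarrow> bool" where
  "regular_level_sets G P J \<mu> \<longleftrightarrow>
     submanifold P (level_set P J \<mu>) \<and>
     (\<forall>p\<in>level_set P J \<mu>.
        sub_tangent P (level_set P J \<mu>) p = (\<Inter>\<beta>. vectors_into_line G P J \<mu> \<beta> p)) \<and>
     (\<forall>\<alpha>. submanifold P (level_set_comp P J \<mu> \<alpha>) \<and>
        (\<forall>p\<in>level_set_comp P J \<mu> \<alpha>.
           sub_tangent P (level_set_comp P J \<mu> \<alpha>) p = vectors_into_line G P J \<mu> \<alpha> p))"

subsection \<open>The Lie algebras\<close>

definition ker_dual :: "('g, 'f::real_normed_vector) liegrp \<Rightarrow> ('f \<Rightarrow>\<^sub>L real) \<Rightarrow> 'f set" where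
  "ker_dual G \<mu> = {\<xi> \<in> lie_algebra G. blinfun_apply \<mu> \<xi> = 0}"

definition ad_star :: "('g, 'f::real_normed_vector) liegrp \<Rightarrow> 'f \<Rightarrow> ('f \<Rightarrow>\<^sub>L real) \<Rightarrow> 'f \<Rightarrow> real" where
  "ad_star G \<xi> \<mu> \<nu> = blinfun_apply \<mu> (lie_bracket G \<xi> \<nu>)"

definition wedge :: "('f \<Rightarrow> real) \<Rightarrow> ('f \<Rightarrow> real) \<Rightarrow> 'f \<Rightarrow> 'f \<Rightarrow> real" where
  "wedge a b u v = a u * b v - a v * b u"

definition g_bracket :: "('g, 'f::real_normed_vector) liegrp \<Rightarrow> ('f \<Rightarrow>\<^sub>L real) \<Rightarrow> 'f set" where
  "g_bracket G \<mu> =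
     {\<xi> \<in> lie_algebra G. \<forall>u\<in>lie_algebra G. \<forall>v\<in>lie_algebra G.
        wedge (ad_star G \<xi> \<mu>) (blinfun_apply \<mu>) u v = 0}"

definition k_bracket :: "('g, 'f::real_normed_vector) liegrp \<Rightarrow> ('f \<Rightarrow>\<^sub>L real) \<Rightarrow> 'f set" where
  "k_bracket G \<mu> = ker_dual G \<mu> \<inter> g_bracket G \<mu>"

definition k_bracket_multi ::
  "('g, 'f::real_normed_vector) liegrp \<Rightarrow> ('f \<Rightarrow>\<^sub>L real) ^ 'k::finite \<Rightarrow> 'f set" where
  "k_bracket_multi G \<mu> = (\<Inter>\<alpha>. k_bracket G (\<mu> $ \<alpha>))"

end

theory Submission
  imports Defs
begin

text \<open>Fix \<open>p\<close> in the level set \<open>S\<close>, let \<open>\<mm>\<^sub>\<alpha>\<close> be the annihilator of \<open>\<mu>\<^sup>\<alpha>\<close> in the Lie algebra and write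
  \<open>\<xi>\<^sub>P\<close> for the infinitesimal generators. Invariance of \<open>\<Theta>\<close> gives \<open>\<omega>(\<xi>\<^sub>P, v) = - dJ\<^sub>\<xi>(v)\<close> and
  \<open>\<omega>(\<xi>\<^sub>P, \<eta>\<^sub>P) = - J([\<xi>, \<eta>])\<close>. Hence the tangent space of the level set of \<open>J\<^sub>\<alpha>\<close> is the
  \<open>\<omega>\<^sup>\<alpha>\<close>-orthogonal of \<open>(\<mm>\<^sub>\<alpha>)\<^sub>P\<close>, and \<open>\<kk>\<^bsub>[\<mu>\<^sup>\<alpha>]\<^esub>\<close> is the radical of \<open>\<omega>\<^sup>\<alpha>\<close> pulled back to \<open>\<mm>\<^sub>\<alpha>\<close>. With the
  first tangent space hypothesis, presymplectic linear algebra identifies the kernel of \<open>\<omega>\<^sup>\<alpha>\<close> restricted to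
  \<open>T\<^sub>p S\<close> with \<open>T\<^sub>p S \<inter> (ker \<omega>\<^sup>\<alpha> + T\<^sub>p(K\<^bsub>[\<mu>\<^sup>\<alpha>]\<^esub> p))\<close> and shows that its dimension does not depend on \<open>p\<close>.
  The form \<open>\<Theta>\<close> restricted to \<open>S\<close> is invariant and vanishes on \<open>\<kk>\<^bsub>[\<mu>]\<^esub>\<close>, so it descends; by the second
  hypothesis the kernels of the components of the reduced \<open>\<omega>\<close> meet only in the kernel of \<open>T\<^sub>p\<pi>\<close>, which is zero
  in the quotient. That \<open>ker T\<^sub>p\<pi>\<close> is the tangent space of the orbit, and not larger, uses the second
  countability of the group.\<close>

section \<open>Calculus of smooth maps\<close>

text \<open>The generators in the momentum map are defined through \<open>lie_exp\<close>, a
  definite description, which says nothing until one-parameter subgroups are known to exist and to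
  be unique. This is what forces the local solution of differential equations. Afterwards
  \<open>gen\<close>, the derivative of the orbit map at the identity, takes over. Charts map into
  linear subspaces, on which no Frechet derivative of the ambient space is available, so everything
  is extended along linear projections. The dimension of the ambient type may thus exceed that of
  the manifold, and the orbit argument has to thicken by the excess directions as well. That the
  reduced form has constant rank rests on a count. All points p of the level set satisfy
  J_\<alpha>(p) = c \<mu>^\<alpha> with c nonzero, so one fixed subalgebra serves all of them; each
  level set has one model space and hence tangent spaces of one dimension; and the rank of
  \<omega>^\<alpha> is constant by assumption. The dimensions that may jump with p, such as those of
  the orbit directions, cancel.\<close>

abbreviation fd :: "('a::real_normed_vector \<Rightarrow> 'b::real_normed_vector) \<Rightarrow> 'a \<Rightarrow> 'a \<Rightarrow> 'b" where
  "fd f x \<equiv> frechet_derivative f (at x)"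

lemma fd_eqI: "(f has_derivative f') (at x) \<Longrightarrow> fd f x = f'"
  by (metis frechet_derivative_at)

lemma fd_works: "f differentiable at x \<Longrightarrow> (f has_derivative fd f x) (at x)"
  by (simp add: frechet_derivative_works)

lemma fd_cong_open:
  assumes "open W" "x \<in> W" "\<And>y. y \<in> W \<Longrightarrow> f y = g y"
  shows "fd f x = fd g x"
proof -
  have "(f has_derivative D) (at x) \<longleftrightarrow> (g has_derivative D) (at x)" for D
    using assms by (metis has_derivative_transform_within_open)
  then show ?thesis by (simp add: frechet_derivative_def)
qed

lemma differentiable_cong_open:
  assumes "open W" "x \<in> W" "\<And>y. y \<in> W \<Longrightarrow> f y = g y"
  shows "f differentiable at x \<longleftrightarrow> g differentiable at x"
  unfolding differentiable_def using assms by (metis has_derivative_transform_within_open)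

lemma C_k_on_cong:
  "open W \<Longrightarrow> (\<And>y. y \<in> W \<Longrightarrow> f y = g y) \<Longrightarrow> C_k_on n W f \<longleftrightarrow> C_k_on n W g"
proof (induction n arbitrary: f g)
  case 0
  then show ?case by (auto cong: continuous_on_cong)
next
  case (Suc n)
  have "C_k_on n W (\<lambda>x. fd f x v) \<longleftrightarrow> C_k_on n W (\<lambda>x. fd g x v)" for v
  proof (rule Suc.IH[OF Suc.prems(1)])
    fix x assume "x \<in> W"
    then show "fd f x v = fd g x v" using fd_cong_open[OF Suc.prems(1) _ Suc.prems(2)] by simp
  qed
  moreover have "f differentiable at x \<longleftrightarrow> g differentiable at x" if "x \<in> W" for x
    by (rule differentiable_cong_open[OF Suc.prems(1) that Suc.prems(2)])
  ultimately show ?case by auto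
qed

lemma C_k_on_transform:
  "(\<And>y. y \<in> W \<Longrightarrow> f y = g y) \<Longrightarrow> C_k_on n W g \<Longrightarrow> open W \<Longrightarrow> C_k_on n W f"
  using C_k_on_cong[of W f g n] by simp

lemma C_k_on_subset: "C_k_on n W f \<Longrightarrow> V \<subseteq> W \<Longrightarrow> C_k_on n V f"
proof (induction n arbitrary: f)
  case 0
  then show ?case by (auto intro: continuous_on_subset)
qed auto

lemma C_k_on_local:
  assumes "\<And>x. x \<in> W \<Longrightarrow> \<exists>V. open V \<and> x \<in> V \<and> C_k_on n (V \<inter> W) f" "open W"
  shows "C_k_on n W f"
  using assms(1)
proof (induction n arbitrary: f)
  case 0
  have "isCont f x" if "x \<in> W" for x
    using 0[OF that] \<open>open W\<close> that
    by (auto simp: continuous_on_eq_continuous_at open_Int)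
  then show ?case using \<open>open W\<close> by (simp add: continuous_on_eq_continuous_at)
next
  case (Suc n)
  have "f differentiable at x" if "x \<in> W" for x
    using Suc.prems[OF that] that by auto
  moreover have "C_k_on n W (\<lambda>x. fd f x v)" for v
  proof (rule Suc.IH)
    fix x assume "x \<in> W"
    from Suc.prems[OF this] obtain V where "open V" "x \<in> V" "C_k_on (Suc n) (V \<inter> W) f" by blast
    then show "\<exists>V. open V \<and> x \<in> V \<and> C_k_on n (V \<inter> W) (\<lambda>x. fd f x v)" by auto
  qed
  ultimately show ?case by simp
qed

lemma C_k_on_continuous: "C_k_on n W f \<Longrightarrow> continuous_on W f"
  by (cases n) (auto intro!: continuous_at_imp_continuous_on differentiable_imp_continuous_within)

lemma C_k_on_SucD: "C_k_on (Suc n) W f \<Longrightarrow> C_k_on n W f"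
proof (induction n arbitrary: f)
  case 0
  then show ?case using C_k_on_continuous by fastforce
next
  case (Suc n)
  from Suc.prems have "C_k_on (Suc n) W (\<lambda>x. fd f x v)" for v by simp
  from Suc.IH[OF this] Suc.prems show ?case by simp
qed

lemma C_k_on_const: "C_k_on n W (\<lambda>x. c)"
  by (induction n arbitrary: c) (auto simp: frechet_derivative_const)

lemma C_k_on_bounded_linear:
  assumes "bounded_linear l" "open W"
  shows "C_k_on n W l"
proof (cases n)
  case 0
  then show ?thesis using assms by (simp add: linear_continuous_on)
next
  case (Suc m)
  have d: "(l has_derivative l) (at x)" for x
    using assms bounded_linear_imp_has_derivative by blast
  have "fd l x = l" for x by (rule fd_eqI[OF d])
  then show ?thesis using Suc d C_k_on_const by (auto simp: differentiable_def)
qed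

lemma C_k_on_bounded_linear_comp:
  assumes l: "bounded_linear l" and "open W"
  shows "C_k_on n W f \<Longrightarrow> C_k_on n W (\<lambda>x. l (f x))"
proof (induction n arbitrary: f)
  case 0
  then show ?case using l by (auto intro: bounded_linear.continuous_on)
next
  case (Suc n)
  have d: "((\<lambda>x. l (f x)) has_derivative (\<lambda>v. l (fd f x v))) (at x)" if "x \<in> W" for x
    using Suc.prems that by (auto intro!: bounded_linear.has_derivative[OF l] fd_works)
  then have "fd (\<lambda>x. l (f x)) x v = l (fd f x v)" if "x \<in> W" for x v
    by (simp add: fd_eqI[OF d[OF that]])
  moreover have "C_k_on n W (\<lambda>x. l (fd f x v))" for v using Suc by simp
  ultimately have "C_k_on n W (\<lambda>x. fd (\<lambda>x. l (f x)) x v)" for v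
    by (rule C_k_on_transform) (simp_all add: \<open>open W\<close>)
  then show ?case using d by (auto simp: differentiable_def)
qed

lemma C_k_on_add:
  assumes "open W"
  shows "C_k_on n W f \<Longrightarrow> C_k_on n W g \<Longrightarrow> C_k_on n W (\<lambda>x. f x + g x)"
proof (induction n arbitrary: f g)
  case 0
  then show ?case by (simp add: continuous_on_add)
next
  case (Suc n)
  have d: "((\<lambda>x. f x + g x) has_derivative (\<lambda>v. fd f x v + fd g x v)) (at x)" if "x \<in> W" for x
    using Suc.prems that by (auto intro!: has_derivative_add fd_works)
  then have "fd (\<lambda>x. f x + g x) x v = fd f x v + fd g x v" if "x \<in> W" for x v
    by (simp add: fd_eqI[OF d[OF that]])
  moreover have "C_k_on n W (\<lambda>x. fd f x v + fd g x v)" for v using Suc by simp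
  ultimately have "C_k_on n W (\<lambda>x. fd (\<lambda>x. f x + g x) x v)" for v
    by (rule C_k_on_transform) (simp_all add: \<open>open W\<close>)
  then show ?case using d by (auto simp: differentiable_def)
qed

lemma C_k_on_sum:
  assumes "open W" "\<And>i. i \<in> I \<Longrightarrow> C_k_on n W (f i)"
  shows "C_k_on n W (\<lambda>x. \<Sum>i\<in>I. f i x)"
  using assms(2)
proof (induction I rule: infinite_finite_induct)
  case (insert i I)
  then show ?case using C_k_on_add[OF \<open>open W\<close>, of n "f i"] by auto
qed (auto simp: C_k_on_const)

lemma C_k_on_bilinear:
  assumes b: "bounded_bilinear b" and "open W"
  shows "C_k_on n W f \<Longrightarrow> C_k_on n W g \<Longrightarrow> C_k_on n W (\<lambda>x. b (f x) (g x))"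
proof (induction n arbitrary: f g)
  case 0
  then show ?case using b by (auto intro: bounded_bilinear.continuous_on)
next
  case (Suc n)
  have d: "((\<lambda>x. b (f x) (g x)) has_derivative (\<lambda>v. b (f x) (fd g x v) + b (fd f x v) (g x))) (at x)"
    if "x \<in> W" for x
    using Suc.prems that by (auto intro!: bounded_bilinear.FDERIV[OF b] fd_works)
  then have "fd (\<lambda>x. b (f x) (g x)) x v = b (f x) (fd g x v) + b (fd f x v) (g x)"
    if "x \<in> W" for x v
    by (simp add: fd_eqI[OF d[OF that]])
  moreover have "C_k_on n W (\<lambda>x. b (f x) (fd g x v) + b (fd f x v) (g x))" for v
    using Suc.prems Suc.prems[THEN C_k_on_SucD] by (intro C_k_on_add \<open>open W\<close> Suc.IH) auto
  ultimately have "C_k_on n W (\<lambda>x. fd (\<lambda>x. b (f x) (g x)) x v)" for v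
    by (rule C_k_on_transform) (simp_all add: \<open>open W\<close>)
  then show ?case using d by (auto simp: differentiable_def)
qed

lemma linear_basis_sum:
  fixes l :: "'a::euclidean_space \<Rightarrow> 'b::real_vector"
  assumes "linear l"
  shows "l v = (\<Sum>b\<in>Basis. (v \<bullet> b) *\<^sub>R l b)"
proof -
  have "l v = l (\<Sum>b\<in>Basis. (v \<bullet> b) *\<^sub>R b)" by (simp add: euclidean_representation)
  then show ?thesis using assms by (simp add: linear_sum linear_cmul)
qed

text \<open>The derivative of the composite applies a varying linear map to a varying vector. With a
  Euclidean intermediate space it expands over \<open>Basis\<close> into a finite sum of products,
  whose factors the induction hypothesis covers.\<close>

lemma C_k_on_compose:
  fixes f :: "'a::real_normed_vector \<Rightarrow> 'b::euclidean_space" and g :: "'b \<Rightarrow> 'c::real_normed_vector"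
  assumes "open W" "open V" "f ` W \<subseteq> V"
  shows "C_k_on n W f \<Longrightarrow> C_k_on n V g \<Longrightarrow> C_k_on n W (\<lambda>x. g (f x))"
  using assms(3)
proof (induction n arbitrary: g)
  case 0
  then show ?case by (auto intro: continuous_on_compose2[of V g W f])
next
  case (Suc n)
  have d: "((\<lambda>x. g (f x)) has_derivative (\<lambda>v. fd g (f x) (fd f x v))) (at x)" if "x \<in> W" for x
  proof -
    have "(f has_derivative fd f x) (at x)" "(g has_derivative fd g (f x)) (at (f x))"
      using Suc.prems that by (auto intro!: fd_works)
    then show ?thesis using diff_chain_at[of f "fd f x" x g "fd g (f x)"] by (simp add: comp_def)
  qed
  have "fd (\<lambda>x. g (f x)) x v = (\<Sum>b\<in>Basis. (fd f x v \<bullet> b) *\<^sub>R fd g (f x) b)" if "x \<in> W" for x v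
  proof -
    have "linear (fd g (f x))" using Suc.prems that by (intro linear_frechet_derivative) auto
    then show ?thesis unfolding fd_eqI[OF d[OF that]] by (rule linear_basis_sum)
  qed
  moreover have "C_k_on n W (\<lambda>x. \<Sum>b\<in>Basis. (fd f x v \<bullet> b) *\<^sub>R fd g (f x) b)" for v
  proof (rule C_k_on_sum[OF \<open>open W\<close>], rule C_k_on_bilinear[OF bounded_bilinear_scaleR \<open>open W\<close>])
    fix b :: 'b
    show "C_k_on n W (\<lambda>x. fd f x v \<bullet> b)"
      using Suc.prems by (intro C_k_on_bounded_linear_comp[OF bounded_linear_inner_left \<open>open W\<close>]) simp
    show "C_k_on n W (\<lambda>x. fd g (f x) b)"
      using Suc.prems C_k_on_SucD[OF Suc.prems(1)] by (intro Suc.IH) auto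
  qed
  ultimately have "C_k_on n W (\<lambda>x. fd (\<lambda>x. g (f x)) x v)" for v
    by (rule C_k_on_transform) (simp_all add: \<open>open W\<close>)
  then show ?case using d by (auto simp: differentiable_def)
qed

text \<open>Openness is built in because \<open>C_k_on\<close> uses derivatives \<open>at x\<close>
  in the full space, which describe the function on W only when W is open. \<open>smooth_on\<close>
  is the counterpart on sets that are not open.\<close>

definition cinf :: "'a::real_normed_vector set \<Rightarrow> ('a \<Rightarrow> 'b::real_normed_vector) \<Rightarrow> bool" where
  "cinf W f \<longleftrightarrow> open W \<and> (\<forall>n. C_k_on n W f)"

lemma cinfI: "open W \<Longrightarrow> (\<And>n. C_k_on n W f) \<Longrightarrow> cinf W f"
  by (simp add: cinf_def)

lemma cinfD: "cinf W f \<Longrightarrow> C_k_on n W f"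
  by (simp add: cinf_def)

lemma cinf_open: "cinf W f \<Longrightarrow> open W"
  by (simp add: cinf_def)

lemma cinf_subset: "cinf W f \<Longrightarrow> open V \<Longrightarrow> V \<subseteq> W \<Longrightarrow> cinf V f"
  by (blast intro: cinfI C_k_on_subset cinfD)

lemma cinf_Suc: "cinf W f \<Longrightarrow> C_k_on (Suc n) W f"
  by (rule cinfD)

lemma cinf_differentiable: "cinf W f \<Longrightarrow> x \<in> W \<Longrightarrow> f differentiable at x"
  using cinf_Suc[of W f 0] by simp

lemma cinf_has_derivative: "cinf W f \<Longrightarrow> x \<in> W \<Longrightarrow> (f has_derivative fd f x) (at x)"
  using cinf_differentiable fd_works by blast

lemma cinf_linear_fd: "cinf W f \<Longrightarrow> x \<in> W \<Longrightarrow> linear (fd f x)"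
  using cinf_differentiable linear_frechet_derivative by blast

lemma cinf_continuous: "cinf W f \<Longrightarrow> continuous_on W f"
  using C_k_on_continuous cinf_def by blast

lemma cinf_fd: "cinf W f \<Longrightarrow> cinf W (\<lambda>x. fd f x v)"
  using cinf_Suc[of W f] by (auto intro: cinfI cinf_open)

lemma cinf_cong: "cinf W f \<Longrightarrow> (\<And>x. x \<in> W \<Longrightarrow> f x = g x) \<Longrightarrow> cinf W g"
  using C_k_on_cong[of W f g] cinf_open[of W f] by (auto intro!: cinfI dest: cinfD)

lemma cinf_local:
  assumes "open W" "\<And>x. x \<in> W \<Longrightarrow> \<exists>V. x \<in> V \<and> cinf V f"
  shows "cinf W f"
  unfolding cinf_def
proof (intro conjI allI assms(1) C_k_on_local)
  fix n x assume "x \<in> W"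
  then obtain V where "x \<in> V" "cinf V f" using assms(2) by blast
  then show "\<exists>V. open V \<and> x \<in> V \<and> C_k_on n (V \<inter> W) f"
    by (meson C_k_on_subset Int_lower1 cinf_def)
qed

lemma cinf_const: "open W \<Longrightarrow> cinf W (\<lambda>x. c)"
  by (simp add: cinf_def C_k_on_const)

lemma cinf_bounded_linear: "bounded_linear l \<Longrightarrow> open W \<Longrightarrow> cinf W l"
  by (simp add: cinf_def C_k_on_bounded_linear)

lemma cinf_linear:
  fixes l :: "'a::euclidean_space \<Rightarrow> 'b::real_normed_vector"
  shows "linear l \<Longrightarrow> open W \<Longrightarrow> cinf W l"
  by (simp add: cinf_bounded_linear linear_conv_bounded_linear)

lemma cinf_id: "open W \<Longrightarrow> cinf W (\<lambda>x. x)"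
  by (simp add: cinf_bounded_linear)

lemma cinf_bounded_linear_comp: "bounded_linear l \<Longrightarrow> cinf W f \<Longrightarrow> cinf W (\<lambda>x. l (f x))"
  by (simp add: cinf_def C_k_on_bounded_linear_comp)

lemma cinf_linear_comp:
  fixes l :: "'a::euclidean_space \<Rightarrow> 'b::real_normed_vector"
  shows "linear l \<Longrightarrow> cinf W f \<Longrightarrow> cinf W (\<lambda>x. l (f x))"
  by (simp add: cinf_bounded_linear_comp linear_conv_bounded_linear)

lemma cinf_add: "cinf W f \<Longrightarrow> cinf W g \<Longrightarrow> cinf W (\<lambda>x. f x + g x)"
  by (simp add: cinf_def C_k_on_add)

lemma cinf_diff:
  assumes "cinf W f" "cinf W g"
  shows "cinf W (\<lambda>x. f x - g x)"
  using cinf_add[OF assms(1) cinf_bounded_linear_comp[OF bounded_linear_minus[OF bounded_linear_ident] assms(2)]] by simp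

lemma cinf_sum: "open W \<Longrightarrow> (\<And>i. i \<in> I \<Longrightarrow> cinf W (f i)) \<Longrightarrow> cinf W (\<lambda>x. \<Sum>i\<in>I. f i x)"
  by (simp add: cinf_def C_k_on_sum)

lemma cinf_bilinear: "bounded_bilinear b \<Longrightarrow> cinf W f \<Longrightarrow> cinf W g \<Longrightarrow> cinf W (\<lambda>x. b (f x) (g x))"
  by (simp add: cinf_def C_k_on_bilinear)

lemma cinf_compose:
  fixes f :: "'a::real_normed_vector \<Rightarrow> 'b::euclidean_space" and g :: "'b \<Rightarrow> 'c::real_normed_vector"
  assumes "cinf W f" "cinf V g" "\<And>x. x \<in> W \<Longrightarrow> f x \<in> V"
  shows "cinf W (\<lambda>x. g (f x))"
proof (rule cinfI)
  show "C_k_on n W (\<lambda>x. g (f x))" for n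
    by (rule C_k_on_compose[of W V f]) (use assms in \<open>auto simp: cinf_open cinfD\<close>)
qed (rule cinf_open[OF assms(1)])

lemma cinf_Pair:
  assumes "cinf W f" "cinf W g"
  shows "cinf W (\<lambda>x. (f x, g x))"
proof -
  have "cinf W (\<lambda>x. (f x, 0))" "cinf W (\<lambda>x. (0, g x))"
    using cinf_bounded_linear_comp[OF bounded_linear_Pair[OF bounded_linear_ident bounded_linear_zero] assms(1)]
      cinf_bounded_linear_comp[OF bounded_linear_Pair[OF bounded_linear_zero bounded_linear_ident] assms(2)] by auto
  then show ?thesis using cinf_add[of W "\<lambda>x. (f x, 0)" "\<lambda>x. (0, g x)"] by simp
qed

lemma cinf_preimage_open:
  "cinf W f \<Longrightarrow> open V \<Longrightarrow> open {x \<in> W. f x \<in> V}"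
  using continuous_on_open_vimage[of W f] cinf_continuous[of W f] cinf_open[of W f]
  by (simp add: Int_def vimage_def conj_commute)

lemma fd_compose:
  assumes "f differentiable at x" "g differentiable at (f x)"
  shows "fd (\<lambda>x. g (f x)) x v = fd g (f x) (fd f x v)"
  using fd_eqI[OF diff_chain_at[OF fd_works[OF assms(1)] fd_works[OF assms(2)]]]
  by (simp add: comp_def)

text \<open>A form applied to a varying vector: expanded in a basis, it only involves functions known to be smooth.\<close>

lemma cinf_apply_linear:
  fixes R :: "'a::real_normed_vector \<Rightarrow> 'b::euclidean_space \<Rightarrow> 'c::real_normed_vector"
  assumes R: "\<And>b. b \<in> Basis \<Longrightarrow> cinf W (\<lambda>x. R x b)" and lin: "\<And>x. x \<in> W \<Longrightarrow> linear (R x)"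
    and h: "cinf W h"
  shows "cinf W (\<lambda>x. R x (h x))"
proof (rule cinf_cong)
  show "cinf W (\<lambda>x. \<Sum>b\<in>Basis. (h x \<bullet> b) *\<^sub>R R x b)"
    by (rule cinf_sum[OF cinf_open[OF h]], rule cinf_bilinear[OF bounded_bilinear_scaleR],
        rule cinf_bounded_linear_comp[OF bounded_linear_inner_left h], rule R)
qed (rule linear_basis_sum[OF lin, symmetric])

section \<open>Derivatives along lines\<close>

lemma dir_deriv_eq:
  assumes "(f has_derivative f') (at x)"
  shows "dir_deriv f x v = f' v"
proof -
  have "((\<lambda>t::real. x + t *\<^sub>R v) has_derivative (\<lambda>t. t *\<^sub>R v)) (at 0)"
    by (auto intro!: derivative_eq_intros)
  moreover have "(f has_derivative f') (at (x + 0 *\<^sub>R v))" using assms by simp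
  ultimately have "((\<lambda>t::real. f (x + t *\<^sub>R v)) has_derivative (\<lambda>t. f' (t *\<^sub>R v))) (at 0)"
    using diff_chain_at[of "\<lambda>t. x + t *\<^sub>R v" "\<lambda>t. t *\<^sub>R v" 0 f f'] by (simp add: comp_def)
  moreover have "f' (t *\<^sub>R v) = t *\<^sub>R f' v" for t
    using assms by (simp add: has_derivative_linear linear_cmul)
  ultimately show ?thesis
    by (simp add: dir_deriv_def has_vector_derivative_def vector_derivative_at)
qed

lemma dir_deriv_fd: "f differentiable at x \<Longrightarrow> dir_deriv f x v = fd f x v"
  using dir_deriv_eq fd_works by blast

text \<open>A derivative along a line sees only values on that line. Maps that agree on the model
  space but not around it can therefore be exchanged, which is how \<open>icoord\<close> gives way
  to its smooth extension \<open>pchart\<close>.\<close>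

lemma dir_deriv_cong_line:
  fixes f g :: "'a::real_normed_vector \<Rightarrow> 'b::real_normed_vector"
  assumes "open W" "x \<in> W" "\<And>t::real. x + t *\<^sub>R v \<in> W \<Longrightarrow> f (x + t *\<^sub>R v) = g (x + t *\<^sub>R v)"
  shows "dir_deriv f x v = dir_deriv g x v"
proof -
  have "open ((\<lambda>t::real. x + t *\<^sub>R v) -` W)"
    by (intro continuous_open_vimage[OF assms(1)] continuous_intros)
  then have "eventually (\<lambda>t::real. x + t *\<^sub>R v \<in> W) (nhds 0)"
    using assms(2) by (auto simp: eventually_nhds vimage_def)
  then have "eventually (\<lambda>t. t \<in> UNIV \<longrightarrow> f (x + t *\<^sub>R v) = g (x + t *\<^sub>R v)) (nhds 0)"
    by (rule eventually_mono) (use assms(3) in blast)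
  then show ?thesis unfolding dir_deriv_def by (rule vector_derivative_cong_eq) auto
qed

subsection \<open>Symmetry of second derivatives\<close>

lemma fd_inner: "f differentiable at x \<Longrightarrow> fd (\<lambda>y. f y \<bullet> b) x v = fd f x v \<bullet> b"
  using fd_eqI[OF has_derivative_inner_left[OF fd_works, of f x b]] by simp

lemma cinf_line_derivative:
  fixes f :: "'a::real_normed_vector \<Rightarrow> 'b::real_normed_vector"
  assumes "cinf W f" "p + s *\<^sub>R u \<in> W"
  shows "((\<lambda>s::real. f (p + s *\<^sub>R u)) has_vector_derivative fd f (p + s *\<^sub>R u) u) (at s)"
proof -
  have l: "((\<lambda>t::real. p + t *\<^sub>R u) has_derivative (\<lambda>t. t *\<^sub>R u)) (at s)"
    by (auto intro!: derivative_eq_intros)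
  have "linear (fd f (p + s *\<^sub>R u))" by (rule cinf_linear_fd[OF assms])
  moreover have "((\<lambda>t. f (p + t *\<^sub>R u)) has_derivative (\<lambda>t. fd f (p + s *\<^sub>R u) (t *\<^sub>R u))) (at s)"
    using diff_chain_at[OF l cinf_has_derivative[OF assms]] by (simp add: comp_def)
  ultimately show ?thesis by (simp add: has_vector_derivative_def linear_cmul)
qed

text \<open>The left-hand side is symmetric in u and v. The mean value theorem, applied along u to a
  difference in direction v and then along v to the derivative in direction u, turns it into a mixed
  derivative at an intermediate point; exchanging u and v gives the other order.\<close>

lemma second_difference_mvt:
  fixes f :: "'a::real_normed_vector \<Rightarrow> real"
  assumes f: "cinf W f" and "h > 0"
    and W: "\<And>s t. 0 \<le> s \<Longrightarrow> s \<le> h \<Longrightarrow> 0 \<le> t \<Longrightarrow> t \<le> h \<Longrightarrow> x + s *\<^sub>R u + t *\<^sub>R v \<in> W"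
  shows "\<exists>s t. 0 \<le> s \<and> s \<le> h \<and> 0 \<le> t \<and> t \<le> h \<and>
     f (x + h *\<^sub>R u + h *\<^sub>R v) - f (x + h *\<^sub>R u) - f (x + h *\<^sub>R v) + f x =
       h * (h * fd (\<lambda>y. fd f y u) (x + s *\<^sub>R u + t *\<^sub>R v) v)"
proof -
  let ?g = "\<lambda>s. f (x + h *\<^sub>R v + s *\<^sub>R u) - f (x + s *\<^sub>R u)"
  have "(?g has_real_derivative (fd f (x + h *\<^sub>R v + s *\<^sub>R u) u - fd f (x + s *\<^sub>R u) u)) (at s)"
    if "0 \<le> s" "s \<le> h" for s
  proof -
    have "x + h *\<^sub>R v + s *\<^sub>R u \<in> W" "x + s *\<^sub>R u \<in> W"
      using W[OF that, of h] W[OF that, of 0] \<open>h > 0\<close> by (auto simp: algebra_simps)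
    then show ?thesis
      using cinf_line_derivative[OF f] by (auto intro!: has_vector_derivative_diff simp: has_real_derivative_iff_has_vector_derivative)
  qed
  from MVT2[OF \<open>h > 0\<close> this] obtain s where s: "0 < s" "s < h"
      "?g h - ?g 0 = (h - 0) * (fd f (x + h *\<^sub>R v + s *\<^sub>R u) u - fd f (x + s *\<^sub>R u) u)"
    by auto
  let ?k = "\<lambda>t. fd f (x + s *\<^sub>R u + t *\<^sub>R v) u"
  have "(?k has_real_derivative fd (\<lambda>y. fd f y u) (x + s *\<^sub>R u + t *\<^sub>R v) v) (at t)"
    if "0 \<le> t" "t \<le> h" for t
    using cinf_line_derivative[OF cinf_fd[OF f], of "x + s *\<^sub>R u" t v] W[of s t] s that
    by (auto simp: has_real_derivative_iff_has_vector_derivative)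
  from MVT2[OF \<open>h > 0\<close> this] obtain t where t: "0 < t" "t < h"
      "?k h - ?k 0 = (h - 0) * fd (\<lambda>y. fd f y u) (x + s *\<^sub>R u + t *\<^sub>R v) v"
    by auto
  have "f (x + h *\<^sub>R u + h *\<^sub>R v) - f (x + h *\<^sub>R u) - f (x + h *\<^sub>R v) + f x = ?g h - ?g 0"
    by (simp add: algebra_simps)
  also have "\<dots> = h * (?k h - ?k 0)"
    unfolding s(3) by (simp add: algebra_simps)
  also have "\<dots> = h * (h * fd (\<lambda>y. fd f y u) (x + s *\<^sub>R u + t *\<^sub>R v) v)"
    unfolding t(3) by simp
  finally show ?thesis using s t by (intro exI[of _ s] exI[of _ t]) auto
qed

lemma fd_commute_real:
  fixes f :: "'a::real_normed_vector \<Rightarrow> real"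
  assumes f: "cinf W f" and x: "x \<in> W"
  shows "fd (\<lambda>y. fd f y u) x v = fd (\<lambda>y. fd f y v) x u"
proof (rule ccontr)
  let ?A = "\<lambda>y. fd (\<lambda>y. fd f y u) y v" and ?B = "\<lambda>y. fd (\<lambda>y. fd f y v) y u"
  assume ne: "?A x \<noteq> ?B x"
  define e where "e = \<bar>?A x - ?B x\<bar> / 2"
  have "e > 0" using ne by (simp add: e_def)
  have "isCont ?A x" "isCont ?B x"
    using cinf_continuous[OF cinf_fd[OF cinf_fd[OF f]]] continuous_on_eq_continuous_at[OF cinf_open[OF f]] x
    by blast+
  then obtain d1 d2 where d: "d1 > 0" "d2 > 0"
      "\<And>y. dist y x < d1 \<Longrightarrow> dist (?A y) (?A x) < e" "\<And>y. dist y x < d2 \<Longrightarrow> dist (?B y) (?B x) < e"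
    using \<open>e > 0\<close> unfolding continuous_at_eps_delta by metis
  obtain d3 where d3: "d3 > 0" "ball x d3 \<subseteq> W" using cinf_open[OF f] x openE by blast
  define d0 where "d0 = min d1 (min d2 d3)"
  \<comment> \<open>With this step size the whole parallelogram spanned at x by h u and h v stays
    within d0 / 2 of x; the summand 1 keeps the denominator positive when u and v vanish.\<close>
  define h where "h = d0 / (2 * (norm u + norm v + 1))"
  have pos: "norm u + norm v + 1 > 0" using norm_ge_zero[of u] norm_ge_zero[of v] by linarith
  have "d0 > 0" using d d3 by (simp add: d0_def)
  then have "h > 0" using pos by (simp add: h_def)
  have near: "dist (x + s *\<^sub>R u + t *\<^sub>R v) x < d0" if "0 \<le> s" "s \<le> h" "0 \<le> t" "t \<le> h" for s t
  proof -
    have "dist (x + s *\<^sub>R u + t *\<^sub>R v) x \<le> s * norm u + t * norm v"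
      using norm_triangle_ineq[of "s *\<^sub>R u" "t *\<^sub>R v"] that by (simp add: dist_norm algebra_simps)
    also have "\<dots> \<le> h * norm u + h * norm v" using that by (intro add_mono mult_right_mono) auto
    also have "\<dots> \<le> h * (norm u + norm v + 1)" using \<open>h > 0\<close> by (simp add: algebra_simps)
    also have "\<dots> = d0 / 2" using pos by (simp add: h_def field_simps)
    finally show ?thesis using \<open>d0 > 0\<close> by linarith
  qed
  have inW: "x + s *\<^sub>R u + t *\<^sub>R v \<in> W" if "0 \<le> s" "s \<le> h" "0 \<le> t" "t \<le> h" for s t
    using near[OF that] d3 by (auto simp: d0_def dist_commute)
  have inW': "x + s *\<^sub>R v + t *\<^sub>R u \<in> W" if "0 \<le> s" "s \<le> h" "0 \<le> t" "t \<le> h" for s t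
    using inW[of t s] that by (simp add: algebra_simps)
  obtain s t where st: "0 \<le> s" "s \<le> h" "0 \<le> t" "t \<le> h"
     "f (x + h *\<^sub>R u + h *\<^sub>R v) - f (x + h *\<^sub>R u) - f (x + h *\<^sub>R v) + f x = h * (h * ?A (x + s *\<^sub>R u + t *\<^sub>R v))"
    using second_difference_mvt[OF f \<open>h > 0\<close> inW] by blast
  obtain s' t' where st': "0 \<le> s'" "s' \<le> h" "0 \<le> t'" "t' \<le> h"
     "f (x + h *\<^sub>R v + h *\<^sub>R u) - f (x + h *\<^sub>R v) - f (x + h *\<^sub>R u) + f x = h * (h * ?B (x + s' *\<^sub>R v + t' *\<^sub>R u))"
    using second_difference_mvt[OF f \<open>h > 0\<close> inW'] by blast
  have "h * (h * ?A (x + s *\<^sub>R u + t *\<^sub>R v)) = h * (h * ?B (x + s' *\<^sub>R v + t' *\<^sub>R u))"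
    using st(5) st'(5) by (simp add: algebra_simps)
  then have eq: "?A (x + s *\<^sub>R u + t *\<^sub>R v) = ?B (x + s' *\<^sub>R v + t' *\<^sub>R u)" using \<open>h > 0\<close> by simp
  have "dist (?A (x + s *\<^sub>R u + t *\<^sub>R v)) (?A x) < e"
    using near[OF st(1-4)] by (intro d) (simp add: d0_def)
  moreover have "dist (?B (x + s' *\<^sub>R v + t' *\<^sub>R u)) (?B x) < e"
    using near[OF st'(3,4,1,2)] by (intro d) (simp add: d0_def algebra_simps)
  ultimately show False unfolding eq e_def dist_real_def by (simp add: abs_if split: if_splits)
qed

lemma fd_commute:
  fixes f :: "'a::real_normed_vector \<Rightarrow> 'b::euclidean_space"
  assumes f: "cinf W f" and x: "x \<in> W"
  shows "fd (\<lambda>y. fd f y u) x v = fd (\<lambda>y. fd f y v) x u"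
proof (rule euclidean_eqI)
  fix b :: 'b
  have g: "cinf W (\<lambda>y. f y \<bullet> b)" by (rule cinf_bounded_linear_comp[OF bounded_linear_inner_left f])
  have "fd (\<lambda>y. fd f y u) x v \<bullet> b = fd (\<lambda>y. fd (\<lambda>y. f y \<bullet> b) y u) x v" for u v
  proof -
    have "fd (\<lambda>y. fd f y u) x v \<bullet> b = fd (\<lambda>y. fd f y u \<bullet> b) x v"
      using fd_inner[OF cinf_differentiable[OF cinf_fd[OF f] x]] by simp
    also have "fd (\<lambda>y. fd f y u \<bullet> b) x = fd (\<lambda>y. fd (\<lambda>y. f y \<bullet> b) y u) x"
      by (rule fd_cong_open[OF cinf_open[OF f] x]) (simp add: fd_inner[OF cinf_differentiable[OF f]])
    finally show ?thesis .
  qed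
  then show "fd (\<lambda>y. fd f y u) x v \<bullet> b = fd (\<lambda>y. fd f y v) x u \<bullet> b"
    using fd_commute_real[OF g x] by simp
qed

subsection \<open>The smooth inverse function theorem\<close>

text \<open>The map (x, z) \<mapsto> (x, A x z) is inverted by applying the inverse of A x to the
  second component, and its derivative is triangular with invertible diagonal. Differentiating that
  inverse at fixed w gives the formula, without any operator norm.\<close>

lemma inverse_family_differentiable:
  fixes A :: "'a::euclidean_space \<Rightarrow> 'b::euclidean_space \<Rightarrow> 'b"
  assumes A: "\<And>w. cinf U (\<lambda>x. A x w)" and lin: "\<And>x. x \<in> U \<Longrightarrow> linear (A x)"
    and bij: "\<And>x. x \<in> U \<Longrightarrow> bij (A x)" and x: "x \<in> U"
  shows "((\<lambda>x. inv_into UNIV (A x) w) has_derivative (\<lambda>v. - inv_into UNIV (A x) (fd (\<lambda>y. A y (inv_into UNIV (A x) w)) x v))) (at x)"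
proof -
  define z where "z = inv_into UNIV (A x) w"
  have U: "open U" using A cinf_open by blast
  have inv1: "inv_into UNIV (A x) (A x y) = y" "A x (inv_into UNIV (A x) y) = y" if "x \<in> U" for x y
    using bij[OF that] by (auto simp: bij_is_inj bij_is_surj surj_f_inv_f)
  have lin_inv: "linear (inv_into UNIV (A x))" if "x \<in> U" for x
    by (rule inj_linear_imp_inv_linear[OF lin[OF that] bij_is_inj[OF bij[OF that]]])
  let ?F = "\<lambda>p. (fst p, A (fst p) (snd p))" and ?G = "\<lambda>p. (fst p, inv_into UNIV (A (fst p)) (snd p))"
  have cA: "cinf (U \<times> UNIV) (\<lambda>p. A (fst p) (snd p))"
  proof (rule cinf_apply_linear[where R = "\<lambda>p. A (fst p)" and h = snd])
    show "cinf (U \<times> UNIV) (\<lambda>p. A (fst p) b)" for b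
      by (rule cinf_compose[of "U \<times> UNIV" fst U "\<lambda>x. A x b"])
        (auto intro: A cinf_bounded_linear bounded_linear_fst open_Times[OF U])
    show "cinf (U \<times> UNIV) snd"
      by (rule cinf_bounded_linear[OF bounded_linear_snd]) (simp add: open_Times U)
  qed (auto intro: lin)
  have cF: "cinf (U \<times> UNIV) ?F"
    by (rule cinf_Pair[OF cinf_bounded_linear[OF bounded_linear_fst] cA]) (simp add: open_Times U)
  have xz: "(x, z) \<in> U \<times> UNIV" using x by simp
  have dA: "((\<lambda>p. A (fst p) (snd p)) has_derivative (\<lambda>p. fd (\<lambda>y. A y z) x (fst p) + A x (snd p))) (at (x, z))"
  proof -
    let ?D = "fd (\<lambda>p. A (fst p) (snd p)) (x, z)"
    have D: "((\<lambda>p. A (fst p) (snd p)) has_derivative ?D) (at (x, z))"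
      by (rule cinf_has_derivative[OF cA xz])
    have "?D (v, 0) = fd (\<lambda>y. A y z) x v" for v
    proof -
      have "((\<lambda>y. (y, z)) has_derivative (\<lambda>v. (v, 0))) (at x)" by (auto intro!: derivative_eq_intros)
      from diff_chain_at[OF this D] show ?thesis by (simp add: comp_def fd_eqI)
    qed
    moreover have "?D (0, w) = A x w" for w
    proof -
      have "((\<lambda>y. (x, y)) has_derivative (\<lambda>w. (0, w))) (at z)" by (auto intro!: derivative_eq_intros)
      from diff_chain_at[OF this D] have "((\<lambda>y. A x y) has_derivative (\<lambda>w. ?D (0, w))) (at z)"
        by (simp add: comp_def)
      moreover have "(A x has_derivative A x) (at z)"
        using lin[OF x] by (simp add: linear_imp_has_derivative)
      ultimately show ?thesis using has_derivative_unique by metis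
    qed
    moreover have "?D p = ?D (fst p, 0) + ?D (0, snd p)" for p
      using linear_add[OF cinf_linear_fd[OF cA xz], of "(fst p, 0)" "(0, snd p)"] by simp
    ultimately have "?D = (\<lambda>p. fd (\<lambda>y. A y z) x (fst p) + A x (snd p))" by (metis ext)
    then show ?thesis using D by simp
  qed
  have dF: "(?F has_derivative (\<lambda>p. (fst p, fd (\<lambda>y. A y z) x (fst p) + A x (snd p)))) (at (x, z))"
    by (rule has_derivative_Pair[OF has_derivative_fst[OF has_derivative_ident] dA])
  have "(?G has_derivative (\<lambda>p. (fst p, inv_into UNIV (A x) (snd p - fd (\<lambda>y. A y z) x (fst p))))) (at (?F (x, z)))"
  proof (rule has_derivative_inverse_strong[OF _ xz cinf_continuous[OF cF] _ dF])
    show "open (U \<times> UNIV)" by (simp add: open_Times U)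
    show "?G (?F p) = p" if "p \<in> U \<times> UNIV" for p using that by (auto simp: inv1)
  qed (auto simp: inv1 x)
  then have dG: "(?G has_derivative (\<lambda>p. (fst p, inv_into UNIV (A x) (snd p - fd (\<lambda>y. A y z) x (fst p))))) (at (x, w))"
    by (simp add: z_def inv1 x)
  have "((\<lambda>y. (y, w)) has_derivative (\<lambda>v. (v, 0))) (at x)" by (auto intro!: derivative_eq_intros)
  from has_derivative_snd[OF diff_chain_at[OF this dG]] show ?thesis
    using linear_neg[OF lin_inv[OF x]] by (simp add: comp_def z_def)
qed

text \<open>The derivative of the inverse is minus the inverse, applied to the derivative of A,
  applied to the inverse. It is thus quadratic in the inverse itself with smooth coefficients, and
  each order of differentiability yields the next.\<close>

lemma cinf_inverse_family:
  fixes A :: "'a::euclidean_space \<Rightarrow> 'b::euclidean_space \<Rightarrow> 'b"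
  assumes A: "\<And>w. cinf U (\<lambda>x. A x w)" and lin: "\<And>x. x \<in> U \<Longrightarrow> linear (A x)"
    and bij: "\<And>x. x \<in> U \<Longrightarrow> bij (A x)"
  shows "cinf U (\<lambda>x. inv_into UNIV (A x) w)"
proof (rule cinfI)
  show U: "open U" using A cinf_open by blast
  have d: "((\<lambda>x. inv_into UNIV (A x) w) has_derivative
      (\<lambda>v. - inv_into UNIV (A x) (fd (\<lambda>y. A y (inv_into UNIV (A x) w)) x v))) (at x)" if "x \<in> U" for x w
    by (rule inverse_family_differentiable) (use A lin bij that in auto)
  have lin_inv: "linear (inv_into UNIV (A x))" if "x \<in> U" for x
    by (rule inj_linear_imp_inv_linear[OF lin[OF that] bij_is_inj[OF bij[OF that]]])
  show "C_k_on n U (\<lambda>x. inv_into UNIV (A x) w)" for n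
  proof (induction n arbitrary: w)
    case 0
    show ?case
      using d by (auto intro!: continuous_at_imp_continuous_on has_derivative_continuous)
  next
    case (Suc n)
    let ?q = "\<lambda>v x. \<Sum>b\<in>Basis. (inv_into UNIV (A x) w \<bullet> b) *\<^sub>R fd (\<lambda>y. A y b) x v"
    have q: "C_k_on n U (?q v)" for v
      by (rule C_k_on_sum[OF U], rule C_k_on_bilinear[OF bounded_bilinear_scaleR U],
          rule C_k_on_bounded_linear_comp[OF bounded_linear_inner_left U Suc.IH], rule cinfD[OF cinf_fd[OF A]])
    have q_eq: "fd (\<lambda>y. A y (inv_into UNIV (A x) w)) x v = ?q v x" if "x \<in> U" for x v
    proof -
      have "((\<lambda>y. \<Sum>b\<in>Basis. (inv_into UNIV (A x) w \<bullet> b) *\<^sub>R A y b) has_derivative (\<lambda>v. ?q v x)) (at x)"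
        by (intro has_derivative_sum has_derivative_scaleR_right cinf_has_derivative[OF A that])
      then have "((\<lambda>y. A y (inv_into UNIV (A x) w)) has_derivative (\<lambda>v. ?q v x)) (at x)"
        by (rule has_derivative_transform_within_open[OF _ U that]) (simp add: linear_basis_sum[OF lin, symmetric])
      then show ?thesis by (simp add: fd_eqI)
    qed
    have "C_k_on n U (\<lambda>x. \<Sum>b\<in>Basis. (- ?q v x \<bullet> b) *\<^sub>R inv_into UNIV (A x) b)" for v
      by (rule C_k_on_sum[OF U], rule C_k_on_bilinear[OF bounded_bilinear_scaleR U],
          rule C_k_on_bounded_linear_comp[OF bounded_linear_inner_left U],
          rule C_k_on_bounded_linear_comp[OF bounded_linear_minus[OF bounded_linear_ident] U q], rule Suc.IH)
    moreover have "fd (\<lambda>x. inv_into UNIV (A x) w) x v = (\<Sum>b\<in>Basis. (- ?q v x \<bullet> b) *\<^sub>R inv_into UNIV (A x) b)" if "x \<in> U" for x v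
      unfolding fd_eqI[OF d[OF that]] q_eq[OF that] linear_neg[OF lin_inv[OF that], symmetric]
      by (rule linear_basis_sum[OF lin_inv[OF that]])
    ultimately have "C_k_on n U (\<lambda>x. fd (\<lambda>x. inv_into UNIV (A x) w) x v)" for v
      using C_k_on_cong[OF U, of "\<lambda>x. fd (\<lambda>x. inv_into UNIV (A x) w) x v"] by simp
    then show ?case using d by (auto simp: differentiable_def)
  qed
qed

text \<open>The C^1 theorem gives a local inverse whose derivative is the inverse of that of f at
  the image point; smoothness follows by bootstrapping along this equation. The derivative at
  \<open>x0\<close> is taken to be the identity, since the coordinate changes below are built to
  satisfy that.\<close>

lemma cinf_inverse_function:
  fixes f :: "'a::euclidean_space \<Rightarrow> 'a"
  assumes f: "cinf U f" and x0: "x0 \<in> U" and id: "\<And>v. fd f x0 v = v"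
  obtains U' V g where "open U'" "U' \<subseteq> U" "x0 \<in> U'" "open V" "f x0 \<in> V"
    "\<And>x. x \<in> U' \<Longrightarrow> f x \<in> V \<and> g (f x) = x" "\<And>y. y \<in> V \<Longrightarrow> g y \<in> U' \<and> f (g y) = y" "cinf V g"
proof -
  define f' where "f' x = Blinfun (fd f x)" for x
  have f': "blinfun_apply (f' x) = fd f x" if "x \<in> U" for x
    using cinf_linear_fd[OF f that] by (simp add: f'_def bounded_linear_Blinfun_apply linear_conv_bounded_linear)
  have cont: "continuous_on U f'"
  proof (rule continuous_on_blinfun_componentwise)
    fix i :: 'a
    have "continuous_on U (\<lambda>x. fd f x i)" by (rule cinf_continuous[OF cinf_fd[OF f]])
    then show "continuous_on U (\<lambda>x. blinfun_apply (f' x) i)"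
      by (rule continuous_on_eq) (simp add: f')
  qed
  have "id_blinfun o\<^sub>L f' x0 = id_blinfun"
    by (rule blinfun_eqI) (simp add: f' x0 id)
  moreover have "(f has_derivative blinfun_apply (f' x)) (at x)" if "x \<in> U" for x
    using cinf_has_derivative[OF f that] f'[OF that] by simp
  ultimately obtain U' V g g' where g: "open U'" "U' \<subseteq> U" "x0 \<in> U'" "open V" "f x0 \<in> V" "homeomorphism U' V f g"
    "\<And>y. y \<in> V \<Longrightarrow> (g has_derivative (g' y)) (at y)"
    "\<And>y. y \<in> V \<Longrightarrow> g' y = inv_into UNIV (blinfun_apply (f'(g y)))"
    "\<And>y. y \<in> V \<Longrightarrow> bij (blinfun_apply (f'(g y)))"
    using inverse_function_theorem[OF cinf_open[OF f] _ cont x0] by metis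
  have gU: "g y \<in> U'" "f (g y) = y" if "y \<in> V" for y
    using g(6) that by (auto simp: homeomorphism_def)
  have fV: "f x \<in> V" "g (f x) = x" if "x \<in> U'" for x
    using g(6) that by (auto simp: homeomorphism_def)
  have "bij (fd f x)" if "x \<in> U'" for x
    using g(9)[OF fV(1)[OF that]] fV(2)[OF that] f' g(2) that by auto
  then have inv_sm: "cinf U' (\<lambda>x. inv_into UNIV (fd f x) v)" for v
    using g(1,2) by (intro cinf_inverse_family cinf_subset[OF cinf_fd[OF f]] cinf_linear_fd[OF f]) auto
  have fdg: "fd g y v = inv_into UNIV (fd f (g y)) v" if "y \<in> V" for y v
    using fd_eqI[OF g(7)[OF that]] g(8)[OF that] f' gU[OF that] g(2) by auto
  have "C_k_on n V g" for n
  proof (induction n)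
    case 0
    then show ?case using g(6) by (simp add: homeomorphism_def)
  next
    case (Suc n)
    have "C_k_on n V (\<lambda>y. inv_into UNIV (fd f (g y)) v)" for v
      by (rule C_k_on_compose[OF g(4) g(1) _ Suc.IH cinfD[OF inv_sm]]) (use gU in auto)
    then have "C_k_on n V (\<lambda>y. fd g y v)" for v
      using C_k_on_cong[OF g(4), of "\<lambda>y. fd g y v"] fdg by simp
    then show ?case using g(7) by (auto simp: differentiable_def)
  qed
  then have "cinf V g" using g(4) by (simp add: cinf_def)
  then show ?thesis using that g(1-5) gU fV by metis
qed

subsection \<open>Images of maps of constant rank\<close>

lemma linear_comp_has_derivative:
  fixes l :: "'a::euclidean_space \<Rightarrow> 'b::real_normed_vector"
  shows "linear l \<Longrightarrow> (f has_derivative f') F \<Longrightarrow> ((\<lambda>x. l (f x)) has_derivative (\<lambda>v. l (f' v))) F"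
  by (simp add: bounded_linear.has_derivative linear_conv_bounded_linear)

lemma linear_right_inverse_on_range:
  fixes A :: "'a::euclidean_space \<Rightarrow> 'b::euclidean_space"
  assumes "linear A"
  obtains T where "linear T" "\<And>y. y \<in> range A \<Longrightarrow> A (T y) = y"
  using linear_exists_right_inverse_on[OF assms subspace_UNIV] by auto

definition proj_on :: "'a::euclidean_space set \<Rightarrow> 'a \<Rightarrow> 'a" where
  "proj_on E = (SOME P. linear P \<and> (\<forall>x. P x \<in> E) \<and> (\<forall>x\<in>E. P x = x))"

lemma proj_on:
  fixes E :: "'a::euclidean_space set"
  assumes "subspace E"
  shows linear_proj_on: "linear (proj_on E)" and proj_on_in: "proj_on E x \<in> E"
    and proj_on_id: "x \<in> E \<Longrightarrow> proj_on E x = x"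
proof -
  have "\<exists>P. linear P \<and> (\<forall>x. P x \<in> E) \<and> (\<forall>x\<in>E. P x = x)"
    using linear_exists_right_inverse_on[OF linear_ident assms] by auto
  from someI_ex[OF this] show "linear (proj_on E)" "proj_on E x \<in> E" "x \<in> E \<Longrightarrow> proj_on E x = x"
    unfolding proj_on_def by blast+
qed

text \<open>A right inverse g of f on f(S) is injective, so its image has the dimension of f(S) and
  therefore fills S. Each x in S is then g y for some y in f(S), and f x = 0 forces y = 0.\<close>

lemma inj_on_of_dim_image:
  fixes f :: "'a::euclidean_space \<Rightarrow> 'b::euclidean_space"
  assumes f: "linear f" and S: "subspace S" and d: "dim S \<le> dim (f ` S)" and x: "x \<in> S" "f x = 0"
  shows "x = 0"
proof -
  obtain g where g: "range g \<subseteq> S" "linear g" "\<And>v. v \<in> f ` S \<Longrightarrow> f (g v) = v"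
    using linear_exists_right_inverse_on[OF f S] by auto
  let ?T = "g ` (f ` S)"
  have inj: "inj_on g (f ` S)" by (metis g(3) inj_onI)
  have sp: "span (f ` S) = f ` S" using span_eq_iff linear_subspace_image[OF f S] by blast
  have "dim ?T = dim (f ` S)"
    by (rule dim_image_eq[OF g(2)]) (subst sp, rule inj)
  then have "?T = S"
    using g(1) d S linear_subspace_image[OF g(2) linear_subspace_image[OF f S]]
    by (intro subspace_dim_equal) auto
  then obtain y where "x = g y" "y \<in> f ` S" using x(1) by (metis imageE)
  then show ?thesis using g(2,3) x(2) linear_0 by metis
qed

text \<open>The constant rank theorem in measure-theoretic form: near \<open>x0\<close> the image of
  \<psi> has only r degrees of freedom, so adding a subspace Z that leaves the total below the
  dimension of the target still gives a null set. Z is there because orbits will have to be compared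
  with fibres, which may be null sets themselves.\<close>

lemma negligible_constant_rank:
  fixes \<psi> :: "'a::euclidean_space \<Rightarrow> 'b::euclidean_space"
  assumes \<psi>: "cinf W \<psi>" and x0: "x0 \<in> W" and rank: "\<And>x. x \<in> W \<Longrightarrow> dim (range (fd \<psi> x)) = r"
    and Z: "subspace Z" and small: "r + dim Z < DIM('b)"
  shows "\<exists>W'. open W' \<and> x0 \<in> W' \<and> W' \<subseteq> W \<and> negligible {\<psi> x + z | x z. x \<in> W' \<and> z \<in> Z}"
proof -
  define A where "A = fd \<psi> x0"
  have A: "linear A" unfolding A_def by (rule cinf_linear_fd[OF \<psi> x0])
  define R where "R = range A"
  have R: "subspace R" unfolding R_def by (rule linear_subspace_image[OF A subspace_UNIV])
  have dimR: "dim R = r" using rank[OF x0] by (simp add: R_def A_def)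
  define pr where "pr = proj_on R"
  have pr: "linear pr" "\<And>x. pr x \<in> R" "\<And>x. x \<in> R \<Longrightarrow> pr x = x"
    using proj_on[OF R] by (auto simp: pr_def)
  obtain T where T: "linear T" "\<And>y. y \<in> R \<Longrightarrow> A (T y) = y"
    using linear_right_inverse_on_range[OF A] by (auto simp: R_def)
  have AR: "A x \<in> R" for x by (simp add: R_def)
  \<comment> \<open>Replaces the component of x seen by A by the component of \<psi> x in R: the
    derivative at \<open>x0\<close> is the identity and A (H x) = pr (\<psi> x), so in the new
    coordinates pr \<circ> \<psi> is the linear map A.\<close>
  define H where "H x = x - T (A x) + T (pr (\<psi> x))" for x
  have W: "open W" using \<psi> cinf_open by blast
  have H: "cinf W H" unfolding H_def
    by (intro cinf_add cinf_diff cinf_id W cinf_linear_comp[OF T(1)] cinf_linear_comp[OF pr(1)] cinf_linear[OF A] \<psi>)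
  have "fd H x0 v = v" for v
  proof -
    have "(H has_derivative (\<lambda>v. v - T (A v) + T (pr (A v)))) (at x0)"
      unfolding H_def A_def
      by (intro has_derivative_add has_derivative_diff has_derivative_ident
          linear_comp_has_derivative[OF T(1)] linear_comp_has_derivative[OF pr(1)]
          linear_comp_has_derivative[OF A[unfolded A_def]]
          cinf_has_derivative[OF \<psi> x0])
    from fd_eqI[OF this] show ?thesis by (simp add: pr(3)[OF AR])
  qed
  from cinf_inverse_function[OF H x0 this] obtain U' V G where G: "open U'" "U' \<subseteq> W" "x0 \<in> U'" "open V" "H x0 \<in> V"
    "\<And>x. x \<in> U' \<Longrightarrow> H x \<in> V \<and> G (H x) = x" "\<And>y. y \<in> V \<Longrightarrow> G y \<in> U' \<and> H (G y) = y" "cinf V G" by metis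
  have AH: "A (H x) = pr (\<psi> x)" for x
    using T(2) pr(2) AR by (simp add: H_def linear_add[OF A] linear_diff[OF A])
  define \<phi> where "\<phi> w = \<psi> (G w)" for w
  have \<phi>: "cinf V \<phi>" unfolding \<phi>_def by (rule cinf_compose[OF G(8) \<psi>]) (use G(2,7) in blast)
  have fd\<phi>: "fd \<phi> w \<zeta> = fd \<psi> (G w) (fd G w \<zeta>)" if "w \<in> V" for w \<zeta>
    unfolding \<phi>_def[abs_def]
    by (rule fd_compose[OF cinf_differentiable[OF G(8) that] cinf_differentiable[OF \<psi>]]) (use that G in blast)
  have pr\<phi>: "pr (fd \<phi> w \<zeta>) = A \<zeta>" if w: "w \<in> V" for w \<zeta>
  proof -
    have "((\<lambda>w. pr (\<phi> w)) has_derivative (\<lambda>\<zeta>. pr (fd \<phi> w \<zeta>))) (at w)"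
      by (rule linear_comp_has_derivative[OF pr(1) cinf_has_derivative[OF \<phi> w]])
    moreover have "pr (\<phi> w') = A w'" if "w' \<in> V" for w'
      using AH[of "G w'"] G(7)[OF that] by (simp add: \<phi>_def)
    ultimately have "(A has_derivative (\<lambda>\<zeta>. pr (fd \<phi> w \<zeta>))) (at w)"
      by (rule has_derivative_transform_within_open[OF _ G(4) w])
    moreover have "(A has_derivative A) (at w)" using A by (rule linear_imp_has_derivative)
    ultimately have "(\<lambda>\<zeta>. pr (fd \<phi> w \<zeta>)) = A" by (rule has_derivative_unique)
    then show ?thesis by metis
  qed
  \<comment> \<open>Here constancy of the rank enters. The projection pr maps the r-dimensional
    range of the derivative of \<psi> onto at least R, which also has dimension r, and is thus
    injective on it. If A kills a vector, so does pr after the derivative of \<phi>, and hence that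
    derivative itself.\<close>
  have ker0: "fd \<phi> w \<eta> = 0" if w: "w \<in> V" and "A \<eta> = 0" for w \<eta>
  proof (rule inj_on_of_dim_image[OF pr(1)])
    let ?S = "range (fd \<psi> (G w))"
    have Gw: "G w \<in> W" using G w by blast
    show "subspace ?S" by (rule linear_subspace_image[OF cinf_linear_fd[OF \<psi> Gw] subspace_UNIV])
    have "A \<zeta> \<in> pr ` ?S" for \<zeta>
      using pr\<phi>[OF w, of \<zeta>] fd\<phi>[OF w, of \<zeta>] by (intro image_eqI[of _ _ "fd \<phi> w \<zeta>"]) auto
    then have "R \<subseteq> pr ` ?S" unfolding R_def by blast
    then show "dim ?S \<le> dim (pr ` ?S)" using dim_subset rank[OF Gw] dimR by metis
    show "fd \<phi> w \<eta> \<in> ?S" using fd\<phi>[OF w] by simp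
    show "pr (fd \<phi> w \<eta>) = 0" using pr\<phi>[OF w] that by simp
  qed
  define w0 where "w0 = H x0"
  obtain e where e: "e > 0" "ball w0 e \<subseteq> V" using G(4,5) openE unfolding w0_def by blast
  define q where "q w = w0 + T (A (w - w0))" for w
  have contq: "continuous_on UNIV q" unfolding q_def
    using T(1) A by (intro continuous_intros linear_continuous_on_compose[OF _ T(1)] linear_continuous_on_compose[OF _ A])
  \<comment> \<open>Both w and its projection q w along the kernel of A lie in one convex ball, so
    the segment between them stays in V, where \<phi> has zero derivative in its direction.\<close>
  define B where "B = ball w0 e \<inter> q -` ball w0 e"
  have B: "open B" unfolding B_def by (intro open_Int open_ball open_vimage contq)
  have slice: "\<phi> w = \<phi> (q w)" if "w \<in> B" for w
  proof -
    let ?d = "w - q w"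
    have Ad: "A ?d = 0"
    proof -
      have "?d = (w - w0) - T (A (w - w0))" by (simp add: q_def)
      then have "A ?d = A (w - w0) - A (T (A (w - w0)))" by (simp only: linear_diff[OF A, of "w - w0"])
      then show ?thesis using T(2)[OF AR] by simp
    qed
    have seg: "q w + t *\<^sub>R ?d \<in> V" if "t \<in> {0..1}" for t
    proof -
      have "(1 - t) *\<^sub>R q w + t *\<^sub>R w \<in> ball w0 e"
        using \<open>w \<in> B\<close> that by (intro convexD[OF convex_ball]) (auto simp: B_def)
      then show ?thesis using e(2) by (auto simp: algebra_simps)
    qed
    have "((\<lambda>t. \<phi> (q w + t *\<^sub>R ?d)) has_vector_derivative 0) (at t within {0..1})" if "t \<in> {0..1}" for t
      using cinf_line_derivative[OF \<phi> seg[OF that]] unfolding ker0[OF seg[OF that] Ad]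
      by (rule has_vector_derivative_at_within)
    then obtain c where "\<And>t. t \<in> {0..1} \<Longrightarrow> \<phi> (q w + t *\<^sub>R ?d) = c"
      by (rule has_vector_derivative_zero_constant[OF convex_real_interval(5)]) (assumption, blast)
    from this[of 0] this[of 1] show ?thesis by simp
  qed
  define W' where "W' = {x \<in> U'. H x \<in> B}"
  have W': "open W'" unfolding W'_def by (rule cinf_preimage_open[OF cinf_subset[OF H G(1,2)] B])
  have "w0 \<in> B" using e by (simp add: B_def q_def linear_0[OF A] linear_0[OF T(1)])
  then have "x0 \<in> W'" using G(3) by (simp add: W'_def w0_def)
  have RZ: "subspace (R \<times> Z)" by (rule subspace_Times[OF R Z])
  have dimRZ: "dim (R \<times> Z) = r + dim Z" using dim_Times[OF R Z] dimR by simp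
  \<comment> \<open>The parameters range over R \<times> Z, which lives in another type. A copy Y of
    it inside the target space is a null set there, since its dimension is smaller, and
    differentiable maps of a space into itself preserve null sets.\<close>
  obtain Y :: "'b set" where Y: "subspace Y" "dim Y = r + dim Z"
    using choose_subspace_of_subspace[of "r + dim Z" "UNIV :: 'b set"] small by auto
  obtain \<kappa> where \<kappa>: "linear \<kappa>" "\<kappa> ` Y = R \<times> Z"
    using isometries_subspaces[OF Y(1) RZ] Y(2) dimRZ by metis
  define \<Xi> where "\<Xi> y = \<phi> (w0 + T (fst (\<kappa> y))) + snd (\<kappa> y)" for y
  define l where "l y = w0 + T (fst (\<kappa> y))" for y
  have lsm: "cinf UNIV l" unfolding l_def
    by (rule cinf_add[OF cinf_const], simp, rule cinf_linear_comp[OF T(1)],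
        rule cinf_bounded_linear_comp[OF bounded_linear_fst], rule cinf_linear[OF \<kappa>(1)], simp)
  have Y': "open {y. l y \<in> V}" using cinf_preimage_open[OF lsm G(4)] by simp
  have "cinf {y. l y \<in> V} (\<lambda>y. \<phi> (l y) + snd (\<kappa> y))"
    by (rule cinf_add, rule cinf_compose[OF cinf_subset[OF lsm Y'] \<phi>], simp, simp,
        rule cinf_bounded_linear_comp[OF bounded_linear_snd], rule cinf_linear[OF \<kappa>(1) Y'])
  then have "\<Xi> differentiable_on (Y \<inter> {y. l y \<in> V})"
    unfolding \<Xi>_def l_def[symmetric] differentiable_on_def
    by (auto intro: differentiable_at_withinI dest: cinf_differentiable)
  moreover have "negligible (Y \<inter> {y. l y \<in> V})"
    using negligible_lowdim[of Y] Y(2) small negligible_Int by auto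
  ultimately have neg: "negligible (\<Xi> ` (Y \<inter> {y. l y \<in> V}))"
    by (intro negligible_differentiable_image_negligible) auto
  have "{\<psi> x + z | x z. x \<in> W' \<and> z \<in> Z} \<subseteq> \<Xi> ` (Y \<inter> {y. l y \<in> V})"
  proof clarify
    fix x z assume x: "x \<in> W'" and z: "z \<in> Z"
    have HB: "H x \<in> B" "x \<in> U'" using x by (auto simp: W'_def)
    let ?s = "A (H x - w0)"
    have "(?s, z) \<in> R \<times> Z" using AR z by simp
    then obtain y where y: "y \<in> Y" "\<kappa> y = (?s, z)" using \<kappa>(2) by (metis imageE)
    have ly: "l y = q (H x)" by (simp add: l_def q_def y)
    have "\<psi> x = \<phi> (H x)" using G(6)[OF HB(2)] by (simp add: \<phi>_def)
    also have "\<dots> = \<phi> (l y)" using slice[OF HB(1)] ly by simp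
    finally have "\<psi> x + z = \<Xi> y" by (simp add: \<Xi>_def l_def y)
    moreover have "l y \<in> V" using HB(1) e(2) ly by (auto simp: B_def)
    ultimately show "\<psi> x + z \<in> \<Xi> ` (Y \<inter> {y. l y \<in> V})" using y(1) by blast
  qed
  then have "negligible {\<psi> x + z | x z. x \<in> W' \<and> z \<in> Z}" by (rule negligible_subset[OF neg])
  then show ?thesis using W' \<open>x0 \<in> W'\<close> G(2) by (intro exI[of _ W']) (auto simp: W'_def)
qed

subsection \<open>Local solutions of smooth autonomous differential equations\<close>

lemma cinf_lipschitz_ball:
  fixes X :: "'a::euclidean_space \<Rightarrow> 'b::real_normed_vector"
  assumes X: "cinf W X" and sub: "cball x0 r \<subseteq> W"
  obtains L where "L > 0" "\<And>x y. x \<in> cball x0 r \<Longrightarrow> y \<in> cball x0 r \<Longrightarrow> norm (X x - X y) \<le> L * norm (x - y)"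
proof -
  let ?k = "\<lambda>x. \<Sum>b\<in>Basis. norm (fd X x b)"
  have "continuous_on (cball x0 r) ?k"
    by (intro continuous_on_sum continuous_on_norm continuous_on_subset[OF cinf_continuous[OF cinf_fd[OF X]] sub])
  then have "bounded (?k ` cball x0 r)" by (intro compact_imp_bounded compact_continuous_image compact_cball)
  then obtain C where C: "C > 0" "\<And>x. x \<in> cball x0 r \<Longrightarrow> norm (?k x) \<le> C"
    unfolding bounded_pos by auto
  have on: "onorm (fd X x) \<le> C" if "x \<in> cball x0 r" for x
  proof (rule onorm_le)
    fix v
    have lin: "linear (fd X x)" by (rule cinf_linear_fd[OF X]) (use sub that in auto)
    have "norm (fd X x v) \<le> (\<Sum>b\<in>Basis. norm ((v \<bullet> b) *\<^sub>R fd X x b))"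
      unfolding linear_basis_sum[OF lin, of v] by (rule norm_sum)
    also have "\<dots> \<le> (\<Sum>b\<in>Basis. norm v * norm (fd X x b))"
      by (intro sum_mono) (auto intro!: mult_right_mono simp: Basis_le_norm)
    also have "\<dots> = norm v * ?k x" by (simp add: sum_distrib_left)
    also have "\<dots> \<le> norm v * C" using C(2)[OF that] by (intro mult_left_mono) auto
    finally show "norm (fd X x v) \<le> C * norm v" by (simp add: mult.commute)
  qed
  show ?thesis
  proof (rule that[OF C(1)])
    fix x y assume "x \<in> cball x0 r" "y \<in> cball x0 r"
    then show "norm (X x - X y) \<le> C * norm (x - y)"
      by (intro differentiable_bound[OF convex_cball
            has_derivative_at_withinI[OF cinf_has_derivative[OF X subsetD[OF sub]]] on])
  qed
qed

text \<open>Picard iteration. The iterates are bounded continuous functions on the whole line, a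
  complete type, with time clamped to [-e, e] by c; the fixed point theorem then applies directly,
  and the equation is read off inside the interval.\<close>

lemma lipschitz_ode:
  fixes F :: "'a::euclidean_space \<Rightarrow> 'a"
  assumes L: "L > 0" "\<And>x y. norm (F x - F y) \<le> L * norm (x - y)"
  obtains e y where "e > (0::real)" "continuous_on UNIV (y :: real \<Rightarrow> 'a)" "y 0 = x0"
    "\<And>t. t \<in> {-e<..<e} \<Longrightarrow> (y has_vector_derivative F (y t)) (at t)"
proof -
  \<comment> \<open>Makes the contraction factor 4 e L equal to 1/2: each of the two integrals in P
    f t runs over a length of at most 2 e.\<close>
  define e where "e = 1 / (8 * L)"
  have e: "e > 0" "4 * e * L < 1" using L(1) by (auto simp: e_def)
  define c where "c t = max (-e) (min e t)" for t :: real
  have c: "c t \<in> {-e..e}" for t using e by (auto simp: c_def)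
  have contc: "continuous_on UNIV c" unfolding c_def by (intro continuous_intros)
  have contF: "continuous_on S F" for S
  proof (rule continuous_on_subset[OF lipschitz_on_continuous_on])
    show "L-lipschitz_on UNIV F" using L by (auto simp: lipschitz_on_def dist_norm)
  qed simp
  \<comment> \<open>Integration starts at -e; subtracting I f 0 in P then treats negative times
    without reversed integrals.\<close>
  define I where "I f t = integral {-e..t} (\<lambda>s. F (f s))" for f :: "real \<Rightarrow> 'a" and t
  have contFf: "continuous_on S (\<lambda>s. F (f s))" if "continuous_on UNIV f" for f :: "real \<Rightarrow> 'a" and S :: "real set"
    by (rule continuous_on_compose2[OF contF continuous_on_subset[OF that]]) auto
  have int: "(\<lambda>s. F (f s)) integrable_on {a..b}" if "continuous_on UNIV f" for f :: "real \<Rightarrow> 'a" and a b :: real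
    by (rule integrable_continuous_interval[OF contFf[OF that]])
  have dI: "(I f has_vector_derivative F (f t)) (at t within {-e..e})" if "continuous_on UNIV f" "t \<in> {-e..e}" for f t
    unfolding I_def using integral_has_vector_derivative[OF contFf[OF that(1)] that(2)] .
  define P where "P f t = x0 + I f (c t) - I f 0" for f t
  have contP: "continuous_on UNIV (P f)" if "continuous_on UNIV f" for f
  proof -
    have "continuous_on {-e..e} (I f)"
      using dI[OF that] has_vector_derivative_continuous continuous_on_eq_continuous_within by blast
    then have "continuous_on UNIV (\<lambda>t. I f (c t))"
      by (rule continuous_on_compose2[OF _ contc]) (use c in blast)
    then show ?thesis unfolding P_def by (intro continuous_intros)
  qed
  have bP: "P f \<in> bcontfun" if "continuous_on UNIV f" for f
  proof -
    have "range (P f) = P f ` {-e..e}"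
    proof -
      have "P f t = P f (c t)" for t using e(1) by (auto simp: P_def c_def)
      then show ?thesis using c by (metis (no_types, lifting) UNIV_I image_subsetI image_eqI subset_antisym subset_UNIV image_mono)
    qed
    moreover have "compact (P f ` {-e..e})"
      by (intro compact_continuous_image continuous_on_subset[OF contP[OF that]]) auto
    ultimately show ?thesis using contP[OF that] compact_imp_bounded by (auto simp: bcontfun_def)
  qed
  define Q where "Q f = Bcontfun (P (apply_bcontfun f))" for f
  have Q: "apply_bcontfun (Q f) = P (apply_bcontfun f)" for f
    unfolding Q_def by (rule Bcontfun_inverse[OF bP]) simp
  have "\<exists>!f. Q f = f"
  proof (rule banach_fix_type[of "4 * e * L"])
    show "\<forall>f g. dist (Q f) (Q g) \<le> 4 * e * L * dist f g"
    proof (intro allI dist_bound)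
      fix f g :: "real \<Rightarrow>\<^sub>C 'a" and t
      have b: "norm (I f t - I g t) \<le> L * dist f g * (2 * e)" if "t \<in> {-e..e}" for t
      proof -
        have "norm (I f t - I g t) = norm (integral {-e..t} (\<lambda>s. F (f s) - F (g s)))"
          unfolding I_def by (simp add: Henstock_Kurzweil_Integration.integral_diff int)
        also have "\<dots> \<le> L * dist f g * (t - (-e))"
        proof (rule integral_bound)
          show "norm (F (f s) - F (g s)) \<le> L * dist f g" for s
          proof -
            have "norm (f s - g s) \<le> dist f g" using dist_bounded[of f s g] by (simp add: dist_norm)
            then have "L * norm (f s - g s) \<le> L * dist f g" using L(1) by (intro mult_left_mono) auto
            then show ?thesis using L(2)[of "f s" "g s"] by (rule order_trans[rotated])
          qed
          show "continuous_on {-e..t} (\<lambda>s. F (f s) - F (g s))"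
            by (intro continuous_intros contFf) simp_all
        qed (use that in auto)
        also have "\<dots> \<le> L * dist f g * (2 * e)" using that L(1) by (intro mult_left_mono) auto
        finally show ?thesis .
      qed
      have "dist (Q f t) (Q g t) = norm ((I f (c t) - I g (c t)) - (I f 0 - I g 0))"
        unfolding Q P_def by (simp add: dist_norm algebra_simps)
      also have "\<dots> \<le> L * dist f g * (2 * e) + L * dist f g * (2 * e)"
      proof -
        have "norm (I f 0 - I g 0) \<le> L * dist f g * (2 * e)" using e(1) by (intro b) auto
        then show ?thesis
          using norm_triangle_ineq4[of "I f (c t) - I g (c t)" "I f 0 - I g 0"] b[OF c, of t] by linarith
      qed
      finally show "dist (Q f t) (Q g t) \<le> 4 * e * L * dist f g" by (simp add: algebra_simps)
    qed
  qed (use e L in auto)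
  then obtain f where "Q f = f" by blast
  then have f: "apply_bcontfun f = P f" using Q[of f] by (rule subst[where P = "\<lambda>g. apply_bcontfun g = P (apply_bcontfun f)"])
  show ?thesis
  proof (rule that[OF e(1)])
    show "continuous_on UNIV f" by simp
    show "apply_bcontfun f 0 = x0" using e(1) by (subst f) (simp add: P_def c_def)
    fix t assume t: "t \<in> {-e<..<e}"
    have "(I f has_vector_derivative F (f t)) (at t)"
      using dI[of f t] t at_within_Icc_at[of "-e" t e] by auto
    then have "((\<lambda>t. x0 + I f t - I f 0) has_vector_derivative F (f t)) (at t)"
      by (auto intro!: derivative_eq_intros)
    moreover have "x0 + I f s - I f 0 = apply_bcontfun f s" if "s \<in> {-e<..<e}" for s
      using that by (subst f) (simp add: P_def c_def)
    ultimately show "(apply_bcontfun f has_vector_derivative F (f t)) (at t)"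
      by (rule has_vector_derivative_transform_within_open[OF _ open_greaterThanLessThan t])
  qed
qed

text \<open>The field is Lipschitz only on a ball around \<open>x0\<close>. Precomposing with the
  nearest-point projection, which does not increase distances, makes it globally Lipschitz, and for
  short times the solution stays in the ball, where nothing was changed. Smoothness bootstraps from
  the equation y' = X(y).\<close>

lemma smooth_ode:
  fixes X :: "'a::euclidean_space \<Rightarrow> 'a"
  assumes X: "cinf W X" and x0: "x0 \<in> W"
  obtains e y where "e > (0::real)" "y 0 = x0" "\<And>t. t \<in> {-e<..<e} \<Longrightarrow> y t \<in> W"
    "\<And>t. t \<in> {-e<..<e} \<Longrightarrow> (y has_vector_derivative X (y t)) (at t)" "cinf {-e<..<e} y"
proof -
  obtain r where r: "r > 0" "cball x0 r \<subseteq> W" using cinf_open[OF X] x0 open_contains_cball by blast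
  obtain L where L: "L > 0"
      "\<And>x y. x \<in> cball x0 r \<Longrightarrow> y \<in> cball x0 r \<Longrightarrow> norm (X x - X y) \<le> L * norm (x - y)"
    using cinf_lipschitz_ball[OF X r(2)] by blast
  let ?p = "closest_point (cball x0 r)"
  have p: "?p x \<in> cball x0 r" for x using r(1) by (intro closest_point_in_set) auto
  have "norm (X (?p x) - X (?p y)) \<le> L * norm (x - y)" for x y
  proof -
    have "norm (?p x - ?p y) \<le> norm (x - y)"
      using closest_point_lipschitz[of "cball x0 r" x y] r(1) by (simp add: dist_norm)
    then show ?thesis using L(2)[OF p p, of x y] mult_left_mono[of _ _ L] L(1) by (meson less_imp_le order_trans)
  qed
  then obtain e y where y: "e > (0::real)" "continuous_on UNIV y" "y 0 = x0"
    "\<And>t. t \<in> {-e<..<e} \<Longrightarrow> (y has_vector_derivative X (?p (y t))) (at t)"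
    using lipschitz_ode[OF L(1), of "\<lambda>x. X (?p x)"] by metis
  have "open (y -` ball x0 r)" by (rule open_vimage[OF open_ball y(2)])
  then obtain d where d: "d > 0" "ball 0 d \<subseteq> y -` ball x0 r"
    using y(3) r(1) openE[of "y -` ball x0 r" 0] by auto
  define e' where "e' = min e d"
  have e': "e' > 0" using y(1) d(1) by (simp add: e'_def)
  have inb: "y t \<in> cball x0 r" if "t \<in> {-e'<..<e'}" for t
  proof -
    have "t \<in> ball 0 d" using that by (auto simp: e'_def)
    then show ?thesis using d(2) by (force simp: less_imp_le)
  qed
  have der: "(y has_vector_derivative X (y t)) (at t)" if "t \<in> {-e'<..<e'}" for t
    using y(4)[of t] closest_point_self[OF inb[OF that]] that by (auto simp: e'_def min_def split: if_splits)
  have inW: "y t \<in> W" if "t \<in> {-e'<..<e'}" for t using inb[OF that] r(2) by blast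
  have "C_k_on n {-e'<..<e'} y" for n
  proof (induction n)
    case 0
    show ?case using continuous_on_subset[OF y(2)] by simp
  next
    case (Suc n)
    have "C_k_on n {-e'<..<e'} (\<lambda>t. v *\<^sub>R X (y t))" for v :: real
      by (rule C_k_on_bounded_linear_comp[OF bounded_linear_scaleR_right open_greaterThanLessThan],
          rule C_k_on_compose[OF open_greaterThanLessThan cinf_open[OF X] _ Suc.IH cinfD[OF X]])
        (use inW in blast)
    moreover have "fd y t v = v *\<^sub>R X (y t)" if "t \<in> {-e'<..<e'}" for t v
      using fd_eqI[OF der[OF that, unfolded has_vector_derivative_def]] by simp
    ultimately have "C_k_on n {-e'<..<e'} (\<lambda>t. fd y t v)" for v
      using C_k_on_cong[OF open_greaterThanLessThan, of _ _ "\<lambda>t. fd y t v"] by simp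
    moreover have "y differentiable at t" if "t \<in> {-e'<..<e'}" for t
      using der[OF that] unfolding has_vector_derivative_def differentiable_def by blast
    ultimately show ?case by simp
  qed
  then have "cinf {-e'<..<e'} y" by (simp add: cinf_def)
  then show ?thesis using that[OF e' y(3) inW der] by blast
qed

section \<open>Parametrised pieces of manifolds\<close>

text \<open>The part of the manifold axioms that products satisfy trivially.\<close>

definition charted :: "('a, 'e::euclidean_space) mfd \<Rightarrow> bool" where
  "charted M \<longleftrightarrow> subspace (model M) \<and> (\<Union>(U, c)\<in>atlas M. U) = pts M \<and>
     (\<forall>(U, c)\<in>atlas M. openin (mtop M) U \<and> inj_on c U \<and>
        (\<forall>V. V \<subseteq> U \<longrightarrow> openin (mtop M) V \<longrightarrow> openin (top_of_set (model M)) (c ` V)))"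

lemma charted_subspace: "charted M \<Longrightarrow> subspace (model M)"
  by (simp add: charted_def)

lemma charted_openin: "charted M \<Longrightarrow> (U, c) \<in> atlas M \<Longrightarrow> openin (mtop M) U"
  unfolding charted_def by blast

lemma charted_inj: "charted M \<Longrightarrow> (U, c) \<in> atlas M \<Longrightarrow> inj_on c U"
  unfolding charted_def by blast

lemma charted_image:
  "charted M \<Longrightarrow> (U, c) \<in> atlas M \<Longrightarrow> V \<subseteq> U \<Longrightarrow> openin (mtop M) V \<Longrightarrow>
    openin (top_of_set (model M)) (c ` V)"
  unfolding charted_def by blast

lemma charted_model: "charted M \<Longrightarrow> (U, c) \<in> atlas M \<Longrightarrow> q \<in> U \<Longrightarrow> c q \<in> model M"
  using openin_imp_subset[OF charted_image[OF _ _ subset_refl charted_openin]] by blast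

lemma charted_cover: "charted M \<Longrightarrow> p \<in> pts M \<Longrightarrow> \<exists>U c. (U, c) \<in> atlas M \<and> p \<in> U"
  unfolding charted_def by blast

lemma smooth_manifold_subspace: "smooth_manifold M \<Longrightarrow> subspace (model M)"
  unfolding smooth_manifold_def by (metis subspace_span)

lemma smooth_manifold_homeo:
  assumes "smooth_manifold M" "(U, c) \<in> atlas M"
  shows "homeomorphic_map (subtopology (mtop M) U) (top_of_set (c ` U)) c"
    and "openin (mtop M) U" and "openin (top_of_set (model M)) (c ` U)"
  using assms unfolding smooth_manifold_def by blast+

lemma smooth_manifold_charted:
  fixes M :: "('a, 'e::euclidean_space) mfd"
  assumes M: "smooth_manifold M"
  shows "charted M"
proof -
  have "inj_on c U \<and> (\<forall>V. V \<subseteq> U \<longrightarrow> openin (mtop M) V \<longrightarrow> openin (top_of_set (model M)) (c ` V))"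
    if C: "(U, c) \<in> atlas M" for U c
  proof (intro conjI allI impI)
    note h = smooth_manifold_homeo[OF M C]
    have "topspace (subtopology (mtop M) U) = U"
      using openin_subset[OF h(2)] by auto
    then show "inj_on c U" using homeomorphic_imp_injective_map[OF h(1)] by simp
    fix V assume V: "V \<subseteq> U" "openin (mtop M) V"
    then have "openin (subtopology (mtop M) U) V" by (meson openin_open_subtopology h(2))
    then have "openin (top_of_set (c ` U)) (c ` V)"
      using homeomorphic_imp_open_map[OF h(1)] by (simp add: open_map_def)
    then show "openin (top_of_set (model M)) (c ` V)" using h(3) openin_trans by blast
  qed
  then show ?thesis
    using M smooth_manifold_subspace[OF M] unfolding charted_def smooth_manifold_def by blast
qed

lemma charted_prod:
  assumes M: "charted M" and N: "charted N"
  shows "charted (prod_mfd M N)"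
proof -
  have "openin (top_of_set (model M \<times> model N)) (map_prod c c' ` V)"
    if C: "(U, c) \<in> atlas M" and C': "(U', c') \<in> atlas N" and V: "V \<subseteq> U \<times> U'"
      "openin (prod_topology (mtop M) (mtop N)) V" for U c U' c' V
  proof (rule openin_subopen[THEN iffD2], rule ballI)
    fix y assume "y \<in> map_prod c c' ` V"
    then obtain a b where ab: "(a, b) \<in> V" and y: "y = map_prod c c' (a, b)" by (metis imageE prod.exhaust)
    from V(2)[unfolded openin_prod_topology_alt, rule_format, OF ab]
    obtain A B where AB: "openin (mtop M) A" "openin (mtop N) B" "a \<in> A" "b \<in> B" "A \<times> B \<subseteq> V"
      by (elim exE conjE)
    have "A \<subseteq> U" "B \<subseteq> U'" using AB V(1) by blast+
    then have "openin (top_of_set (model M \<times> model N)) (c ` A \<times> c' ` B)"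
      using charted_image[OF M C _ AB(1)] charted_image[OF N C' _ AB(2)]
      by (intro openin_Times)
    moreover have "map_prod c c' (a, b) \<in> c ` A \<times> c' ` B" using AB by simp
    moreover have "c ` A \<times> c' ` B \<subseteq> map_prod c c' ` V"
    proof clarify
      fix x y assume "x \<in> A" "y \<in> B"
      then show "(c x, c' y) \<in> map_prod c c' ` V"
        using AB(5) by (intro image_eqI[of _ _ "(x, y)"]) auto
    qed
    ultimately show "\<exists>T. openin (top_of_set (model M \<times> model N)) T \<and> y \<in> T \<and>
        T \<subseteq> map_prod c c' ` V" unfolding y by (intro exI[of _ "c ` A \<times> c' ` B"] conjI)
  qed
  note image = this
  have cov: "(\<Union>(U, c)\<in>atlas (prod_mfd M N). U) = pts (prod_mfd M N)"
  proof (rule Set.set_eqI, rule iffI)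
    fix x assume "x \<in> (\<Union>(U, c)\<in>atlas (prod_mfd M N). U)"
    then obtain W d where "(W, d) \<in> atlas (prod_mfd M N)" "x \<in> W" by blast
    then obtain U c U' c' where *: "(U, c) \<in> atlas M" "(U', c') \<in> atlas N" "x \<in> U \<times> U'"
      unfolding prod_mfd_def mfd.simps by blast
    show "x \<in> pts (prod_mfd M N)"
      using openin_subset[OF charted_openin[OF M *(1)]] openin_subset[OF charted_openin[OF N *(2)]] *(3)
      by (auto simp: prod_mfd_def)
  next
    fix x assume "x \<in> pts (prod_mfd M N)"
    then obtain a b where x: "x = (a, b)" "a \<in> pts M" "b \<in> pts N" by (auto simp: prod_mfd_def)
    obtain U c where "(U, c) \<in> atlas M" "a \<in> U" using charted_cover[OF M x(2)] by blast
    moreover obtain U' c' where "(U', c') \<in> atlas N" "b \<in> U'" using charted_cover[OF N x(3)] by blast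
    ultimately have "(U \<times> U', map_prod c c') \<in> atlas (prod_mfd M N)" "x \<in> U \<times> U'"
      using x(1) by (auto simp: prod_mfd_def)
    then show "x \<in> (\<Union>(U, c)\<in>atlas (prod_mfd M N). U)" by blast
  qed
  have "openin (mtop (prod_mfd M N)) W \<and> inj_on d W \<and>
      (\<forall>V. V \<subseteq> W \<longrightarrow> openin (mtop (prod_mfd M N)) V \<longrightarrow> openin (top_of_set (model (prod_mfd M N))) (d ` V))"
    if WD: "(W, d) \<in> atlas (prod_mfd M N)" for W d
  proof -
    obtain U c U' c' where *: "(U, c) \<in> atlas M" "(U', c') \<in> atlas N" "W = U \<times> U'" "d = map_prod c c'"
      using WD unfolding prod_mfd_def mfd.simps by blast
    show ?thesis
      using charted_openin[OF M *(1)] charted_openin[OF N *(2)] image[OF *(1,2)]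
        map_prod_inj_on[OF charted_inj[OF M *(1)] charted_inj[OF N *(2)]]
      by (simp add: *(3,4) prod_mfd_def openin_prod_Times_iff)
  qed
  moreover have "subspace (model (prod_mfd M N))"
    using subspace_Times[OF charted_subspace[OF M] charted_subspace[OF N]] by (simp add: prod_mfd_def)
  ultimately show ?thesis using cov unfolding charted_def by blast
qed

lemma open_fat:
  assumes "subspace E" "openin (top_of_set E) A"
  shows "open {x. proj_on E x \<in> A}"
proof -
  obtain T where T: "open T" "A = E \<inter> T" using assms(2) openin_open by blast
  have "{x. proj_on E x \<in> A} = proj_on E -` T" using T(2) proj_on_in[OF assms(1)] by auto
  moreover have "continuous_on UNIV (proj_on E)"
    using linear_proj_on[OF assms(1)] linear_continuous_on linear_conv_bounded_linear by blast
  ultimately show ?thesis using open_vimage[OF T(1)] by simp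
qed

lemma smooth_onE:
  assumes "smooth_on A f" "x \<in> A"
  obtains W g where "x \<in> W" "cinf W g" "\<And>y. y \<in> A \<Longrightarrow> y \<in> W \<Longrightarrow> g y = f y"
proof -
  from bspec[OF assms(1)[unfolded smooth_on_def] assms(2)] obtain W g where
    *: "open W" "x \<in> W" "\<forall>n. C_k_on n W g" "\<forall>y\<in>A \<inter> W. g y = f y" by (elim exE conjE)
  show ?thesis by (rule that[of W g]) (use * in \<open>simp_all add: cinf_def\<close>)
qed

text \<open>The local extensions supplied by \<open>smooth_on\<close> need not agree off A.
  Composition with the projection replaces them by one extension on an open set, constant along the
  kernel of the projection.\<close>

lemma cinf_of_smooth_on:
  assumes E: "subspace E" and A: "openin (top_of_set E) A" and f: "smooth_on A f"
  shows "cinf {x. proj_on E x \<in> A} (\<lambda>x. f (proj_on E x))"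
proof (rule cinf_local[OF open_fat[OF E A]])
  fix x assume "x \<in> {x. proj_on E x \<in> A}"
  then obtain W g where W: "proj_on E x \<in> W" and g: "cinf W g"
    and eq: "\<And>y. y \<in> A \<Longrightarrow> y \<in> W \<Longrightarrow> g y = f y"
    using smooth_onE[OF f, of "proj_on E x"] by auto
  have p: "cinf {x. proj_on E x \<in> A} (proj_on E)"
    by (rule cinf_linear[OF linear_proj_on[OF E] open_fat[OF E A]])
  let ?V = "{y \<in> {x. proj_on E x \<in> A}. proj_on E y \<in> W}"
  have V: "open ?V" by (rule cinf_preimage_open[OF p cinf_open[OF g]])
  have "cinf ?V (\<lambda>y. g (proj_on E y))"
    by (rule cinf_compose[OF cinf_subset[OF p V] g]) auto
  then have "cinf ?V (\<lambda>y. f (proj_on E y))" by (rule cinf_cong) (use eq in simp)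
  then show "\<exists>V. x \<in> V \<and> cinf V (\<lambda>y. f (proj_on E y))"
    using \<open>x \<in> _\<close> W by (intro exI[of _ ?V]) simp
qed

lemma smooth_onI:
  assumes "\<And>x. x \<in> A \<Longrightarrow> \<exists>W g. x \<in> W \<and> cinf W g \<and> (\<forall>y\<in>A \<inter> W. g y = f y)"
  shows "smooth_on A f"
  unfolding smooth_on_def
proof
  fix x assume "x \<in> A"
  then obtain W g where "x \<in> W" "cinf W g" "\<forall>y\<in>A \<inter> W. g y = f y" using assms by blast
  then show "\<exists>W g. open W \<and> x \<in> W \<and> (\<forall>n. C_k_on n W g) \<and> (\<forall>y\<in>A \<inter> W. g y = f y)"
    unfolding cinf_def by blast
qed

text \<open>Charts take values in a subspace; composing inverse charts with a linear projection onto it gives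
  maps defined on open sets of the ambient space, to which ordinary calculus applies. Such maps into a
  manifold, of arbitrary dimension of the parameter space, replace the charts below.\<close>

definition param :: "('p, 'e::euclidean_space) mfd \<Rightarrow> 'a::euclidean_space set \<Rightarrow> ('a \<Rightarrow> 'p) \<Rightarrow> bool" where
  "param M W \<phi> \<longleftrightarrow> open W \<and> \<phi> ` W \<subseteq> pts M \<and>
     (\<forall>(U, c)\<in>atlas M. cinf {x \<in> W. \<phi> x \<in> U} (\<lambda>x. c (\<phi> x)))"

text \<open>The chart is the preferred one at \<phi> x and stays fixed while y varies, so the result
  is a tangent vector at \<phi> x in the sense of \<open>tangent_space\<close>. The parameter space
  is unrelated to the model, so curves, charts and maps from products are treated alike.\<close>

definition ptan :: "('p, 'e::euclidean_space) mfd \<Rightarrow> ('a::euclidean_space \<Rightarrow> 'p) \<Rightarrow> 'a \<Rightarrow> 'a \<Rightarrow> 'e" where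
  "ptan M \<phi> x v = fd (\<lambda>y. coord M (\<phi> x) (\<phi> y)) x v"

definition fat_dom :: "('p, 'e::euclidean_space) mfd \<Rightarrow> 'p set \<times> ('p \<Rightarrow> 'e) \<Rightarrow> 'e set" where
  "fat_dom M C = {x. proj_on (model M) x \<in> snd C ` fst C}"

definition fat_chart :: "('p, 'e::euclidean_space) mfd \<Rightarrow> 'p set \<times> ('p \<Rightarrow> 'e) \<Rightarrow> 'e \<Rightarrow> 'p" where
  "fat_chart M C x = inv_into (fst C) (snd C) (proj_on (model M) x)"

lemma paramD:
  assumes "param M W \<phi>"
  shows param_open: "open W" and param_pts: "x \<in> W \<Longrightarrow> \<phi> x \<in> pts M"
    and param_chart: "(U, c) \<in> atlas M \<Longrightarrow> cinf {x \<in> W. \<phi> x \<in> U} (\<lambda>x. c (\<phi> x))"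
  using assms unfolding param_def by blast+

lemma param_chart_open: "param M W \<phi> \<Longrightarrow> (U, c) \<in> atlas M \<Longrightarrow> open {x \<in> W. \<phi> x \<in> U}"
  by (rule cinf_open[OF param_chart])

lemma param_subset:
  assumes "param M W \<phi>" "open V" "V \<subseteq> W"
  shows "param M V \<phi>"
proof -
  have "cinf {x \<in> V. \<phi> x \<in> U} (\<lambda>x. c (\<phi> x))" if "(U, c) \<in> atlas M" for U c
  proof (rule cinf_subset[OF param_chart[OF assms(1) that]])
    have "{x \<in> V. \<phi> x \<in> U} = V \<inter> {x \<in> W. \<phi> x \<in> U}" using assms(3) by blast
    then show "open {x \<in> V. \<phi> x \<in> U}"
      using open_Int[OF assms(2) param_chart_open[OF assms(1) that]] by simp
  qed (use assms(3) in blast)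
  then show ?thesis using assms unfolding param_def by blast
qed

lemma param_cong:
  assumes "param M W \<phi>" "\<And>x. x \<in> W \<Longrightarrow> \<phi> x = \<psi> x"
  shows "param M W \<psi>"
proof -
  have "{x \<in> W. \<psi> x \<in> U} = {x \<in> W. \<phi> x \<in> U}" for U using assms(2) by auto
  moreover have "cinf {x \<in> W. \<phi> x \<in> U} (\<lambda>x. c (\<psi> x))" if "(U, c) \<in> atlas M" for U c
    by (rule cinf_cong[OF param_chart[OF assms(1) that]]) (use assms(2) in auto)
  ultimately show ?thesis using assms unfolding param_def by auto
qed

lemma param_local:
  assumes "open W" "\<And>x. x \<in> W \<Longrightarrow> \<exists>V. x \<in> V \<and> param M V \<phi>"
  shows "param M W \<phi>"
proof -
  have "cinf {x \<in> W. \<phi> x \<in> U} (\<lambda>x. c (\<phi> x))" if C: "(U, c) \<in> atlas M" for U c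
  proof (rule cinf_local)
    have *: "\<exists>V. x \<in> V \<and> V \<subseteq> {x \<in> W. \<phi> x \<in> U} \<and> cinf V (\<lambda>x. c (\<phi> x))" if "x \<in> W" "\<phi> x \<in> U" for x
    proof -
      obtain V where V: "x \<in> V" "param M V \<phi>" using assms(2) \<open>x \<in> W\<close> by blast
      have "param M (V \<inter> W) \<phi>" by (rule param_subset[OF V(2)]) (use assms(1) V param_open in auto)
      from param_chart[OF this C] show ?thesis
        using that V(1) by (intro exI[of _ "{x \<in> V \<inter> W. \<phi> x \<in> U}"]) auto
    qed
    show "open {x \<in> W. \<phi> x \<in> U}"
    proof (rule open_subopen[THEN iffD2], rule ballI)
      fix x assume "x \<in> {x \<in> W. \<phi> x \<in> U}"
      then obtain V where "x \<in> V" "V \<subseteq> {x \<in> W. \<phi> x \<in> U}" "cinf V (\<lambda>x. c (\<phi> x))" using *[of x] by auto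
      then show "\<exists>T. open T \<and> x \<in> T \<and> T \<subseteq> {x \<in> W. \<phi> x \<in> U}"
        by (intro exI[of _ V] conjI) (simp_all add: cinf_open)
    qed
    show "\<exists>V. x \<in> V \<and> cinf V (\<lambda>x. c (\<phi> x))" if "x \<in> {x \<in> W. \<phi> x \<in> U}" for x
      using *[of x] that by auto
  qed
  moreover have "\<phi> ` W \<subseteq> pts M" using assms(2) param_pts by (metis image_subsetI)
  ultimately show ?thesis using assms(1) unfolding param_def by blast
qed

lemma param_reparam:
  assumes "param M W \<phi>" "cinf V h"
  shows "param M {x \<in> V. h x \<in> W} (\<lambda>x. \<phi> (h x))"
proof -
  have o: "open {x \<in> V. h x \<in> W}" by (rule cinf_preimage_open[OF assms(2) param_open[OF assms(1)]])
  have "cinf {x \<in> {x \<in> V. h x \<in> W}. \<phi> (h x) \<in> U} (\<lambda>x. c (\<phi> (h x)))" if C: "(U, c) \<in> atlas M" for U c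
  proof -
    have eq: "{x \<in> {x \<in> V. h x \<in> W}. \<phi> (h x) \<in> U} = {x \<in> V. h x \<in> {y \<in> W. \<phi> y \<in> U}}" by auto
    have "open {x \<in> V. h x \<in> {y \<in> W. \<phi> y \<in> U}}"
      by (rule cinf_preimage_open[OF assms(2) param_chart_open[OF assms(1) C]])
    then have "cinf {x \<in> V. h x \<in> {y \<in> W. \<phi> y \<in> U}} h" by (rule cinf_subset[OF assms(2)]) auto
    from cinf_compose[OF this param_chart[OF assms(1) C]] show ?thesis unfolding eq by simp
  qed
  then show ?thesis using o param_pts[OF assms(1)] unfolding param_def by auto
qed

lemma param_const:
  assumes "open W" "p \<in> pts M"
  shows "param M W (\<lambda>x. p)"
proof -
  have "cinf {x \<in> W. p \<in> U} (\<lambda>x. c p)" for U and c :: "'b \<Rightarrow> 'c"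
    by (cases "p \<in> U") (simp_all add: cinf_const assms(1))
  then show ?thesis using assms unfolding param_def by auto
qed

lemma param_Pair:
  assumes "param M W \<phi>" "param N W \<psi>"
  shows "param (prod_mfd M N) W (\<lambda>x. (\<phi> x, \<psi> x))"
proof -
  have "cinf {x \<in> W. (\<phi> x, \<psi> x) \<in> U \<times> U'} (\<lambda>x. map_prod c c' (\<phi> x, \<psi> x))"
    if C: "(U, c) \<in> atlas M" and C': "(U', c') \<in> atlas N" for U c U' c'
  proof -
    have eq: "{x \<in> W. (\<phi> x, \<psi> x) \<in> U \<times> U'} = {x \<in> W. \<phi> x \<in> U} \<inter> {x \<in> W. \<psi> x \<in> U'}" by auto
    have o: "open ({x \<in> W. \<phi> x \<in> U} \<inter> {x \<in> W. \<psi> x \<in> U'})"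
      by (intro open_Int param_chart_open[OF assms(1) C] param_chart_open[OF assms(2) C'])
    show ?thesis unfolding eq map_prod_simp
      by (intro cinf_Pair cinf_subset[OF param_chart[OF assms(1) C] o] cinf_subset[OF param_chart[OF assms(2) C'] o]) auto
  qed
  then show ?thesis
    using assms(1) param_pts[OF assms(1)] param_pts[OF assms(2)]
    unfolding param_def by (auto simp: prod_mfd_def simp del: map_prod_simp)
qed

lemma chart_param:
  assumes "charted M" "(U, c) \<in> atlas M" "q \<in> U"
  shows "c q \<in> fat_dom M (U, c)" "fat_chart M (U, c) (c q) = q" "proj_on (model M) (c q) = c q"
proof -
  have m: "c q \<in> model M" by (rule charted_model[OF assms])
  show p: "proj_on (model M) (c q) = c q" by (rule proj_on_id[OF charted_subspace[OF assms(1)] m])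
  show "c q \<in> fat_dom M (U, c)" "fat_chart M (U, c) (c q) = q"
    using assms(3) charted_inj[OF assms(1,2)] by (auto simp: fat_dom_def fat_chart_def p)
qed

lemma fat_chart:
  assumes "x \<in> fat_dom M (U, c)"
  shows "fat_chart M (U, c) x \<in> U" "c (fat_chart M (U, c) x) = proj_on (model M) x"
  using assms inv_into_into[of "proj_on (model M) x" c U] f_inv_into_f[of "proj_on (model M) x" c U]
  by (auto simp: fat_dom_def fat_chart_def)

text \<open>\<open>param\<close> requires smoothness in every chart but not continuity into
  \<open>mtop M\<close>; this recovers it, as charts send open sets to relatively open ones.\<close>

lemma param_openin:
  assumes M: "charted M" and \<phi>: "param M W \<phi>" and S: "openin (mtop M) S"
  shows "open {x \<in> W. \<phi> x \<in> S}"
proof (rule open_subopen[THEN iffD2], clarify)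
  fix x assume x: "x \<in> W" "\<phi> x \<in> S"
  obtain U c where C: "(U, c) \<in> atlas M" "\<phi> x \<in> U" using charted_cover[OF M param_pts[OF \<phi> x(1)]] by blast
  have "openin (top_of_set (model M)) (c ` (S \<inter> U))"
    using charted_openin[OF M C(1)] S by (intro charted_image[OF M C(1)]) auto
  then obtain T where T: "open T" "c ` (S \<inter> U) = model M \<inter> T" using openin_open by blast
  let ?V = "{y \<in> {y \<in> W. \<phi> y \<in> U}. c (\<phi> y) \<in> T}"
  have "open ?V" by (rule cinf_preimage_open[OF param_chart[OF \<phi> C(1)] T(1)])
  moreover have "x \<in> ?V" using x C T(2) by blast
  moreover have "?V \<subseteq> {x \<in> W. \<phi> x \<in> S}"
  proof clarsimp
    fix y assume y: "y \<in> W" "\<phi> y \<in> U" "c (\<phi> y) \<in> T"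
    then have "c (\<phi> y) \<in> c ` (S \<inter> U)" using T(2) charted_model[OF M C(1)] by blast
    then show "\<phi> y \<in> S" using charted_inj[OF M C(1)] y(2) by (auto dest: inj_onD)
  qed
  ultimately show "\<exists>T. open T \<and> x \<in> T \<and> T \<subseteq> {x \<in> W. \<phi> x \<in> S}" by blast
qed

lemma param_smooth_map:
  assumes M: "charted M" and N: "charted N" and f: "smooth_map M N f" and \<phi>: "param M W \<phi>"
  shows "param N W (\<lambda>x. f (\<phi> x))"
proof -
  have cont: "continuous_map (mtop M) (mtop N) f"
    and sm: "\<And>U c U' c'. (U, c) \<in> atlas M \<Longrightarrow> (U', c') \<in> atlas N \<Longrightarrow>
      smooth_on (c ` {x \<in> U. f x \<in> U'}) (c' \<circ> f \<circ> inv_into U c)"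
    using f unfolding smooth_map_def by blast+
  have "cinf {x \<in> W. f (\<phi> x) \<in> U'} (\<lambda>x. c' (f (\<phi> x)))" if C': "(U', c') \<in> atlas N" for U' c'
  proof -
    have S: "openin (mtop M) {q \<in> pts M. f q \<in> U'}"
      by (rule openin_continuous_map_preimage[OF cont charted_openin[OF N C']])
    have "{x \<in> W. f (\<phi> x) \<in> U'} = {x \<in> W. \<phi> x \<in> {q \<in> pts M. f q \<in> U'}}"
      using param_pts[OF \<phi>] by auto
    then have o: "open {x \<in> W. f (\<phi> x) \<in> U'}" using param_openin[OF M \<phi> S] by simp
    show ?thesis
    proof (rule cinf_local[OF o])
      fix x assume x: "x \<in> {x \<in> W. f (\<phi> x) \<in> U'}"
      then obtain U c where C: "(U, c) \<in> atlas M" "\<phi> x \<in> U" using charted_cover[OF M param_pts[OF \<phi>]] by blast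
      let ?A = "c ` {q \<in> U. f q \<in> U'}" and ?P = "proj_on (model M)"
      have U: "U \<subseteq> pts M" using charted_openin[OF M C(1)] openin_subset by blast
      have "{q \<in> U. f q \<in> U'} = U \<inter> {q \<in> pts M. f q \<in> U'}" using U by blast
      then have "openin (mtop M) {q \<in> U. f q \<in> U'}" using charted_openin[OF M C(1)] S by auto
      then have A: "openin (top_of_set (model M)) ?A" by (intro charted_image[OF M C(1)]) auto
      note s = cinf_of_smooth_on[OF charted_subspace[OF M] A sm[OF C(1) C']]
      let ?V = "{y \<in> W. \<phi> y \<in> U} \<inter> {x \<in> W. f (\<phi> x) \<in> U'}"
      have V: "open ?V" by (intro open_Int o param_chart_open[OF \<phi> C(1)])
      have P: "?P (c (\<phi> y)) = c (\<phi> y)" if "y \<in> ?V" for y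
        using that by (intro chart_param(3)[OF M C(1)]) auto
      have "cinf ?V (\<lambda>y. (c' \<circ> f \<circ> inv_into U c) (?P (c (\<phi> y))))"
        by (rule cinf_compose[OF cinf_subset[OF param_chart[OF \<phi> C(1)] V] s]) (use P in auto)
      then have "cinf ?V (\<lambda>y. c' (f (\<phi> y)))"
        by (rule cinf_cong) (use P charted_inj[OF M C(1)] in auto)
      then show "\<exists>V. x \<in> V \<and> cinf V (\<lambda>y. c' (f (\<phi> y)))" using x C by (intro exI[of _ ?V]) auto
    qed
  qed
  moreover have "f (\<phi> x) \<in> pts N" if "x \<in> W" for x
    using param_pts[OF \<phi> that] continuous_map_image_subset_topspace[OF cont] by blast
  ultimately show ?thesis using param_open[OF \<phi>] unfolding param_def by blast
qed

lemma param_fat_chart: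
  assumes M: "smooth_manifold M" and C: "(U, c) \<in> atlas M"
  shows "param M (fat_dom M (U, c)) (fat_chart M (U, c))"
proof -
  have ch: "charted M" by (rule smooth_manifold_charted[OF M])
  have E: "subspace (model M)" by (rule charted_subspace[OF ch])
  have "fat_chart M (U, c) x \<in> pts M" if "x \<in> fat_dom M (U, c)" for x
    using fat_chart(1)[OF that] openin_subset[OF charted_openin[OF ch C]] by blast
  moreover have "open (fat_dom M (U, c))"
    unfolding fat_dom_def using open_fat[OF E smooth_manifold_homeo(3)[OF M C]] by simp
  moreover have "cinf {x \<in> fat_dom M (U, c). fat_chart M (U, c) x \<in> U'} (\<lambda>x. c' (fat_chart M (U, c) x))"
    if C': "(U', c') \<in> atlas M" for U' c'
  proof -
    have A: "openin (top_of_set (model M)) (c ` (U \<inter> U'))"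
      using charted_openin[OF ch C] charted_openin[OF ch C'] by (intro charted_image[OF ch C]) auto
    have "smooth_on (c ` (U \<inter> U')) (c' \<circ> inv_into U c)"
      using M C C' unfolding smooth_manifold_def by blast
    from cinf_of_smooth_on[OF E A this]
    have "cinf {x. proj_on (model M) x \<in> c ` (U \<inter> U')} (\<lambda>x. c' (fat_chart M (U, c) x))"
      by (simp add: fat_chart_def)
    moreover have "{x. proj_on (model M) x \<in> c ` (U \<inter> U')} = {x \<in> fat_dom M (U, c). fat_chart M (U, c) x \<in> U'}"
    proof (intro Set.set_eqI iffI)
      fix x assume "x \<in> {x. proj_on (model M) x \<in> c ` (U \<inter> U')}"
      then show "x \<in> {x \<in> fat_dom M (U, c). fat_chart M (U, c) x \<in> U'}"
        using charted_inj[OF ch C] by (auto simp: fat_dom_def fat_chart_def)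
    next
      fix x assume "x \<in> {x \<in> fat_dom M (U, c). fat_chart M (U, c) x \<in> U'}"
      then show "x \<in> {x. proj_on (model M) x \<in> c ` (U \<inter> U')}"
        using fat_chart[of x M U c] by (metis (mono_tags, lifting) IntI imageI mem_Collect_eq)
    qed
    ultimately show ?thesis by simp
  qed
  ultimately show ?thesis unfolding param_def by blast
qed

text \<open>Fat charts are themselves parametrised pieces, so it is enough to test a map on those.
  This converse of \<open>param_smooth_map\<close> lets smoothness of composites, translations and
  orbit maps be proved without handling charts.\<close>

lemma smooth_mapI:
  fixes M :: "('a, 'e::euclidean_space) mfd" and N :: "('b, 'f::euclidean_space) mfd"
  assumes M: "smooth_manifold M" and N: "charted N"
    and f: "\<And>W (\<phi> :: 'e \<Rightarrow> 'a). param M W \<phi> \<Longrightarrow> param N W (\<lambda>x. f (\<phi> x))"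
  shows "smooth_map M N f"
proof -
  have ch: "charted M" by (rule smooth_manifold_charted[OF M])
  note par = f[OF param_fat_chart[OF M]]
  have "continuous_map (mtop M) (mtop N) f"
    unfolding continuous_map_def
  proof (intro conjI allI impI)
    have "f q \<in> pts N" if q: "q \<in> pts M" for q
    proof -
      obtain U c where C: "(U, c) \<in> atlas M" "q \<in> U" using charted_cover[OF ch q] by blast
      then show ?thesis using param_pts[OF par[OF C(1)] chart_param(1)[OF ch C]] chart_param(2)[OF ch C] by simp
    qed
    then show "f \<in> pts M \<rightarrow> pts N" by blast
    fix S assume S: "openin (mtop N) S"
    show "openin (mtop M) {q \<in> pts M. f q \<in> S}"
    proof (rule openin_subopen[THEN iffD2], clarify)
      fix q assume q: "q \<in> pts M" "f q \<in> S"
      obtain U c where C: "(U, c) \<in> atlas M" "q \<in> U" using charted_cover[OF ch q(1)] by blast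
      let ?T = "{x \<in> fat_dom M (U, c). f (fat_chart M (U, c) x) \<in> S}"
      have T: "open ?T" by (rule param_openin[OF N par[OF C(1)] S])
      note h = smooth_manifold_homeo[OF M C(1)]
      have ts: "topspace (subtopology (mtop M) U) = U" using openin_subset[OF h(2)] by auto
      have "openin (top_of_set (c ` U)) (c ` U \<inter> ?T)" using T by (simp add: openin_open_Int)
      from openin_continuous_map_preimage[OF homeomorphic_imp_continuous_map[OF h(1)] this]
      have "openin (subtopology (mtop M) U) {x \<in> U. c x \<in> c ` U \<inter> ?T}" unfolding ts .
      then have "openin (mtop M) {x \<in> U. c x \<in> c ` U \<inter> ?T}" using h(2) openin_trans_full by blast
      moreover have "q \<in> {x \<in> U. c x \<in> c ` U \<inter> ?T}"
        using C chart_param[OF ch C] q(2) by auto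
      moreover have "{x \<in> U. c x \<in> c ` U \<inter> ?T} \<subseteq> {q \<in> pts M. f q \<in> S}"
      proof
        fix z assume "z \<in> {x \<in> U. c x \<in> c ` U \<inter> ?T}"
        then show "z \<in> {q \<in> pts M. f q \<in> S}"
          using chart_param(2)[OF ch C(1), of z] openin_subset[OF h(2)] by auto
      qed
      ultimately show "\<exists>T. openin (mtop M) T \<and> q \<in> T \<and> T \<subseteq> {q \<in> pts M. f q \<in> S}" by blast
    qed
  qed
  moreover have "smooth_on (c ` {x \<in> U. f x \<in> U'}) (c' \<circ> f \<circ> inv_into U c)"
    if C: "(U, c) \<in> atlas M" and C': "(U', c') \<in> atlas N" for U c U' c'
  proof (rule smooth_onI)
    fix x assume "x \<in> c ` {x \<in> U. f x \<in> U'}"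
    then obtain q where q: "q \<in> U" "f q \<in> U'" "x = c q" by blast
    note p = param_chart[OF par[OF C] C']
    have "(c' \<circ> f \<circ> inv_into U c) y = c' (f (fat_chart M (U, c) y))" if "y \<in> c ` {x \<in> U. f x \<in> U'}" for y
      using that chart_param(3)[OF ch C] by (auto simp: fat_chart_def)
    moreover have "x \<in> {x \<in> fat_dom M (U, c). f (fat_chart M (U, c) x) \<in> U'}"
      using q chart_param[OF ch C q(1)] by simp
    ultimately show "\<exists>W g. x \<in> W \<and> cinf W g \<and> (\<forall>y\<in>c ` {x \<in> U. f x \<in> U'} \<inter> W. g y = (c' \<circ> f \<circ> inv_into U c) y)"
      using p by (intro exI[of _ "{x \<in> fat_dom M (U, c). f (fat_chart M (U, c) x) \<in> U'}"]
          exI[of _ "\<lambda>x. c' (f (fat_chart M (U, c) x))"]) auto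
  qed
  ultimately show ?thesis unfolding smooth_map_def by blast
qed

subsection \<open>Tangent vectors of parametrised pieces\<close>

definition pchart :: "('p, 'e::euclidean_space) mfd \<Rightarrow> 'p \<Rightarrow> 'e \<Rightarrow> 'p" where
  "pchart M p = fat_chart M (chart_at M p)"

definition pdom :: "('p, 'e::euclidean_space) mfd \<Rightarrow> 'p \<Rightarrow> 'e set" where
  "pdom M p = fat_dom M (chart_at M p)"

definition pnbhd :: "('p, 'e) mfd \<Rightarrow> 'p \<Rightarrow> 'p set" where
  "pnbhd M p = fst (chart_at M p)"

lemma chart_at:
  assumes "charted M" "p \<in> pts M"
  shows chart_at_atlas: "(pnbhd M p, coord M p) \<in> atlas M" and in_pnbhd: "p \<in> pnbhd M p"
proof -
  obtain U c where "(U, c) \<in> atlas M" "p \<in> U" using charted_cover[OF assms] by blast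
  then have "chart_at M p \<in> atlas M \<and> p \<in> fst (chart_at M p)"
    unfolding chart_at_def by (intro someI[of "\<lambda>C. C \<in> atlas M \<and> p \<in> fst C" "(U, c)"]) simp
  then show "(pnbhd M p, coord M p) \<in> atlas M" "p \<in> pnbhd M p" by (simp_all add: pnbhd_def coord_def)
qed

lemma chart_at_eq: "chart_at M p = (pnbhd M p, coord M p)"
  by (simp add: pnbhd_def coord_def)

lemma pchart:
  fixes M :: "('p, 'e::euclidean_space) mfd"
  assumes M: "smooth_manifold M" and p: "p \<in> pts M"
  shows param_pchart: "param M (pdom M p) (pchart M p)"
    and pchart_coord: "q \<in> pnbhd M p \<Longrightarrow> pchart M p (coord M p q) = q"
    and coord_pdom: "q \<in> pnbhd M p \<Longrightarrow> coord M p q \<in> pdom M p"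
    and proj_coord: "q \<in> pnbhd M p \<Longrightarrow> proj_on (model M) (coord M p q) = coord M p q"
    and coord_model: "q \<in> pnbhd M p \<Longrightarrow> coord M p q \<in> model M"
    and pchart_pnbhd: "x \<in> pdom M p \<Longrightarrow> pchart M p x \<in> pnbhd M p"
    and coord_pchart: "x \<in> pdom M p \<Longrightarrow> coord M p (pchart M p x) = proj_on (model M) x"
    and pchart_proj: "pchart M p (proj_on (model M) x) = pchart M p x"
    and open_pdom: "open (pdom M p)"
proof -
  have ch: "charted M" by (rule smooth_manifold_charted[OF M])
  note C = chart_at_atlas[OF ch p]
  show P: "param M (pdom M p) (pchart M p)"
    unfolding pdom_def pchart_def chart_at_eq by (rule param_fat_chart[OF M C])
  then show "open (pdom M p)" by (rule param_open)
  show "pchart M p (coord M p q) = q" "coord M p q \<in> pdom M p"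
    "proj_on (model M) (coord M p q) = coord M p q" "coord M p q \<in> model M" if "q \<in> pnbhd M p"
    unfolding pdom_def pchart_def chart_at_eq
    using chart_param[OF ch C that] charted_model[OF ch C that] by simp_all
  show "pchart M p x \<in> pnbhd M p" "coord M p (pchart M p x) = proj_on (model M) x" if "x \<in> pdom M p"
    using that fat_chart[of x M "pnbhd M p" "coord M p"] unfolding pdom_def pchart_def chart_at_eq by simp_all
  have "proj_on (model M) (proj_on (model M) x) = proj_on (model M) x"
    by (rule proj_on_id[OF charted_subspace[OF ch] proj_on_in[OF charted_subspace[OF ch]]])
  then show "pchart M p (proj_on (model M) x) = pchart M p x"
    by (simp add: pchart_def fat_chart_def)
qed

lemma pchart_self:
  assumes "smooth_manifold M" "p \<in> pts M"
  shows "pchart M p (coord M p p) = p" "coord M p p \<in> pdom M p" "coord M p p \<in> model M"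
  using pchart[OF assms] in_pnbhd[OF smooth_manifold_charted[OF assms(1)] assms(2)] by auto

lemma param_coord:
  assumes "smooth_manifold M" "param M W \<phi>" "p \<in> pts M"
  shows "cinf {y \<in> W. \<phi> y \<in> pnbhd M p} (\<lambda>y. coord M p (\<phi> y))"
  by (rule param_chart[OF assms(2) chart_at_atlas[OF smooth_manifold_charted[OF assms(1)] assms(3)]])

lemma param_near:
  assumes "smooth_manifold M" "param M W \<phi>" "x \<in> W"
  shows "\<phi> x \<in> pnbhd M (\<phi> x)" "x \<in> {y \<in> W. \<phi> y \<in> pnbhd M (\<phi> x)}"
  using in_pnbhd[OF smooth_manifold_charted[OF assms(1)] param_pts[OF assms(2,3)]] assms(3) by auto

lemma ptan_cong:
  assumes "open W" "x \<in> W" "\<And>y. y \<in> W \<Longrightarrow> \<phi> y = \<psi> y"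
  shows "ptan M \<phi> x v = ptan M \<psi> x v"
proof -
  have "fd (\<lambda>y. coord M (\<phi> x) (\<phi> y)) x = fd (\<lambda>y. coord M (\<phi> x) (\<psi> y)) x"
    by (rule fd_cong_open[OF assms(1,2)]) (simp add: assms(3))
  then show ?thesis using assms(2,3) by (simp add: ptan_def)
qed

lemma ptan_linear:
  assumes "smooth_manifold M" "param M W \<phi>" "x \<in> W"
  shows "linear (ptan M \<phi> x)"
  unfolding ptan_def[abs_def]
  using cinf_linear_fd[OF param_coord[OF assms(1,2) param_pts[OF assms(2,3)]] param_near(2)[OF assms]] by simp

lemma ptan_in:
  assumes M: "smooth_manifold M" and \<phi>: "param M W \<phi>" and x: "x \<in> W"
  shows "ptan M \<phi> x v \<in> model M"
proof -
  let ?P = "proj_on (model M)" and ?h = "\<lambda>y. coord M (\<phi> x) (\<phi> y)"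
  have E: "subspace (model M)" by (rule smooth_manifold_subspace[OF M])
  note c = param_coord[OF M \<phi> param_pts[OF \<phi> x]]
  note d = cinf_has_derivative[OF c param_near(2)[OF M \<phi> x]]
  have "((\<lambda>y. ?P (?h y)) has_derivative (\<lambda>v. ?P (fd ?h x v))) (at x)"
    by (rule linear_comp_has_derivative[OF linear_proj_on[OF E] d])
  then have "(?h has_derivative (\<lambda>v. ?P (fd ?h x v))) (at x)"
    by (rule has_derivative_transform_within_open[OF _ cinf_open[OF c] param_near(2)[OF M \<phi> x]])
      (use proj_coord[OF M param_pts[OF \<phi> x]] in auto)
  from fd_eqI[OF this] have "fd ?h x v = ?P (fd ?h x v)" by metis
  then show ?thesis using proj_on_in[OF E] unfolding ptan_def by metis
qed

text \<open>The chain rule, with the preferred chart at \<phi> x as intermediate variable. As g is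
  any function on points, it may be a coordinate map of another chart or such a map after a map
  between manifolds.\<close>

lemma fd_along_param:
  fixes g :: "'p \<Rightarrow> 'z::real_normed_vector"
  assumes M: "smooth_manifold M" and \<phi>: "param M W \<phi>" and x: "x \<in> W"
    and g: "(\<lambda>y. g (pchart M (\<phi> x) y)) differentiable at (coord M (\<phi> x) (\<phi> x))"
  shows "((\<lambda>y. g (\<phi> y)) has_derivative
      (\<lambda>v. fd (\<lambda>y. g (pchart M (\<phi> x) y)) (coord M (\<phi> x) (\<phi> x)) (ptan M \<phi> x v))) (at x)"
proof -
  let ?h = "\<lambda>y. coord M (\<phi> x) (\<phi> y)"
  note p = param_pts[OF \<phi> x]
  note c = param_coord[OF M \<phi> p]
  have "((\<lambda>y. g (pchart M (\<phi> x) (?h y))) has_derivative (\<lambda>v. fd (\<lambda>y. g (pchart M (\<phi> x) y)) (?h x) (fd ?h x v))) (at x)"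
    using diff_chain_at[OF cinf_has_derivative[OF c param_near(2)[OF M \<phi> x]] fd_works[OF g]] by (simp add: comp_def)
  then show ?thesis unfolding ptan_def
    by (rule has_derivative_transform_within_open[OF _ cinf_open[OF c] param_near(2)[OF M \<phi> x]])
      (use pchart_coord[OF M p] in auto)
qed

lemma ptan_reparam:
  assumes M: "smooth_manifold M" and \<phi>: "param M W \<phi>" and h: "h differentiable at x" and x: "h x \<in> W"
  shows "ptan M (\<lambda>y. \<phi> (h y)) x v = ptan M \<phi> (h x) (fd h x v)"
  unfolding ptan_def
  by (rule fd_compose[OF h cinf_differentiable[OF param_coord[OF M \<phi> param_pts[OF \<phi> x]] param_near(2)[OF M \<phi> x]]])

lemma ptan_pchart:
  assumes M: "smooth_manifold M" and p: "p \<in> pts M"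
  shows "ptan M (pchart M p) (coord M p p) v = proj_on (model M) v"
proof -
  have E: "subspace (model M)" by (rule smooth_manifold_subspace[OF M])
  have "(proj_on (model M) has_derivative proj_on (model M)) (at (coord M p p))"
    by (rule linear_imp_has_derivative[OF linear_proj_on[OF E]])
  then have "((\<lambda>y. coord M p (pchart M p y)) has_derivative proj_on (model M)) (at (coord M p p))"
    by (rule has_derivative_transform_within_open[OF _ open_pdom[OF M p] pchart_self(2)[OF M p]])
      (simp add: coord_pchart[OF M p])
  from fd_eqI[OF this] show ?thesis by (simp add: ptan_def pchart_self[OF M p])
qed

lemma ptan_pchart_model:
  assumes "smooth_manifold M" "p \<in> pts M" "v \<in> model M"
  shows "ptan M (pchart M p) (coord M p p) v = v"
  using ptan_pchart[OF assms(1,2)] proj_on_id[OF smooth_manifold_subspace[OF assms(1)] assms(3)] by simp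

lemma smooth_map_coord_differentiable:
  fixes M :: "('a, 'e::euclidean_space) mfd" and N :: "('b, 'f::euclidean_space) mfd"
  assumes M: "smooth_manifold M" and N: "smooth_manifold N" and f: "smooth_map M N f" and p: "p \<in> pts M"
  shows "(\<lambda>y. coord N (f p) (f (pchart M p y))) differentiable at (coord M p p)"
proof -
  note par = param_smooth_map[OF smooth_manifold_charted[OF M] smooth_manifold_charted[OF N] f param_pchart[OF M p]]
  have e: "coord M p p \<in> pdom M p" "f (pchart M p (coord M p p)) = f p" using pchart_self[OF M p] by simp_all
  show ?thesis
    using cinf_differentiable[OF param_coord[OF N par param_pts[OF par e(1)]] param_near(2)[OF N par e(1)]] e(2) by simp
qed

text \<open>\<open>tmap\<close> differentiates along a line through a point of the model space in a
  direction of the model space. On that line the inverse chart and its extension agree, so the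
  ordinary derivative of the extension may be used.\<close>

lemma tmap_eq_fd:
  assumes M: "smooth_manifold M" and p: "p \<in> pts M" and v: "v \<in> model M"
    and d: "(\<lambda>y. coord N (f p) (f (pchart M p y))) differentiable at (coord M p p)"
  shows "tmap M N f p v = fd (\<lambda>y. coord N (f p) (f (pchart M p y))) (coord M p p) v"
proof -
  have E: "subspace (model M)" by (rule smooth_manifold_subspace[OF M])
  have "tmap M N f p v = dir_deriv (\<lambda>y. coord N (f p) (f (pchart M p y))) (coord M p p) v"
    unfolding tmap_def
  proof (rule dir_deriv_cong_line[OF open_UNIV UNIV_I])
    fix t :: real
    have "coord M p p + t *\<^sub>R v \<in> model M"
      using pchart_self(3)[OF M p] v E by (simp add: subspace_add subspace_scale)
    from proj_on_id[OF E this]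
    show "(coord N (f p) \<circ> f \<circ> icoord M p) (coord M p p + t *\<^sub>R v) =
        coord N (f p) (f (pchart M p (coord M p p + t *\<^sub>R v)))"
      by (simp add: pchart_def fat_chart_def icoord_def)
  qed
  then show ?thesis using dir_deriv_fd[OF d] by simp
qed

lemma tmap_eq_ptan:
  fixes M :: "('a, 'e::euclidean_space) mfd" and N :: "('b, 'f::euclidean_space) mfd"
  assumes M: "smooth_manifold M" and N: "smooth_manifold N" and f: "smooth_map M N f"
    and p: "p \<in> pts M" and v: "v \<in> model M"
  shows "tmap M N f p v = ptan N (\<lambda>y. f (pchart M p y)) (coord M p p) v"
  using tmap_eq_fd[where N = N and f = f, OF M p v smooth_map_coord_differentiable[OF M N f p]]
  by (simp add: ptan_def pchart_self[OF M p])

lemma ptan_smooth_map: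
  fixes M :: "('a, 'e::euclidean_space) mfd" and N :: "('b, 'f::euclidean_space) mfd"
  assumes M: "smooth_manifold M" and N: "smooth_manifold N" and f: "smooth_map M N f"
    and \<phi>: "param M W \<phi>" and x: "x \<in> W"
  shows "ptan N (\<lambda>y. f (\<phi> y)) x v = tmap M N f (\<phi> x) (ptan M \<phi> x v)"
proof -
  note p = param_pts[OF \<phi> x]
  note d = smooth_map_coord_differentiable[OF M N f p]
  have "ptan N (\<lambda>y. f (\<phi> y)) x v =
      fd (\<lambda>y. coord N (f (\<phi> x)) (f (pchart M (\<phi> x) y))) (coord M (\<phi> x) (\<phi> x)) (ptan M \<phi> x v)"
    unfolding ptan_def[of N] using fd_eqI[OF fd_along_param[where g = "\<lambda>q. coord N (f (\<phi> x)) (f q)", OF M \<phi> x d]] by simp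
  also have "\<dots> = tmap M N f (\<phi> x) (ptan M \<phi> x v)"
    by (rule tmap_eq_fd[where N = N and f = f, OF M p ptan_in[OF M \<phi> x] d, symmetric])
  finally show ?thesis .
qed

text \<open>The composite is a separate function h because it has to coincide with g \<circ> f only
  on the points of M: identities such as the action law hold only on carriers.\<close>

lemma tmap_compose:
  fixes M :: "('a, 'e::euclidean_space) mfd" and N :: "('b, 'f::euclidean_space) mfd"
    and L :: "('c, 'h::euclidean_space) mfd"
  assumes M: "smooth_manifold M" and N: "smooth_manifold N" and L: "smooth_manifold L"
    and f: "smooth_map M N f" and g: "smooth_map N L g" and gf: "smooth_map M L h"
    and eq: "\<And>q. q \<in> pts M \<Longrightarrow> h q = g (f q)"
    and p: "p \<in> pts M" and v: "v \<in> model M"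
  shows "tmap M L h p v = tmap N L g (f p) (tmap M N f p v)"
proof -
  note P = param_pchart[OF M p] and e = pchart_self[OF M p]
  note par = param_smooth_map[OF smooth_manifold_charted[OF M] smooth_manifold_charted[OF N] f P]
  have "tmap M L h p v = ptan L (\<lambda>y. h (pchart M p y)) (coord M p p) v"
    by (rule tmap_eq_ptan[OF M L gf p v])
  also have "\<dots> = ptan L (\<lambda>y. g (f (pchart M p y))) (coord M p p) v"
    by (rule ptan_cong[OF open_pdom[OF M p] e(2)]) (simp add: eq param_pts[OF P])
  also have "\<dots> = tmap N L g (f p) (ptan N (\<lambda>y. f (pchart M p y)) (coord M p p) v)"
    using ptan_smooth_map[OF N L g par e(2)] e(1) by simp
  finally show ?thesis using tmap_eq_ptan[OF M N f p v] by simp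
qed

lemma tmap_in:
  fixes M :: "('a, 'e::euclidean_space) mfd" and N :: "('b, 'f::euclidean_space) mfd"
  assumes M: "smooth_manifold M" and N: "smooth_manifold N" and f: "smooth_map M N f"
    and p: "p \<in> pts M" and v: "v \<in> model M"
  shows "tmap M N f p v \<in> model N"
  unfolding tmap_eq_ptan[OF assms]
  by (rule ptan_in[OF N param_smooth_map[OF smooth_manifold_charted[OF M] smooth_manifold_charted[OF N] f
        param_pchart[OF M p]] pchart_self(2)[OF M p]])

text \<open>\<open>tmap\<close> itself is only meaningful, hence linear, on the model space.\<close>

lemma tmap_linear_ext:
  fixes M :: "('a, 'e::euclidean_space) mfd" and N :: "('b, 'f::euclidean_space) mfd"
  assumes M: "smooth_manifold M" and N: "smooth_manifold N" and f: "smooth_map M N f" and p: "p \<in> pts M"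
  obtains l where "linear l" "\<And>v. v \<in> model M \<Longrightarrow> tmap M N f p v = l v"
  using that[OF ptan_linear[OF N param_smooth_map[OF smooth_manifold_charted[OF M] smooth_manifold_charted[OF N] f
        param_pchart[OF M p]] pchart_self(2)[OF M p]]] tmap_eq_ptan[OF M N f p] by blast

lemma tmap_lincomb:
  fixes M :: "('a, 'e::euclidean_space) mfd" and N :: "('b, 'f::euclidean_space) mfd"
  assumes "smooth_manifold M" "smooth_manifold N" "smooth_map M N f" "p \<in> pts M" "u \<in> model M" "v \<in> model M"
  shows "tmap M N f p (a *\<^sub>R u + b *\<^sub>R v) = a *\<^sub>R tmap M N f p u + b *\<^sub>R tmap M N f p v"
proof -
  obtain l where "linear l" "\<And>v. v \<in> model M \<Longrightarrow> tmap M N f p v = l v"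
    using tmap_linear_ext[OF assms(1-4)] by blast
  then show ?thesis
    using assms(5,6) smooth_manifold_subspace[OF assms(1)]
    by (simp add: linear_add linear_cmul subspace_add subspace_scale)
qed

subsection \<open>Forms along parametrised pieces\<close>

definition pform :: "('p, 'e::euclidean_space) mfd \<Rightarrow> ('p \<Rightarrow> 'e \<Rightarrow> 'w) \<Rightarrow> ('a::euclidean_space \<Rightarrow> 'p) \<Rightarrow> 'a \<Rightarrow> 'a \<Rightarrow> 'w"
  where "pform M \<theta> \<phi> x v = \<theta> (\<phi> x) (ptan M \<phi> x v)"

lemma linear_form_linear:
  assumes M: "smooth_manifold M" and \<phi>: "param M W \<phi>" and x: "x \<in> W"
    and l: "linear_form_on (model M) (\<theta> (\<phi> x))"
  shows "linear (pform M \<theta> \<phi> x)"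
proof -
  note t = ptan_linear[OF M \<phi> x] and i = ptan_in[OF M \<phi> x]
  have l': "\<theta> (\<phi> x) (a *\<^sub>R u + b *\<^sub>R v) = a *\<^sub>R \<theta> (\<phi> x) u + b *\<^sub>R \<theta> (\<phi> x) v"
    if "u \<in> model M" "v \<in> model M" for a b u v
    using l that unfolding linear_form_on_def by blast
  show ?thesis
  proof (rule linearI)
    show "pform M \<theta> \<phi> x (u + v) = pform M \<theta> \<phi> x u + pform M \<theta> \<phi> x v" for u v
      using l'[OF i i, of 1 u 1 v] by (simp add: pform_def linear_add[OF t])
    show "pform M \<theta> \<phi> x (r *\<^sub>R u) = r *\<^sub>R pform M \<theta> \<phi> x u" for r u
      using l'[OF i i, of r u 0 u] by (simp add: pform_def linear_cmul[OF t])
  qed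
qed

lemma one_form_linear:
  "smooth_manifold M \<Longrightarrow> one_form M \<theta> \<Longrightarrow> param M W \<phi> \<Longrightarrow> x \<in> W \<Longrightarrow> linear (pform M \<theta> \<phi> x)"
  by (rule linear_form_linear) (auto simp: one_form_def tangent_space_def param_pts)

lemma chart_at_vspace: "x \<in> V \<Longrightarrow> chart_at (vspace_mfd V) x = (V, id)"
  unfolding chart_at_def vspace_mfd_def by (rule some_equality) auto

lemma tmap_vspace:
  assumes E: "subspace E" and x: "x \<in> E" and v: "v \<in> E"
  shows "tmap (vspace_mfd E) M f x v = dir_deriv (\<lambda>y. coord M (f x) (f y)) x v"
proof -
  have "tmap (vspace_mfd E) M f x v = dir_deriv (coord M (f x) \<circ> f \<circ> inv_into E id) x v"
    by (simp add: tmap_def coord_def[of "vspace_mfd E"] icoord_def chart_at_vspace[OF x])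
  also have "\<dots> = dir_deriv (\<lambda>y. coord M (f x) (f y)) x v"
  proof (rule dir_deriv_cong_line[OF open_UNIV UNIV_I])
    fix t :: real
    have "x + t *\<^sub>R v \<in> E" using x v E by (simp add: subspace_add subspace_scale)
    from inv_into_f_f[OF inj_on_id this] show "(coord M (f x) \<circ> f \<circ> inv_into E id) (x + t *\<^sub>R v) = coord M (f x) (f (x + t *\<^sub>R v))"
      by simp
  qed
  finally show ?thesis .
qed

lemma tmap_inv_chart:
  assumes M: "smooth_manifold M" and C: "(U, c) \<in> atlas M" and x: "x \<in> c ` U" and v: "v \<in> model M"
  shows "x \<in> fat_dom M (U, c)" "fat_chart M (U, c) x = inv_into U c x"
    "tmap (vspace_mfd (model M)) M (inv_into U c) x v = ptan M (fat_chart M (U, c)) x v"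
proof -
  have ch: "charted M" by (rule smooth_manifold_charted[OF M])
  have E: "subspace (model M)" by (rule smooth_manifold_subspace[OF M])
  obtain q where q: "q \<in> U" "x = c q" using x by blast
  have P: "proj_on (model M) x = x" using chart_param(3)[OF ch C q(1)] q(2) by simp
  have xE: "x \<in> model M" using charted_model[OF ch C q(1)] q(2) by simp
  show d: "x \<in> fat_dom M (U, c)" using chart_param(1)[OF ch C q(1)] q(2) by simp
  show eq: "fat_chart M (U, c) x = inv_into U c x" by (simp add: fat_chart_def P)
  note par = param_fat_chart[OF M C]
  have "tmap (vspace_mfd (model M)) M (inv_into U c) x v
      = dir_deriv (\<lambda>y. coord M (fat_chart M (U, c) x) (fat_chart M (U, c) y)) x v"
    unfolding tmap_vspace[OF E xE v]
  proof (rule dir_deriv_cong_line[OF open_UNIV UNIV_I])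
    fix t :: real
    have "x + t *\<^sub>R v \<in> model M" using xE v E by (simp add: subspace_add subspace_scale)
    from proj_on_id[OF E this] show "coord M (inv_into U c x) (inv_into U c (x + t *\<^sub>R v)) =
        coord M (fat_chart M (U, c) x) (fat_chart M (U, c) (x + t *\<^sub>R v))"
      unfolding eq by (simp add: fat_chart_def)
  qed
  also have "\<dots> = ptan M (fat_chart M (U, c)) x v"
    unfolding ptan_def
    by (rule dir_deriv_fd[OF cinf_differentiable[OF param_coord[OF M par param_pts[OF par d]] param_near(2)[OF M par d]]])
  finally show "tmap (vspace_mfd (model M)) M (inv_into U c) x v = ptan M (fat_chart M (U, c)) x v" .
qed

lemma pullback1_inv_chart:
  assumes "smooth_manifold M" "(U, c) \<in> atlas M" "x \<in> c ` U" "v \<in> model M"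
  shows "pullback1 (vspace_mfd (model M)) M (inv_into U c) \<theta> x v = pform M \<theta> (fat_chart M (U, c)) x v"
  using tmap_inv_chart[OF assms] by (simp add: pullback1_def pform_def)

lemma pullback2_inv_chart:
  assumes "smooth_manifold M" "(U, c) \<in> atlas M" "x \<in> c ` U" "u \<in> model M" "v \<in> model M"
  shows "pullback2 (vspace_mfd (model M)) M (inv_into U c) \<omega> x u v =
    \<omega> (fat_chart M (U, c) x) (ptan M (fat_chart M (U, c)) x u) (ptan M (fat_chart M (U, c)) x v)"
  using tmap_inv_chart[OF assms(1-4)] tmap_inv_chart[OF assms(1-3,5)] by (simp add: pullback2_def)

lemma cinf_pform_fat_chart:
  assumes M: "smooth_manifold M" and \<theta>: "one_form M \<theta>" and C: "(U, c) \<in> atlas M"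
  shows "cinf (fat_dom M (U, c)) (\<lambda>x. pform M \<theta> (fat_chart M (U, c)) x v)"
proof -
  let ?P = "proj_on (model M)" and ?F = "fat_chart M (U, c)"
  have ch: "charted M" by (rule smooth_manifold_charted[OF M])
  have E: "subspace (model M)" by (rule smooth_manifold_subspace[OF M])
  note par = param_fat_chart[OF M C]
  have "smooth_on (c ` U) (\<lambda>x. pullback1 (vspace_mfd (model M)) M (inv_into U c) \<theta> x (?P v))"
    using \<theta> C proj_on_in[OF E] unfolding one_form_def by blast
  from cinf_of_smooth_on[OF E smooth_manifold_homeo(3)[OF M C] this]
  have "cinf (fat_dom M (U, c)) (\<lambda>x. pullback1 (vspace_mfd (model M)) M (inv_into U c) \<theta> (?P x) (?P v))"
    by (simp add: fat_dom_def)
  then show ?thesis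
  proof (rule cinf_cong)
    fix x assume x: "x \<in> fat_dom M (U, c)"
    then have Px: "?P x \<in> c ` U" by (simp add: fat_dom_def)
    have FP: "?F (?P y) = ?F y" for y
      using proj_on_id[OF E proj_on_in[OF E]] by (simp add: fat_chart_def)
    have d: "(?P has_derivative ?P) (at x)" by (rule linear_imp_has_derivative[OF linear_proj_on[OF E]])
    have "ptan M (\<lambda>y. ?F (?P y)) x v = ptan M ?F (?P x) (?P v)"
      using ptan_reparam[OF M par, of ?P x v] d fd_eqI[OF d] tmap_inv_chart(1)[OF M C Px proj_on_in[OF E]]
      by (auto simp: differentiable_def)
    then show "pullback1 (vspace_mfd (model M)) M (inv_into U c) \<theta> (?P x) (?P v) = pform M \<theta> ?F x v"
      unfolding pullback1_inv_chart[OF M C Px proj_on_in[OF E]] by (simp add: pform_def FP)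
  qed
qed

text \<open>Near x the map \<phi> factors as an extended chart after a smooth coordinate expression;
  the pullback is then the smooth coefficient form of \<theta> in that chart, taken at and applied
  to smooth functions.\<close>

lemma cinf_pform:
  fixes \<theta> :: "'p \<Rightarrow> 'e::euclidean_space \<Rightarrow> 'w::real_normed_vector"
  assumes M: "smooth_manifold M" and \<theta>: "one_form M \<theta>" and \<phi>: "param M W \<phi>"
  shows "cinf W (\<lambda>x. pform M \<theta> \<phi> x v)"
proof (rule cinf_local[OF param_open[OF \<phi>]])
  have ch: "charted M" by (rule smooth_manifold_charted[OF M])
  fix x assume x: "x \<in> W"
  note p = param_pts[OF \<phi> x]
  let ?V = "{y \<in> W. \<phi> y \<in> pnbhd M (\<phi> x)}" and ?h = "\<lambda>y. coord M (\<phi> x) (\<phi> y)" and ?F = "pchart M (\<phi> x)"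
  note h = param_coord[OF M \<phi> p]
  have hV: "?h y \<in> pdom M (\<phi> x)" if "y \<in> ?V" for y using that coord_pdom[OF M p] by simp
  have R: "cinf (pdom M (\<phi> x)) (\<lambda>y. pform M \<theta> ?F y b)" for b
    unfolding pdom_def pchart_def chart_at_eq by (rule cinf_pform_fat_chart[OF M \<theta> chart_at_atlas[OF ch p]])
  have "cinf ?V (\<lambda>y. pform M \<theta> ?F (?h y) (fd ?h y v))"
  proof (rule cinf_apply_linear[where R = "\<lambda>y. pform M \<theta> ?F (?h y)" and h = "\<lambda>y. fd ?h y v"])
    show "cinf ?V (\<lambda>y. pform M \<theta> ?F (?h y) b)" for b by (rule cinf_compose[OF h R hV])
    show "linear (pform M \<theta> ?F (?h y))" if "y \<in> ?V" for y
      by (rule one_form_linear[OF M \<theta> param_pchart[OF M p] hV[OF that]])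
  qed (rule cinf_fd[OF h])
  then have "cinf ?V (\<lambda>y. pform M \<theta> \<phi> y v)"
  proof (rule cinf_cong)
    fix y assume y: "y \<in> ?V"
    have F: "?F (?h z) = \<phi> z" if "z \<in> ?V" for z using that pchart_coord[OF M p] by simp
    have "ptan M \<phi> y v = ptan M (\<lambda>z. ?F (?h z)) y v"
      by (rule ptan_cong[OF cinf_open[OF h] y]) (simp add: F[simplified])
    also have "\<dots> = ptan M ?F (?h y) (fd ?h y v)"
      by (rule ptan_reparam[OF M param_pchart[OF M p] cinf_differentiable[OF h y] hV[OF y]])
    finally show "pform M \<theta> ?F (?h y) (fd ?h y v) = pform M \<theta> \<phi> y v"
      using F[OF y] by (simp add: pform_def)
  qed
  then show "\<exists>V. x \<in> V \<and> cinf V (\<lambda>y. pform M \<theta> \<phi> y v)"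
    using param_near(2)[OF M \<phi> x] by (intro exI[of _ ?V] conjI)
qed

lemma fd_apply_linear:
  fixes S :: "'a::euclidean_space \<Rightarrow> 'b::euclidean_space \<Rightarrow> 'c::real_normed_vector"
  assumes S: "\<And>b. cinf V (\<lambda>y. S y b)" and lin: "\<And>y. y \<in> V \<Longrightarrow> linear (S y)" and k: "cinf V k" and x: "x \<in> V"
  shows "fd (\<lambda>y. S y (k y)) x u = S x (fd k x u) + fd (\<lambda>y. S y (k x)) x u"
proof -
  have d: "((\<lambda>y. S y (m y)) has_derivative
      (\<lambda>u. \<Sum>b\<in>Basis. (m x \<bullet> b) *\<^sub>R fd (\<lambda>y. S y b) x u + (fd m x u \<bullet> b) *\<^sub>R S x b)) (at x)"
    if m: "cinf V m" for m
  proof -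
    have "((\<lambda>y. \<Sum>b\<in>Basis. (m y \<bullet> b) *\<^sub>R S y b) has_derivative
      (\<lambda>u. \<Sum>b\<in>Basis. (m x \<bullet> b) *\<^sub>R fd (\<lambda>y. S y b) x u + (fd m x u \<bullet> b) *\<^sub>R S x b)) (at x)"
      by (rule has_derivative_sum, rule has_derivative_scaleR)
        (rule has_derivative_inner_left[OF cinf_has_derivative[OF m x]], rule cinf_has_derivative[OF S x])
    then show ?thesis
      by (rule has_derivative_transform_within_open[OF _ cinf_open[OF k] x]) (rule linear_basis_sum[OF lin, symmetric])
  qed
  have c: "cinf V (\<lambda>y. k x)" by (rule cinf_const[OF cinf_open[OF k]])
  have "fd (\<lambda>y. S y (k y)) x u = (\<Sum>b\<in>Basis. (k x \<bullet> b) *\<^sub>R fd (\<lambda>y. S y b) x u) + S x (fd k x u)"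
    unfolding fd_eqI[OF d[OF k]] linear_basis_sum[OF lin[OF x], of "fd k x u"] by (simp add: sum.distrib)
  moreover have "fd (\<lambda>y. S y (k x)) x u = (\<Sum>b\<in>Basis. (k x \<bullet> b) *\<^sub>R fd (\<lambda>y. S y b) x u)"
    unfolding fd_eqI[OF d[OF c]] by (simp add: frechet_derivative_const)
  ultimately show ?thesis by simp
qed

text \<open>The exterior derivative in local coordinates commutes with pullback: the second derivatives of
  the map cancel.\<close>

lemma ext_deriv_pullback:
  fixes R :: "'b::euclidean_space \<Rightarrow> 'b \<Rightarrow> 'c::real_normed_vector" and h :: "'a::euclidean_space \<Rightarrow> 'b"
  assumes R: "\<And>b. cinf V (\<lambda>y. R y b)" and lin: "\<And>y. y \<in> V \<Longrightarrow> linear (R y)"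
    and h: "cinf W h" and hV: "\<And>y. y \<in> W \<Longrightarrow> h y \<in> V" and x: "x \<in> W"
  shows "fd (\<lambda>y. R (h y) (fd h y v)) x u - fd (\<lambda>y. R (h y) (fd h y u)) x v =
    fd (\<lambda>z. R z (fd h x v)) (h x) (fd h x u) - fd (\<lambda>z. R z (fd h x u)) (h x) (fd h x v)"
proof -
  have Rh: "cinf W (\<lambda>y. R (h y) b)" for b by (rule cinf_compose[OF h R hV])
  have "fd (\<lambda>y. R (h y) (fd h y v)) x u =
      R (h x) (fd (\<lambda>y. fd h y v) x u) + fd (\<lambda>z. R z (fd h x v)) (h x) (fd h x u)" for u v
  proof -
    have "fd (\<lambda>y. R (h y) (fd h y v)) x u =
        R (h x) (fd (\<lambda>y. fd h y v) x u) + fd (\<lambda>y. R (h y) (fd h x v)) x u"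
      by (rule fd_apply_linear[where S = "\<lambda>y. R (h y)", OF Rh lin[OF hV] cinf_fd[OF h] x])
    also have "fd (\<lambda>y. R (h y) (fd h x v)) x u = fd (\<lambda>z. R z (fd h x v)) (h x) (fd h x u)"
      by (rule fd_compose[OF cinf_differentiable[OF h x] cinf_differentiable[OF R hV[OF x]]])
    finally show ?thesis .
  qed
  then show ?thesis using fd_commute[OF h x, of u v] by simp
qed

lemma ext_deriv1_pchart:
  assumes M: "smooth_manifold M" and \<theta>: "one_form M \<theta>" and p: "p \<in> pts M" and u: "u \<in> model M" and v: "v \<in> model M"
  shows "ext_deriv1 M \<theta> p u v = fd (\<lambda>y. pform M \<theta> (pchart M p) y v) (coord M p p) u
     - fd (\<lambda>y. pform M \<theta> (pchart M p) y u) (coord M p p) v"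
proof -
  have ch: "charted M" by (rule smooth_manifold_charted[OF M])
  have E: "subspace (model M)" by (rule smooth_manifold_subspace[OF M])
  note C = chart_at_atlas[OF ch p] and e = pchart_self[OF M p]
  have "dir_deriv (\<lambda>y. pullback1 (vspace_mfd (model M)) M (icoord M p) \<theta> y v) (coord M p p) u
      = fd (\<lambda>y. pform M \<theta> (pchart M p) y v) (coord M p p) u" if u: "u \<in> model M" and v: "v \<in> model M" for u v
  proof -
    have "dir_deriv (\<lambda>y. pullback1 (vspace_mfd (model M)) M (icoord M p) \<theta> y v) (coord M p p) u =
        dir_deriv (\<lambda>y. pform M \<theta> (pchart M p) y v) (coord M p p) u"
    proof (rule dir_deriv_cong_line[OF open_pdom[OF M p] e(2)])
      fix t :: real
      assume t: "coord M p p + t *\<^sub>R u \<in> pdom M p"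
      have "coord M p p + t *\<^sub>R u \<in> model M" using e(3) u E by (simp add: subspace_add subspace_scale)
      from proj_on_id[OF E this] t have "coord M p p + t *\<^sub>R u \<in> coord M p ` pnbhd M p"
        by (simp add: pdom_def fat_dom_def chart_at_eq)
      from pullback1_inv_chart[OF M C this v]
      show "pullback1 (vspace_mfd (model M)) M (icoord M p) \<theta> (coord M p p + t *\<^sub>R u) v =
          pform M \<theta> (pchart M p) (coord M p p + t *\<^sub>R u) v"
        by (simp add: icoord_def chart_at_eq pchart_def)
    qed
    then show ?thesis
      using dir_deriv_fd[OF cinf_differentiable[OF cinf_pform[OF M \<theta> param_pchart[OF M p]] e(2)]] by simp
  qed
  then show ?thesis using u v by (simp add: ext_deriv1_def Let_def)
qed

text \<open>In the preferred chart at \<phi> x the map \<phi> becomes its coordinate expression h,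
  and the exterior derivative commutes with pullback along h. Since \<phi> need be neither injective
  nor of full rank, the formula can be used on products of a group with a manifold and on orbit
  maps.\<close>

lemma ext_deriv1_param:
  fixes \<theta> :: "'p \<Rightarrow> 'e::euclidean_space \<Rightarrow> 'w::real_normed_vector"
  assumes M: "smooth_manifold M" and \<theta>: "one_form M \<theta>" and \<phi>: "param M W \<phi>" and x: "x \<in> W"
  shows "ext_deriv1 M \<theta> (\<phi> x) (ptan M \<phi> x u) (ptan M \<phi> x v) =
    fd (\<lambda>y. pform M \<theta> \<phi> y v) x u - fd (\<lambda>y. pform M \<theta> \<phi> y u) x v"
proof -
  note p = param_pts[OF \<phi> x]
  let ?V = "{y \<in> W. \<phi> y \<in> pnbhd M (\<phi> x)}" and ?h = "\<lambda>y. coord M (\<phi> x) (\<phi> y)" and ?F = "pchart M (\<phi> x)"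
  note h = param_coord[OF M \<phi> p] and xV = param_near(2)[OF M \<phi> x]
  have hV: "?h y \<in> pdom M (\<phi> x)" if "y \<in> ?V" for y using that coord_pdom[OF M p] by simp
  have F: "?F (?h z) = \<phi> z" if "z \<in> ?V" for z using that pchart_coord[OF M p] by simp
  have eq: "pform M \<theta> ?F (?h y) (fd ?h y w) = pform M \<theta> \<phi> y w" if y: "y \<in> ?V" for y w
  proof -
    have "ptan M \<phi> y w = ptan M (\<lambda>z. ?F (?h z)) y w"
      by (rule ptan_cong[OF cinf_open[OF h] y]) (simp add: F[simplified])
    also have "\<dots> = ptan M ?F (?h y) (fd ?h y w)"
      by (rule ptan_reparam[OF M param_pchart[OF M p] cinf_differentiable[OF h y] hV[OF y]])
    finally show ?thesis using F[OF y] by (simp add: pform_def)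
  qed
  have fdeq: "fd (\<lambda>y. pform M \<theta> ?F (?h y) (fd ?h y w)) x = fd (\<lambda>y. pform M \<theta> \<phi> y w) x" for w
    by (rule fd_cong_open[OF cinf_open[OF h] xV eq])
  have "ext_deriv1 M \<theta> (\<phi> x) (ptan M \<phi> x u) (ptan M \<phi> x v) =
      fd (\<lambda>y. pform M \<theta> ?F y (fd ?h x v)) (?h x) (fd ?h x u)
      - fd (\<lambda>y. pform M \<theta> ?F y (fd ?h x u)) (?h x) (fd ?h x v)"
    using ext_deriv1_pchart[OF M \<theta> p ptan_in[OF M \<phi> x] ptan_in[OF M \<phi> x]] by (simp add: ptan_def)
  also have "\<dots> = fd (\<lambda>y. pform M \<theta> ?F (?h y) (fd ?h y v)) x u - fd (\<lambda>y. pform M \<theta> ?F (?h y) (fd ?h y u)) x v"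
    by (rule ext_deriv_pullback[symmetric, where V = "pdom M (\<phi> x)" and W = ?V,
          OF cinf_pform[OF M \<theta> param_pchart[OF M p]] one_form_linear[OF M \<theta> param_pchart[OF M p]] h hV xV])
  finally show ?thesis by (simp add: fdeq)
qed

subsection \<open>Exterior derivatives are closed\<close>

lemma fd_linear_param:
  fixes g :: "'a::euclidean_space \<Rightarrow> 'b::real_vector \<Rightarrow> 'c::real_normed_vector"
  assumes g: "\<And>w. cinf V (\<lambda>y. g y w)" and lin: "\<And>y. y \<in> V \<Longrightarrow> linear (g y)" and x: "x \<in> V"
  shows "linear (\<lambda>w. fd (\<lambda>y. g y w) x v)"
proof (rule linearI)
  have V: "open V" by (rule cinf_open[OF g])
  note d = cinf_has_derivative[OF g x]
  fix u w :: 'b and r :: real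
  have "((\<lambda>y. g y u + g y w) has_derivative (\<lambda>v. fd (\<lambda>y. g y u) x v + fd (\<lambda>y. g y w) x v)) (at x)"
    by (rule has_derivative_add[OF d d])
  then have "((\<lambda>y. g y (u + w)) has_derivative (\<lambda>v. fd (\<lambda>y. g y u) x v + fd (\<lambda>y. g y w) x v)) (at x)"
    by (rule has_derivative_transform_within_open[OF _ V x]) (simp add: linear_add[OF lin])
  from fd_eqI[OF this] show "fd (\<lambda>y. g y (u + w)) x v = fd (\<lambda>y. g y u) x v + fd (\<lambda>y. g y w) x v" by simp
  have "((\<lambda>y. r *\<^sub>R g y u) has_derivative (\<lambda>v. r *\<^sub>R fd (\<lambda>y. g y u) x v)) (at x)"
    by (rule has_derivative_scaleR_right[OF d])
  then have "((\<lambda>y. g y (r *\<^sub>R u)) has_derivative (\<lambda>v. r *\<^sub>R fd (\<lambda>y. g y u) x v)) (at x)"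
    by (rule has_derivative_transform_within_open[OF _ V x]) (simp add: linear_cmul[OF lin])
  from fd_eqI[OF this] show "fd (\<lambda>y. g y (r *\<^sub>R u)) x v = r *\<^sub>R fd (\<lambda>y. g y u) x v" by simp
qed

lemma linear_form_onI:
  assumes E: "subspace E" and l: "linear l" and eq: "\<And>v. v \<in> E \<Longrightarrow> f v = l v"
  shows "linear_form_on E f"
  unfolding linear_form_on_def
  by (simp add: eq subspace_add[OF E] subspace_scale[OF E] linear_add[OF l] linear_cmul[OF l])

lemma ext_deriv1_linear:
  fixes \<theta> :: "'p \<Rightarrow> 'e::euclidean_space \<Rightarrow> 'w::real_normed_vector"
  assumes M: "smooth_manifold M" and \<theta>: "one_form M \<theta>" and p: "p \<in> pts M" and u: "u \<in> model M"
  shows "linear_form_on (model M) (ext_deriv1 M \<theta> p u)"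
    and "linear_form_on (model M) (\<lambda>v. ext_deriv1 M \<theta> p v u)"
    and "ext_deriv1 M \<theta> p u u = 0"
    and "v \<in> model M \<Longrightarrow> ext_deriv1 M \<theta> p v u = - ext_deriv1 M \<theta> p u v"
proof -
  have E: "subspace (model M)" by (rule smooth_manifold_subspace[OF M])
  let ?e = "coord M p p" and ?g = "\<lambda>v y. pform M \<theta> (pchart M p) y v"
  note e = pchart_self(2)[OF M p]
  have c: "cinf (pdom M p) (?g v)" for v by (rule cinf_pform[OF M \<theta> param_pchart[OF M p]])
  have l1: "linear (fd (?g v) ?e)" for v by (rule cinf_linear_fd[OF c e])
  have l2: "linear (\<lambda>v. fd (?g v) ?e u)" for u
    by (rule fd_linear_param[OF c one_form_linear[OF M \<theta> param_pchart[OF M p]] e])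
  have l: "linear (\<lambda>v. fd (?g v) ?e u - fd (?g u) ?e v)" by (rule linear_compose_sub[OF l2 l1])
  have l': "linear (\<lambda>v. fd (?g u) ?e v - fd (?g v) ?e u)" by (rule linear_compose_sub[OF l1 l2])
  show "linear_form_on (model M) (ext_deriv1 M \<theta> p u)"
    by (rule linear_form_onI[OF E l]) (rule ext_deriv1_pchart[OF M \<theta> p u])
  show "linear_form_on (model M) (\<lambda>v. ext_deriv1 M \<theta> p v u)"
    by (rule linear_form_onI[OF E l']) (rule ext_deriv1_pchart[OF M \<theta> p _ u])
  show "ext_deriv1 M \<theta> p u u = 0" by (simp add: ext_deriv1_pchart[OF M \<theta> p u u])
  show "ext_deriv1 M \<theta> p v u = - ext_deriv1 M \<theta> p u v" if "v \<in> model M"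
    by (simp add: ext_deriv1_pchart[OF M \<theta> p u that] ext_deriv1_pchart[OF M \<theta> p that u])
qed

lemma pullback2_ext_deriv1:
  fixes \<theta> :: "'p \<Rightarrow> 'e::euclidean_space \<Rightarrow> 'w::real_normed_vector"
  assumes M: "smooth_manifold M" and \<theta>: "one_form M \<theta>" and C: "(U, c) \<in> atlas M"
    and x: "x \<in> c ` U" and u: "u \<in> model M" and v: "v \<in> model M"
  shows "pullback2 (vspace_mfd (model M)) M (inv_into U c) (ext_deriv1 M \<theta>) x u v =
    fd (\<lambda>y. pform M \<theta> (fat_chart M (U, c)) y v) x u - fd (\<lambda>y. pform M \<theta> (fat_chart M (U, c)) y u) x v"
  unfolding pullback2_inv_chart[OF M C x u v]
  by (rule ext_deriv1_param[OF M \<theta> param_fat_chart[OF M C] tmap_inv_chart(1)[OF M C x u]])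

lemma closed_two_form_ext_deriv1:
  fixes \<theta> :: "'p \<Rightarrow> 'e::euclidean_space \<Rightarrow> 'w::euclidean_space"
  assumes M: "smooth_manifold M" and \<theta>: "one_form M \<theta>"
  shows "closed_two_form M (ext_deriv1 M \<theta>)"
proof -
  have ch: "charted M" by (rule smooth_manifold_charted[OF M])
  have E: "subspace (model M)" by (rule smooth_manifold_subspace[OF M])
  have "smooth_on (c ` U) (\<lambda>x. pullback2 (vspace_mfd (model M)) M (inv_into U c) (ext_deriv1 M \<theta>) x u v)"
    if C: "(U, c) \<in> atlas M" and uv: "u \<in> model M" "v \<in> model M" for U c u v
  proof (rule smooth_onI)
    fix x assume x: "x \<in> c ` U"
    let ?g = "\<lambda>x. fd (\<lambda>y. pform M \<theta> (fat_chart M (U, c)) y v) x u - fd (\<lambda>y. pform M \<theta> (fat_chart M (U, c)) y u) x v"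
    have "cinf (fat_dom M (U, c)) ?g"
      by (rule cinf_diff; rule cinf_fd; rule cinf_pform[OF M \<theta> param_fat_chart[OF M C]])
    then show "\<exists>W g. x \<in> W \<and> cinf W g \<and> (\<forall>y\<in>c ` U \<inter> W.
        g y = pullback2 (vspace_mfd (model M)) M (inv_into U c) (ext_deriv1 M \<theta>) y u v)"
      using tmap_inv_chart(1)[OF M C x uv(1)] pullback2_ext_deriv1[OF M \<theta> C _ uv]
      by (intro exI[of _ "fat_dom M (U, c)"] exI[of _ ?g] conjI) simp_all
  qed
  then have two: "two_form M (ext_deriv1 M \<theta>)"
    using ext_deriv1_linear[OF M \<theta>] unfolding two_form_def tangent_space_def by blast
  have "ext_deriv2 M (ext_deriv1 M \<theta>) p u v w = 0"
    if p: "p \<in> pts M" and u: "u \<in> model M" and v: "v \<in> model M" and w: "w \<in> model M" for p u v w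
  proof -
    let ?e = "coord M p p" and ?g = "\<lambda>v y. pform M \<theta> (pchart M p) y v"
    note e = pchart_self[OF M p] and C = chart_at_atlas[OF ch p]
    have c: "cinf (pdom M p) (?g v)" for v by (rule cinf_pform[OF M \<theta> param_pchart[OF M p]])
    have D: "dir_deriv (\<lambda>y. pullback2 (vspace_mfd (model M)) M (icoord M p) (ext_deriv1 M \<theta>) y a b) ?e d =
        fd (\<lambda>y. fd (?g b) y a) ?e d - fd (\<lambda>y. fd (?g a) y b) ?e d"
      if a: "a \<in> model M" and b: "b \<in> model M" and d: "d \<in> model M" for a b d
    proof -
      have "dir_deriv (\<lambda>y. pullback2 (vspace_mfd (model M)) M (icoord M p) (ext_deriv1 M \<theta>) y a b) ?e d =
          dir_deriv (\<lambda>y. fd (?g b) y a - fd (?g a) y b) ?e d"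
      proof (rule dir_deriv_cong_line[OF open_pdom[OF M p] e(2)])
        fix t :: real
        assume t: "?e + t *\<^sub>R d \<in> pdom M p"
        have "?e + t *\<^sub>R d \<in> model M" using e(3) d E by (simp add: subspace_add subspace_scale)
        from proj_on_id[OF E this] t have "?e + t *\<^sub>R d \<in> coord M p ` pnbhd M p"
          by (simp add: pdom_def fat_dom_def chart_at_eq)
        from pullback2_ext_deriv1[OF M \<theta> C this a b]
        show "pullback2 (vspace_mfd (model M)) M (icoord M p) (ext_deriv1 M \<theta>) (?e + t *\<^sub>R d) a b =
          fd (?g b) (?e + t *\<^sub>R d) a - fd (?g a) (?e + t *\<^sub>R d) b"
          by (simp add: icoord_def chart_at_eq pchart_def)
      qed
      also have "\<dots> = fd (\<lambda>y. fd (?g b) y a) ?e d - fd (\<lambda>y. fd (?g a) y b) ?e d"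
        by (rule dir_deriv_eq, rule has_derivative_diff) (rule cinf_has_derivative[OF cinf_fd[OF c] e(2)])+
      finally show ?thesis .
    qed
    \<comment> \<open>Each of the three terms is a difference of two second derivatives; symmetry
      pairs the six with opposite signs.\<close>
    show ?thesis
      unfolding ext_deriv2_def Let_def D[OF v w u] D[OF u w v] D[OF u v w]
      by (simp add: fd_commute[OF c e(2), of w v u] fd_commute[OF c e(2), of v w u] fd_commute[OF c e(2), of u w v])
  qed
  then show ?thesis using two unfolding closed_two_form_def tangent_space_def by blast
qed

subsection \<open>Maps into vector spaces\<close>

lemma cinf_smooth_map_vspace:
  fixes f :: "'a \<Rightarrow> 'z::real_normed_vector"
  assumes M: "smooth_manifold M" and f: "smooth_map M (vspace_mfd V) f" and \<phi>: "param M W \<phi>"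
  shows "cinf W (\<lambda>x. f (\<phi> x))" and "x \<in> W \<Longrightarrow> f (\<phi> x) \<in> V"
proof -
  have ch: "charted M" by (rule smooth_manifold_charted[OF M])
  have E: "subspace (model M)" by (rule smooth_manifold_subspace[OF M])
  have cont: "continuous_map (mtop M) (top_of_set V) f" using f by (simp add: smooth_map_def vspace_mfd_def)
  have V: "f q \<in> V" if "q \<in> pts M" for q
    using continuous_map_image_subset_topspace[OF cont] that by auto
  then show "f (\<phi> x) \<in> V" if "x \<in> W" using param_pts[OF \<phi> that] by blast
  show "cinf W (\<lambda>x. f (\<phi> x))"
  proof (rule cinf_local[OF param_open[OF \<phi>]])
    fix x assume x: "x \<in> W"
    note p = param_pts[OF \<phi> x]
    note C = chart_at_atlas[OF ch p]
    have U: "{q \<in> pnbhd M (\<phi> x). f q \<in> V} = pnbhd M (\<phi> x)"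
      using V openin_subset[OF charted_openin[OF ch C]] by blast
    have "(V, id) \<in> atlas (vspace_mfd V)" by (simp add: vspace_mfd_def)
    then have "smooth_on (coord M (\<phi> x) ` {q \<in> pnbhd M (\<phi> x). f q \<in> V}) (id \<circ> f \<circ> inv_into (pnbhd M (\<phi> x)) (coord M (\<phi> x)))"
      using f C unfolding smooth_map_def by blast
    from cinf_of_smooth_on[OF E smooth_manifold_homeo(3)[OF M C] this[unfolded U]]
    have g: "cinf (pdom M (\<phi> x)) (\<lambda>y. f (pchart M (\<phi> x) y))"
      by (simp add: pdom_def fat_dom_def pchart_def fat_chart_def chart_at_eq)
    note h = param_coord[OF M \<phi> p]
    let ?V = "{y \<in> W. \<phi> y \<in> pnbhd M (\<phi> x)}"
    have "cinf ?V (\<lambda>y. f (pchart M (\<phi> x) (coord M (\<phi> x) (\<phi> y))))"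
      by (rule cinf_compose[OF h g]) (simp add: coord_pdom[OF M p])
    then have "cinf ?V (\<lambda>y. f (\<phi> y))" by (rule cinf_cong) (simp add: pchart_coord[OF M p])
    then show "\<exists>V. x \<in> V \<and> cinf V (\<lambda>y. f (\<phi> y))"
      using param_near(2)[OF M \<phi> x] by (intro exI[of _ ?V] conjI)
  qed
qed

subsection \<open>Local sections of submersions\<close>

text \<open>With A the derivative of the coordinate representation g and L a right inverse of A on
  \<open>model Q\<close>, the map H x = x - L (A x) + L (g x) has identity derivative at the base
  point and satisfies A (H x) = g x. In the coordinates H the submersion is the linear map A,
  without any splitting of the space into a product.\<close>

lemma submersion_straighten:
  fixes N :: "('a, 'e::euclidean_space) mfd" and Q :: "('b, 'f::euclidean_space) mfd"
  assumes N: "smooth_manifold N" and Q: "smooth_manifold Q" and s: "submersion N Q f" and p: "p \<in> pts N"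
  defines "g \<equiv> \<lambda>y. coord Q (f p) (f (pchart N p y))"
  obtains A L U V h where "linear A" "linear L" "range A = model Q"
    "\<And>y. y \<in> model Q \<Longrightarrow> A (L y) = y"
    "open U" "coord N p p \<in> U" "U \<subseteq> pdom N p" "\<And>x. x \<in> U \<Longrightarrow> f (pchart N p x) \<in> pnbhd Q (f p)"
    "open V" "\<And>x. x \<in> U \<Longrightarrow> x - L (A x) + L (g x) \<in> V"
    "\<And>z. z \<in> V \<Longrightarrow> h z \<in> U \<and> h z - L (A (h z)) + L (g (h z)) = z"
    "\<And>x. x \<in> U \<Longrightarrow> h (x - L (A x) + L (g x)) = x" "cinf V h"
    "\<And>v. A v = tmap N Q f p (proj_on (model N) v)"
proof -
  have f: "smooth_map N Q f" and surj: "tmap N Q f p ` model N = model Q"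
    using s p by (auto simp: submersion_def tangent_space_def)
  have E: "subspace (model N)" by (rule smooth_manifold_subspace[OF N])
  note par = param_smooth_map[OF smooth_manifold_charted[OF N] smooth_manifold_charted[OF Q] f param_pchart[OF N p]]
  note e = pchart_self[OF N p]
  let ?e = "coord N p p"
  have q: "f p \<in> pts Q" using param_pts[OF par e(2)] e(1) by simp
  define U0 where "U0 = {y \<in> pdom N p. f (pchart N p y) \<in> pnbhd Q (f p)}"
  have g: "cinf U0 g" unfolding U0_def g_def by (rule param_coord[OF Q par q])
  have e0: "?e \<in> U0" using param_near(2)[OF Q par e(2)] e(1) by (simp add: U0_def)
  define A where "A = fd g ?e"
  have linA: "linear A" unfolding A_def by (rule cinf_linear_fd[OF g e0])
  have A: "A v = tmap N Q f p (proj_on (model N) v)" for v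
  proof -
    have "g (proj_on (model N) y) = g y" for y by (simp add: g_def pchart_proj[OF N p])
    moreover have "(proj_on (model N) has_derivative proj_on (model N)) (at ?e)"
      by (rule linear_imp_has_derivative[OF linear_proj_on[OF E]])
    moreover have Pe: "proj_on (model N) ?e = ?e" by (rule proj_on_id[OF E e(3)])
    ultimately have "fd g ?e v = fd g ?e (proj_on (model N) v)"
      using fd_compose[of "proj_on (model N)" ?e g v] fd_eqI[of "proj_on (model N)" "proj_on (model N)" ?e]
        cinf_differentiable[OF g e0] by (auto simp: differentiable_def)
    then show ?thesis
      using tmap_eq_fd[where N = Q and f = f, OF N p proj_on_in[OF E] smooth_map_coord_differentiable[OF N Q f p], of v]
      by (simp add: A_def g_def)
  qed
  have rangeA: "range A = model Q"
  proof
    show "range A \<subseteq> model Q" using A tmap_in[OF N Q f p proj_on_in[OF E]] by auto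
    show "model Q \<subseteq> range A"
    proof
      fix y assume "y \<in> model Q"
      then obtain v where v: "v \<in> model N" "y = tmap N Q f p v" using surj by blast
      then have "y = A v" using A[of v] proj_on_id[OF E v(1)] by simp
      then show "y \<in> range A" by blast
    qed
  qed
  obtain L where L: "linear L" "\<And>y. y \<in> range A \<Longrightarrow> A (L y) = y" using linear_right_inverse_on_range[OF linA] by blast
  define H where "H x = x - L (A x) + L (g x)" for x
  have U0: "open U0" by (rule cinf_open[OF g])
  have H: "cinf U0 H" unfolding H_def
    by (rule cinf_add[OF cinf_diff[OF cinf_id[OF U0] cinf_linear_comp[OF L(1) cinf_linear[OF linA U0]]] cinf_linear_comp[OF L(1) g]])
  have dH: "fd H ?e v = v" for v
  proof -
    have "(H has_derivative (\<lambda>v. v - L (A v) + L (A v))) (at ?e)"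
      unfolding H_def
      by (rule has_derivative_add[OF has_derivative_diff[OF has_derivative_ident linear_comp_has_derivative[OF L(1)]]
            linear_comp_has_derivative[OF L(1) cinf_has_derivative[OF g e0, folded A_def]]])
        (rule linear_imp_has_derivative[OF linA])
    from fd_eqI[OF this] show ?thesis by simp
  qed
  obtain U V h where inv: "open U" "U \<subseteq> U0" "?e \<in> U" "open V" "H ?e \<in> V"
    "\<And>x. x \<in> U \<Longrightarrow> H x \<in> V \<and> h (H x) = x" "\<And>y. y \<in> V \<Longrightarrow> h y \<in> U \<and> H (h y) = y" "cinf V h"
    using cinf_inverse_function[OF H e0 dH] by blast
  show ?thesis
    by (rule that[of A L U V h]) (use linA L A rangeA inv in \<open>auto simp: H_def U0_def\<close>)
qed

text \<open>In straightened coordinates the submersion is linear, so a lift moves along the range of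
  L, by the amount that the coordinates of \<rho> change. The motion starts at the coordinates of p,
  which gives the prescribed value at x.\<close>

lemma submersion_section:
  fixes N :: "('a, 'e::euclidean_space) mfd" and Q :: "('b, 'f::euclidean_space) mfd"
  assumes N: "smooth_manifold N" and Q: "smooth_manifold Q" and s: "submersion N Q f" and p: "p \<in> pts N"
    and \<rho>: "param Q W \<rho>" and x: "x \<in> W" and eq: "\<rho> x = f p"
  obtains W' \<sigma> where "x \<in> W'" "W' \<subseteq> W" "param N W' \<sigma>" "\<sigma> x = p" "\<And>y. y \<in> W' \<Longrightarrow> f (\<sigma> y) = \<rho> y"
proof -
  let ?g = "\<lambda>y. coord Q (f p) (f (pchart N p y))" and ?e = "coord N p p"
  show thesis
  proof (rule submersion_straighten[OF N Q s p], goal_cases)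
  case (1 A L U V h)
  note * = 1
  have q: "f p \<in> pts Q" using param_pts[OF \<rho> x] eq by simp
  define H where "H x = x - L (A x) + L (?g x)" for x
  define c where "c y = coord Q (f p) (\<rho> y)" for y
  define W0 where "W0 = {y \<in> W. \<rho> y \<in> pnbhd Q (f p)}"
  have c: "cinf W0 c" unfolding W0_def c_def by (rule param_coord[OF Q \<rho> q])
  have W0: "open W0" by (rule cinf_open[OF c])
  have xW0: "x \<in> W0" using param_near(2)[OF Q \<rho> x] by (simp add: W0_def eq)
  define z where "z y = H ?e - L (c x) + L (c y)" for y
  have z: "cinf W0 z" unfolding z_def
    by (rule cinf_add[OF cinf_const[OF W0] cinf_linear_comp[OF *(2) c]])
  define W' where "W' = {y \<in> W0. z y \<in> V}"
  have W': "open W'" unfolding W'_def by (rule cinf_preimage_open[OF z *(9)])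
  have zx: "z x = H ?e" by (simp add: z_def)
  have xW': "x \<in> W'" using xW0 *(10)[OF *(6)] zx by (simp add: W'_def H_def)
  define \<sigma> where "\<sigma> y = pchart N p (h (z y))" for y
  have hz: "cinf W' (\<lambda>y. h (z y))"
    by (rule cinf_compose[OF cinf_subset[OF z W'] *(13)]) (auto simp: W'_def)
  have hU: "h (z y) \<in> U" if "y \<in> W'" for y using *(11)[of "z y"] that by (simp add: W'_def)
  have par: "param N {y \<in> W'. h (z y) \<in> pdom N p} (\<lambda>y. pchart N p (h (z y)))"
    by (rule param_reparam[OF param_pchart[OF N p] hz])
  have "{y \<in> W'. h (z y) \<in> pdom N p} = W'" using hU *(7) by blast
  then have "param N W' \<sigma>" using par by (simp add: \<sigma>_def[abs_def])
  moreover have "\<sigma> x = p"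
    using *(12)[OF *(6)] pchart_self(1)[OF N p] by (simp add: \<sigma>_def zx H_def)
  moreover have "f (\<sigma> y) = \<rho> y" if y: "y \<in> W'" for y
  proof -
    have AR: "A v \<in> model Q" for v using *(3) by blast
    have gQ: "?g v \<in> model Q" if "v \<in> U" for v using coord_model[OF Q q *(8)[OF that]] .
    have cQ: "c y' \<in> model Q" if "y' \<in> W0" for y' using coord_model[OF Q q] that by (simp add: c_def W0_def)
    have AH: "A (H v) = ?g v" if "v \<in> U" for v
      by (simp add: H_def linear_add[OF *(1)] linear_diff[OF *(1)] *(4)[OF AR] *(4)[OF gQ[OF that]])
    have yW0: "y \<in> W0" using y by (simp add: W'_def)
    have ge: "?g ?e = c x" by (simp add: c_def eq pchart_self(1)[OF N p])
    have "?g (h (z y)) = A (H (h (z y)))" using AH[OF hU[OF y]] by simp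
    also have "\<dots> = A (z y)" using *(11)[of "z y"] y by (simp add: W'_def H_def)
    also have "\<dots> = c y"
      by (simp add: z_def linear_add[OF *(1)] linear_diff[OF *(1)] AH[OF *(6)] ge *(4)[OF cQ[OF xW0]] *(4)[OF cQ[OF yW0]])
    finally have "coord Q (f p) (f (\<sigma> y)) = coord Q (f p) (\<rho> y)" by (simp add: \<sigma>_def c_def)
    then show ?thesis
      using pchart_coord[OF Q q, of "f (\<sigma> y)"] pchart_coord[OF Q q, of "\<rho> y"] *(8)[OF hU[OF y]] yW0
      by (simp add: \<sigma>_def W0_def)
  qed
  moreover have "W' \<subseteq> W" by (auto simp: W'_def W0_def)
  ultimately show thesis using that xW' by blast
  qed
qed

section \<open>Lie groups and their actions\<close>

lemma velocity_ptan:
  assumes M: "smooth_manifold M" and \<gamma>: "param M W \<gamma>" and t: "t \<in> W"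
  shows "velocity M \<gamma> t = ptan M \<gamma> t 1"
proof -
  let ?c = "\<lambda>s. coord M (\<gamma> t) (\<gamma> s)"
  note d = cinf_has_derivative[OF param_coord[OF M \<gamma> param_pts[OF \<gamma> t]] param_near(2)[OF M \<gamma> t]]
  have "fd ?c t s = s *\<^sub>R fd ?c t 1" for s
    using linear_cmul[OF has_derivative_linear[OF d], of s 1] by simp
  then have "fd ?c t = (\<lambda>s. s *\<^sub>R fd ?c t 1)" by (rule ext)
  with d have "(?c has_vector_derivative fd ?c t 1) (at t)"
    unfolding has_vector_derivative_def by simp
  then show ?thesis by (simp add: velocity_def ptan_def vector_derivative_at)
qed

text \<open>In a chart a curve with vanishing velocity is locally constant, and connectedness does
  the rest. The velocity at r is measured in the preferred chart at \<gamma> r, while the argument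
  stays in the chart at \<gamma> a; the chain rule carries zero from one to the other.\<close>

lemma param_constant:
  fixes \<gamma> :: "real \<Rightarrow> 'p" and M :: "('p, 'e::euclidean_space) mfd"
  assumes M: "smooth_manifold M" and \<gamma>: "param M W \<gamma>" and S: "connected S" "S \<subseteq> W"
    and z: "\<And>t. t \<in> W \<Longrightarrow> ptan M \<gamma> t 1 = 0" and st: "s \<in> S" "t \<in> S"
  shows "\<gamma> s = \<gamma> t"
proof -
  have "\<gamma> constant_on S"
  proof (rule locally_constant_imp_constant[OF S(1)])
    fix a assume a: "a \<in> S"
    then have aW: "a \<in> W" using S(2) by blast
    note p = param_pts[OF \<gamma> aW] and near = param_near(2)[OF M \<gamma> aW]
    let ?V = "{y \<in> W. \<gamma> y \<in> pnbhd M (\<gamma> a)}" and ?c = "coord M (\<gamma> a)"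
    note c = param_coord[OF M \<gamma> p]
    obtain e where e: "e > 0" "ball a e \<subseteq> ?V" using cinf_open[OF c] near openE by blast
    have d0: "((\<lambda>y. ?c (\<gamma> y)) has_vector_derivative 0) (at r within ball a e)" if r: "r \<in> ball a e" for r
    proof -
      have rV: "r \<in> W" "\<gamma> r \<in> pnbhd M (\<gamma> a)" using e(2) r by auto
      note pr = param_pts[OF \<gamma> rV(1)]
      have rr: "coord M (\<gamma> r) (\<gamma> r) \<in> {y \<in> pdom M (\<gamma> r). pchart M (\<gamma> r) y \<in> pnbhd M (\<gamma> a)}"
        using pchart_self[OF M pr] rV(2) by simp
      from fd_along_param[OF M \<gamma> rV(1) cinf_differentiable[OF param_coord[OF M param_pchart[OF M pr] p] rr]]
      have D: "((\<lambda>y. ?c (\<gamma> y)) has_derivative (\<lambda>v. fd (\<lambda>y. ?c (pchart M (\<gamma> r) y)) (coord M (\<gamma> r) (\<gamma> r)) (ptan M \<gamma> r v))) (at r)" .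
      have "ptan M \<gamma> r v = 0" for v
        using linear_cmul[OF ptan_linear[OF M \<gamma> rV(1)], of v 1] z[OF rV(1)] by simp
      moreover have "fd (\<lambda>y. ?c (pchart M (\<gamma> r) y)) (coord M (\<gamma> r) (\<gamma> r)) 0 = 0"
        by (rule linear_0[OF cinf_linear_fd[OF param_coord[OF M param_pchart[OF M pr] p] rr]])
      ultimately show ?thesis using D by (simp add: has_vector_derivative_def has_derivative_at_withinI)
    qed
    obtain k where k: "\<And>r. r \<in> ball a e \<Longrightarrow> ?c (\<gamma> r) = k"
      by (rule has_vector_derivative_zero_constant[OF convex_ball d0]) (assumption, blast)
    have "\<gamma> r = \<gamma> a" if r: "r \<in> ball a e" for r
    proof -
      have "?c (\<gamma> r) = ?c (\<gamma> a)" using k[OF r] k[of a] e(1) by simp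
      moreover have "\<gamma> r \<in> pnbhd M (\<gamma> a)" "\<gamma> a \<in> pnbhd M (\<gamma> a)" using e r near by auto
      ultimately show ?thesis
        using pchart_coord[OF M p, of "\<gamma> r"] pchart_coord[OF M p, of "\<gamma> a"] by simp
    qed
    then have eq: "\<forall>x\<in>S \<inter> ball a e. \<gamma> x = \<gamma> a" by blast
    have "a \<in> S \<inter> ball a e" using e(1) a by simp
    with eq show "\<exists>T. openin (top_of_set S) T \<and> a \<in> T \<and> (\<forall>x\<in>T. \<gamma> x = \<gamma> a)"
      by (intro exI[of _ "S \<inter> ball a e"] conjI openin_open_Int[OF open_ball])
  qed
  then show ?thesis using st unfolding constant_on_def by auto
qed

lemma ptan_pchart_proj:
  assumes M: "smooth_manifold M" and p: "p \<in> pts M" and x: "x \<in> pdom M p"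
  shows "ptan M (pchart M p) x v = ptan M (pchart M p) (proj_on (model M) x) (proj_on (model M) v)"
proof -
  let ?P = "proj_on (model M)"
  have E: "subspace (model M)" by (rule smooth_manifold_subspace[OF M])
  have d: "(?P has_derivative ?P) (at x)" by (rule linear_imp_has_derivative[OF linear_proj_on[OF E]])
  have "?P x \<in> pdom M p" using x proj_on_id[OF E proj_on_in[OF E]] by (simp add: pdom_def fat_dom_def)
  then have "ptan M (\<lambda>y. pchart M p (?P y)) x v = ptan M (pchart M p) (?P x) (?P v)"
    using ptan_reparam[OF M param_pchart[OF M p], of ?P x v] d fd_eqI[OF d] by (auto simp: differentiable_def)
  then show ?thesis by (simp add: pchart_proj[OF M p])
qed

lemma smooth_manifold_real: "smooth_manifold (vspace_mfd (UNIV :: real set))"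
proof -
  have "second_countable (euclidean :: real topology)"
  proof -
    obtain \<B> :: "real set set" where \<B>: "countable \<B>" "\<And>S. S \<in> \<B> \<Longrightarrow> open S"
        "\<And>S. open S \<Longrightarrow> \<exists>\<U>. \<U> \<subseteq> \<B> \<and> S = \<Union>\<U>"
      using univ_second_countable by metis
    show ?thesis unfolding second_countable_def
    proof (intro exI[of _ \<B>] conjI allI impI ballI)
      fix U and x :: real assume "openin euclidean U \<and> x \<in> U"
      then obtain \<U> where "\<U> \<subseteq> \<B>" "U = \<Union>\<U>" "x \<in> U" using \<B>(3)[of U] by auto
      then show "\<exists>V\<in>\<B>. x \<in> V \<and> V \<subseteq> U" by blast
    qed (use \<B> in auto)
  qed
  moreover have "smooth_on (UNIV :: real set) (id \<circ> inv_into UNIV id)"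
  proof (rule smooth_onI)
    fix x :: real
    show "\<exists>W g. x \<in> W \<and> cinf W g \<and> (\<forall>y\<in>UNIV \<inter> W. g y = (id \<circ> inv_into UNIV id) y)"
      using cinf_id[of "UNIV :: real set"] inv_into_f_f[OF inj_on_id]
      by (intro exI[of _ UNIV] exI[of _ "\<lambda>x. x"]) auto
  qed
  moreover have "(UNIV :: real set) = span Basis" by (rule span_Basis[symmetric])
  moreover have "Hausdorff_space (euclidean :: real topology)" by simp
  ultimately show ?thesis
    unfolding smooth_manifold_def vspace_mfd_def by (auto simp del: Basis_real_def intro!: exI[of _ "Basis :: real set"])
qed

lemma param_real:
  assumes "smooth_map (vspace_mfd (UNIV :: real set)) M \<gamma>" "smooth_manifold M"
  shows "param M UNIV \<gamma>"
proof -
  have "param (vspace_mfd (UNIV :: real set)) UNIV (\<lambda>x. x)"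
    unfolding param_def by (auto simp: vspace_mfd_def cinf_id id_def)
  from param_smooth_map[OF smooth_manifold_charted[OF smooth_manifold_real] smooth_manifold_charted[OF assms(2)] assms(1) this]
  show ?thesis .
qed

lemma smooth_map_real:
  fixes M :: "('p, 'e::euclidean_space) mfd"
  assumes "param M UNIV \<gamma>" "smooth_manifold M"
  shows "smooth_map (vspace_mfd (UNIV :: real set)) M \<gamma>"
proof (rule smooth_mapI[OF smooth_manifold_real smooth_manifold_charted[OF assms(2)]])
  fix W and \<phi> :: "real \<Rightarrow> real" assume \<phi>: "param (vspace_mfd (UNIV :: real set)) W \<phi>"
  have "cinf {x \<in> W. \<phi> x \<in> UNIV} (\<lambda>x. id (\<phi> x))"
    using param_chart[OF \<phi>, of UNIV id] by (simp add: vspace_mfd_def)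
  then have "cinf W \<phi>" by simp
  from param_reparam[OF assms(1) this] show "param M W (\<lambda>x. \<gamma> (\<phi> x))" by simp
qed

section \<open>Smoothness of the group operations and of actions\<close>

lemma lie_groupD:
  assumes "lie_group G"
  shows "group G" "smooth_manifold (lg_mfd G)" "pts (lg_mfd G) = carrier G"
    "charted (lg_mfd G)" "\<one>\<^bsub>G\<^esub> \<in> pts (lg_mfd G)"
  using assms group.is_monoid[THEN monoid.one_closed] smooth_manifold_charted[of "lg_mfd G"]
  unfolding lie_group_def by auto

lemma param_mult:
  fixes G :: "('g, 'f::euclidean_space) liegrp"
  assumes G: "lie_group G" and "param (lg_mfd G) W a" "param (lg_mfd G) W b"
  shows "param (lg_mfd G) W (\<lambda>x. a x \<otimes>\<^bsub>G\<^esub> b x)"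
proof -
  have "smooth_map (prod_mfd (lg_mfd G) (lg_mfd G)) (lg_mfd G) (\<lambda>(g, h). g \<otimes>\<^bsub>G\<^esub> h)"
    using G by (simp add: lie_group_def)
  from param_smooth_map[OF charted_prod[OF lie_groupD(4)[OF G] lie_groupD(4)[OF G]] lie_groupD(4)[OF G] this param_Pair[OF assms(2,3)]]
  show ?thesis by simp
qed

lemma param_inv:
  fixes G :: "('g, 'f::euclidean_space) liegrp"
  assumes G: "lie_group G" and a: "param (lg_mfd G) W a"
  shows "param (lg_mfd G) W (\<lambda>x. inv\<^bsub>G\<^esub> a x)"
proof -
  have "smooth_map (lg_mfd G) (lg_mfd G) (\<lambda>g. inv\<^bsub>G\<^esub> g)"
    using G by (simp add: lie_group_def)
  from param_smooth_map[OF lie_groupD(4)[OF G] lie_groupD(4)[OF G] this a] show ?thesis .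
qed

lemma smooth_left_mult:
  fixes G :: "('g, 'f::euclidean_space) liegrp"
  assumes G: "lie_group G" and g: "g \<in> carrier G"
  shows "smooth_map (lg_mfd G) (lg_mfd G) (\<lambda>h. g \<otimes>\<^bsub>G\<^esub> h)"
proof (rule smooth_mapI[OF lie_groupD(2,4)[OF G]])
  fix W and \<phi> :: "'f \<Rightarrow> 'g" assume \<phi>: "param (lg_mfd G) W \<phi>"
  have "param (lg_mfd G) W (\<lambda>x. g)"
    by (rule param_const[OF param_open[OF \<phi>]]) (simp add: g lie_groupD(3)[OF G])
  from param_mult[OF G this \<phi>] show "param (lg_mfd G) W (\<lambda>x. g \<otimes>\<^bsub>G\<^esub> \<phi> x)" .
qed

lemma param_action:
  fixes G :: "('g, 'f::euclidean_space) liegrp" and M :: "('a, 'e::euclidean_space) mfd"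
  assumes A: "lie_action G M \<Phi>" and a: "param (lg_mfd G) W a" and \<phi>: "param M W \<phi>"
  shows "param M W (\<lambda>x. \<Phi> (a x) (\<phi> x))"
proof -
  have G: "lie_group G" and M: "smooth_manifold M"
    and s: "smooth_map (prod_mfd (lg_mfd G) M) M (\<lambda>(g, p). \<Phi> g p)"
    using A by (simp_all add: lie_action_def)
  from param_smooth_map[OF charted_prod[OF lie_groupD(4)[OF G] smooth_manifold_charted[OF M]] smooth_manifold_charted[OF M] s param_Pair[OF a \<phi>]]
  show ?thesis by simp
qed

lemma smooth_action:
  fixes G :: "('g, 'f::euclidean_space) liegrp" and M :: "('a, 'e::euclidean_space) mfd"
  assumes A: "lie_action G M \<Phi>" and g: "g \<in> carrier G"
  shows "smooth_map M M (\<Phi> g)"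
proof -
  have G: "lie_group G" and M: "smooth_manifold M" using A by (simp_all add: lie_action_def)
  show ?thesis
  proof (rule smooth_mapI[OF M smooth_manifold_charted[OF M]])
    fix W and \<phi> :: "'e \<Rightarrow> 'a" assume \<phi>: "param M W \<phi>"
    have "param (lg_mfd G) W (\<lambda>x. g)"
      by (rule param_const[OF param_open[OF \<phi>]]) (simp add: g lie_groupD(3)[OF G])
    from param_action[OF A this \<phi>] show "param M W (\<lambda>x. \<Phi> g (\<phi> x))" .
  qed
qed

lemma smooth_orbit_map:
  fixes G :: "('g, 'f::euclidean_space) liegrp" and M :: "('a, 'e::euclidean_space) mfd"
  assumes A: "lie_action G M \<Phi>" and p: "p \<in> pts M"
  shows "smooth_map (lg_mfd G) M (\<lambda>g. \<Phi> g p)"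
proof -
  have G: "lie_group G" and M: "smooth_manifold M" using A by (simp_all add: lie_action_def)
  show ?thesis
  proof (rule smooth_mapI[OF lie_groupD(2)[OF G] smooth_manifold_charted[OF M]])
    fix W and \<phi> :: "'f \<Rightarrow> 'g" assume \<phi>: "param (lg_mfd G) W \<phi>"
    from param_action[OF A \<phi> param_const[OF param_open[OF \<phi>] p]] show "param M W (\<lambda>x. \<Phi> (\<phi> x) p)" .
  qed
qed

subsection \<open>One-parameter subgroups\<close>

text \<open>Integral curves of the left-invariant field of \<open>\<xi>\<close>.\<close>

definition integral_curve :: "('g, 'f::euclidean_space) liegrp \<Rightarrow> 'f \<Rightarrow> real set \<Rightarrow> (real \<Rightarrow> 'g) \<Rightarrow> bool" where
  "integral_curve G \<xi> I a \<longleftrightarrow> param (lg_mfd G) I a \<and>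
     (\<forall>t\<in>I. ptan (lg_mfd G) (\<lambda>s. inv\<^bsub>G\<^esub> a t \<otimes>\<^bsub>G\<^esub> a s) t 1 = \<xi>)"

text \<open>The velocity of a b^{-1} at t is found without differentiating the product or the
  inverse separately. With both curves written as left translates of curves \<alpha>, \<beta> that
  pass through the identity with velocity \<xi>, it becomes the derivative of F at the identity
  along the diagonal vector (\<xi>, \<xi>); and F is constant on the diagonal.\<close>

lemma integral_curve_quotient_constant:
  fixes G :: "('g, 'f::euclidean_space) liegrp"
  assumes G: "lie_group G" and a: "integral_curve G \<xi> I a" and b: "integral_curve G \<xi> I b"
    and I: "connected I" and st: "s \<in> I" "t \<in> I"
  shows "a s \<otimes>\<^bsub>G\<^esub> inv\<^bsub>G\<^esub> b s = a t \<otimes>\<^bsub>G\<^esub> inv\<^bsub>G\<^esub> b t"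
proof -
  let ?M = "lg_mfd G" and ?p = "pchart (lg_mfd G) \<one>\<^bsub>G\<^esub>" and ?c = "coord (lg_mfd G) \<one>\<^bsub>G\<^esub>"
  let ?e = "?c \<one>\<^bsub>G\<^esub>" and ?D = "pdom (lg_mfd G) \<one>\<^bsub>G\<^esub>"
  note M = lie_groupD(2)[OF G] and ca = lie_groupD(3)[OF G] and one = lie_groupD(5)[OF G]
  interpret group G by (rule lie_groupD(1)[OF G])
  have pa: "param ?M I a" and pb: "param ?M I b"
    and ta: "\<And>t. t \<in> I \<Longrightarrow> ptan ?M (\<lambda>s. inv\<^bsub>G\<^esub> a t \<otimes>\<^bsub>G\<^esub> a s) t 1 = \<xi>"
    and tb: "\<And>t. t \<in> I \<Longrightarrow> ptan ?M (\<lambda>s. inv\<^bsub>G\<^esub> b t \<otimes>\<^bsub>G\<^esub> b s) t 1 = \<xi>"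
    using a b by (simp_all add: integral_curve_def)
  have Io: "open I" by (rule param_open[OF pa])
  have ac: "a t \<in> carrier G" "b t \<in> carrier G" if "t \<in> I" for t
    using param_pts[OF pa that] param_pts[OF pb that] ca by auto
  have pe: "?p ?e = \<one>\<^bsub>G\<^esub>" "?e \<in> ?D" using pchart_self[OF M one] by auto
  have pP: "param ?M ?D ?p" by (rule param_pchart[OF M one])
  have "ptan ?M (\<lambda>s. a s \<otimes>\<^bsub>G\<^esub> inv\<^bsub>G\<^esub> b s) t 1 = 0" if t: "t \<in> I" for t
  proof -
    define F where "F z = a t \<otimes>\<^bsub>G\<^esub> ?p (fst z) \<otimes>\<^bsub>G\<^esub> inv\<^bsub>G\<^esub> (?p (snd z)) \<otimes>\<^bsub>G\<^esub> inv\<^bsub>G\<^esub> b t" for z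
    have DD: "open (?D \<times> ?D)" by (intro open_Times open_pdom[OF M one])
    have c1: "cinf (?D \<times> ?D) fst" "cinf (?D \<times> ?D) snd"
      by (rule cinf_bounded_linear[OF bounded_linear_fst DD], rule cinf_bounded_linear[OF bounded_linear_snd DD])
    have s1: "{x \<in> ?D \<times> ?D. fst x \<in> ?D} = ?D \<times> ?D" "{x \<in> ?D \<times> ?D. snd x \<in> ?D} = ?D \<times> ?D" by auto
    have p1: "param ?M (?D \<times> ?D) (\<lambda>z. ?p (fst z))" "param ?M (?D \<times> ?D) (\<lambda>z. ?p (snd z))"
      using param_reparam[OF pP c1(1)] param_reparam[OF pP c1(2)] unfolding s1 .
    have cst: "param ?M (?D \<times> ?D) (\<lambda>z. g)" if "g \<in> carrier G" for g
      by (rule param_const[OF DD]) (simp add: that ca)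
    have F: "param ?M (?D \<times> ?D) F" unfolding F_def
      by (intro param_mult[OF G] param_inv[OF G] p1 cst inv_closed ac t)
    have diag: "ptan ?M F (?e, ?e) (\<xi>, \<xi>) = 0"
    proof -
      have d: "((\<lambda>x. (x, x)) has_derivative (\<lambda>v. (v, v))) (at ?e)" by (auto intro!: derivative_eq_intros)
      have "ptan ?M (\<lambda>x. F (x, x)) ?e \<xi> = ptan ?M F (?e, ?e) (\<xi>, \<xi>)"
        using ptan_reparam[OF M F, of "\<lambda>x. (x, x)" ?e \<xi>] d fd_eqI[OF d] pe(2) by (auto simp: differentiable_def)
      moreover have "ptan ?M (\<lambda>x. F (x, x)) ?e \<xi> = ptan ?M (\<lambda>x. a t \<otimes>\<^bsub>G\<^esub> inv\<^bsub>G\<^esub> b t) ?e \<xi>"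
      proof (rule ptan_cong[OF open_pdom[OF M one] pe(2)])
        fix y assume "y \<in> ?D"
        then have "?p y \<in> carrier G" using param_pts[OF pP] ca by blast
        then show "F (y, y) = a t \<otimes>\<^bsub>G\<^esub> inv\<^bsub>G\<^esub> b t"
          using ac[OF t] by (simp add: F_def m_assoc r_inv)
      qed
      ultimately show ?thesis by (simp add: ptan_def frechet_derivative_const)
    qed
    define \<alpha> where "\<alpha> s = inv\<^bsub>G\<^esub> a t \<otimes>\<^bsub>G\<^esub> a s" for s
    define \<beta> where "\<beta> s = inv\<^bsub>G\<^esub> b t \<otimes>\<^bsub>G\<^esub> b s" for s
    have csI: "param ?M I (\<lambda>z. g)" if "g \<in> carrier G" for g
      by (rule param_const[OF Io]) (simp add: that ca)
    have p\<alpha>: "param ?M I \<alpha>" "param ?M I \<beta>" unfolding \<alpha>_def \<beta>_def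
      by (intro param_mult[OF G] csI inv_closed ac t pa pb)+
    have at1: "\<alpha> t = \<one>\<^bsub>G\<^esub>" "\<beta> t = \<one>\<^bsub>G\<^esub>" using ac[OF t] by (simp_all add: \<alpha>_def \<beta>_def l_inv)
    let ?V = "{s \<in> I. \<alpha> s \<in> pnbhd ?M \<one>\<^bsub>G\<^esub>} \<inter> {s \<in> I. \<beta> s \<in> pnbhd ?M \<one>\<^bsub>G\<^esub>}"
    note c\<alpha> = param_coord[OF M p\<alpha>(1) one] and c\<beta> = param_coord[OF M p\<alpha>(2) one]
    have V: "open ?V" by (intro open_Int cinf_open[OF c\<alpha>] cinf_open[OF c\<beta>])
    have tV: "t \<in> ?V" using t at1 in_pnbhd[OF lie_groupD(4)[OF G] one] by simp
    let ?h = "\<lambda>s. (?c (\<alpha> s), ?c (\<beta> s))"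
    have h: "cinf ?V ?h"
      by (intro cinf_Pair cinf_subset[OF c\<alpha> V] cinf_subset[OF c\<beta> V]) auto
    have fdh: "fd ?h t 1 = (\<xi>, \<xi>)"
    proof -
      have tV': "t \<in> {s \<in> I. \<alpha> s \<in> pnbhd ?M \<one>\<^bsub>G\<^esub>}" "t \<in> {s \<in> I. \<beta> s \<in> pnbhd ?M \<one>\<^bsub>G\<^esub>}" using tV by auto
      have "fd ?h t = (\<lambda>v. (fd (\<lambda>s. ?c (\<alpha> s)) t v, fd (\<lambda>s. ?c (\<beta> s)) t v))"
        by (rule fd_eqI, rule has_derivative_Pair; rule cinf_has_derivative[OF c\<alpha> tV'(1)] cinf_has_derivative[OF c\<beta> tV'(2)])
      moreover have "fd (\<lambda>s. ?c (\<alpha> s)) t 1 = \<xi>" "fd (\<lambda>s. ?c (\<beta> s)) t 1 = \<xi>"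
        using ta[OF t] tb[OF t] unfolding \<alpha>_def[symmetric] \<beta>_def[symmetric] by (simp_all add: ptan_def at1)
      ultimately show ?thesis by simp
    qed
    have "ptan ?M (\<lambda>s. a s \<otimes>\<^bsub>G\<^esub> inv\<^bsub>G\<^esub> b s) t 1 = ptan ?M (\<lambda>s. F (?h s)) t 1"
    proof (rule ptan_cong[OF V tV])
      fix s assume s: "s \<in> ?V"
      then have "?p (?c (\<alpha> s)) = \<alpha> s" "?p (?c (\<beta> s)) = \<beta> s" using pchart_coord[OF M one] by auto
      moreover have "s \<in> I" using s by simp
      moreover have "a t \<otimes>\<^bsub>G\<^esub> \<alpha> s = a s" using ac[OF t] ac[OF \<open>s \<in> I\<close>]
        by (simp add: \<alpha>_def m_assoc[symmetric] r_inv)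
      moreover have "inv\<^bsub>G\<^esub> \<beta> s \<otimes>\<^bsub>G\<^esub> inv\<^bsub>G\<^esub> b t = inv\<^bsub>G\<^esub> b s"
      proof -
        have "b t \<otimes>\<^bsub>G\<^esub> \<beta> s = b s" using ac[OF t] ac[OF \<open>s \<in> I\<close>] by (simp add: \<beta>_def m_assoc[symmetric] r_inv)
        moreover have "\<beta> s \<in> carrier G" using ac[OF t] ac[OF \<open>s \<in> I\<close>] by (simp add: \<beta>_def)
        ultimately show ?thesis using inv_mult_group[of "b t" "\<beta> s"] ac[OF t] by simp
      qed
      ultimately show "a s \<otimes>\<^bsub>G\<^esub> inv\<^bsub>G\<^esub> b s = F (?h s)"
        using ac[OF t] ac[OF \<open>s \<in> I\<close>] by (simp add: F_def m_assoc \<beta>_def)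
    qed
    also have "\<dots> = ptan ?M F (?h t) (fd ?h t 1)"
      by (rule ptan_reparam[OF M F cinf_differentiable[OF h tV]]) (use pe(2) at1 in simp)
    also have "\<dots> = 0" using diag fdh at1 by simp
    finally show ?thesis .
  qed
  moreover have "param ?M I (\<lambda>s. a s \<otimes>\<^bsub>G\<^esub> inv\<^bsub>G\<^esub> b s)"
    by (intro param_mult[OF G] param_inv[OF G] pa pb)
  ultimately show ?thesis using param_constant[OF M _ I order_refl _ st] by blast
qed

lemma one_parameter_subgroup_integral_curve:
  fixes G :: "('g, 'f::euclidean_space) liegrp"
  assumes G: "lie_group G" and \<gamma>: "one_parameter_subgroup G \<xi> \<gamma>"
  shows "integral_curve G \<xi> UNIV \<gamma>" "\<gamma> 0 = \<one>\<^bsub>G\<^esub>" "\<gamma> t \<in> carrier G" "ptan (lg_mfd G) \<gamma> 0 1 = \<xi>"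
proof -
  note M = lie_groupD(2)[OF G] and ca = lie_groupD(3)[OF G]
  interpret group G by (rule lie_groupD(1)[OF G])
  have p: "param (lg_mfd G) UNIV \<gamma>" and add: "\<And>s t. \<gamma> (s + t) = \<gamma> s \<otimes>\<^bsub>G\<^esub> \<gamma> t"
    and v: "velocity (lg_mfd G) \<gamma> 0 = \<xi>"
    using \<gamma> param_real[OF _ M] by (auto simp: one_parameter_subgroup_def)
  show c: "\<gamma> t \<in> carrier G" for t using param_pts[OF p, of t] ca by simp
  show \<gamma>0: "\<gamma> 0 = \<one>\<^bsub>G\<^esub>" using add[of 0 0] c[of 0] by (simp add: l_cancel_one')
  show \<xi>: "ptan (lg_mfd G) \<gamma> 0 1 = \<xi>" using velocity_ptan[OF M p, of 0] v by simp
  have "ptan (lg_mfd G) (\<lambda>s. inv\<^bsub>G\<^esub> \<gamma> t \<otimes>\<^bsub>G\<^esub> \<gamma> s) t 1 = \<xi>" for t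
  proof -
    have "inv\<^bsub>G\<^esub> \<gamma> t \<otimes>\<^bsub>G\<^esub> \<gamma> s = \<gamma> (s - t)" for s
      using add[of t "s - t"] c by (simp add: m_assoc[symmetric] l_inv)
    moreover have d: "((\<lambda>s. s - t) has_derivative (\<lambda>s. s)) (at t)" by (auto intro!: derivative_eq_intros)
    have "ptan (lg_mfd G) (\<lambda>s. \<gamma> (s - t)) t 1 = ptan (lg_mfd G) \<gamma> 0 1"
      using ptan_reparam[OF M p, of "\<lambda>s. s - t" t 1] d fd_eqI[OF d] by (auto simp: differentiable_def)
    ultimately show ?thesis using \<xi> by simp
  qed
  then show "integral_curve G \<xi> UNIV \<gamma>" using p by (simp add: integral_curve_def)
qed

lemma one_parameter_subgroup_unique:
  fixes G :: "('g, 'f::euclidean_space) liegrp"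
  assumes G: "lie_group G" and a: "one_parameter_subgroup G \<xi> a" and b: "one_parameter_subgroup G \<xi> b"
  shows "a = b"
proof
  fix t
  interpret group G by (rule lie_groupD(1)[OF G])
  note A = one_parameter_subgroup_integral_curve[OF G a] and B = one_parameter_subgroup_integral_curve[OF G b]
  have "a t \<otimes>\<^bsub>G\<^esub> inv\<^bsub>G\<^esub> b t = a 0 \<otimes>\<^bsub>G\<^esub> inv\<^bsub>G\<^esub> b 0"
    by (rule integral_curve_quotient_constant[OF G A(1) B(1)]) auto
  then have "a t \<otimes>\<^bsub>G\<^esub> inv\<^bsub>G\<^esub> b t = \<one>\<^bsub>G\<^esub>" using A(2) B(2) by simp
  then show "a t = b t" using A(3) B(3) by (metis inv_equality inv_inv inv_closed)
qed

subsection \<open>Left-invariant fields\<close>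

definition gmul :: "('g, 'f::euclidean_space) liegrp \<Rightarrow> 'f \<times> 'f \<Rightarrow> 'g" where
  "gmul G z = pchart (lg_mfd G) \<one>\<^bsub>G\<^esub> (fst z) \<otimes>\<^bsub>G\<^esub> pchart (lg_mfd G) \<one>\<^bsub>G\<^esub> (snd z)"

definition gdom :: "('g, 'f::euclidean_space) liegrp \<Rightarrow> ('f \<times> 'f) set" where
  "gdom G = {z \<in> pdom (lg_mfd G) \<one>\<^bsub>G\<^esub> \<times> pdom (lg_mfd G) \<one>\<^bsub>G\<^esub>. gmul G z \<in> pnbhd (lg_mfd G) \<one>\<^bsub>G\<^esub>}"

text \<open>The coordinate representation of the left-invariant field, as a partial derivative of the
  multiplication.\<close>

definition lfield :: "('g, 'f::euclidean_space) liegrp \<Rightarrow> 'f \<Rightarrow> 'f \<Rightarrow> 'f" where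
  "lfield G \<eta> x = fd (\<lambda>z. coord (lg_mfd G) \<one>\<^bsub>G\<^esub> (gmul G z)) (x, coord (lg_mfd G) \<one>\<^bsub>G\<^esub> \<one>\<^bsub>G\<^esub>) (0, \<eta>)"

definition ldom :: "('g, 'f::euclidean_space) liegrp \<Rightarrow> 'f set" where
  "ldom G = {x. (x, coord (lg_mfd G) \<one>\<^bsub>G\<^esub> \<one>\<^bsub>G\<^esub>) \<in> gdom G}"

lemma fd_in_subspace:
  fixes h :: "'a::real_normed_vector \<Rightarrow> 'b::euclidean_space"
  assumes E: "subspace E" and h: "(h has_derivative h') (at x)" and W: "open W" "x \<in> W" "\<And>y. y \<in> W \<Longrightarrow> h y \<in> E"
  shows "h' v \<in> E"
proof -
  have "((\<lambda>y. proj_on E (h y)) has_derivative (\<lambda>v. proj_on E (h' v))) (at x)"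
    by (rule linear_comp_has_derivative[OF linear_proj_on[OF E] h])
  then have "(h has_derivative (\<lambda>v. proj_on E (h' v))) (at x)"
    by (rule has_derivative_transform_within_open[OF _ W(1,2)]) (simp add: proj_on_id[OF E W(3)])
  from has_derivative_unique[OF h this] show ?thesis using proj_on_in[OF E] by metis
qed

lemma fst_snd_param:
  assumes \<phi>: "param M D \<phi>" and \<psi>: "param N D' \<psi>"
  shows "param M (D \<times> D') (\<lambda>z. \<phi> (fst z))" "param N (D \<times> D') (\<lambda>z. \<psi> (snd z))"
proof -
  have DD: "open (D \<times> D')" by (intro open_Times param_open[OF \<phi>] param_open[OF \<psi>])
  have s: "{x \<in> D \<times> D'. fst x \<in> D} = D \<times> D'" "{x \<in> D \<times> D'. snd x \<in> D'} = D \<times> D'" by auto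
  show "param M (D \<times> D') (\<lambda>z. \<phi> (fst z))" "param N (D \<times> D') (\<lambda>z. \<psi> (snd z))"
    using param_reparam[OF \<phi> cinf_bounded_linear[OF bounded_linear_fst DD]]
      param_reparam[OF \<psi> cinf_bounded_linear[OF bounded_linear_snd DD]] unfolding s .
qed

context
  fixes G :: "('g, 'f::euclidean_space) liegrp"
  assumes G: "lie_group G"
begin

abbreviation (input) "LM \<equiv> lg_mfd G"
abbreviation (input) "Lp \<equiv> pchart (lg_mfd G) \<one>\<^bsub>G\<^esub>"
abbreviation (input) "Lc \<equiv> coord (lg_mfd G) \<one>\<^bsub>G\<^esub>"
abbreviation (input) "Le \<equiv> coord (lg_mfd G) \<one>\<^bsub>G\<^esub> \<one>\<^bsub>G\<^esub>"
abbreviation (input) "LD \<equiv> pdom (lg_mfd G) \<one>\<^bsub>G\<^esub>"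

lemma Lp_carrier: "x \<in> LD \<Longrightarrow> Lp x \<in> carrier G"
  using param_pts[OF param_pchart[OF lie_groupD(2,5)[OF G]]] lie_groupD(3)[OF G] by simp

lemma param_gmul: "param LM (LD \<times> LD) (gmul G)"
  unfolding gmul_def[abs_def]
  by (rule param_mult[OF G fst_snd_param[OF param_pchart param_pchart]]) (rule lie_groupD(2,5)[OF G])+

lemma cinf_gmul: "cinf (gdom G) (\<lambda>z. Lc (gmul G z))"
  unfolding gdom_def by (rule param_coord[OF lie_groupD(2)[OF G] param_gmul lie_groupD(5)[OF G]])

lemma gmul_one: "x \<in> LD \<Longrightarrow> gmul G (x, Le) = Lp x"
  using Lp_carrier pchart_self(1)[OF lie_groupD(2,5)[OF G]] monoid.r_one[OF group.is_monoid[OF lie_groupD(1)[OF G]]]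
  by (simp add: gmul_def)

lemma ldom_LD: "x \<in> ldom G \<Longrightarrow> x \<in> LD"
  by (simp add: ldom_def gdom_def)

lemma one_ldom: "Le \<in> ldom G"
  using gmul_one pchart_self[OF lie_groupD(2,5)[OF G]] in_pnbhd[OF lie_groupD(4,5)[OF G]]
  by (simp add: ldom_def gdom_def)

lemma cinf_lfield: "cinf (ldom G) (lfield G \<eta>)"
proof -
  have pair: "cinf UNIV (\<lambda>x. (x, Le))" by (rule cinf_Pair[OF cinf_id cinf_const]) auto
  have U: "open (ldom G)" using cinf_preimage_open[OF pair cinf_open[OF cinf_gmul]] by (simp add: ldom_def)
  show ?thesis unfolding lfield_def[abs_def]
    by (rule cinf_compose[OF cinf_subset[OF pair U subset_UNIV] cinf_fd[OF cinf_gmul]]) (simp add: ldom_def)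
qed

lemma lfield_derivative:
  assumes "x \<in> ldom G"
  shows "((\<lambda>z. Lc (gmul G (x, z))) has_derivative (\<lambda>v. lfield G v x)) (at Le)"
    and "open {z. (x, z) \<in> gdom G}" and "Le \<in> {z. (x, z) \<in> gdom G}"
proof -
  have d: "((\<lambda>z. (x, z)) has_derivative (\<lambda>v. (0, v))) (at Le)" by (auto intro!: derivative_eq_intros)
  have xW: "(x, Le) \<in> gdom G" using assms by (simp add: ldom_def)
  show "((\<lambda>z. Lc (gmul G (x, z))) has_derivative (\<lambda>v. lfield G v x)) (at Le)"
    using diff_chain_at[OF d cinf_has_derivative[OF cinf_gmul xW]] by (simp add: comp_def lfield_def)
  show "open {z. (x, z) \<in> gdom G}"
    using cinf_preimage_open[OF cinf_Pair[OF cinf_const cinf_id] cinf_open[OF cinf_gmul], of UNIV x] by simp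
  show "Le \<in> {z. (x, z) \<in> gdom G}" using xW by simp
qed

lemma lfield_model: "x \<in> ldom G \<Longrightarrow> lfield G v x \<in> model LM"
  by (rule fd_in_subspace[OF smooth_manifold_subspace[OF lie_groupD(2)[OF G]] lfield_derivative])
    (auto simp: gdom_def coord_model[OF lie_groupD(2,5)[OF G]])

lemma lfield_one: "\<eta> \<in> model LM \<Longrightarrow> lfield G \<eta> Le = \<eta>"
proof -
  note M = lie_groupD(2)[OF G] and one = lie_groupD(5)[OF G]
  interpret group G by (rule lie_groupD(1)[OF G])
  assume \<eta>: "\<eta> \<in> model LM"
  have E: "subspace (model LM)" by (rule smooth_manifold_subspace[OF M])
  have "Lc (gmul G (Le, z)) = proj_on (model LM) z" if "z \<in> LD" for z
    using Lp_carrier[OF that] pchart_self(1)[OF M one] coord_pchart[OF M one that] by (simp add: gmul_def)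
  then have "(proj_on (model LM) has_derivative (\<lambda>v. lfield G v Le)) (at Le)"
    using has_derivative_transform_within_open[OF lfield_derivative(1)[OF one_ldom] open_pdom[OF M one] pchart_self(2)[OF M one]]
    by simp
  from has_derivative_unique[OF linear_imp_has_derivative[OF linear_proj_on[OF E]] this]
  have "proj_on (model LM) \<eta> = lfield G \<eta> Le" by metis
  then show ?thesis using proj_on_id[OF E \<eta>] by simp
qed

text \<open>This ties \<open>lfield\<close> to translations: pushed to the group,
  \<open>lfield G \<eta> x\<close> is the left translate of \<eta> to the point with coordinates x.
  One chart serves all points near the identity, so integral curves solve one differential equation
  in a fixed vector space.\<close>

lemma ptan_left_mult:
  assumes x: "x \<in> ldom G"
  shows "ptan LM (\<lambda>z. Lp x \<otimes>\<^bsub>G\<^esub> Lp z) Le \<eta> = ptan LM Lp x (lfield G \<eta> x)"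
proof -
  note M = lie_groupD(2)[OF G] and one = lie_groupD(5)[OF G]
  have E: "subspace (model LM)" by (rule smooth_manifold_subspace[OF M])
  note d = lfield_derivative[OF x]
  let ?h = "\<lambda>z. Lc (gmul G (x, z))"
  have he: "?h Le = proj_on (model LM) x"
    using gmul_one[OF ldom_LD[OF x]] coord_pchart[OF M one ldom_LD[OF x]] by simp
  have heD: "?h Le \<in> LD" using coord_pdom[OF M one] d(3) by (simp add: gdom_def)
  have "ptan LM (\<lambda>z. Lp x \<otimes>\<^bsub>G\<^esub> Lp z) Le \<eta> = ptan LM (\<lambda>z. Lp (?h z)) Le \<eta>"
  proof (rule ptan_cong[OF d(2,3)])
    fix z assume "z \<in> {z. (x, z) \<in> gdom G}"
    then have "Lp (Lc (gmul G (x, z))) = gmul G (x, z)" by (intro pchart_coord[OF M one]) (simp add: gdom_def)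
    then show "Lp x \<otimes>\<^bsub>G\<^esub> Lp z = Lp (?h z)" by (simp add: gmul_def)
  qed
  also have "\<dots> = ptan LM Lp (?h Le) (fd ?h Le \<eta>)"
  proof -
    have dh: "?h differentiable at Le" using d(1) unfolding differentiable_def by blast
    show ?thesis by (rule ptan_reparam[where h = ?h and x = Le, OF M param_pchart[OF M one] dh heD])
  qed
  also have "fd ?h Le \<eta> = lfield G \<eta> x" by (simp add: fd_eqI[OF d(1)])
  finally show ?thesis
    using ptan_pchart_proj[OF M one ldom_LD[OF x], of "lfield G \<eta> x"] proj_on_id[OF E lfield_model[OF x]] he by simp
qed

lemma left_translate_tangent:
  assumes q: "q \<in> carrier G" and \<eta>: "\<eta> \<in> model LM"
  shows "param LM LD (\<lambda>z. q \<otimes>\<^bsub>G\<^esub> Lp z)" "left_inv_field G \<eta> q = ptan LM (\<lambda>z. q \<otimes>\<^bsub>G\<^esub> Lp z) Le \<eta>"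
proof -
  note M = lie_groupD(2)[OF G] and one = lie_groupD(5)[OF G]
  show "param LM LD (\<lambda>z. q \<otimes>\<^bsub>G\<^esub> Lp z)"
    by (rule param_mult[OF G param_const[OF open_pdom[OF M one]] param_pchart[OF M one]])
      (simp add: q lie_groupD(3)[OF G])
  show "left_inv_field G \<eta> q = ptan LM (\<lambda>z. q \<otimes>\<^bsub>G\<^esub> Lp z) Le \<eta>"
    unfolding left_inv_field_def by (rule tmap_eq_ptan[OF M M smooth_left_mult[OF G q] one \<eta>])
qed

text \<open>The field \<open>lfield\<close> is integrated in the chart at the identity. Translating
  the velocity at a t back by the inverse of a t undoes the left translation that produced the
  field, and leaves \<xi>.\<close>

lemma local_integral_curve:
  assumes \<xi>: "\<xi> \<in> lie_algebra G"
  obtains e a where "e > 0" "integral_curve G \<xi> {-e<..<e} a" "a 0 = \<one>\<^bsub>G\<^esub>"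
proof -
  note M = lie_groupD(2)[OF G] and ca = lie_groupD(3)[OF G] and one = lie_groupD(5)[OF G]
  interpret group G by (rule lie_groupD(1)[OF G])
  have \<xi>E: "\<xi> \<in> model LM" using \<xi> by (simp add: lie_algebra_def tangent_space_def)
  note pe = pchart_self[OF M one]
  obtain \<epsilon> y where y: "\<epsilon> > (0::real)" "y 0 = Le" "\<And>t. t \<in> {-\<epsilon><..<\<epsilon>} \<Longrightarrow> y t \<in> ldom G"
    "\<And>t. t \<in> {-\<epsilon><..<\<epsilon>} \<Longrightarrow> (y has_vector_derivative lfield G \<xi> (y t)) (at t)" "cinf {-\<epsilon><..<\<epsilon>} y"
    using smooth_ode[OF cinf_lfield one_ldom] by blast
  let ?I = "{-\<epsilon><..<\<epsilon>}"
  define a where "a t = Lp (y t)" for t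
  have "{t \<in> ?I. y t \<in> LD} = ?I" using ldom_LD[OF y(3)] by blast
  with param_reparam[OF param_pchart[OF M one] y(5)] have pa: "param LM ?I a"
    unfolding a_def[abs_def] by simp
  have ac: "a t \<in> carrier G" if "t \<in> ?I" for t using Lp_carrier[OF ldom_LD[OF y(3)[OF that]]] by (simp add: a_def)
  have "ptan LM (\<lambda>s. inv\<^bsub>G\<^esub> a t \<otimes>\<^bsub>G\<^esub> a s) t 1 = \<xi>" if t: "t \<in> ?I" for t
  proof -
    have at: "a t \<in> carrier G" "inv\<^bsub>G\<^esub> a t \<in> carrier G" using ac[OF t] by auto
    have dy: "fd y t 1 = lfield G \<xi> (y t)" "y differentiable at t"
      using y(4)[OF t] fd_eqI[OF y(4)[OF t, unfolded has_vector_derivative_def]]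
      unfolding has_vector_derivative_def differentiable_def by auto
    have "ptan LM a t 1 = ptan LM Lp (y t) (lfield G \<xi> (y t))"
      unfolding a_def[abs_def] ptan_reparam[OF M param_pchart[OF M one] dy(2) ldom_LD[OF y(3)[OF t]]] dy(1) ..
    then have "ptan LM a t 1 = ptan LM (\<lambda>z. a t \<otimes>\<^bsub>G\<^esub> Lp z) Le \<xi>"
      using ptan_left_mult[OF y(3)[OF t]] by (simp add: a_def)
    moreover have "ptan LM (\<lambda>s. inv\<^bsub>G\<^esub> a t \<otimes>\<^bsub>G\<^esub> a s) t 1 =
        tmap LM LM (\<lambda>h. inv\<^bsub>G\<^esub> a t \<otimes>\<^bsub>G\<^esub> h) (a t) (ptan LM a t 1)"
      by (rule ptan_smooth_map[OF M M smooth_left_mult[OF G at(2)] pa t])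
    moreover have "ptan LM (\<lambda>z. inv\<^bsub>G\<^esub> a t \<otimes>\<^bsub>G\<^esub> (a t \<otimes>\<^bsub>G\<^esub> Lp z)) Le \<xi> =
        tmap LM LM (\<lambda>h. inv\<^bsub>G\<^esub> a t \<otimes>\<^bsub>G\<^esub> h) (a t \<otimes>\<^bsub>G\<^esub> Lp Le) (ptan LM (\<lambda>z. a t \<otimes>\<^bsub>G\<^esub> Lp z) Le \<xi>)"
      by (rule ptan_smooth_map[OF M M smooth_left_mult[OF G at(2)] left_translate_tangent(1)[OF at(1) \<xi>E] pe(2)])
    moreover have "ptan LM (\<lambda>z. inv\<^bsub>G\<^esub> a t \<otimes>\<^bsub>G\<^esub> (a t \<otimes>\<^bsub>G\<^esub> Lp z)) Le \<xi> = ptan LM Lp Le \<xi>"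
      by (rule ptan_cong[OF open_pdom[OF M one] pe(2)]) (simp add: m_assoc[symmetric] at Lp_carrier l_inv)
    ultimately show ?thesis using ptan_pchart_model[OF M one \<xi>E] pe(1) at by simp
  qed
  then have "integral_curve G \<xi> ?I a" using pa by (simp add: integral_curve_def)
  then show ?thesis using that[OF y(1)] y(2) pe(1) by (simp add: a_def)
qed

end

section \<open>Extension of local integral curves to one-parameter subgroups\<close>

lemma integral_curve_subset:
  "integral_curve G \<xi> I a \<Longrightarrow> open J \<Longrightarrow> J \<subseteq> I \<Longrightarrow> integral_curve G \<xi> J a"
  unfolding integral_curve_def using param_subset by blast

lemma integral_curve_shift:
  fixes G :: "('g, 'f::euclidean_space) liegrp"
  assumes G: "lie_group G" and a: "integral_curve G \<xi> I a"
  shows "integral_curve G \<xi> {t. s + t \<in> I} (\<lambda>t. a (s + t))"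
proof -
  note M = lie_groupD(2)[OF G]
  have pa: "param (lg_mfd G) I a" using a by (simp add: integral_curve_def)
  interpret group G by (rule lie_groupD(1)[OF G])
  have "cinf UNIV (\<lambda>t::real. s + t)" by (rule cinf_add[OF cinf_const cinf_id]) auto
  from param_reparam[OF pa this] have "param (lg_mfd G) {t. s + t \<in> I} (\<lambda>t. a (s + t))" by simp
  moreover have "ptan (lg_mfd G) (\<lambda>r. inv\<^bsub>G\<^esub> a (s + t) \<otimes>\<^bsub>G\<^esub> a (s + r)) t 1 = \<xi>" if t: "s + t \<in> I" for t
  proof -
    have "a (s + t) \<in> carrier G" using param_pts[OF pa t] lie_groupD(3)[OF G] by simp
    then have "param (lg_mfd G) I (\<lambda>r. inv\<^bsub>G\<^esub> a (s + t) \<otimes>\<^bsub>G\<^esub> a r)"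
      by (intro param_mult[OF G param_const[OF param_open[OF pa]] pa]) (simp add: lie_groupD(3)[OF G])
    from ptan_reparam[OF M this, of "\<lambda>r. s + r" t 1]
    have "ptan (lg_mfd G) (\<lambda>r. inv\<^bsub>G\<^esub> a (s + t) \<otimes>\<^bsub>G\<^esub> a (s + r)) t 1 =
        ptan (lg_mfd G) (\<lambda>r. inv\<^bsub>G\<^esub> a (s + t) \<otimes>\<^bsub>G\<^esub> a r) (s + t) (fd (\<lambda>r. s + r) t 1)"
      using t by auto
    moreover have "fd (\<lambda>r::real. s + r) t = (\<lambda>r. r)" by (rule fd_eqI) (auto intro!: derivative_eq_intros)
    ultimately show ?thesis using a t by (simp add: integral_curve_def)
  qed
  ultimately show ?thesis by (simp add: integral_curve_def)
qed

text \<open>The local curve a is a homomorphism where defined, by uniqueness of integral curves. It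
  extends to the line by \<gamma>(t) = a(t/n)^n for any n with |t| < n e; a common refinement shows
  that the choice of n does not matter, and commutativity of nearby values makes \<gamma>
  additive.\<close>

lemma one_parameter_subgroup_exists:
  fixes G :: "('g, 'f::euclidean_space) liegrp"
  assumes G: "lie_group G" and \<xi>: "\<xi> \<in> lie_algebra G"
  obtains \<gamma> where "one_parameter_subgroup G \<xi> \<gamma>"
proof -
  note M = lie_groupD(2)[OF G] and ca = lie_groupD(3)[OF G]
  interpret group G by (rule lie_groupD(1)[OF G])
  obtain e a where e: "e > 0" and a: "integral_curve G \<xi> {-e<..<e} a" and a0: "a 0 = \<one>\<^bsub>G\<^esub>"
    by (rule local_integral_curve[OF G \<xi>])
  have pa: "param (lg_mfd G) {-e<..<e} a" using a by (simp add: integral_curve_def)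
  have ac: "a t \<in> carrier G" if "\<bar>t\<bar> < e" for t
  proof -
    have "t \<in> {-e<..<e}" using that by (simp add: abs_less_iff)
    from param_pts[OF pa this] show ?thesis unfolding ca .
  qed
  have add: "a (s + t) = a s \<otimes>\<^bsub>G\<^esub> a t" if s: "\<bar>s\<bar> < e" and t: "\<bar>t\<bar> < e" and st: "\<bar>s + t\<bar> < e" for s t
  proof -
    \<comment> \<open>The interval of all t for which both t and s + t lie in (-e, e); on it a and
      its shift by s are integral curves of the same field, so their quotient keeps its value at
      0.\<close>
    let ?J = "{-e<..<e} \<inter> {-e - s<..<e - s}"
    have "open ?J" by (intro open_Int open_greaterThanLessThan)
    have J: "connected ?J" by (intro convex_connected convex_Int convex_real_interval)
    have "integral_curve G \<xi> ?J a"
      by (rule integral_curve_subset[OF a \<open>open ?J\<close> Int_lower1])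
    moreover have "integral_curve G \<xi> ?J (\<lambda>t. a (s + t))"
      by (rule integral_curve_subset[OF integral_curve_shift[OF G a, of s] \<open>open ?J\<close>]) (auto simp: less_diff_eq add.commute)
    ultimately have "integral_curve G \<xi> ?J (\<lambda>t. a (s + t))" "integral_curve G \<xi> ?J a" by simp_all
    note curves = this
    have "t \<in> ?J" "0 \<in> ?J" using s t st e unfolding abs_less_iff by auto
    from integral_curve_quotient_constant[OF G curves J this]
    have "a (s + t) \<otimes>\<^bsub>G\<^esub> inv\<^bsub>G\<^esub> a t = a s \<otimes>\<^bsub>G\<^esub> inv\<^bsub>G\<^esub> a 0" by simp
    then have "a (s + t) \<otimes>\<^bsub>G\<^esub> inv\<^bsub>G\<^esub> a t \<otimes>\<^bsub>G\<^esub> a t = a s \<otimes>\<^bsub>G\<^esub> a t" using a0 ac[OF s] by simp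
    then show ?thesis using ac[OF st] ac[OF t] by (simp add: m_assoc)
  qed
  have pow: "a (of_nat k * s) = a s [^]\<^bsub>G\<^esub> k" if "of_nat k * \<bar>s\<bar> < e" "\<bar>s\<bar> < e" for k :: nat and s
    using that(1)
  proof (induction k)
    case 0
    then show ?case by (simp add: a0)
  next
    case (Suc k)
    have le: "of_nat k * \<bar>s\<bar> \<le> of_nat (Suc k) * \<bar>s\<bar>" by (intro mult_right_mono) auto
    have "of_nat k * s + s = of_nat (Suc k) * s" by (simp add: algebra_simps)
    then have ab: "\<bar>of_nat k * s\<bar> = of_nat k * \<bar>s\<bar>" "\<bar>of_nat k * s + s\<bar> = of_nat (Suc k) * \<bar>s\<bar>"
      by (simp_all only: abs_mult abs_of_nat)
    have "a (of_nat k * s + s) = a (of_nat k * s) \<otimes>\<^bsub>G\<^esub> a s"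
      using Suc.prems le ab that(2) by (intro add) auto
    then show ?case using Suc.IH Suc.prems le by (simp add: algebra_simps)
  qed
  \<comment> \<open>One more than the integer part of |t| / e, so that |t| / n < e strictly even
    when |t| is a multiple of e.\<close>
  define n where "n t = Suc (nat \<lfloor>\<bar>t\<bar> / e\<rfloor>)" for t :: real
  have n: "\<bar>t\<bar> < of_nat (n t) * e" "n t > 0" for t
  proof -
    have "\<bar>t\<bar> / e < of_nat (n t)" using e unfolding n_def by (simp add: of_nat_nat) linarith?
    then show "\<bar>t\<bar> < of_nat (n t) * e" using e by (simp add: field_simps)
    show "n t > 0" by (simp add: n_def)
  qed
  define \<gamma> where "\<gamma> t = a (t / of_nat (n t)) [^]\<^bsub>G\<^esub> n t" for t
  have refine: "a (t / of_nat k) = a (t / of_nat (k * m)) [^]\<^bsub>G\<^esub> m"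
    if "\<bar>t\<bar> < of_nat k * e" "k > 0" "m > 0" for t and k m :: nat
  proof -
    let ?s = "t / of_nat (k * m)"
    have "of_nat m * ?s = t / of_nat k" using that by simp
    moreover have "of_nat m * \<bar>?s\<bar> < e" using that by (simp add: field_simps abs_mult)
    moreover have "\<bar>?s\<bar> \<le> of_nat m * \<bar>?s\<bar>" using mult_right_mono[of 1 "of_nat m" "\<bar>?s\<bar>"] that(3) by simp
    ultimately show ?thesis using pow[of m ?s] by simp
  qed
  have small: "\<bar>t / of_nat k\<bar> < e" if "\<bar>t\<bar> < of_nat k * e" "k > 0" for t and k :: nat
    using that by (simp add: field_simps)
  have \<gamma>: "\<gamma> t = a (t / of_nat k) [^]\<^bsub>G\<^esub> k" if k: "\<bar>t\<bar> < of_nat k * e" "k > 0" for t and k :: nat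
  proof -
    let ?r = "a (t / of_nat (k * n t))"
    have "\<bar>t\<bar> < of_nat (k * n t) * e"
    proof -
      have "of_nat k * e * 1 \<le> of_nat k * e * of_nat (n t)" using n(2)[of t] e by (intro mult_left_mono) auto
      then show ?thesis using k(1) by (simp add: algebra_simps)
    qed
    moreover have "0 < k * n t" using k(2) n(2)[of t] by simp
    ultimately have r: "?r \<in> carrier G" by (rule ac[OF small])
    have "\<gamma> t = (?r [^]\<^bsub>G\<^esub> k) [^]\<^bsub>G\<^esub> n t"
      using refine[OF n(1) n(2) k(2), of t] by (simp add: \<gamma>_def mult.commute)
    also have "\<dots> = (?r [^]\<^bsub>G\<^esub> n t) [^]\<^bsub>G\<^esub> k" using r by (simp add: nat_pow_pow mult.commute)
    also have "\<dots> = a (t / of_nat k) [^]\<^bsub>G\<^esub> k" using refine[OF k n(2), of t] by simp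
    finally show ?thesis .
  qed
  have \<gamma>add: "\<gamma> (s + t) = \<gamma> s \<otimes>\<^bsub>G\<^esub> \<gamma> t" for s t
  proof -
    define k where "k = n (\<bar>s\<bar> + \<bar>t\<bar>)"
    have k: "\<bar>s\<bar> + \<bar>t\<bar> < of_nat k * e" "k > 0" using n[of "\<bar>s\<bar> + \<bar>t\<bar>"] by (simp_all add: k_def)
    then have kk: "\<bar>s\<bar> < of_nat k * e" "\<bar>t\<bar> < of_nat k * e" "\<bar>s + t\<bar> < of_nat k * e" by linarith+
    have sm: "\<bar>s / of_nat k\<bar> < e" "\<bar>t / of_nat k\<bar> < e" "\<bar>s / of_nat k + t / of_nat k\<bar> < e"
      using small[OF kk(1) k(2)] small[OF kk(2) k(2)] small[OF kk(3) k(2)] by (simp_all add: add_divide_distrib)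
    \<comment> \<open>Both products equal a at the sum of the two times. This permits distributing
      the k-th power over the product in a group that need not be commutative.\<close>
    have com: "a (s / of_nat k) \<otimes>\<^bsub>G\<^esub> a (t / of_nat k) = a (t / of_nat k) \<otimes>\<^bsub>G\<^esub> a (s / of_nat k)"
      using add[OF sm] add[OF sm(2,1)] sm(3) by (simp add: add.commute)
    have "\<gamma> (s + t) = (a (s / of_nat k) \<otimes>\<^bsub>G\<^esub> a (t / of_nat k)) [^]\<^bsub>G\<^esub> k"
      using \<gamma>[OF kk(3) k(2)] add[OF sm] by (simp add: add_divide_distrib)
    also have "\<dots> = a (s / of_nat k) [^]\<^bsub>G\<^esub> k \<otimes>\<^bsub>G\<^esub> a (t / of_nat k) [^]\<^bsub>G\<^esub> k"
      by (rule pow_mult_distrib[OF com ac[OF sm(1)] ac[OF sm(2)]])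
    finally show ?thesis using \<gamma>[OF kk(1) k(2)] \<gamma>[OF kk(2) k(2)] by simp
  qed
  have loc: "\<gamma> t = a t" if "\<bar>t\<bar> < e" for t using \<gamma>[of t 1] that ac[OF that] by simp
  have \<gamma>c: "\<gamma> t \<in> carrier G" for t using ac small[OF n] by (simp add: \<gamma>_def)
  have "param (lg_mfd G) UNIV \<gamma>"
  proof (rule param_local[OF open_UNIV])
    fix t0 :: real
    have "cinf UNIV (\<lambda>t::real. - t0 + t)" by (rule cinf_add[OF cinf_const cinf_id]) auto
    from param_reparam[OF pa this] have p1: "param (lg_mfd G) {t. - t0 + t \<in> {-e<..<e}} (\<lambda>t. a (- t0 + t))" by simp
    have "param (lg_mfd G) {t. - t0 + t \<in> {-e<..<e}} (\<lambda>t. \<gamma> t0 \<otimes>\<^bsub>G\<^esub> a (- t0 + t))"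
      by (rule param_mult[OF G param_const[OF param_open[OF p1]] p1]) (simp add: \<gamma>c ca)
    then have "param (lg_mfd G) {t. - t0 + t \<in> {-e<..<e}} \<gamma>"
    proof (rule param_cong)
      fix t assume "t \<in> {t. - t0 + t \<in> {-e<..<e}}"
      then have "\<bar>- t0 + t\<bar> < e" by auto
      then show "\<gamma> t0 \<otimes>\<^bsub>G\<^esub> a (- t0 + t) = \<gamma> t" using \<gamma>add[of t0 "- t0 + t"] loc by simp
    qed
    then show "\<exists>V. t0 \<in> V \<and> param (lg_mfd G) V \<gamma>" using e by (intro exI[of _ "{t. - t0 + t \<in> {-e<..<e}}"]) simp
  qed
  moreover have "velocity (lg_mfd G) \<gamma> 0 = \<xi>"
  proof -
    have "ptan (lg_mfd G) (\<lambda>s. inv\<^bsub>G\<^esub> a 0 \<otimes>\<^bsub>G\<^esub> a s) 0 1 = ptan (lg_mfd G) \<gamma> 0 1"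
      by (rule ptan_cong[OF open_greaterThanLessThan[of "-e" e]]) (use e loc ac a0 in auto)
    then show ?thesis
      using a e velocity_ptan[OF M \<open>param (lg_mfd G) UNIV \<gamma>\<close>, of 0] by (simp add: integral_curve_def)
  qed
  ultimately have "one_parameter_subgroup G \<xi> \<gamma>"
    using smooth_map_real[OF _ M] \<gamma>add by (simp add: one_parameter_subgroup_def)
  then show ?thesis by (rule that)
qed

text \<open>The curve r \<mapsto> \<gamma>(s r) is the one-parameter subgroup of s \<xi>, and
  uniqueness resolves the definite description in \<open>lie_exp\<close>.\<close>

lemma lie_exp_scale:
  fixes G :: "('g, 'f::euclidean_space) liegrp"
  assumes G: "lie_group G" and \<gamma>: "one_parameter_subgroup G \<xi> \<gamma>"
  shows "lie_exp G (s *\<^sub>R \<xi>) = \<gamma> s"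
proof -
  note M = lie_groupD(2)[OF G]
  have p: "param (lg_mfd G) UNIV \<gamma>"
    using \<gamma> param_real[OF _ M] by (simp add: one_parameter_subgroup_def)
  have "cinf UNIV (\<lambda>r::real. s * r)" by (rule cinf_bounded_linear[OF bounded_linear_mult_right open_UNIV])
  from param_reparam[OF p this] have p': "param (lg_mfd G) UNIV (\<lambda>r. \<gamma> (s * r))" by simp
  have d: "((\<lambda>r. s * r) has_derivative (\<lambda>r. s * r)) (at 0)" by (auto intro!: derivative_eq_intros)
  have "(\<lambda>r. s * r) differentiable at 0" using d unfolding differentiable_def by blast
  from ptan_reparam[OF M p this, of 1]
  have "ptan (lg_mfd G) (\<lambda>r. \<gamma> (s * r)) 0 1 = ptan (lg_mfd G) \<gamma> 0 s" by (simp add: fd_eqI[OF d])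
  also have "\<dots> = s *\<^sub>R \<xi>"
    using linear_cmul[OF ptan_linear[OF M p], of 0 s 1] one_parameter_subgroup_integral_curve(4)[OF G \<gamma>] by simp
  finally have "velocity (lg_mfd G) (\<lambda>r. \<gamma> (s * r)) 0 = s *\<^sub>R \<xi>" using velocity_ptan[OF M p', of 0] by simp
  then have o: "one_parameter_subgroup G (s *\<^sub>R \<xi>) (\<lambda>r. \<gamma> (s * r))"
    using smooth_map_real[OF p' M] \<gamma> by (simp add: one_parameter_subgroup_def distrib_left)
  show ?thesis unfolding lie_exp_def
  proof (rule the_equality)
    show "\<exists>\<gamma>'. one_parameter_subgroup G (s *\<^sub>R \<xi>) \<gamma>' \<and> \<gamma> s = \<gamma>' 1" using o by (intro exI[of _ "\<lambda>r. \<gamma> (s * r)"]) simp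
    fix g assume "\<exists>\<gamma>'. one_parameter_subgroup G (s *\<^sub>R \<xi>) \<gamma>' \<and> g = \<gamma>' 1"
    then obtain \<gamma>' where "one_parameter_subgroup G (s *\<^sub>R \<xi>) \<gamma>'" "g = \<gamma>' 1" by blast
    moreover have "\<gamma>' = (\<lambda>r. \<gamma> (s * r))" by (rule one_parameter_subgroup_unique[OF G calculation(1) o])
    ultimately show "g = \<gamma> s" by simp
  qed
qed

subsection \<open>Infinitesimal generators\<close>

text \<open>The fundamental vector field as the derivative of the orbit map at the identity. In this
  form, and not in that of \<open>inf_generator\<close>, linearity in \<xi> on the Lie algebra comes
  for free.\<close>

definition gen :: "('g, 'f::euclidean_space) liegrp \<Rightarrow> ('p, 'e::euclidean_space) mfd \<Rightarrow> ('g \<Rightarrow> 'p \<Rightarrow> 'p) \<Rightarrow> 'f \<Rightarrow> 'p \<Rightarrow> 'e" where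
  "gen G P \<Phi> \<xi> p = tmap (lg_mfd G) P (\<lambda>g. \<Phi> g p) \<one>\<^bsub>G\<^esub> \<xi>"

lemma lie_actionD:
  assumes "lie_action G P \<Phi>"
  shows "lie_group G" "smooth_manifold P" "p \<in> pts P \<Longrightarrow> \<Phi> \<one>\<^bsub>G\<^esub> p = p"
    "g \<in> carrier G \<Longrightarrow> h \<in> carrier G \<Longrightarrow> p \<in> pts P \<Longrightarrow> \<Phi> (g \<otimes>\<^bsub>G\<^esub> h) p = \<Phi> g (\<Phi> h p)"
  using assms unfolding lie_action_def by blast+

lemma inf_generator_eq_gen:
  fixes G :: "('g, 'f::euclidean_space) liegrp" and P :: "('p, 'e::euclidean_space) mfd"
  assumes A: "lie_action G P \<Phi>" and \<xi>: "\<xi> \<in> lie_algebra G" and p: "p \<in> pts P"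
  shows "inf_generator G P \<Phi> \<xi> p = gen G P \<Phi> \<xi> p"
proof -
  note G = lie_actionD(1)[OF A] and P = lie_actionD(2)[OF A]
  note M = lie_groupD(2)[OF G]
  obtain \<gamma> where \<gamma>: "one_parameter_subgroup G \<xi> \<gamma>" by (rule one_parameter_subgroup_exists[OF G \<xi>])
  note c = one_parameter_subgroup_integral_curve[OF G \<gamma>]
  have p\<gamma>: "param (lg_mfd G) UNIV \<gamma>" using c(1) by (simp add: integral_curve_def)
  note s = smooth_orbit_map[OF A p]
  have "param P UNIV (\<lambda>t. \<Phi> (\<gamma> t) p)"
    by (rule param_smooth_map[OF smooth_manifold_charted[OF M] smooth_manifold_charted[OF P] s p\<gamma>])
  from velocity_ptan[OF P this, of 0]
  have "inf_generator G P \<Phi> \<xi> p = ptan P (\<lambda>t. \<Phi> (\<gamma> t) p) 0 1"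
    by (simp add: inf_generator_def lie_exp_scale[OF G \<gamma>])
  also have "\<dots> = tmap (lg_mfd G) P (\<lambda>g. \<Phi> g p) (\<gamma> 0) (ptan (lg_mfd G) \<gamma> 0 1)"
    by (rule ptan_smooth_map[OF M P s p\<gamma>]) simp
  finally show ?thesis by (simp add: c gen_def)
qed

lemma gen_in:
  assumes "lie_action G P \<Phi>" "\<xi> \<in> lie_algebra G" "p \<in> pts P"
  shows "gen G P \<Phi> \<xi> p \<in> model P"
  unfolding gen_def using assms lie_groupD[OF lie_actionD(1)[OF assms(1)]]
  by (intro tmap_in smooth_orbit_map lie_actionD(2)[OF assms(1)]) (auto simp: lie_algebra_def tangent_space_def)

lemma gen_linear_ext:
  fixes G :: "('g, 'f::euclidean_space) liegrp" and P :: "('p, 'e::euclidean_space) mfd"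
  assumes A: "lie_action G P \<Phi>" and p: "p \<in> pts P"
  obtains l where "linear l" "\<And>\<xi>. \<xi> \<in> lie_algebra G \<Longrightarrow> gen G P \<Phi> \<xi> p = l \<xi>"
proof -
  note G = lie_groupD[OF lie_actionD(1)[OF A]]
  obtain l where "linear l" "\<And>v. v \<in> model (lg_mfd G) \<Longrightarrow> tmap (lg_mfd G) P (\<lambda>g. \<Phi> g p) \<one>\<^bsub>G\<^esub> v = l v"
    using tmap_linear_ext[OF G(2) lie_actionD(2)[OF A] smooth_orbit_map[OF A p] G(5)] by blast
  then show ?thesis by (intro that[of l]) (simp_all add: gen_def lie_algebra_def tangent_space_def)
qed

lemma fd_partial:
  fixes g :: "'a::euclidean_space \<times> 'b::euclidean_space \<Rightarrow> 'c::real_normed_vector"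
  assumes "g differentiable at (x, y)"
  shows "fd (\<lambda>w. g (x, w)) y v = fd g (x, y) (0, v)" "fd (\<lambda>w. g (w, y)) x u = fd g (x, y) (u, 0)"
proof -
  have 1: "((\<lambda>w. (x, w)) has_derivative (\<lambda>v. (0, v))) (at y)"
    and 2: "((\<lambda>w. (w, y)) has_derivative (\<lambda>v. (v, 0))) (at x)" by (auto intro!: derivative_eq_intros)
  note g = fd_works[OF assms]
  show "fd (\<lambda>w. g (x, w)) y v = fd g (x, y) (0, v)"
    using fd_eqI[OF diff_chain_at[OF 1 g]] by (simp add: comp_def)
  show "fd (\<lambda>w. g (w, y)) x u = fd g (x, y) (u, 0)"
    using fd_eqI[OF diff_chain_at[OF 2 g]] by (simp add: comp_def)
qed

lemma ptan_partial:
  fixes \<phi> :: "'a::euclidean_space \<times> 'b::euclidean_space \<Rightarrow> 'p"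
  assumes M: "smooth_manifold M" and \<phi>: "param M W \<phi>" and x: "(x, y) \<in> W"
  shows "ptan M (\<lambda>w. \<phi> (x, w)) y v = ptan M \<phi> (x, y) (0, v)" "ptan M (\<lambda>w. \<phi> (w, y)) x u = ptan M \<phi> (x, y) (u, 0)"
  unfolding ptan_def
  using fd_partial[OF cinf_differentiable[OF param_coord[OF M \<phi> param_pts[OF \<phi> x]] param_near(2)[OF M \<phi> x]]] by simp_all

section \<open>One-forms invariant under a Lie group action\<close>

locale invariant_form =
  fixes G :: "('g, 'f::euclidean_space) liegrp" and P :: "('p, 'e::euclidean_space) mfd"
    and \<Phi> :: "'g \<Rightarrow> 'p \<Rightarrow> 'p" and \<theta> :: "'p \<Rightarrow> 'e \<Rightarrow> 'w::real_normed_vector"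
  assumes A: "lie_action G P \<Phi>" and \<theta>: "one_form P \<theta>"
    and inv: "\<And>g p v. g \<in> carrier G \<Longrightarrow> p \<in> pts P \<Longrightarrow> v \<in> model P \<Longrightarrow> \<theta> (\<Phi> g p) (tmap P P (\<Phi> g) p v) = \<theta> p v"
begin

lemmas G = lie_actionD(1)[OF A] and P = lie_actionD(2)[OF A]
lemmas GM = lie_groupD(2)[OF G] and Gc = lie_groupD(3)[OF G] and one = lie_groupD(5)[OF G]

text \<open>Cartan's formula; the Lie derivative of \<open>\<theta>\<close> vanishes by invariance.\<close>

lemma ext_deriv1_gen:
  assumes p: "p \<in> pts P" and v: "v \<in> model P" and \<xi>: "\<xi> \<in> lie_algebra G"
  shows "ext_deriv1 P \<theta> p (gen G P \<Phi> \<xi> p) v =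
    - fd (\<lambda>y. \<theta> (pchart P p y) (gen G P \<Phi> \<xi> (pchart P p y))) (coord P p p) v"
proof -
  let ?g = "pchart (lg_mfd G) \<one>\<^bsub>G\<^esub>" and ?e = "coord (lg_mfd G) \<one>\<^bsub>G\<^esub> \<one>\<^bsub>G\<^esub>" and ?D = "pdom (lg_mfd G) \<one>\<^bsub>G\<^esub>"
  let ?q = "pchart P p" and ?x = "coord P p p" and ?W = "pdom P p"
  have \<xi>E: "\<xi> \<in> model (lg_mfd G)" using \<xi> by (simp add: lie_algebra_def tangent_space_def)
  note e = pchart_self[OF GM one] and x = pchart_self[OF P p]
  note pg = param_pchart[OF GM one] and pq = param_pchart[OF P p]
  \<comment> \<open>The action in coordinates of G times P. Pulling \<theta> back along F, the
    exterior derivative is evaluated on the constant fields (\<xi>, 0) and (0, v), which takes the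
    place of extending v to a vector field and forming a Lie derivative.\<close>
  define F where "F z = \<Phi> (?g (fst z)) (?q (snd z))" for z
  have F: "param P (?D \<times> ?W) F" unfolding F_def[abs_def]
    by (rule param_action[OF A fst_snd_param[OF pg pq]])
  have z0: "(?e, ?x) \<in> ?D \<times> ?W" using e x by simp
  have Fz0: "F (?e, ?x) = p" using e x lie_actionD(3)[OF A p] by (simp add: F_def)
  have DW: "open (?D \<times> ?W)" by (rule param_open[OF F])
  \<comment> \<open>Invariance: the pulled-back form applied to (0, v) does not depend on the group
    variable, so its derivative in the direction (\<xi>, 0) vanishes.\<close>
  have f1: "pform P \<theta> F z (0, v) = pform P \<theta> ?q (snd z) v" if z: "z \<in> ?D \<times> ?W" for z
  proof -
    obtain a b where ab: "z = (a, b)" "a \<in> ?D" "b \<in> ?W" using z by blast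
    have gc: "?g a \<in> carrier G" using param_pts[OF pg ab(2)] Gc by simp
    have qb: "?q b \<in> pts P" by (rule param_pts[OF pq ab(3)])
    have "ptan P F (a, b) (0, v) = ptan P (\<lambda>w. F (a, w)) b v"
      using ptan_partial(1)[OF P F] ab by simp
    also have "\<dots> = tmap P P (\<Phi> (?g a)) (?q b) (ptan P ?q b v)"
      unfolding F_def fst_conv snd_conv by (rule ptan_smooth_map[OF P P smooth_action[OF A gc] pq ab(3)])
    finally show ?thesis
      using inv[OF gc qb ptan_in[OF P pq ab(3)]] by (simp add: pform_def ab(1) F_def)
  qed
  have f2: "pform P \<theta> F (?e, y) (\<xi>, 0) = \<theta> (?q y) (gen G P \<Phi> \<xi> (?q y))"
    and t2: "ptan P F (?e, y) (\<xi>, 0) = gen G P \<Phi> \<xi> (?q y)" if y: "y \<in> ?W" for y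
  proof -
    have qy: "?q y \<in> pts P" by (rule param_pts[OF pq y])
    have "ptan P F (?e, y) (\<xi>, 0) = ptan P (\<lambda>w. F (w, y)) ?e \<xi>"
      using ptan_partial(2)[OF P F] y e by simp
    also have "\<dots> = tmap (lg_mfd G) P (\<lambda>g. \<Phi> g (?q y)) (?g ?e) (ptan (lg_mfd G) ?g ?e \<xi>)"
      unfolding F_def fst_conv snd_conv by (rule ptan_smooth_map[OF GM P smooth_orbit_map[OF A qy] pg e(2)])
    finally show t: "ptan P F (?e, y) (\<xi>, 0) = gen G P \<Phi> \<xi> (?q y)"
      using ptan_pchart_model[OF GM one \<xi>E] e(1) by (simp add: gen_def)
    have "F (?e, y) = ?q y" using e(1) lie_actionD(3)[OF A qy] by (simp add: F_def)
    with t show "pform P \<theta> F (?e, y) (\<xi>, 0) = \<theta> (?q y) (gen G P \<Phi> \<xi> (?q y))" by (simp add: pform_def)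
  qed
  have t1: "ptan P F (?e, ?x) (0, v) = v"
  proof -
    have "ptan P F (?e, ?x) (0, v) = ptan P (\<lambda>w. F (?e, w)) ?x v"
      using ptan_partial(1)[OF P F z0] by simp
    also have "\<dots> = ptan P ?q ?x v"
      by (rule ptan_cong[OF open_pdom[OF P p] x(2)])
        (simp add: F_def e(1) lie_actionD(3)[OF A] param_pts[OF pq])
    finally show ?thesis using ptan_pchart_model[OF P p v] by simp
  qed
  have "ext_deriv1 P \<theta> p (gen G P \<Phi> \<xi> p) v =
      fd (\<lambda>z. pform P \<theta> F z (0, v)) (?e, ?x) (\<xi>, 0) - fd (\<lambda>z. pform P \<theta> F z (\<xi>, 0)) (?e, ?x) (0, v)"
    using ext_deriv1_param[OF P \<theta> F z0, of "(\<xi>, 0)" "(0, v)"] t1 t2[OF x(2)] x(1) Fz0 by simp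
  moreover have "fd (\<lambda>z. pform P \<theta> F z (0, v)) (?e, ?x) (\<xi>, 0) = 0"
  proof -
    have "fd (\<lambda>z. pform P \<theta> F z (0, v)) (?e, ?x) (\<xi>, 0) = fd (\<lambda>w. pform P \<theta> F (w, ?x) (0, v)) ?e \<xi>"
      by (rule fd_partial(2)[symmetric, OF cinf_differentiable[OF cinf_pform[OF P \<theta> F] z0]])
    also have "fd (\<lambda>w. pform P \<theta> F (w, ?x) (0, v)) ?e = fd (\<lambda>w. pform P \<theta> ?q ?x v) ?e"
      by (rule fd_cong_open[OF open_pdom[OF GM one] e(2)]) (use f1 x(2) in simp)
    finally show ?thesis by (simp add: frechet_derivative_const)
  qed
  moreover have "fd (\<lambda>z. pform P \<theta> F z (\<xi>, 0)) (?e, ?x) (0, v) =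
      fd (\<lambda>y. \<theta> (?q y) (gen G P \<Phi> \<xi> (?q y))) ?x v"
  proof -
    have "fd (\<lambda>z. pform P \<theta> F z (\<xi>, 0)) (?e, ?x) (0, v) = fd (\<lambda>w. pform P \<theta> F (?e, w) (\<xi>, 0)) ?x v"
      by (rule fd_partial(1)[symmetric, OF cinf_differentiable[OF cinf_pform[OF P \<theta> F] z0]])
    also have "fd (\<lambda>w. pform P \<theta> F (?e, w) (\<xi>, 0)) ?x = fd (\<lambda>y. \<theta> (?q y) (gen G P \<Phi> \<xi> (?q y))) ?x"
      by (rule fd_cong_open[OF open_pdom[OF P p] x(2)]) (rule f2)
    finally show ?thesis .
  qed
  ultimately show ?thesis by simp
qed

text \<open>\<open>field_rep\<close> works in the fixed chart at the identity with vectors that live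
  in the preferred charts of other points. The chain rule through those charts removes them and
  leaves the partial derivative of the multiplication.\<close>

lemma field_rep_left_inv:
  assumes x: "x \<in> ldom G" "x \<in> model (lg_mfd G)" and \<eta>: "\<eta> \<in> model (lg_mfd G)"
  shows "field_rep (lg_mfd G) \<one>\<^bsub>G\<^esub> (left_inv_field G \<eta>) x = lfield G \<eta> x"
proof -
  let ?M = "lg_mfd G" and ?p = "pchart (lg_mfd G) \<one>\<^bsub>G\<^esub>" and ?c = "coord (lg_mfd G) \<one>\<^bsub>G\<^esub>"
  let ?e = "?c \<one>\<^bsub>G\<^esub>" and ?q = "pchart (lg_mfd G) \<one>\<^bsub>G\<^esub> x" and ?D = "pdom (lg_mfd G) \<one>\<^bsub>G\<^esub>"
  let ?V = "vspace_mfd (model (lg_mfd G))"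
  have E: "subspace (model ?M)" by (rule smooth_manifold_subspace[OF GM])
  note d = lfield_derivative[OF G x(1)] and xD = ldom_LD[OF G x(1)] and e = pchart_self[OF GM one]
  have qc: "?q \<in> carrier G" by (rule Lp_carrier[OF G xD])
  have qp: "?q \<in> pts ?M" using qc Gc by simp
  note l = left_translate_tangent[OF G qc \<eta>]
  have ic: "icoord ?M \<one>\<^bsub>G\<^esub> x = ?q"
    using proj_on_id[OF E x(2)] by (simp add: pchart_def fat_chart_def icoord_def)
  have qU: "?q \<in> pnbhd ?M \<one>\<^bsub>G\<^esub>" by (rule pchart_pnbhd[OF GM one xD])
  have at: "?q \<otimes>\<^bsub>G\<^esub> ?p ?e = ?q"
    using e(1) qc monoid.r_one[OF group.is_monoid[OF lie_groupD(1)[OF G]]] by simp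
  have cV: "coord ?V (?c ?q) = id"
    using coord_model[OF GM one qU] by (simp add: coord_def[of ?V] chart_at_vspace)
  have qq: "coord ?M ?q ?q \<in> {y \<in> pdom ?M ?q. pchart ?M ?q y \<in> pnbhd ?M \<one>\<^bsub>G\<^esub>}"
    using pchart_self[OF GM qp] qU by simp
  note dd = cinf_differentiable[OF param_coord[OF GM param_pchart[OF GM qp] one] qq]
  have "field_rep ?M \<one>\<^bsub>G\<^esub> (left_inv_field G \<eta>) x = tmap ?M ?V ?c ?q (left_inv_field G \<eta> ?q)"
    by (simp add: field_rep_def ic Let_def)
  also have "\<dots> = fd (\<lambda>y. ?c (pchart ?M ?q y)) (coord ?M ?q ?q) (left_inv_field G \<eta> ?q)"
    using tmap_eq_fd[where N = ?V and f = ?c, OF GM qp, of "left_inv_field G \<eta> ?q"] dd cV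
      ptan_in[OF GM l(1) e(2)] l(2) by simp
  also have "\<dots> = fd (\<lambda>z. ?c (?q \<otimes>\<^bsub>G\<^esub> ?p z)) ?e \<eta>"
    using fd_eqI[OF fd_along_param[where g = ?c, OF GM l(1) e(2)]] dd at l(2) by simp
  also have "\<dots> = lfield G \<eta> x"
    using fd_eqI[OF d(1)] by (simp add: gmul_def)
  finally show ?thesis .
qed

lemma dir_deriv_field_rep:
  assumes \<xi>: "\<xi> \<in> model (lg_mfd G)" and \<eta>: "\<eta> \<in> model (lg_mfd G)"
  defines "e \<equiv> coord (lg_mfd G) \<one>\<^bsub>G\<^esub> \<one>\<^bsub>G\<^esub>"
  shows "dir_deriv (field_rep (lg_mfd G) \<one>\<^bsub>G\<^esub> (left_inv_field G \<eta>)) e \<xi> = fd (lfield G \<eta>) e \<xi>"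
    "fd (lfield G \<eta>) e \<xi> \<in> model (lg_mfd G)"
proof -
  have E: "subspace (model (lg_mfd G))" by (rule smooth_manifold_subspace[OF GM])
  note c = cinf_lfield[OF G, of \<eta>] and e0 = one_ldom[OF G, folded e_def]
  have "dir_deriv (field_rep (lg_mfd G) \<one>\<^bsub>G\<^esub> (left_inv_field G \<eta>)) e \<xi> = dir_deriv (lfield G \<eta>) e \<xi>"
  proof (rule dir_deriv_cong_line[OF cinf_open[OF c] e0])
    fix t :: real assume t: "e + t *\<^sub>R \<xi> \<in> ldom G"
    have "e + t *\<^sub>R \<xi> \<in> model (lg_mfd G)"
      using pchart_self(3)[OF GM one] \<xi> E by (simp add: subspace_add subspace_scale e_def)
    from field_rep_left_inv[OF t this \<eta>]
    show "field_rep (lg_mfd G) \<one>\<^bsub>G\<^esub> (left_inv_field G \<eta>) (e + t *\<^sub>R \<xi>) = lfield G \<eta> (e + t *\<^sub>R \<xi>)" .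
  qed
  then show "dir_deriv (field_rep (lg_mfd G) \<one>\<^bsub>G\<^esub> (left_inv_field G \<eta>)) e \<xi> = fd (lfield G \<eta>) e \<xi>"
    using dir_deriv_fd[OF cinf_differentiable[OF c e0]] by simp
  show "fd (lfield G \<eta>) e \<xi> \<in> model (lg_mfd G)"
    by (rule fd_in_subspace[OF E cinf_has_derivative[OF c e0] cinf_open[OF c] e0]) (rule lfield_model[OF G])
qed

lemma lie_bracket_eq:
  assumes \<xi>: "\<xi> \<in> lie_algebra G" and \<eta>: "\<eta> \<in> lie_algebra G"
  defines "e \<equiv> coord (lg_mfd G) \<one>\<^bsub>G\<^esub> \<one>\<^bsub>G\<^esub>"
  shows "lie_bracket G \<xi> \<eta> = fd (lfield G \<eta>) e \<xi> - fd (lfield G \<xi>) e \<eta>" "lie_bracket G \<xi> \<eta> \<in> lie_algebra G"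
proof -
  let ?p = "pchart (lg_mfd G) \<one>\<^bsub>G\<^esub>"
  have E: "subspace (model (lg_mfd G))" by (rule smooth_manifold_subspace[OF GM])
  have m: "\<xi> \<in> model (lg_mfd G)" "\<eta> \<in> model (lg_mfd G)"
    using \<xi> \<eta> by (simp_all add: lie_algebra_def tangent_space_def)
  have one': "\<one>\<^bsub>G\<^esub> \<in> carrier G" using one Gc by simp
  have "left_inv_field G \<zeta> \<one>\<^bsub>G\<^esub> = \<zeta>" if "\<zeta> \<in> model (lg_mfd G)" for \<zeta>
  proof -
    have "left_inv_field G \<zeta> \<one>\<^bsub>G\<^esub> = ptan (lg_mfd G) ?p e \<zeta>"
      unfolding left_translate_tangent(2)[OF G one' that] e_def
      by (rule ptan_cong[OF open_pdom[OF GM one] pchart_self(2)[OF GM one]])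
        (simp add: Lp_carrier[OF G] monoid.l_one[OF group.is_monoid[OF lie_groupD(1)[OF G]]])
    then show ?thesis using ptan_pchart_model[OF GM one that] by (simp add: e_def)
  qed
  then show eq: "lie_bracket G \<xi> \<eta> = fd (lfield G \<eta>) e \<xi> - fd (lfield G \<xi>) e \<eta>"
    unfolding lie_bracket_def field_bracket_def e_def
    using dir_deriv_field_rep(1)[OF m] dir_deriv_field_rep(1)[OF m(2,1)] m by simp
  show "lie_bracket G \<xi> \<eta> \<in> lie_algebra G"
    unfolding eq e_def lie_algebra_def tangent_space_def
    by (intro subspace_diff[OF E] dir_deriv_field_rep(2) m)
qed

text \<open>The pullback of \<open>\<theta>\<close> along an orbit map is left-invariant, hence satisfies the Maurer--Cartan equation.\<close>

lemma ext_deriv1_gen_gen: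
  assumes p: "p \<in> pts P" and \<xi>: "\<xi> \<in> lie_algebra G" and \<eta>: "\<eta> \<in> lie_algebra G"
  shows "ext_deriv1 P \<theta> p (gen G P \<Phi> \<xi> p) (gen G P \<Phi> \<eta> p) = - \<theta> p (gen G P \<Phi> (lie_bracket G \<xi> \<eta>) p)"
proof -
  let ?M = "lg_mfd G" and ?p = "pchart (lg_mfd G) \<one>\<^bsub>G\<^esub>"
  let ?e = "coord (lg_mfd G) \<one>\<^bsub>G\<^esub> \<one>\<^bsub>G\<^esub>" and ?D = "pdom (lg_mfd G) \<one>\<^bsub>G\<^esub>"
  have m: "\<xi> \<in> model ?M" "\<eta> \<in> model ?M" using \<xi> \<eta> by (simp_all add: lie_algebra_def tangent_space_def)
  note e = pchart_self[OF GM one] and pg = param_pchart[OF GM one] and so = smooth_orbit_map[OF A p]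
  define \<phi> where "\<phi> x = \<Phi> (?p x) p" for x
  have \<phi>: "param P ?D \<phi>" unfolding \<phi>_def[abs_def]
    by (rule param_smooth_map[OF smooth_manifold_charted[OF GM] smooth_manifold_charted[OF P] so pg])
  define \<beta> where "\<beta> x w = pform P \<theta> \<phi> x w" for x w
  have c\<beta>: "cinf (ldom G) (\<lambda>x. \<beta> x w)" for w unfolding \<beta>_def
    by (rule cinf_subset[OF cinf_pform[OF P \<theta> \<phi>] cinf_open[OF cinf_lfield[OF G]]]) (use ldom_LD[OF G] in blast)
  have l\<beta>: "linear (\<beta> x)" if "x \<in> ldom G" for x
    unfolding \<beta>_def[abs_def] using one_form_linear[OF P \<theta> \<phi> ldom_LD[OF G that]] by simp
  note e0 = one_ldom[OF G]
  have \<phi>e: "\<phi> ?e = p" using e(1) lie_actionD(3)[OF A p] by (simp add: \<phi>_def)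
  have tan: "ptan P \<phi> ?e w = gen G P \<Phi> w p" if "w \<in> model ?M" for w
    using ptan_smooth_map[OF GM P so pg e(2), of w] ptan_pchart_model[OF GM one that] e(1)
    by (simp add: \<phi>_def[abs_def] gen_def)
  have const: "\<beta> x (lfield G \<zeta> x) = \<theta> p (gen G P \<Phi> \<zeta> p)" if x: "x \<in> ldom G" and \<zeta>: "\<zeta> \<in> lie_algebra G" for x \<zeta>
  proof -
    note xD = ldom_LD[OF G x]
    let ?q = "?p x"
    have \<zeta>m: "\<zeta> \<in> model ?M" using \<zeta> by (simp add: lie_algebra_def tangent_space_def)
    have qc: "?q \<in> carrier G" by (rule Lp_carrier[OF G xD])
    note l = left_translate_tangent[OF G qc \<zeta>m]
    have at: "?q \<otimes>\<^bsub>G\<^esub> ?p ?e = ?q"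
      using e(1) qc monoid.r_one[OF group.is_monoid[OF lie_groupD(1)[OF G]]] by simp
    have "ptan P \<phi> x (lfield G \<zeta> x) = tmap ?M P (\<lambda>g. \<Phi> g p) ?q (ptan ?M ?p x (lfield G \<zeta> x))"
      unfolding \<phi>_def[abs_def] by (rule ptan_smooth_map[OF GM P so pg xD])
    also have "ptan ?M ?p x (lfield G \<zeta> x) = ptan ?M (\<lambda>z. ?q \<otimes>\<^bsub>G\<^esub> ?p z) ?e \<zeta>"
      by (rule ptan_left_mult[OF G x, symmetric])
    also have "tmap ?M P (\<lambda>g. \<Phi> g p) ?q (ptan ?M (\<lambda>z. ?q \<otimes>\<^bsub>G\<^esub> ?p z) ?e \<zeta>) = ptan P (\<lambda>z. \<Phi> (?q \<otimes>\<^bsub>G\<^esub> ?p z) p) ?e \<zeta>"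
      using ptan_smooth_map[OF GM P so l(1) e(2), of \<zeta>] at by simp
    also have "\<dots> = ptan P (\<lambda>z. \<Phi> ?q (\<phi> z)) ?e \<zeta>"
      by (rule ptan_cong[OF open_pdom[OF GM one] e(2)]) (simp add: \<phi>_def lie_actionD(4)[OF A] qc Lp_carrier[OF G] p)
    also have "\<dots> = tmap P P (\<Phi> ?q) p (gen G P \<Phi> \<zeta> p)"
      using ptan_smooth_map[OF P P smooth_action[OF A qc] \<phi> e(2), of \<zeta>] tan[OF \<zeta>m] \<phi>e by simp
    finally show ?thesis
      using inv[OF qc p gen_in[OF A \<zeta> p]] by (simp add: \<beta>_def pform_def \<phi>_def[abs_def])
  qed
  \<comment> \<open>Differentiating the constant function x \<mapsto> \<beta> x (lfield G \<zeta> x)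
    trades the derivative of \<beta> for that of the field; antisymmetrised, the latter is the Lie
    bracket.\<close>
  have d: "fd (\<lambda>x. \<beta> x \<zeta>) ?e w = - \<beta> ?e (fd (lfield G \<zeta>) ?e w)" if \<zeta>: "\<zeta> \<in> lie_algebra G" for \<zeta> w
  proof -
    have \<zeta>m: "\<zeta> \<in> model ?M" using \<zeta> by (simp add: lie_algebra_def tangent_space_def)
    have "fd (\<lambda>x. \<beta> x (lfield G \<zeta> x)) ?e = fd (\<lambda>x. \<theta> p (gen G P \<Phi> \<zeta> p)) ?e"
      by (rule fd_cong_open[OF cinf_open[OF cinf_lfield[OF G]] e0]) (rule const[OF _ \<zeta>])
    then have "fd (\<lambda>x. \<beta> x (lfield G \<zeta> x)) ?e w = 0" by (simp add: frechet_derivative_const)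
    moreover have "fd (\<lambda>x. \<beta> x (lfield G \<zeta> x)) ?e w =
        \<beta> ?e (fd (lfield G \<zeta>) ?e w) + fd (\<lambda>x. \<beta> x (lfield G \<zeta> ?e)) ?e w"
      by (rule fd_apply_linear[OF c\<beta> l\<beta> cinf_lfield[OF G] e0])
    ultimately have "\<beta> ?e (fd (lfield G \<zeta>) ?e w) + fd (\<lambda>x. \<beta> x \<zeta>) ?e w = 0"
      using lfield_one[OF G \<zeta>m] by simp
    then show ?thesis by (simp add: add_eq_0_iff)
  qed
  have eD: "?e \<in> ?D" by (rule e(2))
  have "ext_deriv1 P \<theta> p (gen G P \<Phi> \<xi> p) (gen G P \<Phi> \<eta> p) = fd (\<lambda>x. \<beta> x \<eta>) ?e \<xi> - fd (\<lambda>x. \<beta> x \<xi>) ?e \<eta>"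
    using ext_deriv1_param[OF P \<theta> \<phi> eD, of \<xi> \<eta>] tan[OF m(1)] tan[OF m(2)] \<phi>e by (simp add: \<beta>_def)
  also have "\<dots> = - \<beta> ?e (lie_bracket G \<xi> \<eta>)"
    unfolding d[OF \<xi>] d[OF \<eta>] lie_bracket_eq(1)[OF \<xi> \<eta>] by (simp add: linear_diff[OF l\<beta>[OF e0]])
  also have "\<dots> = - \<theta> p (gen G P \<Phi> (lie_bracket G \<xi> \<eta>) p)"
    using lie_bracket_eq(2)[OF \<xi> \<eta>] tan \<phi>e by (simp add: \<beta>_def pform_def lie_algebra_def tangent_space_def)
  finally show ?thesis .
qed

end

section \<open>Tangent spaces of orbits and of fibres of the orbit projection\<close>

lemma smooth_map_ident:
  fixes M :: "('a, 'e::euclidean_space) mfd"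
  assumes M: "smooth_manifold M"
  shows "smooth_map M M (\<lambda>q. q)" "p \<in> pts M \<Longrightarrow> v \<in> model M \<Longrightarrow> tmap M M (\<lambda>q. q) p v = v"
proof -
  show s: "smooth_map M M (\<lambda>q. q)" by (rule smooth_mapI[OF M smooth_manifold_charted[OF M]])
  show "tmap M M (\<lambda>q. q) p v = v" if "p \<in> pts M" "v \<in> model M"
    using tmap_eq_ptan[OF M M s that] ptan_pchart_model[OF M that] by simp
qed

lemma smooth_map_comp:
  fixes M :: "('a, 'e::euclidean_space) mfd" and N :: "('b, 'f::euclidean_space) mfd"
    and L :: "('c, 'h::euclidean_space) mfd"
  assumes M: "smooth_manifold M" and N: "smooth_manifold N" and L: "smooth_manifold L"
    and f: "smooth_map M N f" and g: "smooth_map N L g"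
  shows "smooth_map M L (\<lambda>x. g (f x))"
proof (rule smooth_mapI[OF M smooth_manifold_charted[OF L]])
  fix W and \<phi> :: "'e \<Rightarrow> 'a" assume "param M W \<phi>"
  from param_smooth_map[OF smooth_manifold_charted[OF M] smooth_manifold_charted[OF N] f this]
  show "param L W (\<lambda>x. g (f (\<phi> x)))"
    by (rule param_smooth_map[OF smooth_manifold_charted[OF N] smooth_manifold_charted[OF L] g])
qed

lemma tmap_left_inverse:
  fixes M :: "('a, 'e::euclidean_space) mfd" and N :: "('b, 'f::euclidean_space) mfd"
  assumes M: "smooth_manifold M" and N: "smooth_manifold N" and f: "smooth_map M N f" and g: "smooth_map N M g"
    and gf: "\<And>q. q \<in> pts M \<Longrightarrow> g (f q) = q" and p: "p \<in> pts M" and v: "v \<in> model M"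
  shows "tmap N M g (f p) (tmap M N f p v) = v"
  using tmap_compose[OF M N M f g smooth_map_ident(1)[OF M] _ p v] gf smooth_map_ident(2)[OF M p v] by simp

lemma dim_inj_linear_image:
  fixes f :: "'a::euclidean_space \<Rightarrow> 'b::euclidean_space"
  assumes E: "subspace E" and l: "linear l" "\<And>v. v \<in> E \<Longrightarrow> f v = l v" and f: "inj_on f E" and S: "S \<subseteq> E"
  shows "dim (f ` S) = dim S"
proof -
  have "span S \<subseteq> E" using span_minimal[OF S E] .
  then have "inj_on l (span S)" using f l(2) by (metis inj_on_cong inj_on_subset subsetD)
  from dim_image_eq[OF l(1) this] show ?thesis using l(2) S by (metis image_cong subsetD)
qed

lemma openin_coord_preimage:
  fixes M :: "('p, 'e::euclidean_space) mfd"
  assumes M: "smooth_manifold M" and p: "p \<in> pts M" and W: "open W"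
  shows "openin (mtop M) {q \<in> pnbhd M p. coord M p q \<in> W}"
proof -
  note h = smooth_manifold_homeo[OF M chart_at_atlas[OF smooth_manifold_charted[OF M] p]]
  let ?U = "pnbhd M p" and ?c = "coord M p"
  have ts: "topspace (subtopology (mtop M) ?U) = ?U" using openin_subset[OF h(2)] by auto
  have "openin (top_of_set (?c ` ?U)) (?c ` ?U \<inter> W)" by (rule openin_open_Int[OF W])
  from openin_continuous_map_preimage[OF homeomorphic_imp_continuous_map[OF h(1)] this]
  have "openin (subtopology (mtop M) ?U) {x \<in> ?U. ?c x \<in> ?c ` ?U \<inter> W}" unfolding ts .
  moreover have "{x \<in> ?U. ?c x \<in> ?c ` ?U \<inter> W} = {q \<in> ?U. ?c q \<in> W}" by blast
  ultimately show ?thesis using h(2) openin_trans_full by fastforce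
qed

text \<open>\<open>cc\<close> is the derivative of the change from the preferred chart at q to the
  one at p. The tangent map of \<open>pchart M p\<close> undoes it on the model space, so passing to
  a fixed chart preserves dimensions.\<close>

lemma coord_change:
  fixes M :: "('p, 'e::euclidean_space) mfd"
  assumes M: "smooth_manifold M" and p: "p \<in> pts M" and q: "q \<in> pnbhd M p" "q \<in> pts M"
  defines "cc \<equiv> fd (\<lambda>y. coord M p (pchart M q y)) (coord M q q)"
  shows "(\<lambda>y. coord M p (pchart M q y)) differentiable at (coord M q q)" "linear cc" "cc w \<in> model M"
    "w \<in> model M \<Longrightarrow> ptan M (pchart M p) (coord M p q) (cc w) = w"
proof -
  note e = pchart_self[OF M q(2)]
  let ?V = "{y \<in> pdom M q. pchart M q y \<in> pnbhd M p}"
  have eV: "coord M q q \<in> ?V" using e q by simp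
  note c = param_coord[OF M param_pchart[OF M q(2)] p]
  show d: "(\<lambda>y. coord M p (pchart M q y)) differentiable at (coord M q q)" by (rule cinf_differentiable[OF c eV])
  show "linear cc" unfolding cc_def by (rule cinf_linear_fd[OF c eV])
  show "cc w \<in> model M" unfolding cc_def
    by (rule fd_in_subspace[OF smooth_manifold_subspace[OF M] cinf_has_derivative[OF c eV] cinf_open[OF c] eV])
      (simp add: coord_model[OF M p])
  show "ptan M (pchart M p) (coord M p q) (cc w) = w" if w: "w \<in> model M"
  proof -
    have x: "coord M p (pchart M q (coord M q q)) \<in> pdom M p" using e(1) coord_pdom[OF M p q(1)] by simp
    have "ptan M (pchart M q) (coord M q q) w = ptan M (\<lambda>y. pchart M p (coord M p (pchart M q y))) (coord M q q) w"
      by (rule ptan_cong[OF cinf_open[OF c] eV]) (simp add: pchart_coord[OF M p])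
    also have "\<dots> = ptan M (pchart M p) (coord M p (pchart M q (coord M q q))) (cc w)"
      unfolding cc_def by (rule ptan_reparam[where h = "\<lambda>y. coord M p (pchart M q y)", OF M param_pchart[OF M p] d x])
    finally show ?thesis using ptan_pchart_model[OF M q(2) w] e(1) by simp
  qed
qed

lemma range_ptan_pchart:
  fixes M :: "('p, 'e::euclidean_space) mfd"
  assumes M: "smooth_manifold M" and p: "p \<in> pts M" and x: "x \<in> pdom M p"
  shows "range (ptan M (pchart M p) x) = model M"
proof
  let ?q = "pchart M p x"
  note P = param_pchart[OF M p]
  have E: "subspace (model M)" by (rule smooth_manifold_subspace[OF M])
  have q: "?q \<in> pnbhd M p" "?q \<in> pts M" using pchart_pnbhd[OF M p x] param_pts[OF P x] by auto
  show "range (ptan M (pchart M p) x) \<subseteq> model M" using ptan_in[OF M P x] by blast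
  show "model M \<subseteq> range (ptan M (pchart M p) x)"
  proof
    fix w assume w: "w \<in> model M"
    let ?u = "fd (\<lambda>y. coord M p (pchart M ?q y)) (coord M ?q ?q) w"
    note c = coord_change[OF M p q]
    have "ptan M (pchart M p) x ?u = ptan M (pchart M p) (coord M p ?q) ?u"
      using ptan_pchart_proj[OF M p x, of ?u] proj_on_id[OF E c(3)] coord_pchart[OF M p x] by simp
    then have "ptan M (pchart M p) x ?u = w" using c(4)[OF w] by simp
    then show "w \<in> range (ptan M (pchart M p) x)" by (rule range_eqI[OF sym])
  qed
qed

text \<open>The orbit map intertwines left translation by g with the action of g, and both are
  invertible. Its tangent image at g is thus that at the identity, moved by an injective
  map.\<close>

lemma tmap_orbit_map:
  fixes G :: "('g, 'f::euclidean_space) liegrp" and P :: "('p, 'e::euclidean_space) mfd"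
  assumes A: "lie_action G P \<Phi>" and p: "p \<in> pts P" and g: "g \<in> carrier G"
  shows "tmap (lg_mfd G) P (\<lambda>h. \<Phi> h p) g ` model (lg_mfd G) =
      tmap P P (\<Phi> g) p ` (\<lambda>\<xi>. gen G P \<Phi> \<xi> p) ` lie_algebra G" (is "?T g ` ?E = _ ` ?S")
    and "inj_on (tmap P P (\<Phi> g) p) (model P)"
proof -
  note G = lie_actionD(1)[OF A] and P = lie_actionD(2)[OF A]
  note GM = lie_groupD(2)[OF G] and Gc = lie_groupD(3)[OF G] and one = lie_groupD(5)[OF G]
  interpret group G by (rule lie_groupD(1)[OF G])
  have gi: "inv\<^bsub>G\<^esub> g \<in> carrier G" using g by simp
  have "\<Phi> (inv\<^bsub>G\<^esub> g) (\<Phi> g q) = q" if "q \<in> pts P" for q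
    using lie_actionD(4)[OF A gi g that] lie_actionD(3)[OF A that] g by simp
  from tmap_left_inverse[OF P P smooth_action[OF A g] smooth_action[OF A gi] this p]
  show "inj_on (tmap P P (\<Phi> g) p) (model P)" by (rule inj_on_inverseI)
  let ?L = "\<lambda>h. g \<otimes>\<^bsub>G\<^esub> h" and ?Li = "\<lambda>h. inv\<^bsub>G\<^esub> g \<otimes>\<^bsub>G\<^esub> h"
  note sL = smooth_left_mult[OF G g] and sLi = smooth_left_mult[OF G gi] and so = smooth_orbit_map[OF A p]
  have gg: "g \<in> pts (lg_mfd G)" using g Gc by simp
  have LLi: "?L (?Li h) = h" if "h \<in> pts (lg_mfd G)" for h
    using that g Gc by (simp add: m_assoc[symmetric])
  have Lone: "?L \<one>\<^bsub>G\<^esub> = g" "?Li g = \<one>\<^bsub>G\<^esub>" using g by simp_all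
  have comm: "?T g (tmap (lg_mfd G) (lg_mfd G) ?L \<one>\<^bsub>G\<^esub> \<xi>) = tmap P P (\<Phi> g) p (gen G P \<Phi> \<xi> p)"
    if \<xi>: "\<xi> \<in> ?E" for \<xi>
  proof -
    have s: "smooth_map (lg_mfd G) P (\<lambda>h. \<Phi> g (\<Phi> h p))"
      by (rule smooth_map_comp[OF GM P P so smooth_action[OF A g]])
    have "tmap (lg_mfd G) P (\<lambda>h. \<Phi> g (\<Phi> h p)) \<one>\<^bsub>G\<^esub> \<xi> = ?T (?L \<one>\<^bsub>G\<^esub>) (tmap (lg_mfd G) (lg_mfd G) ?L \<one>\<^bsub>G\<^esub> \<xi>)"
      by (rule tmap_compose[OF GM GM P sL so s _ one \<xi>]) (use lie_actionD(4)[OF A g _ p] Gc in simp)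
    moreover have "tmap (lg_mfd G) P (\<lambda>h. \<Phi> g (\<Phi> h p)) \<one>\<^bsub>G\<^esub> \<xi> =
        tmap P P (\<Phi> g) (\<Phi> \<one>\<^bsub>G\<^esub> p) (tmap (lg_mfd G) P (\<lambda>h. \<Phi> h p) \<one>\<^bsub>G\<^esub> \<xi>)"
      by (rule tmap_compose[OF GM P P so smooth_action[OF A g] s _ one \<xi>]) simp
    ultimately show ?thesis using Lone lie_actionD(3)[OF A p] by (simp add: gen_def)
  qed
  show "?T g ` ?E = tmap P P (\<Phi> g) p ` ?S"
  proof
    show "?T g ` ?E \<subseteq> tmap P P (\<Phi> g) p ` ?S"
    proof (rule image_subsetI)
      fix w assume w: "w \<in> ?E"
      let ?\<xi> = "tmap (lg_mfd G) (lg_mfd G) ?Li g w"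
      have \<xi>: "?\<xi> \<in> ?E" by (rule tmap_in[OF GM GM sLi gg w])
      have "tmap (lg_mfd G) (lg_mfd G) ?L \<one>\<^bsub>G\<^esub> ?\<xi> = w"
        using tmap_left_inverse[OF GM GM sLi sL LLi gg w] Lone(2) by simp
      then have "?T g w = tmap P P (\<Phi> g) p (gen G P \<Phi> ?\<xi> p)" using comm[OF \<xi>] by simp
      then show "?T g w \<in> tmap P P (\<Phi> g) p ` ?S" using \<xi> by (simp add: lie_algebra_def tangent_space_def)
    qed
    show "tmap P P (\<Phi> g) p ` ?S \<subseteq> ?T g ` ?E"
    proof (clarify)
      fix \<xi> assume "\<xi> \<in> lie_algebra G"
      then have \<xi>: "\<xi> \<in> ?E" by (simp add: lie_algebra_def tangent_space_def)
      have "tmap (lg_mfd G) (lg_mfd G) ?L \<one>\<^bsub>G\<^esub> \<xi> \<in> ?E" by (rule tmap_in[OF GM GM sL one \<xi>])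
      then show "tmap P P (\<Phi> g) p (gen G P \<Phi> \<xi> p) \<in> ?T g ` ?E"
        using comm[OF \<xi>] by (metis imageI)
    qed
  qed
qed

text \<open>By homogeneity the orbit map has the same rank everywhere. The charts that turn it into
  \<psi> have derivatives onto the model space of the group and injective on that of P, which leaves
  this rank unchanged.\<close>

lemma orbit_map_rank:
  fixes G :: "('g, 'f::euclidean_space) liegrp" and P :: "('p, 'e::euclidean_space) mfd"
  assumes A: "lie_action G P \<Phi>" and p: "p \<in> pts P" and g0: "g0 \<in> carrier G"
  defines "W \<equiv> {x \<in> pdom (lg_mfd G) g0. \<Phi> (pchart (lg_mfd G) g0 x) p \<in> pnbhd P p}"
    and "\<psi> \<equiv> \<lambda>x. coord P p (\<Phi> (pchart (lg_mfd G) g0 x) p)"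
  shows "cinf W \<psi>" "x \<in> W \<Longrightarrow> dim (range (fd \<psi> x)) = dim ((\<lambda>\<xi>. gen G P \<Phi> \<xi> p) ` lie_algebra G)"
proof -
  note G = lie_actionD(1)[OF A] and P = lie_actionD(2)[OF A]
  note GM = lie_groupD(2)[OF G] and Gc = lie_groupD(3)[OF G]
  have gp: "g0 \<in> pts (lg_mfd G)" using g0 Gc by simp
  have E: "subspace (model P)" by (rule smooth_manifold_subspace[OF P])
  note so = smooth_orbit_map[OF A p] and pg = param_pchart[OF GM gp]
  note par = param_smooth_map[OF smooth_manifold_charted[OF GM] smooth_manifold_charted[OF P] so pg]
  show "cinf W \<psi>" unfolding W_def \<psi>_def by (rule param_coord[OF P par p])
  assume x: "x \<in> W"
  then have xD: "x \<in> pdom (lg_mfd G) g0" and qn: "\<Phi> (pchart (lg_mfd G) g0 x) p \<in> pnbhd P p" by (simp_all add: W_def)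
  let ?g = "pchart (lg_mfd G) g0 x" and ?\<phi> = "\<lambda>x. \<Phi> (pchart (lg_mfd G) g0 x) p"
  let ?q = "?\<phi> x" and ?S = "(\<lambda>\<xi>. gen G P \<Phi> \<xi> p) ` lie_algebra G"
  have gc: "?g \<in> carrier G" using param_pts[OF pg xD] Gc by simp
  have qp: "?q \<in> pts P" by (rule param_pts[OF par xD])
  note c = coord_change[OF P p qn qp]
  let ?cc = "fd (\<lambda>y. coord P p (pchart P ?q y)) (coord P ?q ?q)"
  have inj: "inj_on ?cc (model P)"
    by (rule inj_on_inverseI[where g = "ptan P (pchart P p) (coord P p ?q)"]) (rule c(4))
  have "fd \<psi> x v = ?cc (ptan P ?\<phi> x v)" for v
    unfolding \<psi>_def using fd_eqI[OF fd_along_param[where g = "coord P p", OF P par xD c(1)]] by simp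
  then have "range (fd \<psi> x) = ?cc ` range (ptan P ?\<phi> x)" by (simp add: image_image)
  then have "dim (range (fd \<psi> x)) = dim (range (ptan P ?\<phi> x))"
    using dim_inj_linear_image[OF E c(2) refl inj] ptan_in[OF P par xD] by (simp add: image_subset_iff)
  also have "range (ptan P ?\<phi> x) = tmap (lg_mfd G) P (\<lambda>h. \<Phi> h p) ?g ` range (ptan (lg_mfd G) (pchart (lg_mfd G) g0) x)"
    using ptan_smooth_map[OF GM P so pg xD] by (simp add: image_image)
  also have "\<dots> = tmap P P (\<Phi> ?g) p ` ?S"
    unfolding range_ptan_pchart[OF GM gp xD] by (rule tmap_orbit_map(1)[OF A p gc])
  also have "dim \<dots> = dim ?S"
  proof -
    obtain l where l: "linear l" "\<And>v. v \<in> model P \<Longrightarrow> tmap P P (\<Phi> ?g) p v = l v"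
      using tmap_linear_ext[OF P P smooth_action[OF A gc] p] by blast
    have "?S \<subseteq> model P" by (rule image_subsetI) (rule gen_in[OF A _ p])
    from dim_inj_linear_image[OF E l tmap_orbit_map(2)[OF A p gc] this] show ?thesis by simp
  qed
  finally show "dim (range (fd \<psi> x)) = dim ?S" .
qed

text \<open>An orbit of a second countable group is a countable union of images of maps of constant rank.\<close>

lemma negligible_thickened_orbit:
  fixes G :: "('g, 'f::euclidean_space) liegrp" and P :: "('p, 'e::euclidean_space) mfd"
  assumes A: "lie_action G P \<Phi>" and p: "p \<in> pts P" and Z: "subspace Z"
    and small: "dim ((\<lambda>\<xi>. gen G P \<Phi> \<xi> p) ` lie_algebra G) + dim Z < DIM('e)"
  shows "negligible {coord P p (\<Phi> g p) + z | g z. g \<in> carrier G \<and> \<Phi> g p \<in> pnbhd P p \<and> z \<in> Z}"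
proof -
  note G = lie_actionD(1)[OF A]
  note GM = lie_groupD(2)[OF G] and Gc = lie_groupD(3)[OF G]
  define T where "T B = {coord P p (\<Phi> g p) + z | g z. g \<in> B \<and> g \<in> carrier G \<and> \<Phi> g p \<in> pnbhd P p \<and> z \<in> Z}" for B
  have loc: "\<exists>S. openin (mtop (lg_mfd G)) S \<and> g0 \<in> S \<and> negligible (T S)"
    if g0: "g0 \<in> carrier G" "\<Phi> g0 p \<in> pnbhd P p" for g0
  proof -
    have gp: "g0 \<in> pts (lg_mfd G)" using g0 Gc by simp
    let ?q = "pchart (lg_mfd G) g0" and ?x = "coord (lg_mfd G) g0 g0"
    let ?W = "{x \<in> pdom (lg_mfd G) g0. \<Phi> (?q x) p \<in> pnbhd P p}" and ?\<psi> = "\<lambda>x. coord P p (\<Phi> (?q x) p)"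
    have x: "?x \<in> ?W" using pchart_self[OF GM gp] g0 by simp
    obtain W' where W': "open W'" "?x \<in> W'" "negligible {?\<psi> x + z | x z. x \<in> W' \<and> z \<in> Z}"
      using negligible_constant_rank[OF orbit_map_rank(1)[OF A p g0(1)] x orbit_map_rank(2)[OF A p g0(1)] Z small] by blast
    let ?S = "{g \<in> pnbhd (lg_mfd G) g0. coord (lg_mfd G) g0 g \<in> W'}"
    have "T ?S \<subseteq> {?\<psi> x + z | x z. x \<in> W' \<and> z \<in> Z}"
    proof
      fix y assume "y \<in> T ?S"
      then obtain g z where y: "y = coord P p (\<Phi> g p) + z" "g \<in> ?S" "z \<in> Z" unfolding T_def by blast
      then have "y = ?\<psi> (coord (lg_mfd G) g0 g) + z" using pchart_coord[OF GM gp] by simp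
      then show "y \<in> {?\<psi> x + z | x z. x \<in> W' \<and> z \<in> Z}" using y by blast
    qed
    then have "negligible (T ?S)" by (rule negligible_subset[OF W'(3)])
    moreover have "openin (mtop (lg_mfd G)) ?S" by (rule openin_coord_preimage[OF GM gp W'(1)])
    moreover have "g0 \<in> ?S" using in_pnbhd[OF smooth_manifold_charted[OF GM] gp] W'(2) by simp
    ultimately show ?thesis by blast
  qed
  have "second_countable (mtop (lg_mfd G))" using GM by (simp add: smooth_manifold_def)
  then obtain \<B> where \<B>: "countable \<B>"
      "\<And>S g. openin (mtop (lg_mfd G)) S \<and> g \<in> S \<Longrightarrow> \<exists>V\<in>\<B>. g \<in> V \<and> V \<subseteq> S"
    unfolding second_countable_def by blast
  \<comment> \<open>Only basic open sets with negligible image are collected. They still cover: T is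
    monotone, and each relevant group element has a neighbourhood with negligible image, which
    contains a basic set around the element.\<close>
  let ?C = "T ` {B \<in> \<B>. negligible (T B)}"
  have "negligible (\<Union>?C)" using \<B>(1) by (intro negligible_countable_Union) auto
  moreover have "{coord P p (\<Phi> g p) + z | g z. g \<in> carrier G \<and> \<Phi> g p \<in> pnbhd P p \<and> z \<in> Z} \<subseteq> \<Union>?C"
  proof clarify
    fix g z assume g: "g \<in> carrier G" "\<Phi> g p \<in> pnbhd P p" and z: "z \<in> Z"
    obtain S where S: "openin (mtop (lg_mfd G)) S" "g \<in> S" "negligible (T S)" using loc[OF g] by blast
    obtain B where B: "B \<in> \<B>" "g \<in> B" "B \<subseteq> S" using \<B>(2)[of S g] S by blast
    have "T B \<subseteq> T S" using B(3) unfolding T_def by blast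
    then have "negligible (T B)" by (rule negligible_subset[OF S(3)])
    moreover have "coord P p (\<Phi> g p) + z \<in> T B" using B(2) g z unfolding T_def by blast
    ultimately show "coord P p (\<Phi> g p) + z \<in> \<Union>?C" using B(1) by blast
  qed
  ultimately show ?thesis by (rule negligible_subset)
qed

lemma orbit_eqD:
  assumes "lie_action G P \<Phi>" "q \<in> pts P" "orbit G \<Phi> q = orbit G \<Phi> p"
  obtains g where "g \<in> carrier G" "q = \<Phi> g p"
proof -
  have "\<one>\<^bsub>G\<^esub> \<in> carrier G"
    using lie_actionD(1)[OF assms(1)] by (simp add: lie_group_def group.is_monoid monoid.one_closed)
  then have "q \<in> orbit G \<Phi> q" using lie_actionD(3)[OF assms(1,2)] unfolding orbit_def by (metis imageI)
  then show ?thesis using that assms(3) unfolding orbit_def by blast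
qed

lemma orbit_translate:
  fixes G :: "('g, 'f::euclidean_space) liegrp" and P :: "('p, 'e::euclidean_space) mfd"
  assumes A: "lie_action G P \<Phi>" and p: "p \<in> pts P" and g: "g \<in> carrier G"
  shows "orbit G \<Phi> (\<Phi> g p) = orbit G \<Phi> p"
proof -
  interpret group G by (rule lie_groupD(1)[OF lie_actionD(1)[OF A]])
  have "orbit G \<Phi> (\<Phi> g p) = (\<lambda>h. \<Phi> (h \<otimes>\<^bsub>G\<^esub> g) p) ` carrier G"
    unfolding orbit_def using lie_actionD(4)[OF A _ g p] by (intro image_cong) simp_all
  also have "\<dots> = (\<lambda>h. \<Phi> h p) ` ((\<lambda>h. h \<otimes>\<^bsub>G\<^esub> g) ` carrier G)" by (simp add: image_image)
  also have "(\<lambda>h. h \<otimes>\<^bsub>G\<^esub> g) ` carrier G = carrier G"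
  proof
    show "(\<lambda>h. h \<otimes>\<^bsub>G\<^esub> g) ` carrier G \<subseteq> carrier G" using g by auto
    show "carrier G \<subseteq> (\<lambda>h. h \<otimes>\<^bsub>G\<^esub> g) ` carrier G"
    proof
      fix h assume "h \<in> carrier G"
      then show "h \<in> (\<lambda>h. h \<otimes>\<^bsub>G\<^esub> g) ` carrier G"
        using g by (intro image_eqI[of _ _ "h \<otimes>\<^bsub>G\<^esub> inv\<^bsub>G\<^esub> g"]) (simp_all add: m_assoc)
    qed
  qed
  finally show ?thesis by (simp add: orbit_def)
qed

text \<open>If the kernel of \<open>T\<^sub>p\<pi>\<close> were larger than the tangent space of the orbit, then the orbit, being the whole
  fibre of \<open>\<pi>\<close>, would be too large to be negligible in it. The sets are thickened by a complement \<open>Z\<close> of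
  the kernel, which turns fibres into open sets.\<close>

lemma ker_orbit_projection:
  fixes G :: "('g, 'f::euclidean_space) liegrp" and P :: "('p, 'e::euclidean_space) mfd"
    and Q :: "('p set, 'e) mfd"
  assumes A: "lie_action G P \<Phi>" and Q: "is_quotient_structure G P \<Phi> Q" and p: "p \<in> pts P"
  shows "{v \<in> model P. tmap P Q (orbit G \<Phi>) p v = 0} = (\<lambda>\<xi>. gen G P \<Phi> \<xi> p) ` lie_algebra G" (is "?K = ?S")
proof -
  let ?\<pi> = "orbit G \<Phi>"
  note G = lie_actionD(1)[OF A] and P = lie_actionD(2)[OF A]
  note GM = lie_groupD(2)[OF G] and Gc = lie_groupD(3)[OF G] and one = lie_groupD(5)[OF G]
  interpret group G by (rule lie_groupD(1)[OF G])
  have QM: "smooth_manifold Q" and sub: "submersion P Q ?\<pi>"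
    using Q by (simp_all add: is_quotient_structure_def)
  have \<pi>: "smooth_map P Q ?\<pi>" using sub by (simp add: submersion_def)
  have E: "subspace (model P)" by (rule smooth_manifold_subspace[OF P])
  obtain t where t: "linear t" "\<And>v. v \<in> model P \<Longrightarrow> tmap P Q ?\<pi> p v = t v"
    using tmap_linear_ext[OF P QM \<pi> p] by blast
  have K: "?K = model P \<inter> {v. t v = 0}" using t(2) by auto
  have subK: "subspace ?K" unfolding K by (intro subspace_inter E linear_subspace_kernel t(1))
  obtain l where l: "linear l" "\<And>\<xi>. \<xi> \<in> lie_algebra G \<Longrightarrow> gen G P \<Phi> \<xi> p = l \<xi>"
    using gen_linear_ext[OF A p] by blast
  have LG: "subspace (lie_algebra G)" "lie_algebra G = model (lg_mfd G)"
    using smooth_manifold_subspace[OF GM] by (simp_all add: lie_algebra_def tangent_space_def)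
  have Sl: "?S = l ` lie_algebra G" using l(2) by simp
  have subS: "subspace ?S" unfolding Sl by (rule linear_subspace_image[OF l(1) LG(1)])
  have orb: "?\<pi> (\<Phi> g p) = ?\<pi> p" if "g \<in> carrier G" for g by (rule orbit_translate[OF A p that])
  have SK: "?S \<subseteq> ?K"
  proof (rule image_subsetI)
    fix \<xi> assume \<xi>: "\<xi> \<in> lie_algebra G"
    then have \<xi>m: "\<xi> \<in> model (lg_mfd G)" using LG(2) by simp
    note pg = param_pchart[OF GM one] and e = pchart_self[OF GM one]
    have "tmap P Q ?\<pi> p (gen G P \<Phi> \<xi> p) = tmap P Q ?\<pi> (\<Phi> (pchart (lg_mfd G) \<one>\<^bsub>G\<^esub> (coord (lg_mfd G) \<one>\<^bsub>G\<^esub> \<one>\<^bsub>G\<^esub>)) p)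
        (ptan P (\<lambda>y. \<Phi> (pchart (lg_mfd G) \<one>\<^bsub>G\<^esub> y) p) (coord (lg_mfd G) \<one>\<^bsub>G\<^esub> \<one>\<^bsub>G\<^esub>) \<xi>)"
      using tmap_eq_ptan[OF GM P smooth_orbit_map[OF A p] one \<xi>m] e(1) lie_actionD(3)[OF A p] by (simp add: gen_def)
    also have "\<dots> = ptan Q (\<lambda>y. ?\<pi> (\<Phi> (pchart (lg_mfd G) \<one>\<^bsub>G\<^esub> y) p)) (coord (lg_mfd G) \<one>\<^bsub>G\<^esub> \<one>\<^bsub>G\<^esub>) \<xi>"
      by (rule ptan_smooth_map[symmetric, OF P QM \<pi> param_smooth_map[OF smooth_manifold_charted[OF GM]
              smooth_manifold_charted[OF P] smooth_orbit_map[OF A p] pg] e(2)])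
    also have "\<dots> = ptan Q (\<lambda>y. ?\<pi> p) (coord (lg_mfd G) \<one>\<^bsub>G\<^esub> \<one>\<^bsub>G\<^esub>) \<xi>"
      by (rule ptan_cong[OF open_pdom[OF GM one] e(2)]) (simp add: orb Lp_carrier[OF G])
    also have "\<dots> = 0" by (simp add: ptan_def frechet_derivative_const)
    finally show "gen G P \<Phi> \<xi> p \<in> ?K" using gen_in[OF A \<xi> p] by simp
  qed
  have "dim ?K \<le> dim ?S"
  proof (rule ccontr)
    assume lt: "\<not> dim ?K \<le> dim ?S"
    show False
    proof (rule submersion_straighten[OF P QM sub p], goal_cases)
      case (1 B L U V h)
      note * = 1
      let ?e = "coord P p p" and ?pr = "proj_on (model P)"
      define k where "k y = coord Q (?\<pi> p) (?\<pi> (pchart P p y))" for y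
      define H where "H x = x - L (B x) + L (k x)" for x
      have HV: "H x \<in> V" "h (H x) = x" if "x \<in> U" for x
        using *(10,12)[OF that] by (simp_all add: H_def k_def)
      have hU: "h z \<in> U" "H (h z) = z" if "z \<in> V" for z
        using *(11)[OF that] by (simp_all add: H_def k_def)
      have q: "?\<pi> p \<in> pts Q"
        using param_pts[OF param_smooth_map[OF smooth_manifold_charted[OF P] smooth_manifold_charted[OF QM] \<pi> param_pchart[OF P p]]
            pchart_self(2)[OF P p]] pchart_self(1)[OF P p] by simp
      have kQ: "k x \<in> model Q" if "x \<in> U" for x using coord_model[OF QM q *(8)[OF that]] by (simp add: k_def)
      have BQ: "B x \<in> model Q" for x using *(3) by blast
      have BH: "B (H x) = k x" if "x \<in> U" for x
        by (simp add: H_def linear_add[OF *(1)] linear_diff[OF *(1)] *(4)[OF BQ] *(4)[OF kQ[OF that]])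
      \<comment> \<open>Null sets are taken in the ambient type, so the complement of the kernel
        must also contain the directions transversal to \<open>model P\<close>; Z1 supplies these,
        and the image of \<open>model Q\<close> under L the rest.\<close>
      define Z1 where "Z1 = {n. ?pr n = 0}"
      define Z where "Z = {n + y | n y. n \<in> Z1 \<and> y \<in> L ` model Q}"
      have sub1: "subspace Z1" unfolding Z1_def by (rule linear_subspace_kernel[OF linear_proj_on[OF E]])
      have sub2: "subspace (L ` model Q)"
        by (rule linear_subspace_image[OF *(2) smooth_manifold_subspace[OF QM]])
      have Z: "subspace Z" unfolding Z_def by (rule subspace_sums[OF sub1 sub2])
      have Z1Z: "n \<in> Z" if "n \<in> Z1" for n
      proof -
        have "n + 0 \<in> Z" unfolding Z_def using that subspace_0[OF sub2] by blast
        then show ?thesis by simp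
      qed
      have LZ: "L y \<in> Z" if "y \<in> model Q" for y
      proof -
        have "0 + L y \<in> Z" unfolding Z_def using that subspace_0[OF sub1] by blast
        then show ?thesis by simp
      qed
      have "?K \<inter> Z \<subseteq> {0}"
      proof
        fix u assume u: "u \<in> ?K \<inter> Z"
        then obtain n y where ny: "u = n + L y" "?pr n = 0" "y \<in> model Q" unfolding Z_def Z1_def by blast
        have pu: "?pr u = u" using u by (simp add: proj_on_id[OF E])
        have "B u = 0" using *(14)[of u] u pu by simp
        moreover have "B n = 0" using *(14)[of n] ny(2) t(2)[OF subspace_0[OF E]] linear_0[OF t(1)] by simp
        moreover have "B u = B n + B (L y)" unfolding ny(1) by (rule linear_add[OF *(1)])
        ultimately have "y = 0" using *(4)[OF ny(3)] by simp
        then have "u = n" using ny(1) linear_0[OF *(2)] by simp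
        then show "u \<in> {0}" using pu ny(2) by simp
      qed
      then have "dim (?K \<inter> Z) = 0" by (simp add: dim_eq_0)
      then have "dim ?K + dim Z = dim {x + y | x y. x \<in> ?K \<and> y \<in> Z}" using dim_sums_Int[OF subK Z] by (simp del: dim_eq_0)
      also have "\<dots> \<le> DIM('e)" by (rule dim_subset_UNIV)
      finally have small: "dim ?S + dim Z < DIM('e)" using lt by simp
      let ?T = "{coord P p (\<Phi> g p) + z | g z. g \<in> carrier G \<and> \<Phi> g p \<in> pnbhd P p \<and> z \<in> Z}"
      \<comment> \<open>Strips from w - H ?e its image under L \<circ> B: the result has the same
        B-value as H ?e and so lies in the straightened fibre through p, while the part removed
        belongs to Z.\<close>
      let ?m = "\<lambda>w. H ?e + ((w - H ?e) - L (B (w - H ?e)))"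
      have "continuous_on UNIV ?m"
        by (intro continuous_intros linear_continuous_on_compose[OF _ *(2)] linear_continuous_on_compose[OF _ *(1)])
      then have o: "open (?m -` V)" by (rule open_vimage[OF *(9)])
      have ne: "H ?e \<in> ?m -` V" using HV(1)[OF *(6)] by (simp add: linear_0[OF *(1)] linear_0[OF *(2)])
      have "?m -` V \<subseteq> ?T"
      proof
        fix w assume "w \<in> ?m -` V"
        then have mV: "?m w \<in> V" by simp
        let ?x = "h (?m w)"
        have xU: "?x \<in> U" and Hx: "H ?x = ?m w" using hU[OF mV] by auto
        have xD: "?x \<in> pdom P p" using xU *(7) by blast
        have "k ?x = B (?m w)" using BH[OF xU] Hx by simp
        also have "\<dots> = B (H ?e)"
          by (simp only: linear_add[OF *(1)] linear_diff[OF *(1), of "w - H ?e"] *(4)[OF BQ]) simp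
        also have "\<dots> = k ?e" by (rule BH[OF *(6)])
        finally have "coord Q (?\<pi> p) (?\<pi> (pchart P p ?x)) = coord Q (?\<pi> p) (?\<pi> p)"
          by (simp add: k_def pchart_self(1)[OF P p])
        moreover have "?\<pi> (pchart P p ?x) \<in> pnbhd Q (?\<pi> p)" "?\<pi> p \<in> pnbhd Q (?\<pi> p)"
          using *(8)[OF xU] *(8)[OF *(6)] pchart_self(1)[OF P p] by simp_all
        ultimately have "?\<pi> (pchart P p ?x) = ?\<pi> p" using pchart_coord[OF QM q] by metis
        moreover have "pchart P p ?x \<in> pts P" by (rule param_pts[OF param_pchart[OF P p] xD])
        ultimately obtain g where g: "g \<in> carrier G" "pchart P p ?x = \<Phi> g p" using orbit_eqD[OF A] by metis
        have c: "coord P p (\<Phi> g p) = ?pr ?x" using coord_pchart[OF P p xD] g(2) by simp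
        have n: "?x - ?pr ?x \<in> Z1"
          using linear_diff[OF linear_proj_on[OF E]] proj_on_id[OF E proj_on_in[OF E]] by (simp add: Z1_def)
        define z where "z = (?x - ?pr ?x) + (L (k ?x) - L (B ?x)) + L (B (w - H ?e))"
        have "z \<in> Z" unfolding z_def
          by (intro subspace_add[OF Z] subspace_diff[OF Z] Z1Z[OF n] LZ kQ[OF xU] BQ)
        moreover have "w = ?m w + L (B (w - H ?e))" by simp
        then have "w = H ?x + L (B (w - H ?e))" using Hx by simp
        then have "w = coord P p (\<Phi> g p) + z" unfolding c z_def H_def by (simp add: algebra_simps)
        moreover have "\<Phi> g p \<in> pnbhd P p" using pchart_pnbhd[OF P p xD] g(2) by simp
        ultimately show "w \<in> ?T" using g(1) by blast
      qed
      then have "negligible (?m -` V)" by (rule negligible_subset[OF negligible_thickened_orbit[OF A p Z small]])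
      then show False using open_not_negligible[OF o] ne by blast
    qed
  qed
  then show ?thesis using subspace_dim_equal[OF subS subK SK] by simp
qed

section \<open>Linear algebra of the reduction\<close>

lemma dim_image_kernel:
  fixes f :: "'a::euclidean_space \<Rightarrow> 'b::euclidean_space"
  assumes f: "linear f" and S: "subspace S"
  shows "dim (f ` S) + dim {x \<in> S. f x = 0} = dim S"
proof -
  obtain g where g: "range g \<subseteq> S" "linear g" "\<And>v. v \<in> f ` S \<Longrightarrow> f (g v) = v"
    using linear_exists_right_inverse_on[OF f S] by auto
  let ?T = "g ` f ` S" and ?K = "{x \<in> S. f x = 0}"
  have fS: "subspace (f ` S)" by (rule linear_subspace_image[OF f S])
  have T: "subspace ?T" by (rule linear_subspace_image[OF g(2) fS])
  have K: "subspace ?K" using subspace_inter[OF S linear_subspace_kernel[OF f]] by (simp add: Int_def)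
  have "inj_on g (span (f ` S))" using span_eq_iff[THEN iffD2, OF fS] g(3) by (metis inj_onI)
  then have "dim ?T = dim (f ` S)" by (rule dim_image_eq[OF g(2)])
  moreover have "?T \<inter> ?K \<subseteq> {0}"
  proof
    fix x assume x: "x \<in> ?T \<inter> ?K"
    then obtain v where v: "v \<in> f ` S" "x = g v" by blast
    then have "v = 0" using g(3)[OF v(1)] x by simp
    then show "x \<in> {0}" using v(2) linear_0[OF g(2)] by simp
  qed
  then have "dim (?T \<inter> ?K) = 0" by (simp add: dim_eq_0)
  moreover have "{x + y | x y. x \<in> ?T \<and> y \<in> ?K} = S"
  proof
    show "{x + y | x y. x \<in> ?T \<and> y \<in> ?K} \<subseteq> S" using g(1) S by (auto intro: subspace_add)
    show "S \<subseteq> {x + y | x y. x \<in> ?T \<and> y \<in> ?K}"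
    proof
      fix s assume s: "s \<in> S"
      have "g (f s) \<in> S" using g(1) by blast
      then have "s - g (f s) \<in> ?K" using s S g(3)[of "f s"] by (simp add: subspace_diff linear_diff[OF f])
      moreover have "g (f s) \<in> ?T" using s by blast
      moreover have "s = g (f s) + (s - g (f s))" by simp
      ultimately show "s \<in> {x + y | x y. x \<in> ?T \<and> y \<in> ?K}" by blast
    qed
  qed
  ultimately show ?thesis using dim_sums_Int[OF T K] by (simp del: dim_eq_0)
qed

lemma dim_set_plus:
  fixes A B :: "'a::euclidean_space set"
  assumes "subspace A" "subspace B"
  shows "dim (A + B) + dim (A \<inter> B) = dim A + dim B" and "subspace (A + B)"
proof -
  have eq: "A + B = {x + y | x y. x \<in> A \<and> y \<in> B}" by (auto simp: set_plus_def)
  show "dim (A + B) + dim (A \<inter> B) = dim A + dim B" unfolding eq by (rule dim_sums_Int[OF assms])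
  show "subspace (A + B)" unfolding eq by (rule subspace_sums[OF assms])
qed

lemma set_plusD: "x \<in> A + B \<Longrightarrow> \<exists>a\<in>A. \<exists>b\<in>B. x = a + b"
  by (simp add: set_plus_def)

section \<open>Skew bilinear forms on a subspace and their orthogonals\<close>

locale presymplectic =
  fixes V :: "'e::euclidean_space set" and w :: "'e \<Rightarrow> 'e \<Rightarrow> real"
  assumes V: "subspace V" and lin: "\<And>u. u \<in> V \<Longrightarrow> linear_form_on V (w u)"
    and skew: "\<And>u v. u \<in> V \<Longrightarrow> v \<in> V \<Longrightarrow> w v u = - w u v"
begin

definition perp :: "'e set \<Rightarrow> 'e set" where
  "perp A = {v \<in> V. \<forall>u\<in>A. w u v = 0}"

lemma w_right: "u \<in> V \<Longrightarrow> x \<in> V \<Longrightarrow> y \<in> V \<Longrightarrow> w u (a *\<^sub>R x + b *\<^sub>R y) = a * w u x + b * w u y"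
  using lin[of u] unfolding linear_form_on_def by simp

lemma w_left: "u \<in> V \<Longrightarrow> x \<in> V \<Longrightarrow> y \<in> V \<Longrightarrow> w (a *\<^sub>R x + b *\<^sub>R y) u = a * w x u + b * w y u"
  using w_right[of u x y a b] skew[of u "a *\<^sub>R x + b *\<^sub>R y"] skew[of u x] skew[of u y] V
  by (simp add: subspace_add subspace_scale)

lemma w_add_left: "u \<in> V \<Longrightarrow> x \<in> V \<Longrightarrow> y \<in> V \<Longrightarrow> w (x + y) u = w x u + w y u"
  using w_left[of u x y 1 1] by simp

lemma w_add_right: "u \<in> V \<Longrightarrow> x \<in> V \<Longrightarrow> y \<in> V \<Longrightarrow> w u (x + y) = w u x + w u y"
  using w_right[of u x y 1 1] by simp

lemma perp_subset: "perp A \<subseteq> V"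
  by (auto simp: perp_def)

lemma perp_subspace: "A \<subseteq> V \<Longrightarrow> subspace (perp A)"
proof (rule subspaceI)
  assume A: "A \<subseteq> V"
  show "0 \<in> perp A"
    using w_right[of _ 0 0 0 0] A V subspace_0[OF V] by (auto simp: perp_def)
  show "x + y \<in> perp A" if "x \<in> perp A" "y \<in> perp A" for x y
    using that A V w_add_right[of _ x y] by (auto simp: perp_def subspace_add)
  show "c *\<^sub>R x \<in> perp A" if "x \<in> perp A" for c x
    using that A V w_right[of _ x x c 0] by (auto simp: perp_def subspace_scale)
qed

text \<open>With the form written as an inner product with a linear operator, orthogonality for the
  form becomes Euclidean orthogonality, whose dimension formula can be used. The form is meaningful
  only on V, hence the projection of the first argument.\<close>

lemma representation:
  obtains \<Omega> where "linear \<Omega>" "\<And>u. \<Omega> u \<in> V" "\<And>u v. u \<in> V \<Longrightarrow> v \<in> V \<Longrightarrow> w u v = \<Omega> u \<bullet> v"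
proof -
  let ?P = "proj_on V"
  obtain B where B: "finite B" "B \<subseteq> V" "pairwise orthogonal B" "\<And>x. x \<in> B \<Longrightarrow> norm x = 1" "independent B"
      "card B = dim V" "span B = V"
    using orthonormal_basis_subspace[OF V] by (metis independent_bound)
  define \<Omega> where "\<Omega> u = (\<Sum>b\<in>B. w (?P u) b *\<^sub>R b)" for u
  note P = linear_proj_on[OF V] proj_on_in[OF V] proj_on_id[OF V]
  have "linear \<Omega>"
  proof (rule linearI)
    fix x y :: 'e and r :: real
    have "w (?P (x + y)) b = w (?P x) b + w (?P y) b" "w (?P (r *\<^sub>R x)) b = r * w (?P x) b" if "b \<in> B" for b
      using B(2) that P(2) w_add_left[of b "?P x" "?P y"] w_left[of b "?P x" "?P x" r 0]
      by (auto simp: linear_add[OF P(1)] linear_cmul[OF P(1)])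
    then show "\<Omega> (x + y) = \<Omega> x + \<Omega> y" "\<Omega> (r *\<^sub>R x) = r *\<^sub>R \<Omega> x"
      by (simp_all add: \<Omega>_def sum.distrib scaleR_add_left scaleR_sum_right)
  qed
  moreover have "\<Omega> u \<in> V" for u unfolding \<Omega>_def using B(2) by (intro subspace_sum[OF V] subspace_scale[OF V]) auto
  moreover have "w u v = \<Omega> u \<bullet> v" if u: "u \<in> V" and v: "v \<in> V" for u v
  proof -
    have "y \<in> V \<and> w u y = \<Omega> u \<bullet> y" if "y \<in> span B" for y
      using that
    proof (induction rule: span_induct_alt)
      case base
      show ?case using w_right[OF u subspace_0[OF V] subspace_0[OF V], of 0 0] subspace_0[OF V] by simp
    next
      case (step c x y)
      have xV: "x \<in> V" "y \<in> V" using step B(2) by auto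
      have "\<Omega> u \<bullet> x = (\<Sum>b\<in>B. if b = x then w u b else 0)"
        unfolding \<Omega>_def inner_sum_left P(3)[OF u]
      proof (rule sum.cong[OF refl])
        fix b assume b: "b \<in> B"
        show "(w u b *\<^sub>R b) \<bullet> x = (if b = x then w u b else 0)"
        proof (cases "b = x")
          case True
          then show ?thesis using B(4)[OF step(1)] by (simp add: norm_eq_1)
        next
          case False
          then have "orthogonal b x" using B(3) b step(1) by (simp add: pairwise_def)
          then show ?thesis using False by (simp add: orthogonal_def)
        qed
      qed
      also have "\<dots> = w u x" using step(1) B(1) by simp
      finally have x: "\<Omega> u \<bullet> x = w u x" .
      have "w u (c *\<^sub>R x + 1 *\<^sub>R y) = c * w u x + 1 * w u y" by (rule w_right[OF u xV])
      then show ?case using x step xV V by (simp add: inner_add_right subspace_add subspace_scale)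
    qed
    then show ?thesis using v B(7) by blast
  qed
  ultimately show ?thesis by (rule that)
qed

text \<open>The orthogonal of A for the form is the Euclidean complement in V of \<Omega>(A), and by
  skewness the kernel of \<Omega> on A is the part of A in the radical \<open>perp V\<close>.
  Rank-nullity combines the two.\<close>

lemma dim_perp:
  assumes A: "subspace A" "A \<subseteq> V"
  shows "dim (perp A) + dim A = dim V + dim (A \<inter> perp V)"
proof -
  obtain \<Omega> where \<Omega>: "linear \<Omega>" "\<And>u. \<Omega> u \<in> V" "\<And>u v. u \<in> V \<Longrightarrow> v \<in> V \<Longrightarrow> w u v = \<Omega> u \<bullet> v"
    using representation by blast
  have "w u v = \<Omega> u \<bullet> v" if "u \<in> A" "v \<in> V" for u v using that A(2) \<Omega>(3) by blast
  then have "perp A = {y \<in> V. \<forall>x\<in>\<Omega> ` A. orthogonal x y}" by (auto simp: perp_def orthogonal_def)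
  then have 1: "dim (perp A) + dim (\<Omega> ` A) = dim V"
    using dim_subspace_orthogonal_to_vectors[OF linear_subspace_image[OF \<Omega>(1) A(1)] V] \<Omega>(2) by auto
  have "{x \<in> A. \<Omega> x = 0} = A \<inter> perp V"
  proof (intro Set.set_eqI iffI)
    fix x assume x: "x \<in> {x \<in> A. \<Omega> x = 0}"
    then have xV: "x \<in> V" using A(2) by blast
    have "w u x = 0" if "u \<in> V" for u using skew[OF xV that] \<Omega>(3)[OF xV that] x by simp
    then show "x \<in> A \<inter> perp V" using x xV by (simp add: perp_def)
  next
    fix x assume x: "x \<in> A \<inter> perp V"
    then have xV: "x \<in> V" and 0: "w (\<Omega> x) x = 0" using \<Omega>(2) by (simp_all add: perp_def)
    have "\<Omega> x \<bullet> \<Omega> x = 0" using \<Omega>(3)[OF xV \<Omega>(2), of x] skew[OF xV \<Omega>(2), of x] 0 by simp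
    then show "x \<in> {x \<in> A. \<Omega> x = 0}" using x by simp
  qed
  then show ?thesis using 1 dim_image_kernel[OF \<Omega>(1) A(1)] by simp
qed

lemma perp_antimono: "A \<subseteq> B \<Longrightarrow> perp B \<subseteq> perp A"
  by (auto simp: perp_def)

text \<open>The radical is orthogonal to everything, so it must be added on the right. One inclusion
  is immediate, and applying \<open>dim_perp\<close> to A and to \<open>perp A\<close> settles the
  dimensions.\<close>

lemma perp_perp:
  assumes A: "subspace A" "A \<subseteq> V"
  shows "perp (perp A) = A + perp V"
proof -
  have RV: "perp V \<subseteq> perp A" by (rule perp_antimono[OF A(2)])
  note pA = perp_subspace[OF A(2)] and R = perp_subspace[OF order_refl]
  note s = dim_set_plus[OF A(1) R]
  have "A + perp V \<subseteq> perp (perp A)"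
  proof (clarsimp simp: set_plus_def)
    fix a r assume ar: "a \<in> A" "r \<in> perp V"
    have aV: "a \<in> V" "r \<in> V" using ar A(2) perp_subset by auto
    have "w u (a + r) = 0" if u: "u \<in> perp A" for u
    proof -
      have uV: "u \<in> V" using u perp_subset by blast
      have "w u a = 0" using skew[OF aV(1) uV] u ar(1) by (simp add: perp_def)
      moreover have "w u r = 0" using ar(2) uV by (simp add: perp_def)
      ultimately show ?thesis using w_add_right[OF uV aV] by simp
    qed
    then show "a + r \<in> perp (perp A)" using aV V by (simp add: perp_def subspace_add)
  qed
  moreover have "dim (perp (perp A)) \<le> dim (A + perp V)"
  proof -
    have "perp A \<inter> perp V = perp V" using RV by blast
    then have "dim (perp (perp A)) + dim (perp A) = dim V + dim (perp V)"
      using dim_perp[OF pA perp_subset] by simp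
    then show ?thesis using dim_perp[OF A] s(1) by linarith
  qed
  ultimately show ?thesis
    using subspace_dim_equal[OF s(2) perp_subspace[OF perp_subset]] by blast
qed

text \<open>\<open>\<rho>\<close> is the infinitesimal action, \<open>\<mm>\<close> the annihilator of the momentum value; the hypothesis
  \<open>\<kk> = \<dots>\<close> is what equivariance says about \<open>\<kk>\<^bsub>[\<mu>]\<^esub>\<close>.\<close>

lemma reduction:
  fixes \<rho> :: "'f::euclidean_space \<Rightarrow> 'e"
  assumes \<rho>: "linear \<rho>" and m: "subspace \<mm>" "\<rho> ` \<mm> \<subseteq> V"
    and k: "\<kk> = {\<xi> \<in> \<mm>. \<forall>\<eta>\<in>\<mm>. w (\<rho> \<xi>) (\<rho> \<eta>) = 0}"
    and T: "subspace T" and C: "perp (\<rho> ` \<mm>) = T + perp V + \<rho> ` \<kk>"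
  shows "{u \<in> T. \<forall>v\<in>T. w u v = 0} = T \<inter> (perp V + \<rho> ` \<kk>)"
    and "dim {u \<in> T. \<forall>v\<in>T. w u v = 0} + 2 * dim (perp (\<rho> ` \<mm>)) + dim \<mm> = dim T + dim V + dim (perp V) + dim \<kk>"
proof -
  let ?A = "\<rho> ` \<mm>" and ?R = "perp V" and ?B = "\<rho> ` \<kk>"
  let ?C = "perp ?A"
  have A: "subspace ?A" by (rule linear_subspace_image[OF \<rho> m(1)])
  note R = perp_subspace[OF order_refl] and pA = perp_subspace[OF m(2)]
  have RA: "?R \<subseteq> ?C" by (rule perp_antimono[OF m(2)])
  have km: "\<kk> \<subseteq> \<mm>" unfolding k by blast
  have B: "?B = ?A \<inter> ?C"
  proof
    show "?B \<subseteq> ?A \<inter> ?C"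
    proof (rule image_subsetI)
      fix \<xi> assume \<xi>: "\<xi> \<in> \<kk>"
      then have xm: "\<xi> \<in> \<mm>" using km by blast
      have "w (\<rho> \<eta>) (\<rho> \<xi>) = 0" if "\<eta> \<in> \<mm>" for \<eta>
        using skew[of "\<rho> \<xi>" "\<rho> \<eta>"] \<xi> that m(2) xm unfolding k by auto
      then show "\<rho> \<xi> \<in> ?A \<inter> ?C" using xm m(2) by (auto simp: perp_def)
    qed
    show "?A \<inter> ?C \<subseteq> ?B"
    proof
      fix a assume a: "a \<in> ?A \<inter> ?C"
      then obtain \<xi> where \<xi>: "\<xi> \<in> \<mm>" "a = \<rho> \<xi>" by blast
      have "w (\<rho> \<xi>) (\<rho> \<eta>) = 0" if "\<eta> \<in> \<mm>" for \<eta>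
        using skew[of "\<rho> \<eta>" "\<rho> \<xi>"] a that m(2) \<xi> by (auto simp: perp_def)
      then show "a \<in> ?B" using \<xi> unfolding k by blast
    qed
  qed
  have Bs: "subspace ?B" unfolding B by (rule subspace_inter[OF A pA])
  note RB = dim_set_plus[OF R Bs]
  have zB: "0 \<in> ?B" and zR: "0 \<in> ?R" and zT: "0 \<in> T"
    using subspace_0[OF Bs] subspace_0[OF R] subspace_0[OF T] by auto
  have TC: "T \<subseteq> ?C"
  proof
    fix t assume "t \<in> T"
    then have "t + 0 + 0 \<in> T + ?R + ?B" using zB zR by (intro set_plus_intro)
    then show "t \<in> ?C" using C by simp
  qed
  have TV: "T \<subseteq> V" using TC perp_subset by blast
  have BT: "w b v = 0" if "b \<in> ?B" "v \<in> T" for b v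
    using that B TC by (auto simp: perp_def)
  have RT: "w r v = 0" if "r \<in> ?R" "v \<in> V" for r v
    using that skew[OF that(2), of r] by (auto simp: perp_def)
  show D: "{u \<in> T. \<forall>v\<in>T. w u v = 0} = T \<inter> (?R + ?B)"
  proof
    show "T \<inter> (?R + ?B) \<subseteq> {u \<in> T. \<forall>v\<in>T. w u v = 0}"
    proof
      fix u assume u: "u \<in> T \<inter> (?R + ?B)"
      then obtain r b where rb: "r \<in> ?R" "b \<in> ?B" "u = r + b" using set_plusD[of u ?R ?B] by blast
      have rbV: "r \<in> V" "b \<in> V" using rb perp_subset B m(2) by auto
      have "w u v = 0" if v: "v \<in> T" for v
        using w_add_left[OF _ rbV, of v] BT[OF rb(2) v] RT[OF rb(1)] v TV rb(3) by auto
      then show "u \<in> {u \<in> T. \<forall>v\<in>T. w u v = 0}" using u by blast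
    qed
    show "{u \<in> T. \<forall>v\<in>T. w u v = 0} \<subseteq> T \<inter> (?R + ?B)"
    proof
      fix u assume u: "u \<in> {u \<in> T. \<forall>v\<in>T. w u v = 0}"
      have uT: "u \<in> T" using u by blast
      then have uV: "u \<in> V" using TV by blast
      \<comment> \<open>The decomposition of C carries orthogonality from T to all of C: u is
        orthogonal to T by assumption, to the radical always, and to \<rho>(\<kk>) because T lies in
        C. Hence u belongs to the double orthogonal of \<rho>(\<mm>).\<close>
      have "w c u = 0" if c: "c \<in> ?C" for c
      proof -
        have "c \<in> T + ?R + ?B" using c C by simp
        then obtain s b where sb: "s \<in> T + ?R" "b \<in> ?B" "c = s + b" using set_plusD[of c "T + ?R" ?B] by blast
        then obtain t r where "t \<in> T" "r \<in> ?R" "s = t + r" using set_plusD[of s T ?R] by blast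
        with sb have trb: "t \<in> T" "r \<in> ?R" "b \<in> ?B" "c = t + r + b" by simp_all
        have "t \<in> V" "r \<in> V" "b \<in> V" using trb(1-3) TV perp_subset B m(2) by auto
        then have V3: "t \<in> V" "r \<in> V" "b \<in> V" "t + r \<in> V" using subspace_add[OF V] by auto
        have "w t u = 0" using skew[OF uV V3(1)] u trb(1) by simp
        then show ?thesis
          using w_add_left[OF uV V3(4,3)] w_add_left[OF uV V3(1,2)] RT[OF trb(2) uV] BT[OF trb(3) uT] trb(4) by simp
      qed
      then have "u \<in> perp ?C" using uV by (simp add: perp_def)
      then obtain a r where ar: "a \<in> ?A" "r \<in> ?R" "u = a + r"
        unfolding perp_perp[OF A m(2)] using set_plusD[of u ?A ?R] by blast
      have "u - r \<in> ?C" using TC uT RA ar(2) by (intro subspace_diff[OF pA]) auto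
      then have "a \<in> ?B" using ar B by simp
      then have "r + a \<in> ?R + ?B" using ar(2) by (intro set_plus_intro)
      then show "u \<in> T \<inter> (?R + ?B)" using uT ar(3) by (simp add: add.commute)
    qed
  qed
  have kS: "subspace \<kk>"
  proof -
    have "\<kk> = {\<xi> \<in> \<mm>. \<rho> \<xi> \<in> ?B}"
    proof
      show "\<kk> \<subseteq> {\<xi> \<in> \<mm>. \<rho> \<xi> \<in> ?B}" using km by blast
      show "{\<xi> \<in> \<mm>. \<rho> \<xi> \<in> ?B} \<subseteq> \<kk>"
      proof clarify
        fix \<xi> \<zeta> assume "\<xi> \<in> \<mm>" "\<zeta> \<in> \<kk>" "\<rho> \<xi> = \<rho> \<zeta>"
        then show "\<xi> \<in> \<kk>" unfolding k by simp
      qed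
    qed
    then have "\<kk> = \<mm> \<inter> \<rho> -` ?B" by blast
    then show ?thesis using subspace_inter[OF m(1) linear_subspace_vimage[OF \<rho> Bs]] by simp
  qed
  have w0: "w 0 v = 0" if "v \<in> V" for v
    using w_left[OF that subspace_0[OF V] subspace_0[OF V], of 0 0] by simp
  \<comment> \<open>Elements of \<mm> acting trivially at the point lie in \<kk>, so passing from
    \<mm> to its image and from \<kk> to its image loses the same number of dimensions. The
    stabiliser, whose dimension may vary with the point, thereby drops out of the count.\<close>
  have "{\<xi> \<in> \<mm>. \<rho> \<xi> = 0} = {\<xi> \<in> \<kk>. \<rho> \<xi> = 0}"
    unfolding k using w0 m(2) by auto
  then have "dim ?A + dim \<kk> = dim \<mm> + dim ?B"
    using dim_image_kernel[OF \<rho> m(1)] dim_image_kernel[OF \<rho> kS] by simp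
  moreover have "?R \<inter> ?B = ?A \<inter> ?R" using B RA by blast
  then have "dim (?R + ?B) + dim (?A \<inter> ?R) = dim ?R + dim ?B" using RB(1) by simp
  moreover have "dim ?C + dim ?A = dim V + dim (?A \<inter> ?R)" by (rule dim_perp[OF A m(2)])
  moreover have "dim (T + (?R + ?B)) + dim (T \<inter> (?R + ?B)) = dim T + dim (?R + ?B)"
    by (rule dim_set_plus(1)[OF T RB(2)])
  moreover have "T + (?R + ?B) = ?C" using C by (simp add: add.assoc)
  ultimately show "dim {u \<in> T. \<forall>v\<in>T. w u v = 0} + 2 * dim ?C + dim \<mm> = dim T + dim V + dim ?R + dim \<kk>"
    unfolding D by simp
qed

end

section \<open>The reduced space\<close>

text \<open>If m vanishes on V, so does b; otherwise b is m scaled by the ratio of their values at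
  some z with m z nonzero, because x minus a multiple of z lies in the kernel of m. Equality on V
  extends to the whole space, as elements of \<open>dual_space V\<close> vanish on the orthogonal
  complement.\<close>

lemma dual_space_span:
  fixes b m :: "'f::euclidean_space \<Rightarrow>\<^sub>L real"
  assumes V: "subspace V" and b: "b \<in> dual_space V" and m: "m \<in> dual_space V"
    and ker: "\<And>x. x \<in> V \<Longrightarrow> blinfun_apply m x = 0 \<Longrightarrow> blinfun_apply b x = 0"
  shows "b \<in> span {m}"
proof -
  have eqI: "b = c *\<^sub>R m" if c: "\<And>x. x \<in> V \<Longrightarrow> blinfun_apply b x = c * blinfun_apply m x" for c
  proof (rule blinfun_eqI)
    fix x
    obtain y z where yz: "y \<in> span V" "\<And>w. w \<in> span V \<Longrightarrow> orthogonal z w" "x = y + z"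
      using orthogonal_subspace_decomp_exists by metis
    have "y \<in> V" using yz(1) V span_eq_iff by blast
    have "\<forall>v\<in>V. z \<bullet> v = 0" using yz(2) span_base by (auto simp: orthogonal_def)
    then have "blinfun_apply b z = 0" "blinfun_apply m z = 0" using b m by (auto simp: dual_space_def)
    then show "blinfun_apply b x = blinfun_apply (c *\<^sub>R m) x"
      using c[OF \<open>y \<in> V\<close>] yz(3) by (simp add: blinfun.add_right blinfun.scaleR_left)
  qed
  show ?thesis
  proof (cases "\<exists>z\<in>V. blinfun_apply m z \<noteq> 0")
    case True
    then obtain z where z: "z \<in> V" "blinfun_apply m z \<noteq> 0" by blast
    have "blinfun_apply b x = (blinfun_apply b z / blinfun_apply m z) * blinfun_apply m x" if x: "x \<in> V" for x
    proof -
      let ?t = "blinfun_apply m x / blinfun_apply m z"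
      have "x - ?t *\<^sub>R z \<in> V" using x z(1) V by (intro subspace_diff subspace_scale)
      moreover have "blinfun_apply m (x - ?t *\<^sub>R z) = 0" using z(2) by (simp add: blinfun.diff_right blinfun.scaleR_right)
      ultimately have "blinfun_apply b (x - ?t *\<^sub>R z) = 0" by (rule ker)
      then show ?thesis by (simp add: blinfun.diff_right blinfun.scaleR_right)
    qed
    then show ?thesis using eqI by (metis span_base span_scale singletonI)
  next
    case False
    then have "b = 0 *\<^sub>R m" by (intro eqI) (use ker in auto)
    then show ?thesis by (simp add: span_0)
  qed
qed

section \<open>Tangent spaces of submanifolds and of subgroup orbits\<close>

lemma sub_mfd_structure:
  "submanifold M S \<Longrightarrow> is_submanifold_structure M S (sub_mfd M S)"
  unfolding submanifold_def sub_mfd_def by (rule someI_ex)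

lemma sub_mfdD:
  fixes M :: "('a, 'e::euclidean_space) mfd"
  assumes "submanifold M S"
  shows "smooth_manifold (sub_mfd M S)" "pts (sub_mfd M S) = S" "smooth_map (sub_mfd M S) M id" "S \<subseteq> pts M"
    "p \<in> S \<Longrightarrow> inj_on (tmap (sub_mfd M S) M id p) (model (sub_mfd M S))"
proof -
  have s: "is_submanifold_structure M S (sub_mfd M S)" by (rule sub_mfd_structure[OF assms])
  then show a: "smooth_manifold (sub_mfd M S)" "smooth_map (sub_mfd M S) M id" "S \<subseteq> pts M"
    by (simp_all add: is_submanifold_structure_def immersion_def)
  show b: "pts (sub_mfd M S) = S" using s a(3) by (auto simp: is_submanifold_structure_def)
  show "inj_on (tmap (sub_mfd M S) M id p) (model (sub_mfd M S))" if "p \<in> S"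
    using s that unfolding is_submanifold_structure_def immersion_def tangent_space_def b by blast
qed

text \<open>The inclusion is an immersion, so every tangent space is an injective image of the one
  model space. The right-hand side of the dimension formula is free of p, which the rank count
  needs.\<close>

lemma sub_tangent_dim:
  fixes M :: "('a, 'e::euclidean_space) mfd"
  assumes M: "smooth_manifold M" and S: "submanifold M S" and p: "p \<in> S"
  shows "subspace (sub_tangent M S p)" "dim (sub_tangent M S p) = dim (model (sub_mfd M S))"
    "sub_tangent M S p = tmap (sub_mfd M S) M id p ` model (sub_mfd M S)"
proof -
  note s = sub_mfdD[OF S]
  have E: "subspace (model (sub_mfd M S))" by (rule smooth_manifold_subspace[OF s(1)])
  obtain l where l: "linear l" "\<And>v. v \<in> model (sub_mfd M S) \<Longrightarrow> tmap (sub_mfd M S) M id p v = l v"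
    using tmap_linear_ext[OF s(1) M s(3)] p s(2) by blast
  show eq: "sub_tangent M S p = tmap (sub_mfd M S) M id p ` model (sub_mfd M S)"
    by (simp add: sub_tangent_def tangent_space_def)
  also have "\<dots> = l ` model (sub_mfd M S)" using l(2) by simp
  finally show "subspace (sub_tangent M S p)" using linear_subspace_image[OF l(1) E] by simp
  show "dim (sub_tangent M S p) = dim (model (sub_mfd M S))"
    unfolding eq by (rule dim_inj_linear_image[OF E l s(5)[OF p] order_refl])
qed

text \<open>The orbit map of K is that of G after the inclusion of K, whose tangent map at the
  identity sends the Lie algebra of K onto \<hh>. Orbit directions of different subgroups thus
  become images under one linear map.\<close>

lemma orbit_tangent_subgroup:
  fixes G :: "('g, 'f::euclidean_space) liegrp" and P :: "('p, 'e::euclidean_space) mfd"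
  assumes A: "lie_action G P \<Phi>" and K: "connected_lie_subgroup_of G \<hh> K" and p: "p \<in> pts P"
  shows "orbit_tangent K P \<Phi> p = (\<lambda>\<xi>. gen G P \<Phi> \<xi> p) ` \<hh>"
proof -
  note G = lie_actionD(1)[OF A] and P = lie_actionD(2)[OF A]
  note GM = lie_groupD(2)[OF G]
  have KL: "lie_group K" and one: "\<one>\<^bsub>K\<^esub> = \<one>\<^bsub>G\<^esub>" and id: "smooth_map (lg_mfd K) (lg_mfd G) id"
    and h: "tmap (lg_mfd K) (lg_mfd G) id \<one>\<^bsub>G\<^esub> ` lie_algebra K = \<hh>"
    using K by (simp_all add: connected_lie_subgroup_of_def lie_subgroup_def immersion_def)
  note KM = lie_groupD(2)[OF KL] and so = smooth_orbit_map[OF A p]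
  have s: "smooth_map (lg_mfd K) P (\<lambda>g. \<Phi> g p)" using smooth_map_comp[OF KM GM P id so] by simp
  have "tmap (lg_mfd K) P (\<lambda>g. \<Phi> g p) \<one>\<^bsub>K\<^esub> v = gen G P \<Phi> (tmap (lg_mfd K) (lg_mfd G) id \<one>\<^bsub>G\<^esub> v) p"
    if "v \<in> lie_algebra K" for v
    using tmap_compose[OF KM GM P id so s _ lie_groupD(5)[OF KL], of v] that one
    by (simp add: gen_def lie_algebra_def tangent_space_def)
  then show ?thesis unfolding orbit_tangent_def h[symmetric] image_image by (rule image_cong[OF refl])
qed

lemma presymplectic_ext_deriv1:
  fixes \<theta> :: "'p \<Rightarrow> 'e::euclidean_space \<Rightarrow> real ^ 'k::finite"
  assumes M: "smooth_manifold M" and \<theta>: "one_form M \<theta>" and p: "p \<in> pts M"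
  shows "presymplectic (model M) (\<lambda>u v. ext_deriv1 M \<theta> p u v $ \<alpha>)"
proof
  show "subspace (model M)" by (rule smooth_manifold_subspace[OF M])
  show "linear_form_on (model M) (\<lambda>v. ext_deriv1 M \<theta> p u v $ \<alpha>)" if "u \<in> model M" for u
    using ext_deriv1_linear(1)[OF M \<theta> p that] by (simp add: linear_form_on_def)
  show "ext_deriv1 M \<theta> p v u $ \<alpha> = - ext_deriv1 M \<theta> p u v $ \<alpha>" if "u \<in> model M" "v \<in> model M" for u v
    by (simp only: ext_deriv1_linear(4)[OF M \<theta> p that] vector_uminus_component)
qed

text \<open>\<open>comp_ker\<close> varies the second argument of the form and \<open>perp\<close>
  the first; skewness identifies the two.\<close>

lemma comp_ker_eq_perp:
  fixes \<theta> :: "'p \<Rightarrow> 'e::euclidean_space \<Rightarrow> real ^ 'k::finite"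
  assumes M: "smooth_manifold M" and \<theta>: "one_form M \<theta>" and p: "p \<in> pts M"
  shows "comp_ker M (ext_deriv1 M \<theta>) \<alpha> p =
    presymplectic.perp (model M) (\<lambda>u v. ext_deriv1 M \<theta> p u v $ \<alpha>) (model M)"
proof -
  interpret presymplectic "model M" "\<lambda>u v. ext_deriv1 M \<theta> p u v $ \<alpha>"
    by (rule presymplectic_ext_deriv1[OF assms])
  have "ext_deriv1 M \<theta> p u v $ \<alpha> = 0 \<longleftrightarrow> ext_deriv1 M \<theta> p v u $ \<alpha> = 0" if "u \<in> model M" "v \<in> model M" for u v
    using skew[OF that] by linarith
  then show ?thesis unfolding perp_def comp_ker_def tangent_space_def by blast
qed

lemma subspace_comp_ker:
  fixes \<theta> :: "'p \<Rightarrow> 'e::euclidean_space \<Rightarrow> real ^ 'k::finite"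
  assumes "smooth_manifold M" "one_form M \<theta>" "p \<in> pts M"
  shows "subspace (comp_ker M (ext_deriv1 M \<theta>) \<alpha> p)"
  unfolding comp_ker_eq_perp[OF assms]
  by (rule presymplectic.perp_subspace[OF presymplectic_ext_deriv1[OF assms] order_refl])

section \<open>Tangent spaces of the level sets and the kernel of the restricted form\<close>

locale k_symplectic_reduction =
  fixes P :: "('p, 'e::euclidean_space) mfd"
    and \<Theta> :: "'p \<Rightarrow> 'e \<Rightarrow> real ^ 'k::finite"
    and G :: "('g, 'f::euclidean_space) liegrp"
    and \<Phi> :: "'g \<Rightarrow> 'p \<Rightarrow> 'p"
    and J :: "'p \<Rightarrow> ('f \<Rightarrow>\<^sub>L real) ^ 'k"
    and \<mu> :: "('f \<Rightarrow>\<^sub>L real) ^ 'k"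
    and K :: "('g, 'f) liegrp"
    and K\<^sub>c :: "'k \<Rightarrow> ('g, 'f) liegrp"
  assumes exact: "exact_k_symplectic P \<Theta>"
    and action: "exact_k_symplectic_action G P \<Theta> \<Phi>"
    and momentum: "exact_momentum_map G P \<Theta> \<Phi> J"
    and weak_regular: "weak_regular_k_value G P J \<mu>"
    and regular: "regular_level_sets G P J \<mu>"
    and K: "connected_lie_subgroup_of G (k_bracket_multi G \<mu>) K"
    and K\<^sub>c: "\<And>\<alpha>. connected_lie_subgroup_of G (k_bracket G (\<mu> $ \<alpha>)) (K\<^sub>c \<alpha>)"
    and quotientable: "quotientable_action K (sub_mfd P (level_set P J \<mu>)) \<Phi>"
    and tangent_comp: "\<And>p \<alpha>. p \<in> level_set P J \<mu> \<Longrightarrow>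
           sub_tangent P (level_set_comp P J \<mu> \<alpha>) p =
             sub_tangent P (level_set P J \<mu>) p + comp_ker P (ext_deriv1 P \<Theta>) \<alpha> p
               + orbit_tangent (K\<^sub>c \<alpha>) P \<Phi> p"
    and tangent_orbit: "\<And>p. p \<in> level_set P J \<mu> \<Longrightarrow>
           orbit_tangent K P \<Phi> p =
             (\<Inter>\<alpha>. comp_ker P (ext_deriv1 P \<Theta>) \<alpha> p + orbit_tangent (K\<^sub>c \<alpha>) P \<Phi> p)
               \<inter> sub_tangent P (level_set P J \<mu>) p"
begin

abbreviation "S \<equiv> level_set P J \<mu>"
abbreviation "N \<equiv> sub_mfd P S"
abbreviation "Q \<equiv> quotient_mfd K N \<Phi>"
abbreviation "\<pi> \<equiv> orbit K \<Phi>"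
abbreviation "\<omega> \<equiv> ext_deriv1 P \<Theta>"
abbreviation "X \<equiv> gen G P \<Phi>"

lemma P: "smooth_manifold P" and \<Theta>: "one_form P \<Theta>" and rank: "constant_rank P \<omega>"
  using exact by (simp_all add: exact_k_symplectic_def k_symplectic_form_def)

lemma A: "lie_action G P \<Phi>"
  using action by (simp add: exact_k_symplectic_action_def)

lemma inv: "invariant_form G P \<Phi> \<Theta>"
  using A \<Theta> action by unfold_locales (simp_all add: exact_k_symplectic_action_def pullback1_def tangent_space_def)

lemma sub_S: "submanifold P S" and sub_comp: "submanifold P (level_set_comp P J \<mu> \<alpha>)"
  using regular by (simp_all add: regular_level_sets_def)

lemmas N = sub_mfdD[OF sub_S]

lemma AN: "lie_action K N \<Phi>" and Q: "is_quotient_structure K N \<Phi> Q"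
  using quotientable someI_ex[of "is_quotient_structure K N \<Phi>"]
  by (simp_all add: quotientable_action_def quotient_mfd_def)

lemma S_pts: "p \<in> S \<Longrightarrow> p \<in> pts P"
  using N(4) by blast

lemma L: "subspace (lie_algebra G)"
  using smooth_manifold_subspace[OF lie_groupD(2)[OF lie_actionD(1)[OF A]]] by (simp add: lie_algebra_def tangent_space_def)

lemma J: "smooth_map P (dual_power_mfd G) J"
  using momentum by (simp add: exact_momentum_map_def)

lemma J_gen: "p \<in> pts P \<Longrightarrow> \<xi> \<in> lie_algebra G \<Longrightarrow> \<Theta> p (X \<xi> p) $ \<alpha> = blinfun_apply (J p $ \<alpha>) \<xi>"
  using momentum inf_generator_eq_gen[OF A, of \<xi> p] unfolding exact_momentum_map_def by metis

lemma J_dual: "p \<in> pts P \<Longrightarrow> J p $ \<alpha> \<in> dual_space (lie_algebra G)"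
  using cinf_smooth_map_vspace(2)[OF P J param_const[OF open_UNIV], of p "0::real"] by (simp add: dual_power_def)

lemma \<mu>_dual: "\<mu> $ \<alpha> \<in> dual_space (lie_algebra G)"
  using weak_regular by (simp add: weak_regular_k_value_def weak_regular_value_def vspace_mfd_def)

lemma level:
  assumes "p \<in> S"
  obtains c where "c \<noteq> 0" "J p $ \<alpha> = c *\<^sub>R \<mu> $ \<alpha>"
proof -
  obtain c where "\<And>\<alpha>. c \<alpha> \<noteq> 0" "J p = (\<chi> \<alpha>. c \<alpha> *\<^sub>R \<mu> $ \<alpha>)" using assms by (auto simp: level_set_def)
  then show ?thesis using that[of "c \<alpha>"] by simp
qed

lemma level_comp: "p \<in> S \<Longrightarrow> p \<in> level_set_comp P J \<mu> \<alpha>"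
  using level[of p \<alpha>] S_pts[of p] unfolding level_set_comp_def by blast

text \<open>Differentiate the defining equation \<Theta>(\<xi>_P) = J_\<xi> and apply Cartan's
  formula for invariant forms. Membership in the dual space is inherited, because J vanishes on the
  orthogonal complement of the Lie algebra at every point.\<close>

lemma tangent_J:
  fixes \<beta> :: 'k
  assumes p: "p \<in> pts P" and v: "v \<in> model P"
  defines "b \<equiv> tmap P (dual_mfd G) (\<lambda>q. J q $ \<beta>) p v"
  shows "b \<in> dual_space (lie_algebra G)" "\<xi> \<in> lie_algebra G \<Longrightarrow> blinfun_apply b \<xi> = - \<omega> p (X \<xi> p) v $ \<beta>"
proof -
  let ?q = "pchart P p" and ?e = "coord P p p"
  note e = pchart_self[OF P p]
  have cJ: "cinf (pdom P p) (\<lambda>y. J (?q y) $ \<alpha>)" for \<alpha>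
    by (rule cinf_bounded_linear_comp[OF bounded_linear_vec_nth cinf_smooth_map_vspace(1)[OF P J param_pchart[OF P p]]])
  have co: "coord (dual_mfd G) (J p $ \<beta>) = id"
    unfolding coord_def chart_at_vspace[OF J_dual[OF p]] by simp
  have b: "b = fd (\<lambda>y. J (?q y) $ \<beta>) ?e v"
    using tmap_eq_fd[where N = "dual_mfd G" and f = "\<lambda>q. J q $ \<beta>", OF P p v] cinf_differentiable[OF cJ e(2)]
    unfolding b_def co by simp
  have ev: "((\<lambda>y. blinfun_apply (J (?q y) $ \<alpha>) x) has_derivative (\<lambda>v. blinfun_apply (fd (\<lambda>y. J (?q y) $ \<alpha>) ?e v) x)) (at ?e)" for x \<alpha>
    by (rule bounded_linear.has_derivative[OF blinfun.bounded_linear_left cinf_has_derivative[OF cJ e(2)]])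
  have bx: "blinfun_apply b x = fd (\<lambda>y. blinfun_apply (J (?q y) $ \<beta>) x) ?e v" for x
    unfolding b using fd_eqI[OF ev] by simp
  have qp: "y \<in> pdom P p \<Longrightarrow> ?q y \<in> pts P" for y by (rule param_pts[OF param_pchart[OF P p]])
  show "b \<in> dual_space (lie_algebra G)"
    unfolding dual_space_def
  proof (intro CollectI allI impI)
    fix x assume x: "\<forall>v\<in>lie_algebra G. x \<bullet> v = 0"
    have "((\<lambda>y. 0::real) has_derivative (\<lambda>v. 0)) (at ?e)" by (rule has_derivative_const)
    then have "((\<lambda>y. blinfun_apply (J (?q y) $ \<beta>) x) has_derivative (\<lambda>v. 0)) (at ?e)"
      by (rule has_derivative_transform_within_open[OF _ open_pdom[OF P p] e(2)])
        (use J_dual[OF qp] x in \<open>simp add: dual_space_def\<close>)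
    then show "blinfun_apply b x = 0" unfolding bx by (simp add: fd_eqI)
  qed
  assume \<xi>: "\<xi> \<in> lie_algebra G"
  let ?F = "\<lambda>y. \<Theta> (?q y) (X \<xi> (?q y))"
  have F: "?F y = (\<Sum>\<alpha>\<in>UNIV. blinfun_apply (J (?q y) $ \<alpha>) \<xi> *\<^sub>R axis \<alpha> 1)" if "y \<in> pdom P p" for y
    using basis_expansion[of "?F y"] J_gen[OF qp[OF that] \<xi>] by (simp add: scalar_mult_eq_scaleR)
  have "((\<lambda>y. \<Sum>\<alpha>\<in>UNIV. blinfun_apply (J (?q y) $ \<alpha>) \<xi> *\<^sub>R (axis \<alpha> 1 :: real ^ 'k)) has_derivative
      (\<lambda>v. \<Sum>\<alpha>\<in>UNIV. blinfun_apply (fd (\<lambda>y. J (?q y) $ \<alpha>) ?e v) \<xi> *\<^sub>R axis \<alpha> 1)) (at ?e)"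
    by (rule has_derivative_sum) (rule bounded_linear.has_derivative[OF bounded_linear_scaleR_left ev])
  then have "(?F has_derivative (\<lambda>v. \<Sum>\<alpha>\<in>UNIV. blinfun_apply (fd (\<lambda>y. J (?q y) $ \<alpha>) ?e v) \<xi> *\<^sub>R axis \<alpha> 1)) (at ?e)"
    by (rule has_derivative_transform_within_open[OF _ open_pdom[OF P p] e(2)]) (simp add: F)
  then have "fd ?F ?e v = (\<Sum>\<alpha>\<in>UNIV. blinfun_apply (fd (\<lambda>y. J (?q y) $ \<alpha>) ?e v) \<xi> *\<^sub>R axis \<alpha> 1)"
    by (simp add: fd_eqI)
  then have "fd ?F ?e v $ \<beta> = blinfun_apply b \<xi>"
    unfolding b by (simp add: axis_def if_distrib sum.delta cong: if_cong)
  then show "blinfun_apply b \<xi> = - \<omega> p (X \<xi> p) v $ \<beta>"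
    using invariant_form.ext_deriv1_gen[OF inv p v \<xi>] by simp
qed

text \<open>A covector lies on the line of \<mu>^\<beta> exactly if it annihilates the kernel of
  \<mu>^\<beta>. The tangent map of J_\<beta> is given by \<omega> on generators, so this becomes
  orthogonality to the generators of that kernel.\<close>

lemma vectors_into_line_eq:
  assumes p: "p \<in> pts P"
  shows "vectors_into_line G P J \<mu> \<beta> p = {v \<in> model P. \<forall>\<xi>\<in>ker_dual G (\<mu> $ \<beta>). \<omega> p (X \<xi> p) v $ \<beta> = 0}"
    (is "?L = ?R")
proof (rule Set.set_eqI)
  fix v
  show "v \<in> ?L \<longleftrightarrow> v \<in> ?R"
  proof (cases "v \<in> model P")
    case True
    let ?b = "tmap P (dual_mfd G) (\<lambda>q. J q $ \<beta>) p v"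
    note t = tangent_J[where \<beta> = \<beta>, OF p True]
    have "?b \<in> span {\<mu> $ \<beta>} \<longleftrightarrow> (\<forall>\<xi>\<in>ker_dual G (\<mu> $ \<beta>). blinfun_apply ?b \<xi> = 0)"
    proof
      assume "?b \<in> span {\<mu> $ \<beta>}"
      then obtain k where "?b = k *\<^sub>R \<mu> $ \<beta>" by (auto simp: span_singleton)
      then show "\<forall>\<xi>\<in>ker_dual G (\<mu> $ \<beta>). blinfun_apply ?b \<xi> = 0" by (simp add: ker_dual_def blinfun.scaleR_left)
    next
      assume "\<forall>\<xi>\<in>ker_dual G (\<mu> $ \<beta>). blinfun_apply ?b \<xi> = 0"
      then show "?b \<in> span {\<mu> $ \<beta>}"
        by (intro dual_space_span[OF L t(1) \<mu>_dual]) (simp add: ker_dual_def)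
    qed
    then show ?thesis using True t(2) by (simp add: vectors_into_line_def tangent_space_def ker_dual_def)
  qed (simp add: vectors_into_line_def tangent_space_def)
qed

lemma ext_deriv_gen_gen:
  assumes p: "p \<in> pts P" and \<xi>: "\<xi> \<in> lie_algebra G" and \<eta>: "\<eta> \<in> lie_algebra G"
  shows "\<omega> p (X \<xi> p) (X \<eta> p) $ \<alpha> = - ad_star G \<xi> (J p $ \<alpha>) \<eta>"
  using invariant_form.ext_deriv1_gen_gen[OF inv p \<xi> \<eta>] J_gen[OF p invariant_form.lie_bracket_eq(2)[OF inv \<xi> \<eta>]]
  by (simp add: ad_star_def)

text \<open>On the level set J_\<alpha> is c \<mu>^\<alpha> with c nonzero, so \<omega>^\<alpha> on
  generators is -c times the coadjoint expression for \<mu>^\<alpha>; and the wedge with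
  \<mu>^\<alpha> vanishes exactly if that expression vanishes on the kernel of \<mu>^\<alpha>. The
  left-hand side does not mention p: the radical is the same at all points.\<close>

lemma k_bracket_eq:
  assumes p: "p \<in> S"
  shows "k_bracket G (\<mu> $ \<alpha>) =
    {\<xi> \<in> ker_dual G (\<mu> $ \<alpha>). \<forall>\<eta>\<in>ker_dual G (\<mu> $ \<alpha>). \<omega> p (X \<xi> p) (X \<eta> p) $ \<alpha> = 0}"
proof -
  let ?m = "blinfun_apply (\<mu> $ \<alpha>)"
  note pp = S_pts[OF p]
  interpret presymplectic "model P" "\<lambda>u v. \<omega> p u v $ \<alpha>" by (rule presymplectic_ext_deriv1[OF P \<Theta> pp])
  obtain c where c: "c \<noteq> 0" "J p $ \<alpha> = c *\<^sub>R \<mu> $ \<alpha>" by (rule level[OF p])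
  obtain l where l: "linear l" "\<And>\<xi>. \<xi> \<in> lie_algebra G \<Longrightarrow> X \<xi> p = l \<xi>"
    using gen_linear_ext[OF A pp] by blast
  have lV: "l \<xi> \<in> model P" if "\<xi> \<in> lie_algebra G" for \<xi> using gen_in[OF A that pp] l(2)[OF that] by simp
  have w: "\<omega> p (l \<xi>) (l \<eta>) $ \<alpha> = - c * ad_star G \<xi> (\<mu> $ \<alpha>) \<eta>" if "\<xi> \<in> lie_algebra G" "\<eta> \<in> lie_algebra G" for \<xi> \<eta>
    using ext_deriv_gen_gen[OF pp that, of \<alpha>] that c(2) by (simp add: l(2) ad_star_def blinfun.scaleR_left)
  have "\<xi> \<in> g_bracket G (\<mu> $ \<alpha>) \<longleftrightarrow> (\<forall>\<eta>\<in>ker_dual G (\<mu> $ \<alpha>). \<omega> p (X \<xi> p) (X \<eta> p) $ \<alpha> = 0)"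
    if "\<xi> \<in> ker_dual G (\<mu> $ \<alpha>)" for \<xi>
  proof -
    let ?b = "ad_star G \<xi> (\<mu> $ \<alpha>)"
    have \<xi>: "\<xi> \<in> lie_algebra G" using that by (simp add: ker_dual_def)
    have "(\<forall>u\<in>lie_algebra G. \<forall>v\<in>lie_algebra G. wedge ?b ?m u v = 0) \<longleftrightarrow> (\<forall>\<eta>\<in>ker_dual G (\<mu> $ \<alpha>). ?b \<eta> = 0)"
    proof
      assume a: "\<forall>u\<in>lie_algebra G. \<forall>v\<in>lie_algebra G. wedge ?b ?m u v = 0"
      show "\<forall>\<eta>\<in>ker_dual G (\<mu> $ \<alpha>). ?b \<eta> = 0"
      proof
        fix \<eta> assume \<eta>: "\<eta> \<in> ker_dual G (\<mu> $ \<alpha>)"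
        then have \<eta>': "\<eta> \<in> lie_algebra G" "?m \<eta> = 0" by (simp_all add: ker_dual_def)
        have bm: "?b \<eta> * ?m v = 0" if "v \<in> lie_algebra G" for v
          using a[rule_format, OF \<eta>'(1) that] \<eta>'(2) by (simp add: wedge_def)
        show "?b \<eta> = 0"
        proof (cases "\<exists>v\<in>lie_algebra G. ?m v \<noteq> 0")
          \<comment> \<open>If \<mu>^\<alpha> is zero on the Lie algebra, the wedge condition is
            empty, but then \<mu>^\<alpha> also vanishes on brackets, which stay in the
            algebra.\<close>
          case False
          then show ?thesis using invariant_form.lie_bracket_eq(2)[OF inv \<xi> \<eta>'(1)] by (simp add: ad_star_def)
        qed (use bm in auto)
      qed
    next
      assume a: "\<forall>\<eta>\<in>ker_dual G (\<mu> $ \<alpha>). ?b \<eta> = 0"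
      show "\<forall>u\<in>lie_algebra G. \<forall>v\<in>lie_algebra G. wedge ?b ?m u v = 0"
      proof (intro ballI)
        fix u v assume uv: "u \<in> lie_algebra G" "v \<in> lie_algebra G"
        \<comment> \<open>The combination of u and v annihilated by \<mu>^\<alpha>; the value of ?b
          there is the wedge. Linearity in this argument is taken from \<omega>, where it is known,
          rather than from the bracket.\<close>
        let ?\<eta> = "?m v *\<^sub>R u + (- ?m u) *\<^sub>R v"
        have \<eta>: "?\<eta> \<in> lie_algebra G" by (intro subspace_add[OF L] subspace_scale[OF L] uv)
        have "?m ?\<eta> = 0" by (simp add: blinfun.diff_right blinfun.scaleR_right)
        then have "?b ?\<eta> = 0" using a \<eta> by (simp add: ker_dual_def)
        then have "\<omega> p (l \<xi>) (l ?\<eta>) $ \<alpha> = 0" using w[OF \<xi> \<eta>] by simp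
        also have "l ?\<eta> = ?m v *\<^sub>R l u + (- ?m u) *\<^sub>R l v"
          by (simp only: linear_add[OF l(1)] linear_cmul[OF l(1)])
        finally have "?m v * (- c * ?b u) + (- ?m u) * (- c * ?b v) = 0"
          unfolding w_right[OF lV[OF \<xi>] lV[OF uv(1)] lV[OF uv(2)]] w[OF \<xi> uv(1)] w[OF \<xi> uv(2)] .
        then have "c * wedge ?b ?m u v = 0" by (auto simp: wedge_def algebra_simps)
        then show "wedge ?b ?m u v = 0" using c(1) by simp
      qed
    qed
    moreover have "(\<forall>\<eta>\<in>ker_dual G (\<mu> $ \<alpha>). ?b \<eta> = 0) \<longleftrightarrow> (\<forall>\<eta>\<in>ker_dual G (\<mu> $ \<alpha>). \<omega> p (X \<xi> p) (X \<eta> p) $ \<alpha> = 0)"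
      using w[OF \<xi>] l(2) \<xi> c(1) by (intro ball_cong refl) (simp add: ker_dual_def)
    ultimately show ?thesis using \<xi> by (simp add: g_bracket_def)
  qed
  then show ?thesis unfolding k_bracket_def by blast
qed

lemma orbit_tangent_K\<^sub>c: "p \<in> pts P \<Longrightarrow> orbit_tangent (K\<^sub>c \<alpha>) P \<Phi> p = (\<lambda>\<xi>. X \<xi> p) ` k_bracket G (\<mu> $ \<alpha>)"
  by (rule orbit_tangent_subgroup[OF A K\<^sub>c])

lemma orbit_tangent_K: "p \<in> pts P \<Longrightarrow> orbit_tangent K P \<Phi> p = (\<lambda>\<xi>. X \<xi> p) ` k_bracket_multi G \<mu>"
  by (rule orbit_tangent_subgroup[OF A K])

text \<open>The abstract reduction, applied to \<omega>^\<alpha>, the generators of the kernel of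
  \<mu>^\<alpha> and T_p S. In the count, every term except dim D and the dimension of the kernel of
  \<omega>^\<alpha> belongs to a space that does not depend on p.\<close>

lemma kernel_restricted:
  fixes \<alpha> :: 'k
  assumes p: "p \<in> S"
  defines "D \<equiv> {u \<in> sub_tangent P S p. \<forall>v\<in>sub_tangent P S p. \<omega> p u v $ \<alpha> = 0}"
  shows "D = sub_tangent P S p \<inter> (comp_ker P \<omega> \<alpha> p + orbit_tangent (K\<^sub>c \<alpha>) P \<Phi> p)"
    and "dim D + 2 * dim (model (sub_mfd P (level_set_comp P J \<mu> \<alpha>))) + dim (ker_dual G (\<mu> $ \<alpha>)) =
      dim (model N) + dim (model P) + dim (comp_ker P \<omega> \<alpha> p) + dim (k_bracket G (\<mu> $ \<alpha>))"
proof -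
  note pp = S_pts[OF p] and pc = level_comp[OF p, of \<alpha>]
  interpret presymplectic "model P" "\<lambda>u v. \<omega> p u v $ \<alpha>" by (rule presymplectic_ext_deriv1[OF P \<Theta> pp])
  let ?m = "ker_dual G (\<mu> $ \<alpha>)" and ?k = "k_bracket G (\<mu> $ \<alpha>)"
  obtain l where l: "linear l" "\<And>\<xi>. \<xi> \<in> lie_algebra G \<Longrightarrow> X \<xi> p = l \<xi>"
    using gen_linear_ext[OF A pp] by blast
  have mL: "?m \<subseteq> lie_algebra G" by (auto simp: ker_dual_def)
  have kL: "?k \<subseteq> lie_algebra G" using mL by (auto simp: k_bracket_def)
  have "?m = lie_algebra G \<inter> {\<xi>. blinfun_apply (\<mu> $ \<alpha>) \<xi> = 0}" by (auto simp: ker_dual_def)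
  then have m: "subspace ?m"
    using subspace_inter[OF L linear_subspace_kernel[OF bounded_linear.linear[OF blinfun.bounded_linear_right]]] by simp
  have lm: "l ` ?m \<subseteq> model P"
    using gen_in[OF A _ pp] l(2) mL by (metis image_subsetI subsetD)
  have k: "?k = {\<xi> \<in> ?m. \<forall>\<eta>\<in>?m. \<omega> p (l \<xi>) (l \<eta>) $ \<alpha> = 0}"
    unfolding k_bracket_eq[OF p] using l(2) mL by (auto simp: subset_iff)
  note pV = comp_ker_eq_perp[OF P \<Theta> pp, of \<alpha>, symmetric]
  have "sub_tangent P (level_set_comp P J \<mu> \<alpha>) p = vectors_into_line G P J \<mu> \<alpha> p"
    using regular pc by (simp add: regular_level_sets_def)
  also have "\<dots> = perp (l ` ?m)"
    unfolding vectors_into_line_eq[OF pp] perp_def using l(2) mL by (auto simp: subset_iff)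
  finally have C: "perp (l ` ?m) = sub_tangent P (level_set_comp P J \<mu> \<alpha>) p" ..
  have kk: "orbit_tangent (K\<^sub>c \<alpha>) P \<Phi> p = l ` ?k"
    unfolding orbit_tangent_K\<^sub>c[OF pp] by (rule image_cong[OF refl]) (use l(2) kL in blast)
  have C': "perp (l ` ?m) = sub_tangent P S p + perp (model P) + l ` ?k"
    unfolding C tangent_comp[OF p] pV kk ..
  note r = reduction[OF l(1) m lm k sub_tangent_dim(1)[OF P sub_S p] C']
  show "D = sub_tangent P S p \<inter> (comp_ker P \<omega> \<alpha> p + orbit_tangent (K\<^sub>c \<alpha>) P \<Phi> p)"
    using r(1) unfolding D_def pV kk .
  show "dim D + 2 * dim (model (sub_mfd P (level_set_comp P J \<mu> \<alpha>))) + dim (ker_dual G (\<mu> $ \<alpha>)) =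
      dim (model N) + dim (model P) + dim (comp_ker P \<omega> \<alpha> p) + dim (k_bracket G (\<mu> $ \<alpha>))"
    using r(2) unfolding D_def[symmetric] pV C sub_tangent_dim(2)[OF P sub_comp pc] sub_tangent_dim(2)[OF P sub_S p] .
qed

end

section \<open>The one-form on the quotient and its exterior derivative\<close>

context k_symplectic_reduction
begin

lemma QM: "smooth_manifold Q" and sub: "submersion N Q \<pi>" and ptsQ: "pts Q = \<pi> ` S"
  using Q by (simp_all add: is_quotient_structure_def N(2))

lemma \<pi>: "smooth_map N Q \<pi>"
  using sub by (simp add: submersion_def)

lemma T\<pi>_surj: "p \<in> S \<Longrightarrow> tmap N Q \<pi> p ` model N = model Q"
  using sub by (simp add: submersion_def tangent_space_def N(2))

lemma S_N: "p \<in> S \<Longrightarrow> p \<in> pts N"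
  by (simp add: N(2))

lemma carrier_K: "g \<in> carrier K \<Longrightarrow> g \<in> carrier G"
  using K subgroup.subset by (fastforce simp: connected_lie_subgroup_of_def lie_subgroup_def)

lemma inclusion_gen:
  assumes p: "p \<in> S" and \<xi>: "\<xi> \<in> lie_algebra K"
  shows "tmap N P id p (gen K N \<Phi> \<xi> p) = tmap (lg_mfd K) P (\<lambda>g. \<Phi> g p) \<one>\<^bsub>K\<^esub> \<xi>"
proof -
  note KL = lie_actionD(1)[OF AN]
  note KM = lie_groupD(2)[OF KL] and so = smooth_orbit_map[OF AN S_N[OF p]]
  have "smooth_map (lg_mfd K) P (\<lambda>g. \<Phi> g p)"
    using smooth_map_comp[OF KM N(1) P so N(3)] by simp
  from tmap_compose[OF KM N(1) P so N(3) this _ lie_groupD(5)[OF KL], of \<xi>] show ?thesis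
    using \<xi> lie_actionD(3)[OF AN S_N[OF p]] by (simp add: gen_def lie_algebra_def tangent_space_def)
qed

text \<open>The hypotheses speak of tangent spaces in P, the projection of those in N. Descent of
  the form and nondegeneracy both pass through this translation of vertical vectors into orbit
  directions.\<close>

lemma inclusion_ker_T\<pi>:
  assumes p: "p \<in> S"
  shows "tmap N P id p ` {v \<in> model N. tmap N Q \<pi> p v = 0} = orbit_tangent K P \<Phi> p"
  unfolding ker_orbit_projection[OF AN Q S_N[OF p]] image_image orbit_tangent_def
  by (rule image_cong[OF refl]) (rule inclusion_gen[OF p])

text \<open>\<Theta> on a generator is J paired with \<xi>, and J_\<alpha> is a multiple of
  \<mu>^\<alpha>, which every \<xi> in the subalgebra annihilates. This is why the kernel of
  \<mu>^\<alpha> enters the definition of the reducing group: \<Theta> itself, not only \<omega>,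
  has to descend.\<close>

lemma \<Theta>_orbit:
  assumes p: "p \<in> S" and v: "v \<in> orbit_tangent K P \<Phi> p"
  shows "\<Theta> p v = 0"
proof -
  obtain \<xi> where \<xi>: "\<xi> \<in> k_bracket_multi G \<mu>" "v = X \<xi> p"
    using v orbit_tangent_K[OF S_pts[OF p]] by blast
  have "\<Theta> p v $ \<alpha> = 0" for \<alpha>
  proof -
    have x: "\<xi> \<in> lie_algebra G" "blinfun_apply (\<mu> $ \<alpha>) \<xi> = 0"
      using \<xi>(1) by (auto simp: k_bracket_multi_def k_bracket_def ker_dual_def)
    obtain c where "J p $ \<alpha> = c *\<^sub>R \<mu> $ \<alpha>" by (rule level[OF p])
    then show ?thesis using J_gen[OF S_pts[OF p] x(1), of \<alpha>] x(2) \<xi>(2) by (simp add: blinfun.scaleR_left)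
  qed
  then show ?thesis by (simp add: vec_eq_iff)
qed

lemma \<Theta>_linear: "p \<in> S \<Longrightarrow> u \<in> model P \<Longrightarrow> v \<in> model P \<Longrightarrow> \<Theta> p (a *\<^sub>R u + b *\<^sub>R v) = a *\<^sub>R \<Theta> p u + b *\<^sub>R \<Theta> p v"
  using \<Theta> S_pts[of p] by (simp add: one_form_def linear_form_on_def tangent_space_def)

text \<open>Two representatives of one tangent vector of the quotient differ by the action of a
  group element and by a vertical vector. Invariance takes care of the former, vanishing on orbit
  directions of the latter.\<close>

lemma \<Theta>_basic:
  assumes p: "p \<in> S" "p' \<in> S" and u: "u \<in> model N" "u' \<in> model N"
    and eq: "\<pi> p' = \<pi> p" "tmap N Q \<pi> p' u' = tmap N Q \<pi> p u"
  shows "\<Theta> p' (tmap N P id p' u') = \<Theta> p (tmap N P id p u)"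
proof -
  note pN = S_N[OF p(1)] and pN' = S_N[OF p(2)] and pp = S_pts[OF p(1)] and pp' = S_pts[OF p(2)]
  obtain g where g: "g \<in> carrier K" "p' = \<Phi> g p" by (rule orbit_eqD[OF AN pN' eq(1)])
  note gG = carrier_K[OF g(1)]
  note sN = smooth_action[OF AN g(1)] and sP = smooth_action[OF A gG]
  let ?w = "tmap N N (\<Phi> g) p u"
  have w: "?w \<in> model N" by (rule tmap_in[OF N(1) N(1) sN pN u(1)])
  have "tmap N Q \<pi> p u = tmap N Q \<pi> (\<Phi> g p) ?w"
    by (rule tmap_compose[OF N(1) N(1) QM sN \<pi> \<pi> _ pN u(1)]) (simp add: orbit_translate[OF AN _ g(1)])
  then have 1: "tmap N Q \<pi> p' ?w = tmap N Q \<pi> p' u'" using eq(2) g(2) by simp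
  have s: "smooth_map N P (\<Phi> g)" using smooth_map_comp[OF N(1) P P N(3) sP] by simp
  have "tmap N P (\<Phi> g) p u = tmap N P id (\<Phi> g p) ?w"
    by (rule tmap_compose[OF N(1) N(1) P sN N(3) s _ pN u(1)]) simp
  moreover have "tmap N P (\<Phi> g) p u = tmap P P (\<Phi> g) (id p) (tmap N P id p u)"
    by (rule tmap_compose[OF N(1) P P N(3) sP s _ pN u(1)]) simp
  ultimately have 2: "tmap N P id p' ?w = tmap P P (\<Phi> g) p (tmap N P id p u)" using g(2) by simp
  have "\<Theta> p' (tmap N P id p' ?w) = \<Theta> p (tmap N P id p u)"
    unfolding 2 unfolding g(2)
    using invariant_form.inv[OF inv gG pp tmap_in[OF N(1) P N(3) pN u(1)]] .
  moreover have "\<Theta> p' (tmap N P id p' u') = \<Theta> p' (tmap N P id p' ?w)"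
  proof -
    let ?d = "1 *\<^sub>R u' + (-1) *\<^sub>R ?w"
    have "?d \<in> model N" using u(2) w subspace_diff[OF smooth_manifold_subspace[OF N(1)]] by simp
    moreover have "tmap N Q \<pi> p' ?d = 0"
      unfolding tmap_lincomb[OF N(1) QM \<pi> pN' u(2) w] 1 by simp
    ultimately have "tmap N P id p' ?d \<in> orbit_tangent K P \<Phi> p'"
      unfolding inclusion_ker_T\<pi>[OF p(2), symmetric] by blast
    then have "\<Theta> p' (tmap N P id p' ?d) = 0" by (rule \<Theta>_orbit[OF p(2)])
    then show ?thesis
      unfolding tmap_lincomb[OF N(1) P N(3) pN' u(2) w]
        \<Theta>_linear[OF p(2) tmap_in[OF N(1) P N(3) pN' u(2)] tmap_in[OF N(1) P N(3) pN' w]] by simp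
  qed
  ultimately show ?thesis by simp
qed

text \<open>The definite description is justified by \<open>\<Theta>_basic\<close>, and surjectivity
  of the tangent map of \<pi> provides a representative for every tangent vector of the
  quotient.\<close>

definition \<Theta>\<^sub>\<mu> :: "'p set \<Rightarrow> 'e \<Rightarrow> real ^ 'k" where
  "\<Theta>\<^sub>\<mu> q w = (THE y. \<exists>p v. p \<in> S \<and> v \<in> model N \<and> \<pi> p = q \<and> tmap N Q \<pi> p v = w \<and> y = \<Theta> p (tmap N P id p v))"

lemma \<Theta>\<^sub>\<mu>: "p \<in> S \<Longrightarrow> v \<in> model N \<Longrightarrow> \<Theta>\<^sub>\<mu> (\<pi> p) (tmap N Q \<pi> p v) = \<Theta> p (tmap N P id p v)"
  unfolding \<Theta>\<^sub>\<mu>_def by (rule the_equality) (auto intro: \<Theta>_basic)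

lemma pform_\<Theta>\<^sub>\<mu>:
  assumes \<sigma>: "param N W \<sigma>" and y: "y \<in> W"
  shows "pform Q \<Theta>\<^sub>\<mu> (\<lambda>y. \<pi> (\<sigma> y)) y v = pform P \<Theta> \<sigma> y v"
proof -
  have "\<sigma> y \<in> S" using param_pts[OF \<sigma> y] N(2) by simp
  from \<Theta>\<^sub>\<mu>[OF this ptan_in[OF N(1) \<sigma> y]] show ?thesis
    using ptan_smooth_map[OF N(1) QM \<pi> \<sigma> y] ptan_smooth_map[OF N(1) P N(3) \<sigma> y] by (simp add: pform_def)
qed

lemma lift:
  assumes "p \<in> S" "w \<in> model Q"
  obtains v where "v \<in> model N" "w = tmap N Q \<pi> p v"
  using T\<pi>_surj[OF assms(1)] assms(2) by blast

text \<open>Smoothness is tested with a local lift \<sigma> of a chart of the quotient, which exists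
  because the projection is a submersion: the coefficients of the reduced form in the chart are
  those of \<Theta> along \<sigma>.\<close>

lemma one_form_\<Theta>\<^sub>\<mu>: "one_form Q \<Theta>\<^sub>\<mu>"
  unfolding one_form_def tangent_space_def
proof (intro conjI ballI)
  fix q assume "q \<in> pts Q"
  then obtain p where p: "p \<in> S" "q = \<pi> p" unfolding ptsQ by blast
  note pN = S_N[OF p(1)]
  show "linear_form_on (model Q) (\<Theta>\<^sub>\<mu> q)"
    unfolding linear_form_on_def
  proof (intro allI ballI)
    fix a b u v assume uv: "u \<in> model Q" "v \<in> model Q"
    obtain u' where u': "u' \<in> model N" "u = tmap N Q \<pi> p u'" by (rule lift[OF p(1) uv(1)])
    obtain v' where v': "v' \<in> model N" "v = tmap N Q \<pi> p v'" by (rule lift[OF p(1) uv(2)])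
    have s: "a *\<^sub>R u' + b *\<^sub>R v' \<in> model N"
      using u'(1) v'(1) smooth_manifold_subspace[OF N(1)] by (simp add: subspace_add subspace_scale)
    show "\<Theta>\<^sub>\<mu> q (a *\<^sub>R u + b *\<^sub>R v) = a *\<^sub>R \<Theta>\<^sub>\<mu> q u + b *\<^sub>R \<Theta>\<^sub>\<mu> q v"
      unfolding p(2) u'(2) v'(2) \<Theta>\<^sub>\<mu>[OF p(1) u'(1)] \<Theta>\<^sub>\<mu>[OF p(1) v'(1)]
        tmap_lincomb[OF N(1) QM \<pi> pN u'(1) v'(1), symmetric] \<Theta>\<^sub>\<mu>[OF p(1) s]
        tmap_lincomb[OF N(1) P N(3) pN u'(1) v'(1)]
      by (rule \<Theta>_linear[OF p(1) tmap_in[OF N(1) P N(3) pN u'(1)] tmap_in[OF N(1) P N(3) pN v'(1)]])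
  qed
next
  have "smooth_on (c ` U) (\<lambda>x. pullback1 (vspace_mfd (model Q)) Q (inv_into U c) \<Theta>\<^sub>\<mu> x v)"
    if C: "(U, c) \<in> atlas Q" and v: "v \<in> model Q" for U c v
  proof (rule smooth_onI)
    fix x assume x: "x \<in> c ` U"
    let ?\<rho> = "fat_chart Q (U, c)" and ?W = "fat_dom Q (U, c)"
    note \<rho> = param_fat_chart[OF QM C] and xW = tmap_inv_chart(1)[OF QM C x v]
    obtain p where p: "p \<in> S" "?\<rho> x = \<pi> p" using param_pts[OF \<rho> xW] unfolding ptsQ by blast
    obtain W \<sigma> where W: "x \<in> W" "W \<subseteq> ?W" "param N W \<sigma>" "\<sigma> x = p" "\<And>y. y \<in> W \<Longrightarrow> \<pi> (\<sigma> y) = ?\<rho> y"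
      by (rule submersion_section[OF N(1) QM sub S_N[OF p(1)] \<rho> xW p(2)]) blast
    have \<sigma>: "param P W \<sigma>"
      using param_smooth_map[OF smooth_manifold_charted[OF N(1)] smooth_manifold_charted[OF P] N(3) W(3)] by simp
    show "\<exists>W g. x \<in> W \<and> cinf W g \<and>
        (\<forall>y\<in>c ` U \<inter> W. g y = pullback1 (vspace_mfd (model Q)) Q (inv_into U c) \<Theta>\<^sub>\<mu> y v)"
    proof (intro exI conjI ballI)
      show "x \<in> W" by (rule W(1))
      show "cinf W (\<lambda>y. pform P \<Theta> \<sigma> y v)" by (rule cinf_pform[OF P \<Theta> \<sigma>])
      fix y assume y: "y \<in> c ` U \<inter> W"
      have "pform Q \<Theta>\<^sub>\<mu> ?\<rho> y v = pform Q \<Theta>\<^sub>\<mu> (\<lambda>y. \<pi> (\<sigma> y)) y v"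
        unfolding pform_def
        using ptan_cong[of W y "\<lambda>y. \<pi> (\<sigma> y)" ?\<rho> Q v] param_open[OF W(3)] W(5) y by simp
      also have "\<dots> = pform P \<Theta> \<sigma> y v" by (rule pform_\<Theta>\<^sub>\<mu>[OF W(3)]) (use y in simp)
      finally show "pform P \<Theta> \<sigma> y v = pullback1 (vspace_mfd (model Q)) Q (inv_into U c) \<Theta>\<^sub>\<mu> y v"
        unfolding pullback1_inv_chart[OF QM C IntD1[OF y] v] by (rule sym)
    qed
  qed
  then show "case C of (U, c) \<Rightarrow> \<forall>v\<in>model Q. smooth_on (c ` U)
      (\<lambda>x. pullback1 (vspace_mfd (model Q)) Q (inv_into U c) \<Theta>\<^sub>\<mu> x v)" if "C \<in> atlas Q" for C
    using that by (cases C) simp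
qed

abbreviation "\<omega>\<^sub>\<mu> \<equiv> ext_deriv1 Q \<Theta>\<^sub>\<mu>"

text \<open>A chart of N, followed by \<pi> or by the inclusion, gives parametrised pieces of the
  quotient and of P along which the two one-forms have the same pullback. The exterior derivative
  commutes with both pullbacks.\<close>

lemma \<omega>\<^sub>\<mu>:
  assumes p: "p \<in> S" and u: "u \<in> model N" and v: "v \<in> model N"
  shows "\<omega>\<^sub>\<mu> (\<pi> p) (tmap N Q \<pi> p u) (tmap N Q \<pi> p v) = \<omega> p (tmap N P id p u) (tmap N P id p v)"
proof -
  note pN = S_N[OF p]
  let ?q = "pchart N p" and ?e = "coord N p p"
  note q = param_pchart[OF N(1) pN] and e = pchart_self[OF N(1) pN]
  note qQ = param_smooth_map[OF smooth_manifold_charted[OF N(1)] smooth_manifold_charted[OF QM] \<pi> q]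
  note qP = param_smooth_map[OF smooth_manifold_charted[OF N(1)] smooth_manifold_charted[OF P] N(3) q]
  have f: "fd (\<lambda>y. pform Q \<Theta>\<^sub>\<mu> (\<lambda>y. \<pi> (?q y)) y v) ?e = fd (\<lambda>y. pform P \<Theta> (\<lambda>y. id (?q y)) y v) ?e" for v
    by (rule fd_cong_open[OF param_open[OF q] e(2)]) (simp add: pform_\<Theta>\<^sub>\<mu>[OF q])
  show ?thesis
    using ext_deriv1_param[OF QM one_form_\<Theta>\<^sub>\<mu> qQ e(2), of u v] ext_deriv1_param[OF P \<Theta> qP e(2), of u v]
    unfolding f tmap_eq_ptan[OF N(1) QM \<pi> pN u] tmap_eq_ptan[OF N(1) QM \<pi> pN v]
      tmap_eq_ptan[OF N(1) P N(3) pN u] tmap_eq_ptan[OF N(1) P N(3) pN v] e(1) by (simp add: e(1))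
qed

lemma comp_ker_\<omega>\<^sub>\<mu>:
  assumes p: "p \<in> S" and u: "u \<in> model N"
  shows "tmap N Q \<pi> p u \<in> comp_ker Q \<omega>\<^sub>\<mu> \<alpha> (\<pi> p) \<longleftrightarrow>
    tmap N P id p u \<in> {u \<in> sub_tangent P S p. \<forall>v\<in>sub_tangent P S p. \<omega> p u v $ \<alpha> = 0}"
proof -
  have "tmap N Q \<pi> p u \<in> comp_ker Q \<omega>\<^sub>\<mu> \<alpha> (\<pi> p) \<longleftrightarrow>
      (\<forall>v\<in>tmap N Q \<pi> p ` model N. \<omega>\<^sub>\<mu> (\<pi> p) (tmap N Q \<pi> p u) v $ \<alpha> = 0)"
    using T\<pi>_surj[OF p] u unfolding comp_ker_def tangent_space_def by blast
  also have "\<dots> \<longleftrightarrow> (\<forall>v\<in>model N. \<omega> p (tmap N P id p u) (tmap N P id p v) $ \<alpha> = 0)"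
    by (simp add: \<omega>\<^sub>\<mu>[OF p u])
  finally show ?thesis using u unfolding sub_tangent_dim(3)[OF P sub_S p] by simp
qed

text \<open>The kernel of the reduced form and the kernel D of the restricted form have the same
  preimage B in \<open>model N\<close>. The inclusion maps B isomorphically to D, and the tangent
  map of \<pi> maps it onto the reduced kernel with all vertical vectors as kernel. Adding dim D on
  the left avoids a second truncated subtraction.\<close>

lemma dim_comp_ker_\<omega>\<^sub>\<mu>:
  assumes p: "p \<in> S"
  shows "dim (model Q) - dim (comp_ker Q \<omega>\<^sub>\<mu> \<alpha> (\<pi> p)) + dim {u \<in> sub_tangent P S p. \<forall>v\<in>sub_tangent P S p. \<omega> p u v $ \<alpha> = 0} =
    dim (model N)"
proof -
  note pN = S_N[OF p]
  let ?D = "{u \<in> sub_tangent P S p. \<forall>v\<in>sub_tangent P S p. \<omega> p u v $ \<alpha> = 0}"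
  let ?C = "comp_ker Q \<omega>\<^sub>\<mu> \<alpha> (\<pi> p)" and ?K = "{v \<in> model N. tmap N Q \<pi> p v = 0}"
  let ?B = "{u \<in> model N. tmap N P id p u \<in> ?D}"
  have E: "subspace (model N)" by (rule smooth_manifold_subspace[OF N(1)])
  have qQ: "\<pi> p \<in> pts Q" using p ptsQ by blast
  obtain l where l: "linear l" "\<And>v. v \<in> model N \<Longrightarrow> tmap N Q \<pi> p v = l v"
    using tmap_linear_ext[OF N(1) QM \<pi> pN] by blast
  obtain i where i: "linear i" "\<And>v. v \<in> model N \<Longrightarrow> tmap N P id p v = i v"
    using tmap_linear_ext[OF N(1) P N(3) pN] by blast
  have CQ: "?C \<subseteq> model Q" by (auto simp: comp_ker_def tangent_space_def)
  have B: "?B = model N \<inter> l -` ?C" using comp_ker_\<omega>\<^sub>\<mu>[OF p] l(2) by auto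
  have Bs: "subspace ?B" unfolding B
    by (intro subspace_inter E linear_subspace_vimage[OF l(1)] subspace_comp_ker QM one_form_\<Theta>\<^sub>\<mu> qQ)
  have lB: "l ` ?B = ?C"
  proof
    show "l ` ?B \<subseteq> ?C" unfolding B by blast
    show "?C \<subseteq> l ` ?B"
    proof
      fix w assume w: "w \<in> ?C"
      then obtain v where v: "v \<in> model N" "w = tmap N Q \<pi> p v" using lift[OF p, of w] CQ by blast
      then have "v \<in> ?B" unfolding B using w l(2) by simp
      then show "w \<in> l ` ?B" using v l(2) by blast
    qed
  qed
  have "?K \<subseteq> ?B"
  proof
    fix v assume v: "v \<in> ?K"
    have "0 \<in> ?C" using subspace_0[OF subspace_comp_ker[OF QM one_form_\<Theta>\<^sub>\<mu> qQ]] .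
    then have "v \<in> model N \<inter> l -` ?C" using v l(2) by auto
    then show "v \<in> ?B" unfolding B .
  qed
  then have "{v \<in> ?B. l v = 0} = ?K" using l(2) by auto
  then have 1: "dim ?C + dim ?K = dim ?B" using dim_image_kernel[OF l(1) Bs] lB by simp
  have "l ` model N = model Q" "{v \<in> model N. l v = 0} = ?K" using T\<pi>_surj[OF p] l(2) by auto
  then have 2: "dim (model Q) + dim ?K = dim (model N)" using dim_image_kernel[OF l(1) E] by simp
  have "tmap N P id p ` ?B = ?D" unfolding sub_tangent_dim(3)[OF P sub_S p] by auto
  then have "dim ?B = dim ?D"
    using dim_inj_linear_image[OF E i N(5)[OF p], of ?B] by auto
  moreover have "dim ?C \<le> dim (model Q)" by (rule dim_subset[OF CQ])
  ultimately show ?thesis using 1 2 by linarith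
qed

lemma constant_rank_\<omega>\<^sub>\<mu>: "constant_rank Q \<omega>\<^sub>\<mu>"
  unfolding constant_rank_def tangent_space_def
proof
  fix \<alpha>
  obtain r where r: "\<And>p. p \<in> pts P \<Longrightarrow> dim (model P) - dim (comp_ker P \<omega> \<alpha> p) = r"
    using rank unfolding constant_rank_def tangent_space_def by blast
  \<comment> \<open>Solving the two dimension formulas for the reduced rank, with r the rank of
    \<omega>^\<alpha>, gives ?a + r - ?b in the integers. The rank is nonnegative, so truncated
    subtraction yields the same value.\<close>
  let ?a = "2 * dim (model (sub_mfd P (level_set_comp P J \<mu> \<alpha>))) + dim (ker_dual G (\<mu> $ \<alpha>))"
    and ?b = "2 * dim (model P) + dim (k_bracket G (\<mu> $ \<alpha>))"
  have "dim (model Q) - dim (comp_ker Q \<omega>\<^sub>\<mu> \<alpha> q) = ?a + r - ?b" if "q \<in> pts Q" for q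
  proof -
    obtain p where p: "p \<in> S" "q = \<pi> p" using \<open>q \<in> pts Q\<close> unfolding ptsQ by blast
    have "dim (comp_ker P \<omega> \<alpha> p) \<le> dim (model P)"
      by (rule dim_subset) (auto simp: comp_ker_def tangent_space_def)
    then show ?thesis
      unfolding p(2) using kernel_restricted(2)[OF p(1), of \<alpha>] dim_comp_ker_\<omega>\<^sub>\<mu>[OF p(1), of \<alpha>] r[OF S_pts[OF p(1)]] by linarith
  qed
  then show "\<exists>r. \<forall>q\<in>pts Q. dim (model Q) - dim (comp_ker Q \<omega>\<^sub>\<mu> \<alpha> q) = r" by blast
qed

text \<open>A vector in all component kernels lifts to some u whose image in P lies in T_p S and,
  for every \<alpha>, in the kernel of \<omega>^\<alpha> plus the orbit directions of the
  \<alpha>-th group. The second tangent space hypothesis makes it an orbit direction of K.\<close>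

lemma nondegenerate_\<omega>\<^sub>\<mu>: "nondegenerate Q \<omega>\<^sub>\<mu>"
  unfolding nondegenerate_def
proof
  fix q assume q: "q \<in> pts Q"
  then obtain p where p: "p \<in> S" "q = \<pi> p" unfolding ptsQ by blast
  note pN = S_N[OF p(1)]
  show "(\<Inter>\<alpha>. comp_ker Q \<omega>\<^sub>\<mu> \<alpha> q) = {0}"
  proof
    show "{0} \<subseteq> (\<Inter>\<alpha>. comp_ker Q \<omega>\<^sub>\<mu> \<alpha> q)"
      using subspace_0[OF subspace_comp_ker[OF QM one_form_\<Theta>\<^sub>\<mu> q]] by blast
    show "(\<Inter>\<alpha>. comp_ker Q \<omega>\<^sub>\<mu> \<alpha> q) \<subseteq> {0}"
    proof
      fix w assume w: "w \<in> (\<Inter>\<alpha>. comp_ker Q \<omega>\<^sub>\<mu> \<alpha> q)"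
      then have "w \<in> model Q" by (auto simp: comp_ker_def tangent_space_def)
      then obtain u where u: "u \<in> model N" "w = tmap N Q \<pi> p u" by (rule lift[OF p(1)])
      have "tmap N P id p u \<in> sub_tangent P S p \<inter> (comp_ker P \<omega> \<alpha> p + orbit_tangent (K\<^sub>c \<alpha>) P \<Phi> p)" for \<alpha>
        unfolding kernel_restricted(1)[OF p(1), symmetric]
        using w comp_ker_\<omega>\<^sub>\<mu>[OF p(1) u(1), of \<alpha>] unfolding p(2) u(2) by blast
      then have "tmap N P id p u \<in> orbit_tangent K P \<Phi> p"
        unfolding tangent_orbit[OF p(1)] by blast
      then obtain u' where "u' \<in> model N" "tmap N Q \<pi> p u' = 0" "tmap N P id p u = tmap N P id p u'"
        unfolding inclusion_ker_T\<pi>[OF p(1), symmetric] by blast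
      \<comment> \<open>The vertical vector u' has the same image in P as u; the inclusion being an
        immersion, u = u' and so w = 0.\<close>
      then show "w \<in> {0}" using inj_onD[OF N(5)[OF p(1)]] u by auto
    qed
  qed
qed

lemma exact_k_symplectic_quotient: "exact_k_symplectic Q \<Theta>\<^sub>\<mu>"
  unfolding exact_k_symplectic_def k_symplectic_form_def
  by (intro conjI QM one_form_\<Theta>\<^sub>\<mu> closed_two_form_ext_deriv1 constant_rank_\<omega>\<^sub>\<mu> nondegenerate_\<omega>\<^sub>\<mu>)

end

theorem theorem3p23:
  fixes P :: "('p, 'e::euclidean_space) mfd"
    and \<Theta> :: "'p \<Rightarrow> 'e \<Rightarrow> real ^ 'k::finite"
    and G :: "('g, 'f::euclidean_space) liegrp"
    and \<Phi> :: "'g \<Rightarrow> 'p \<Rightarrow> 'p"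
    and J :: "'p \<Rightarrow> ('f \<Rightarrow>\<^sub>L real) ^ 'k"
    and \<mu> :: "('f \<Rightarrow>\<^sub>L real) ^ 'k"
    and K :: "('g, 'f) liegrp"
    and K\<^sub>c :: "'k \<Rightarrow> ('g, 'f) liegrp"
  assumes "exact_k_symplectic P \<Theta>"
    and "exact_k_symplectic_action G P \<Theta> \<Phi>"
    and "exact_momentum_map G P \<Theta> \<Phi> J"
    and "weak_regular_k_value G P J \<mu>"
    and "regular_level_sets G P J \<mu>"
    and "connected_lie_subgroup_of G (k_bracket_multi G \<mu>) K"
    and "\<And>\<alpha>. connected_lie_subgroup_of G (k_bracket G (\<mu> $ \<alpha>)) (K\<^sub>c \<alpha>)"
    and "quotientable_action K (sub_mfd P (level_set P J \<mu>)) \<Phi>"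
    and "\<And>p \<alpha>. p \<in> level_set P J \<mu> \<Longrightarrow>
           sub_tangent P (level_set_comp P J \<mu> \<alpha>) p =
             sub_tangent P (level_set P J \<mu>) p + comp_ker P (ext_deriv1 P \<Theta>) \<alpha> p
               + orbit_tangent (K\<^sub>c \<alpha>) P \<Phi> p"
    and "\<And>p. p \<in> level_set P J \<mu> \<Longrightarrow>
           orbit_tangent K P \<Phi> p =
             (\<Inter>\<alpha>. comp_ker P (ext_deriv1 P \<Theta>) \<alpha> p + orbit_tangent (K\<^sub>c \<alpha>) P \<Phi> p)
               \<inter> sub_tangent P (level_set P J \<mu>) p"
  shows "\<exists>\<Theta>\<^sub>\<mu> :: 'p set \<Rightarrow> 'e \<Rightarrow> real ^ 'k.
           exact_k_symplectic (quotient_mfd K (sub_mfd P (level_set P J \<mu>)) \<Phi>) \<Theta>\<^sub>\<mu> \<and>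
           (\<forall>p\<in>level_set P J \<mu>. \<forall>v\<in>tangent_space (sub_mfd P (level_set P J \<mu>)) p.
              pullback1 (sub_mfd P (level_set P J \<mu>))
                (quotient_mfd K (sub_mfd P (level_set P J \<mu>)) \<Phi>) (orbit K \<Phi>) \<Theta>\<^sub>\<mu> p v =
              pullback1 (sub_mfd P (level_set P J \<mu>)) P id \<Theta> p v)"

proof -
  interpret k_symplectic_reduction P \<Theta> G \<Phi> J \<mu> K K\<^sub>c
    by (rule k_symplectic_reduction.intro) (fact assms)+
  show ?thesis
    using exact_k_symplectic_quotient \<Theta>\<^sub>\<mu> by (auto simp: pullback1_def tangent_space_def)
qed

end
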